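(* There is an algorithm that, given any full-rank $\mathbf{A} \in \mathbb{R}^{n \times d}$ with $n \ge d$, any $b \in \mathbb{R}^n$ and any $\varepsilon \in (0,1)$, with high probability computes a vector $y \in \mathbb{R}^d$ with $\|\mathbf{A} y - b\|_\infty \le (1+\varepsilon)\min_{x \in \mathbb{R}^d}\|\mathbf{A} x - b\|_\infty$ in time $\widetilde{O}\big(d^{1/3}\varepsilon^{-2/3} \cdot \mathcal{T}_{\mathbf{A}}\big)$.
   Context: $\mathcal{T}_{\mathbf{A}}$ denotes the time to (exactly) solve a linear system in a matrix of the form $\mathbf{A}^\top \mathbf{D} \mathbf{A}$, where $\mathbf{D}$ is a positive diagonal matrix. $\widetilde{O}(\cdot)$ hides polylogarithmic factors in $n$. "With high probability" means with probability at least $1 - n^{-C}$ for any constant $C$. *)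

theory Defs
  imports "HOL-Probability.SPMF" "Jordan_Normal_Form.DL_Rank"
begin

section \<open>A randomized real RAM with a linear-system oracle\<close>

text \<open>
  Programs manipulate natural-number variables and arrays (for indices and counters) and
  real variables and arrays (exact real arithmetic).  All variables and arrays are named by
  natural numbers that are fixed in the program text; arrays are addressed by natural-number
  variables.  To keep the unit-cost measure honest, natural numbers can only be added and
  subtracted, there is no rounding of reals to integers, and constants are rational.  The
  functions exp and ln provide the real powers used in weighting schemes.
\<close>

datatype nat_op = NAdd | NSub

datatype real_op = RAdd | RSub | RMul | RDiv

datatype real_fun = RExp | RLn

datatype test = NLess nat nat | RLess nat nat

datatype prog =
    Skip
  | NConst nat nat
  | NOp nat_op nat nat nat
  | NLoad nat nat nat
  | NStore nat nat nat
  | RConst nat rat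
  | ROp real_op nat nat nat
  | RFun real_fun nat nat
  | ROfNat nat nat
  | RLoad nat nat nat
  | RStore nat nat nat
  | Flip nat
  | Solve nat nat nat
  | Seq prog prog
  | Cond test prog prog
  | While test prog

record state =
  nvar :: "nat \<Rightarrow> nat"
  rvar :: "nat \<Rightarrow> real"
  narr :: "nat \<Rightarrow> nat \<Rightarrow> nat"
  rarr :: "nat \<Rightarrow> nat \<Rightarrow> real"
  clock :: real

primrec nat_op_sem :: "nat_op \<Rightarrow> nat \<Rightarrow> nat \<Rightarrow> nat" where
  "nat_op_sem NAdd = (\<lambda>a b. a + b)"
| "nat_op_sem NSub = (\<lambda>a b. a - b)"

primrec real_op_sem :: "real_op \<Rightarrow> real \<Rightarrow> real \<Rightarrow> real" where
  "real_op_sem RAdd = (\<lambda>a b. a + b)"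
| "real_op_sem RSub = (\<lambda>a b. a - b)"
| "real_op_sem RMul = (\<lambda>a b. a * b)"
| "real_op_sem RDiv = (\<lambda>a b. a / b)"

primrec real_fun_sem :: "real_fun \<Rightarrow> real \<Rightarrow> real" where
  "real_fun_sem RExp = exp"
| "real_fun_sem RLn = ln"

primrec test_sem :: "test \<Rightarrow> state \<Rightarrow> bool" where
  "test_sem (NLess x y) s \<longleftrightarrow> nvar s x < nvar s y"
| "test_sem (RLess x y) s \<longleftrightarrow> rvar s x < rvar s y"

definition tick :: "real \<Rightarrow> state \<Rightarrow> state" where
  "tick c s = s\<lparr>clock := clock s + c\<rparr>"

definition set_nvar :: "nat \<Rightarrow> nat \<Rightarrow> state \<Rightarrow> state" where
  "set_nvar x k s = s\<lparr>nvar := (nvar s)(x := k)\<rparr>"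

definition set_rvar :: "nat \<Rightarrow> real \<Rightarrow> state \<Rightarrow> state" where
  "set_rvar x r s = s\<lparr>rvar := (rvar s)(x := r)\<rparr>"

definition set_narr :: "nat \<Rightarrow> nat \<Rightarrow> nat \<Rightarrow> state \<Rightarrow> state" where
  "set_narr a i k s = s\<lparr>narr := (narr s)(a := (narr s a)(i := k))\<rparr>"

definition set_rarr :: "nat \<Rightarrow> nat \<Rightarrow> real \<Rightarrow> state \<Rightarrow> state" where
  "set_rarr a i r s = s\<lparr>rarr := (rarr s)(a := (rarr s a)(i := r))\<rparr>"

text \<open>
  The exact solution of \<open>(A\<^sup>T D A) x = v\<close> with \<open>D\<close> the diagonal matrix of the weights \<open>w\<close>.
  It is unique whenever \<open>A\<close> has full column rank and the weights are positive.
\<close>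

definition weighted_solution ::
    "real mat \<Rightarrow> (nat \<Rightarrow> real) \<Rightarrow> real Matrix.vec \<Rightarrow> real Matrix.vec" where
  "weighted_solution A w v =
     (THE x. x \<in> carrier_vec (dim_col A) \<and>
        (transpose_mat A * mat_diag (dim_row A) w * A) *\<^sub>v x = v)"

text \<open>
  An oracle call reads the weights from array \<open>w\<close> and the right-hand side from array \<open>v\<close> and
  writes the solution to array \<open>z\<close>.  A call with a non-positive weight has no effect.
\<close>

definition oracle_solve :: "real mat \<Rightarrow> nat \<Rightarrow> nat \<Rightarrow> nat \<Rightarrow> state \<Rightarrow> state" where
  "oracle_solve A w v z s =
     (if \<forall>i < dim_row A. 0 < rarr s w i then
        (let x = weighted_solution A (rarr s w) (Matrix.vec (dim_col A) (rarr s v))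
         in s\<lparr>rarr := (rarr s)(z := (\<lambda>j. if j < dim_col A then vec_index x j else rarr s z j))\<rparr>)
      else s)"

partial_function (spmf) iterate ::
    "(state \<Rightarrow> bool) \<Rightarrow> (state \<Rightarrow> state spmf) \<Rightarrow> state \<Rightarrow> state spmf" where
  "iterate t f s =
     (if t s then bind_spmf (f (tick 1 s)) (iterate t f) else return_spmf (tick 1 s))"

text \<open>
  \<open>exec A T p s\<close> is the distribution of the final state of \<open>p\<close> started in \<open>s\<close>; missing mass is
  the probability of divergence.  Every elementary instruction and every test takes one unit of
  time, and solving a system in \<open>A\<^sup>T D A\<close> takes time \<open>T\<close>.
\<close>

primrec exec :: "real mat \<Rightarrow> real \<Rightarrow> prog \<Rightarrow> state \<Rightarrow> state spmf" where
  "exec A T Skip s = return_spmf (tick 1 s)"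
| "exec A T (NConst x k) s = return_spmf (tick 1 (set_nvar x k s))"
| "exec A T (NOp f x y z) s =
     return_spmf (tick 1 (set_nvar x (nat_op_sem f (nvar s y) (nvar s z)) s))"
| "exec A T (NLoad x a i) s = return_spmf (tick 1 (set_nvar x (narr s a (nvar s i)) s))"
| "exec A T (NStore a i x) s = return_spmf (tick 1 (set_narr a (nvar s i) (nvar s x) s))"
| "exec A T (RConst x q) s = return_spmf (tick 1 (set_rvar x (of_rat q) s))"
| "exec A T (ROp f x y z) s =
     return_spmf (tick 1 (set_rvar x (real_op_sem f (rvar s y) (rvar s z)) s))"
| "exec A T (RFun f x y) s = return_spmf (tick 1 (set_rvar x (real_fun_sem f (rvar s y)) s))"
| "exec A T (ROfNat x y) s = return_spmf (tick 1 (set_rvar x (real (nvar s y)) s))"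
| "exec A T (RLoad x a i) s = return_spmf (tick 1 (set_rvar x (rarr s a (nvar s i)) s))"
| "exec A T (RStore a i x) s = return_spmf (tick 1 (set_rarr a (nvar s i) (rvar s x) s))"
| "exec A T (Flip x) s =
     map_spmf (\<lambda>c. tick 1 (set_nvar x (if c then 1 else 0) s)) coin_spmf"
| "exec A T (Solve w v z) s = return_spmf (tick T (oracle_solve A w v z s))"
| "exec A T (Seq p q) s = bind_spmf (exec A T p s) (exec A T q)"
| "exec A T (Cond t p q) s =
     (if test_sem t s then exec A T p (tick 1 s) else exec A T q (tick 1 s))"
| "exec A T (While t p) s = iterate (test_sem t) (exec A T p) s"

section \<open>The regression problem\<close>

definition linf_norm :: "real Matrix.vec \<Rightarrow> real" where
  "linf_norm v = Max ((\<lambda>i. \<bar>vec_index v i\<bar>) ` {..<dim_vec v})"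

definition support :: "real mat \<Rightarrow> (nat \<times> nat) set" where
  "support A = {(i, j). i < dim_row A \<and> j < dim_col A \<and> A $$ (i, j) \<noteq> 0}"

definition nnz :: "real mat \<Rightarrow> nat" where
  "nnz A = card (support A)"

text \<open>
  The matrix is passed in coordinate format: \<open>es\<close> lists the positions of its nonzero entries in
  an arbitrary order.  The remaining inputs are the dimensions, the vector \<open>b\<close>, the accuracy
  \<open>eps\<close> and the exponent \<open>C\<close> of the failure probability.
\<close>

definition input_state ::
    "real mat \<Rightarrow> (nat \<times> nat) list \<Rightarrow> real Matrix.vec \<Rightarrow> real \<Rightarrow> real \<Rightarrow> state" where
  "input_state A es b eps C =
     \<lparr>nvar = (\<lambda>_. 0)(0 := dim_row A, 1 := dim_col A, 2 := length es),
      rvar = (\<lambda>_. 0)(0 := eps, 1 := C),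
      narr = (\<lambda>_ _. 0)(0 := (\<lambda>k. if k < length es then fst (es ! k) else 0),
                       1 := (\<lambda>k. if k < length es then snd (es ! k) else 0)),
      rarr = (\<lambda>_ _. 0)(0 := (\<lambda>k. if k < length es then A $$ (es ! k) else 0),
                       1 := (\<lambda>i. if i < dim_vec b then vec_index b i else 0)),
      clock = 0\<rparr>"

definition output_vec :: "nat \<Rightarrow> state \<Rightarrow> real Matrix.vec" where
  "output_vec d s = Matrix.vec d (rarr s 2)"

end

theory Submission
  imports Defs
begin

text \<open>
  Call weights \<open>w\<close> good if \<open>z\<^sub>i\<^sup>2 \<le> \<Sum>\<^sub>j w\<^sub>j z\<^sub>j\<^sup>2\<close> for all \<open>z\<close> in the column space and all \<open>i\<close>. Good weights of
  total \<open>O(d log n)\<close> are found by starting from \<open>1 / n\<close> and repeatedly increasing \<open>w\<^sub>i\<close> by \<open>4 w\<^sub>i h\<^sub>i\<^sup>2\<close>,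
  where \<open>h\<close> is the weighted projection of a random sign vector: the sum of \<open>1 / w\<^sub>i\<close> over the violated
  coordinates \<open>i\<close> decreases by a constant factor in expectation. This is the only use of randomness.

  Given such weights, every unit ball of the weighted Euclidean norm lies in the unit ball of the
  maximum norm, so the softened maximum of the residuals has a Hessian that is stable on such balls and a
  proximal point is computed by a logarithmic number of Newton steps, each one linear system.
  The weighted least squares solution is within \<open>R\<^sup>2 = O(d log n / \<epsilon>\<^sup>2)\<close> (after scaling)
  of the optimum, and accelerated steps of unit movement reach the optimum after \<open>O(R\<^sup>2\<^sup>/\<^sup>3)\<close> rounds,
  up to logarithms. Bisection on the optimal value adds a logarithmic factor. If \<open>\<epsilon> < 1 / n\<^sup>4\<close> the
  logarithms of \<open>1 / \<epsilon>\<close> are no longer harmless; then \<open>\<epsilon>\<^sup>-\<^sup>2\<^sup>/\<^sup>3\<close> exceeds \<open>n\<^sup>2 log (n / \<epsilon>)\<close> up to a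
  constant, and a plain barrier method suffices.
\<close>

section \<open>A command language and its translation to the machine\<close>

text \<open>The exponent 1/3 comes from balancing two kinds of progress. An accelerated step asks
  for the proximal point at a parameter dictated by the current weight \<open>\<alpha>\<close>, but
  Newton's method is controlled only in a ball of radius about 1 around the centre. No parameter is
  searched for: proximal points are followed from large parameters downwards, and the path is
  abandoned when it leaves the ball. If the dictated parameter is reached, a full step is possible
  and \<open>\<alpha>\<close> grows by \<open>1 + 1/K\<close>. Otherwise the movement itself
  guarantees that, unless a full step is possible anyway, a damped step lowers the potential by the
  order of \<open>K^2\<close>. A potential of \<open>K^3\<close> at the start then allows
  \<open>O(K)\<close> damped steps, and the growth of \<open>\<alpha>\<close> allows
  \<open>O(K)\<close> full ones up to a logarithm; hence \<open>K\<close> is the cube root of the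
  squared radius. The weights are never certified. Sampling poor weights is the only way to fail, so
  everything after the sampling is deterministic and terminates for every outcome. That part is
  written in a small language with total semantics, whose running time is counted in oracle
  times.\<close>

datatype rexp =
    Cst rat
  | V nat
  | At nat
  | Bin real_op rexp rexp
  | Fn real_fun rexp
  | Ite rexp rexp rexp rexp

primrec eval :: "rexp \<Rightarrow> (nat \<Rightarrow> real) \<Rightarrow> (nat \<Rightarrow> nat \<Rightarrow> real) \<Rightarrow> nat \<Rightarrow> real" where
  "eval (Cst q) \<rho> m i = of_rat q"
| "eval (V x) \<rho> m i = \<rho> x"
| "eval (At a) \<rho> m i = m a i"
| "eval (Bin f e1 e2) \<rho> m i = real_op_sem f (eval e1 \<rho> m i) (eval e2 \<rho> m i)"
| "eval (Fn f e) \<rho> m i = real_fun_sem f (eval e \<rho> m i)"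
| "eval (Ite e1 e2 e3 e4) \<rho> m i =
     (if eval e1 \<rho> m i < eval e2 \<rho> m i then eval e3 \<rho> m i else eval e4 \<rho> m i)"

text \<open>Program registers are those below 50. Registers 50 to 89 hold counters and bounds of
  nested loops, and those from 100 on are the evaluation stack, so neither group may be mentioned in
  an expression.\<close>

primrec wf_exp :: "rexp \<Rightarrow> bool" where
  "wf_exp (Cst q) = True"
| "wf_exp (V x) = (x < 50)"
| "wf_exp (At a) = True"
| "wf_exp (Bin f e1 e2) = (wf_exp e1 \<and> wf_exp e2)"
| "wf_exp (Fn f e) = wf_exp e"
| "wf_exp (Ite e1 e2 e3 e4) = (wf_exp e1 \<and> wf_exp e2 \<and> wf_exp e3 \<and> wf_exp e4)"

primrec exp_cost :: "rexp \<Rightarrow> real" where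
  "exp_cost (Cst q) = 1"
| "exp_cost (V x) = 2"
| "exp_cost (At a) = 1"
| "exp_cost (Bin f e1 e2) = exp_cost e1 + exp_cost e2 + 1"
| "exp_cost (Fn f e) = exp_cost e + 1"
| "exp_cost (Ite e1 e2 e3 e4) = exp_cost e1 + exp_cost e2 + exp_cost e3 + exp_cost e4 + 1"

text \<open>The result is left in register \<open>k\<close>, and the registers above it serve as
  stack. Copying a register is an addition to 0, since the machine has no move instruction. Array
  accesses use the index variable 3.\<close>

primrec cexp :: "rexp \<Rightarrow> nat \<Rightarrow> prog" where
  "cexp (Cst q) k = RConst k q"
| "cexp (V x) k = Seq (RConst k 0) (ROp RAdd k k x)"
| "cexp (At a) k = RLoad k a 3"
| "cexp (Bin f e1 e2) k = Seq (cexp e1 k) (Seq (cexp e2 (Suc k)) (ROp f k k (Suc k)))"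
| "cexp (Fn f e) k = Seq (cexp e k) (RFun f k k)"
| "cexp (Ite e1 e2 e3 e4) k = Seq (cexp e1 k) (Seq (cexp e2 (Suc k))
     (Cond (RLess k (Suc k)) (cexp e3 k) (cexp e4 k)))"

datatype dimension = Rows | Cols

primrec dim_var :: "dimension \<Rightarrow> nat" where
  "dim_var Rows = 0"
| "dim_var Cols = 1"

primrec dim_of :: "real mat \<Rightarrow> dimension \<Rightarrow> nat" where
  "dim_of A Rows = dim_row A"
| "dim_of A Cols = dim_col A"

text \<open>Loop counts are evaluated once on entry, so execution is a total function on stores and
  the running time is defined by recursion. Coin flips stay outside this language.\<close>

datatype cmd =
    Nop
  | Assign nat rexp
  | Fill dimension nat rexp
  | Acc nat rexp
  | MulA nat nat
  | MulAT nat nat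
  | Lin nat nat nat
  | Then cmd cmd (infixr ";;" 60)
  | Branch rexp rexp cmd cmd
  | Loop rexp cmd

record store =
  reg :: "nat \<Rightarrow> real"
  mem :: "nat \<Rightarrow> nat \<Rightarrow> real"

primrec acc_iter :: "nat \<Rightarrow> rexp \<Rightarrow> store \<Rightarrow> nat \<Rightarrow> real" where
  "acc_iter x e \<sigma> 0 = reg \<sigma> x"
| "acc_iter x e \<sigma> (Suc i) = eval e ((reg \<sigma>)(x := acc_iter x e \<sigma> i)) (mem \<sigma>) i"

definition lin_app :: "real mat \<Rightarrow> (nat \<Rightarrow> real) \<Rightarrow> nat \<Rightarrow> real" where
  "lin_app A x i = (\<Sum>j<dim_col A. A $$ (i, j) * x j)"

definition lin_adj :: "real mat \<Rightarrow> (nat \<Rightarrow> real) \<Rightarrow> nat \<Rightarrow> real" where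
  "lin_adj A u j = (\<Sum>i<dim_row A. A $$ (i, j) * u i)"

definition solve_arr :: "real mat \<Rightarrow> (nat \<Rightarrow> real) \<Rightarrow> (nat \<Rightarrow> real) \<Rightarrow> (nat \<Rightarrow> real) \<Rightarrow> nat \<Rightarrow> real" where
  "solve_arr A w v z j =
     (if (\<forall>i < dim_row A. 0 < w i) \<and> j < dim_col A
      then vec_index (weighted_solution A w (Matrix.vec (dim_col A) v)) j else z j)"

primrec run :: "real mat \<Rightarrow> cmd \<Rightarrow> store \<Rightarrow> store" where
  "run A Nop \<sigma> = \<sigma>"
| "run A (Assign x e) \<sigma> = \<sigma>\<lparr>reg := (reg \<sigma>)(x := eval e (reg \<sigma>) (mem \<sigma>) 0)\<rparr>"
| "run A (Fill m a e) \<sigma> = \<sigma>\<lparr>mem := (mem \<sigma>)(a :=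
     (\<lambda>i. if i < dim_of A m then eval e (reg \<sigma>) (mem \<sigma>) i else mem \<sigma> a i))\<rparr>"
| "run A (Acc x e) \<sigma> = \<sigma>\<lparr>reg := (reg \<sigma>)(x := acc_iter x e \<sigma> (dim_row A))\<rparr>"
| "run A (MulA a c) \<sigma> = \<sigma>\<lparr>mem := (mem \<sigma>)(a :=
     (\<lambda>i. if i < dim_row A then lin_app A (mem \<sigma> c) i else mem \<sigma> a i))\<rparr>"
| "run A (MulAT a c) \<sigma> = \<sigma>\<lparr>mem := (mem \<sigma>)(a :=
     (\<lambda>j. if j < dim_col A then lin_adj A (mem \<sigma> c) j else mem \<sigma> a j))\<rparr>"
| "run A (Lin w v z) \<sigma> = \<sigma>\<lparr>mem := (mem \<sigma>)(z := solve_arr A (mem \<sigma> w) (mem \<sigma> v) (mem \<sigma> z))\<rparr>"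
| "run A (c1 ;; c2) \<sigma> = run A c2 (run A c1 \<sigma>)"
| "run A (Branch e1 e2 c1 c2) \<sigma> =
     (if eval e1 (reg \<sigma>) (mem \<sigma>) 0 < eval e2 (reg \<sigma>) (mem \<sigma>) 0 then run A c1 \<sigma> else run A c2 \<sigma>)"
| "run A (Loop e c) \<sigma> = (run A c ^^ nat \<lceil>eval e (reg \<sigma>) (mem \<sigma>) 0\<rceil>) \<sigma>"

text \<open>Running time in units of the oracle time, up to the overhead of the translation.\<close>

primrec cost :: "real mat \<Rightarrow> cmd \<Rightarrow> store \<Rightarrow> real" where
  "cost A Nop \<sigma> = 1"
| "cost A (Assign x e) \<sigma> = exp_cost e + 4"
| "cost A (Fill m a e) \<sigma> = exp_cost e + 10"
| "cost A (Acc x e) \<sigma> = exp_cost e + 10"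
| "cost A (MulA a c) \<sigma> = 40"
| "cost A (MulAT a c) \<sigma> = 40"
| "cost A (Lin w v z) \<sigma> = 1"
| "cost A (c1 ;; c2) \<sigma> = cost A c1 \<sigma> + cost A c2 (run A c1 \<sigma>)"
| "cost A (Branch e1 e2 c1 c2) \<sigma> = exp_cost e1 + exp_cost e2 + 4 +
     (if eval e1 (reg \<sigma>) (mem \<sigma>) 0 < eval e2 (reg \<sigma>) (mem \<sigma>) 0 then cost A c1 \<sigma> else cost A c2 \<sigma>)"
| "cost A (Loop e c) \<sigma> = exp_cost e + 8 +
     (\<Sum>k<nat \<lceil>eval e (reg \<sigma>) (mem \<sigma>) 0\<rceil>. cost A c ((run A c ^^ k) \<sigma>) + 4)"

text \<open>Array 0 holds the matrix entries and must survive. A matrix product clears its target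
  before reading the source, hence \<open>a \<noteq> c\<close>. Nesting depth below 20 keeps the
  loop registers below the evaluation stack.\<close>

primrec wf_cmd :: "nat \<Rightarrow> cmd \<Rightarrow> bool" where
  "wf_cmd l Nop = True"
| "wf_cmd l (Assign x e) = (x < 50 \<and> wf_exp e)"
| "wf_cmd l (Fill m a e) = (a \<noteq> 0 \<and> wf_exp e)"
| "wf_cmd l (Acc x e) = (x < 50 \<and> wf_exp e)"
| "wf_cmd l (MulA a c) = (a \<noteq> 0 \<and> a \<noteq> c)"
| "wf_cmd l (MulAT a c) = (a \<noteq> 0 \<and> a \<noteq> c)"
| "wf_cmd l (Lin w v z) = (z \<noteq> 0)"
| "wf_cmd l (c1 ;; c2) = (wf_cmd l c1 \<and> wf_cmd l c2)"
| "wf_cmd l (Branch e1 e2 c1 c2) = (wf_exp e1 \<and> wf_exp e2 \<and> wf_cmd l c1 \<and> wf_cmd l c2)"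
| "wf_cmd l (Loop e c) = (wf_exp e \<and> l < 20 \<and> wf_cmd (Suc l) c)"

definition for_nat :: "nat \<Rightarrow> prog \<Rightarrow> prog" where
  "for_nat m p = Seq (NConst 3 0) (Seq (NConst 4 1)
     (While (NLess 3 m) (Seq p (NOp NAdd 3 3 4))))"

text \<open>The machine cannot round reals, so the counter is itself a real and is compared with the
  unrounded bound. Nesting level \<open>l\<close> owns the registers \<open>50 + 2 * l\<close> and
  \<open>51 + 2 * l\<close>.\<close>

definition for_real :: "nat \<Rightarrow> rexp \<Rightarrow> prog \<Rightarrow> prog" where
  "for_real l e p = Seq (NConst 3 0) (Seq (cexp e 100) (Seq (RConst (50 + 2 * l) 0)
     (Seq (ROp RAdd (51 + 2 * l) 100 (50 + 2 * l))
     (While (RLess (50 + 2 * l) (51 + 2 * l))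
        (Seq p (Seq (RConst 100 1) (ROp RAdd (50 + 2 * l) (50 + 2 * l) 100)))))))"

text \<open>One entry of a product in coordinate format. Exchanging the two index arrays
  \<open>r\<close> and \<open>c\<close> gives the product with the transpose.\<close>

definition add_entries :: "nat \<Rightarrow> nat \<Rightarrow> nat \<Rightarrow> nat \<Rightarrow> prog" where
  "add_entries r c a v =
     Seq (NLoad 5 r 3) (Seq (NLoad 6 c 3) (Seq (RLoad 100 0 3) (Seq (RLoad 101 v 6)
     (Seq (ROp RMul 100 100 101) (Seq (RLoad 101 a 5) (Seq (ROp RAdd 100 101 100)
     (RStore a 5 100)))))))"

definition fill_prog :: "dimension \<Rightarrow> nat \<Rightarrow> rexp \<Rightarrow> prog" where
  "fill_prog m a e = for_nat (dim_var m) (Seq (cexp e 100) (RStore a 3 100))"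

primrec compile :: "nat \<Rightarrow> cmd \<Rightarrow> prog" where
  "compile l Nop = Skip"
| "compile l (Assign x e) = Seq (NConst 3 0) (Seq (cexp e 100) (Seq (RConst 101 0) (ROp RAdd x 100 101)))"
| "compile l (Fill m a e) = fill_prog m a e"
| "compile l (Acc x e) = for_nat 0 (Seq (cexp e 100) (Seq (RConst 101 0) (ROp RAdd x 100 101)))"
| "compile l (MulA a c) = Seq (fill_prog Rows a (Cst 0)) (for_nat 2 (add_entries 0 1 a c))"
| "compile l (MulAT a c) = Seq (fill_prog Cols a (Cst 0)) (for_nat 2 (add_entries 1 0 a c))"
| "compile l (Lin w v z) = Solve w v z"
| "compile l (c1 ;; c2) = Seq (compile l c1) (compile l c2)"
| "compile l (Branch e1 e2 c1 c2) = Seq (NConst 3 0) (Seq (cexp e1 100) (Seq (cexp e2 101)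
     (Cond (RLess 100 101) (compile l c1) (compile l c2))))"
| "compile l (Loop e c) = for_real l e (compile (Suc l) c)"

section \<open>Weakest preconditions of deterministic programs\<close>

definition det :: "real mat \<Rightarrow> real \<Rightarrow> prog \<Rightarrow> state \<Rightarrow> (state \<Rightarrow> bool) \<Rightarrow> bool" where
  "det A T p s Q \<longleftrightarrow> (\<exists>s'. exec A T p s = return_spmf s' \<and> Q s')"

lemma det_mono: "det A T p s Q \<Longrightarrow> (\<And>s'. Q s' \<Longrightarrow> Q' s') \<Longrightarrow> det A T p s Q'"
  by (auto simp: det_def)

text \<open>\<open>det\<close> behaves as a weakest precondition: the claim about the second program
  is the postcondition of the first, which lets proofs execute a program symbolically from left to
  right.\<close>

lemma det_Seq: "det A T p s (\<lambda>s'. det A T q s' Q) \<Longrightarrow> det A T (Seq p q) s Q"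
  by (auto simp: det_def)

lemma det_prims [simp]:
  "det A T Skip s Q = Q (tick 1 s)"
  "det A T (NConst x k) s Q = Q (tick 1 (set_nvar x k s))"
  "det A T (NOp f x y z) s Q = Q (tick 1 (set_nvar x (nat_op_sem f (nvar s y) (nvar s z)) s))"
  "det A T (NLoad x a i) s Q = Q (tick 1 (set_nvar x (narr s a (nvar s i)) s))"
  "det A T (RConst x q) s Q = Q (tick 1 (set_rvar x (of_rat q) s))"
  "det A T (ROp g x y z) s Q = Q (tick 1 (set_rvar x (real_op_sem g (rvar s y) (rvar s z)) s))"
  "det A T (RFun h x y) s Q = Q (tick 1 (set_rvar x (real_fun_sem h (rvar s y)) s))"
  "det A T (ROfNat x y) s Q = Q (tick 1 (set_rvar x (real (nvar s y)) s))"
  "det A T (RLoad x a i) s Q = Q (tick 1 (set_rvar x (rarr s a (nvar s i)) s))"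
  "det A T (RStore a i x) s Q = Q (tick 1 (set_rarr a (nvar s i) (rvar s x) s))"
  "det A T (Solve w v z) s Q = Q (tick T (oracle_solve A w v z s))"
  by (auto simp: det_def)

lemma det_Cond: "det A T (Cond t p q) s Q =
    (if test_sem t s then det A T p (tick 1 s) Q else det A T q (tick 1 s) Q)"
  by (auto simp: det_def)

lemma det_While_True:
  "test_sem t s \<Longrightarrow> det A T p (tick 1 s) (\<lambda>s'. det A T (While t p) s' Q) \<Longrightarrow> det A T (While t p) s Q"
  by (auto simp: det_def) (subst iterate.simps, simp)

lemma det_While_False: "\<not> test_sem t s \<Longrightarrow> Q (tick 1 s) \<Longrightarrow> det A T (While t p) s Q"
  by (auto simp: det_def) (subst iterate.simps, simp)

lemmas state_defs = tick_def set_nvar_def set_rvar_def set_rarr_def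

lemma exp_cost_ge: "1 \<le> exp_cost e"
  by (induction e) auto

text \<open>Stated with an arbitrary postcondition \<open>Q\<close> so that it chains with
  \<open>det_Seq\<close>. Registers below \<open>k\<close> survive, which protects operands already
  on the stack. The clock is only bounded because a conditional runs one of two branches while
  \<open>exp_cost\<close> adds both.\<close>

lemma cexp_correct:
  assumes "wf_exp e" "100 \<le> k"
    and "\<And>\<rho>' c'. \<rho>' k = eval e (rvar s) (rarr s) (nvar s 3) \<Longrightarrow> (\<And>x. x < k \<Longrightarrow> \<rho>' x = rvar s x) \<Longrightarrow>
           c' \<le> clock s + exp_cost e \<Longrightarrow> Q (s\<lparr>rvar := \<rho>', clock := c'\<rparr>)"
  shows "det A T (cexp e k) s Q"
  using assms
proof (induction e arbitrary: k s Q)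
  case (Cst q)
  show ?case using Cst(3)[of "(rvar s)(k := of_rat q)" "clock s + 1"] by (simp add: state_defs fun_upd_def)
next
  case (V x)
  show ?case
    apply (simp, rule det_Seq, simp add: state_defs)
    using V(3)[of "(rvar s)(k := rvar s x)" "2 + clock s"] V(1,2) by (simp add: fun_upd_def)
next
  case (At a)
  show ?case using At(3)[of "(rvar s)(k := rarr s a (nvar s 3))" "clock s + 1"] by (simp add: state_defs fun_upd_def)
next
  case (Bin f e1 e2)
  have ev: "eval e \<rho>' m i = eval e \<rho> m i" if "wf_exp e" "\<And>x. x < k \<Longrightarrow> \<rho>' x = \<rho> x" for e \<rho> \<rho>' m i
    using that Bin.prems(2) by (induction e) auto
  show ?case
    apply simp
    apply (rule det_Seq)
    apply (rule Bin.IH(1))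
    using Bin.prems apply simp
    using Bin.prems apply simp
    apply (rule det_Seq)
    apply (rule Bin.IH(2))
    using Bin.prems apply simp
    using Bin.prems apply simp
    apply (simp add: state_defs)
    subgoal for \<rho>1 c1 \<rho>2 c2
      using Bin.prems(3)[of "\<rho>2(k := real_op_sem f (\<rho>2 k) (\<rho>2 (Suc k)))" "c2 + 1"]
        ev[of e2 \<rho>1 "rvar s"] Bin.prems(1)
      by (simp add: fun_upd_def)
    done
next
  case (Fn f e)
  show ?case
    apply simp
    apply (rule det_Seq)
    apply (rule Fn.IH)
    using Fn.prems apply simp
    using Fn.prems apply simp
    apply (simp add: state_defs)
    subgoal for \<rho>1 c1
      using Fn.prems(3)[of "\<rho>1(k := real_fun_sem f (\<rho>1 k))" "c1 + 1"]
      by (simp add: fun_upd_def)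
    done
next
  case (Ite e1 e2 e3 e4)
  have ev: "eval e \<rho>' m i = eval e \<rho> m i" if "wf_exp e" "\<And>x. x < k \<Longrightarrow> \<rho>' x = \<rho> x" for e \<rho> \<rho>' m i
    using that Ite.prems(2) by (induction e) auto
  show ?case
    apply simp
    apply (rule det_Seq)
    apply (rule Ite.IH(1))
    using Ite.prems apply simp
    using Ite.prems apply simp
    apply (rule det_Seq)
    apply (rule Ite.IH(2))
    using Ite.prems apply simp
    using Ite.prems apply simp
    subgoal for \<rho>1 c1 \<rho>2 c2
      apply (simp add: det_Cond)
      apply (intro conjI impI)
       apply (rule Ite.IH(3))
      using Ite.prems apply simp
      using Ite.prems apply simp
      apply (simp add: state_defs)
      subgoal for \<rho>3 c3
        using Ite.prems(3)[of "\<rho>3" "c3"] ev[of e2 \<rho>1 "rvar s"]  ev[of e3 \<rho>2 "rvar s"]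
          Ite.prems(1) exp_cost_ge[of e4]
        by simp
       apply (rule Ite.IH(4))
      using Ite.prems apply simp
      using Ite.prems apply simp
      apply (simp add: state_defs)
      subgoal for \<rho>3 c3
        using Ite.prems(3)[of "\<rho>3" "c3"] ev[of e2 \<rho>1 "rvar s"]  ev[of e4 \<rho>2 "rvar s"]
          Ite.prems(1) exp_cost_ge[of e3]
        by simp
      done
    done
qed

lemma eval_cong:
  "wf_exp e \<Longrightarrow> (\<And>x. x < 50 \<Longrightarrow> \<rho>' x = \<rho> x) \<Longrightarrow> eval e \<rho>' m i = eval e \<rho> m i"
  by (induction e) auto

text \<open>The bound on \<open>T\<close> makes one pass over the matrix entries or over a vector
  cost a constant number of oracle times. All running times can therefore be counted in units of
  \<open>T\<close>.\<close>

locale machine =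
  fixes A :: "real mat" and T :: real and es :: "(nat \<times> nat) list" and n d :: nat
  assumes carrier: "A \<in> carrier_mat n d"
    and distinct_es: "distinct es"
    and set_es: "set es = support A"
    and T_ge: "real (length es) + real n \<le> T"
    and d_le_n: "d \<le> n"
    and d_pos: "1 \<le> d"
begin

lemma dims [simp]: "dim_row A = n" "dim_col A = d"
  using carrier by auto

lemma n_pos: "1 \<le> n"
  using d_pos d_le_n by simp

lemma T_ge_1: "1 \<le> T" and T_ge_n: "real n \<le> T" and T_ge_d: "real d \<le> T"
  and T_ge_es: "real (length es) \<le> T"
  using T_ge n_pos d_le_n by linarith+

lemma T_nonneg: "0 \<le> T"
  using T_ge_1 by simp

section \<open>Simulation of commands by compiled programs\<close>

definition base :: "state \<Rightarrow> bool" where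
  "base s \<longleftrightarrow> nvar s 0 = n \<and> nvar s 1 = d \<and> nvar s 2 = length es \<and>
     (\<forall>k<length es. narr s 0 k = fst (es ! k) \<and> narr s 1 k = snd (es ! k) \<and> rarr s 0 k = A $$ (es ! k))"

definition sim :: "store \<Rightarrow> state \<Rightarrow> bool" where
  "sim \<sigma> s \<longleftrightarrow> base s \<and> (\<forall>x<50. rvar s x = reg \<sigma> x) \<and> rarr s = mem \<sigma>"

definition lim :: "nat \<Rightarrow> nat" where
  "lim m = (if m = 0 then n else if m = 1 then d else length es)"

lemma base_lim: "base s \<Longrightarrow> m < 3 \<Longrightarrow> nvar s m = lim m"
  by (auto simp: base_def lim_def numeral_3_eq_3 numeral_2_eq_2 less_Suc_eq)

lemma base_simps [simp]:
  "base (tick c s) = base s"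
  "3 \<le> x \<Longrightarrow> base (set_nvar x k s) = base s"
  "base (set_rvar x r s) = base s"
  "a \<noteq> 0 \<Longrightarrow> base (set_rarr a i r s) = base s"
  "base (s\<lparr>rvar := \<rho>, clock := c\<rparr>) = base s"
  by (auto simp: base_def state_defs)

lemma state_simps [simp]:
  "nvar (tick c s) = nvar s" "rvar (tick c s) = rvar s" "rarr (tick c s) = rarr s" "narr (tick c s) = narr s"
  "clock (tick c s) = clock s + c"
  "nvar (set_nvar x k s) = (nvar s)(x := k)" "rvar (set_nvar x k s) = rvar s"
  "rarr (set_nvar x k s) = rarr s" "narr (set_nvar x k s) = narr s" "clock (set_nvar x k s) = clock s"
  "nvar (set_rvar x r s) = nvar s" "rvar (set_rvar x r s) = (rvar s)(x := r)"
  "rarr (set_rvar x r s) = rarr s" "narr (set_rvar x r s) = narr s" "clock (set_rvar x r s) = clock s"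
  "nvar (set_rarr a i r s) = nvar s" "rvar (set_rarr a i r s) = rvar s"
  "rarr (set_rarr a i r s) = (rarr s)(a := (rarr s a)(i := r))" "narr (set_rarr a i r s) = narr s"
  "clock (set_rarr a i r s) = clock s"
  by (auto simp: state_defs)

text \<open>The invariant \<open>J\<close> sees only real registers and arrays. Of the natural
  variables, 3 is the index and 4 the constant 1, and the body has to preserve both.\<close>

lemma for_nat_correct:
  assumes "base s" "m < 3" and J0: "J 0 (rvar s) (rarr s)"
    and step: "\<And>i s. i < lim m \<Longrightarrow> base s \<Longrightarrow> nvar s 3 = i \<Longrightarrow> nvar s 4 = 1 \<Longrightarrow> J i (rvar s) (rarr s) \<Longrightarrow>
       det A T p s (\<lambda>s'. base s' \<and> nvar s' 3 = i \<and> nvar s' 4 = 1 \<and> J (Suc i) (rvar s') (rarr s') \<and>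
         clock s' \<le> clock s + c)"
  shows "det A T (for_nat m p) s (\<lambda>s'. base s' \<and> J (lim m) (rvar s') (rarr s') \<and>
           clock s' \<le> clock s + 3 + real (lim m) * (c + 2))"
proof -
  have *: "det A T (While (NLess 3 m) (Seq p (NOp NAdd 3 3 4))) s
      (\<lambda>s'. base s' \<and> J (lim m) (rvar s') (rarr s') \<and> clock s' \<le> clock s + 1 + real r * (c + 2))"
    if "r \<le> lim m" "base s" "nvar s 3 = lim m - r" "nvar s 4 = 1" "J (lim m - r) (rvar s) (rarr s)" for r s
    using that
  proof (induction r arbitrary: s)
    case 0
    show ?case
      by (rule det_While_False) (use 0 base_lim[OF _ assms(2)] in auto)
  next
    case (Suc r)
    show ?case
    proof (rule det_While_True)
      show "test_sem (NLess 3 m) s"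
        using Suc.prems base_lim[OF _ assms(2), of s] by simp
      show "det A T (Seq p (NOp NAdd 3 3 4)) (tick 1 s)
          (\<lambda>s'. det A T (While (NLess 3 m) (Seq p (NOp NAdd 3 3 4))) s'
            (\<lambda>s'. base s' \<and> J (lim m) (rvar s') (rarr s') \<and> clock s' \<le> clock s + 1 + real (Suc r) * (c + 2)))"
      proof (rule det_Seq, rule det_mono, rule step[of "lim m - Suc r"], goal_cases)
        case (6 s')
        have "Suc (lim m - Suc r) = lim m - r" using Suc.prems(1) by simp
        with 6 show ?case
          apply simp
          apply (rule det_mono, rule Suc.IH)
          using Suc.prems(1) by (auto simp: algebra_simps)
      qed (use Suc.prems in auto)
    qed
  qed
  show ?thesis
    unfolding for_nat_def
    apply (rule det_Seq, simp, rule det_Seq, simp)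
    apply (rule det_mono, rule *[of "lim m"])
    using assms(1) J0 by auto
qed

lemma fill_correct:
  assumes "sim \<sigma> s" "a \<noteq> 0" "wf_exp e"
  shows "det A T (fill_prog dm a e) s (\<lambda>s'. sim (run A (Fill dm a e) \<sigma>) s' \<and>
     clock s' \<le> clock s + 3 + real (dim_of A dm) * (exp_cost e + 3) \<and> (\<forall>x<100. rvar s' x = rvar s x))"
proof -
  have lim: "lim (dim_var dm) = dim_of A dm" by (cases dm) (auto simp: lim_def)
  define J where "J = (\<lambda>i \<rho> m. (\<forall>x<100. \<rho> x = rvar s x) \<and> m = (mem \<sigma>)(a :=
     (\<lambda>k. if k < i \<and> k < dim_of A dm then eval e (reg \<sigma>) ((mem \<sigma>)) k else mem \<sigma> a k)))"
  txt \<open>The expression is evaluated in the partially overwritten memory, so it may mention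
    the target array only at the current index.\<close>
  have ev: "eval e \<rho> ((mem \<sigma>)(a := g)) i = eval e \<rho> (mem \<sigma>) i" if "g i = mem \<sigma> a i" for g i \<rho>
    using that by (induction e) auto
  have ec: "eval e \<rho> m i = eval e (reg \<sigma>) m i" if "\<forall>x<100. \<rho> x = rvar s x" for \<rho> m i
    using that assms by (intro eval_cong) (auto simp: sim_def)
  show ?thesis
    unfolding fill_prog_def
    apply (rule det_mono, rule for_nat_correct[where J = J and c = "exp_cost e + 1"])
    using assms(1) apply (simp add: sim_def)
    apply (cases dm; simp)
    using assms(1) apply (simp add: sim_def J_def)
     apply (rule det_Seq, rule cexp_correct[OF assms(3)], simp)
    subgoal for i s1 \<rho>' c'
    proof -
      assume h: "i < lim (dim_var dm)" "base s1" "nvar s1 3 = i" "nvar s1 4 = 1" "J i (rvar s1) (rarr s1)"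
        "\<rho>' 100 = eval e (rvar s1) (rarr s1) (nvar s1 3)" "\<And>x. x < 100 \<Longrightarrow> \<rho>' x = rvar s1 x"
        "c' \<le> clock s1 + exp_cost e"
      then have "eval e (rvar s1) (rarr s1) i = eval e (reg \<sigma>) (mem \<sigma>) i"
        using ec[of "rvar s1"] by (auto simp: J_def intro!: ev)
      with h assms(2) show ?thesis
        by (auto simp: J_def fun_eq_iff lim)
    qed
    subgoal for s'
      using assms(1) by (auto simp: sim_def J_def lim algebra_simps fun_eq_iff)
    done
qed

text \<open>As \<open>es\<close> is distinct, list positions correspond one to one to nonzero
  entries. The remaining index pairs contribute 0.\<close>

lemma sum_entries:
  assumes "r < n"
  shows "(\<Sum>k<length es. if fst (es ! k) = r then A $$ (es ! k) * x (snd (es ! k)) else 0) = lin_app A x r"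
proof -
  let ?g = "\<lambda>p. if fst p = r then A $$ p * x (snd p) else 0"
  have "(\<Sum>k<length es. ?g (es ! k)) = (\<Sum>p\<in>support A. ?g p)"
    using sum.reindex_bij_betw[OF bij_betw_nth[OF distinct_es refl set_es[symmetric]], of ?g]
    by simp
  also have "\<dots> = (\<Sum>p\<in>{..<n} \<times> {..<d}. ?g p)"
    by (rule sum.mono_neutral_left) (auto simp: support_def)
  also have "\<dots> = (\<Sum>i<n. \<Sum>j<d. ?g (i, j))"
    by (simp add: sum.cartesian_product')
  also have "\<dots> = (\<Sum>i<n. if i = r then (\<Sum>j<d. A $$ (i, j) * x j) else 0)"
    by (intro sum.cong) auto
  also have "\<dots> = lin_app A x r"
    using assms by (simp add: lin_app_def)
  finally show ?thesis .
qed

lemma sum_entries_adj: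
  assumes "r < d"
  shows "(\<Sum>k<length es. if snd (es ! k) = r then A $$ (es ! k) * x (fst (es ! k)) else 0) = lin_adj A x r"
proof -
  let ?g = "\<lambda>p. if snd p = r then A $$ p * x (fst p) else 0"
  have "(\<Sum>k<length es. ?g (es ! k)) = (\<Sum>p\<in>support A. ?g p)"
    using sum.reindex_bij_betw[OF bij_betw_nth[OF distinct_es refl set_es[symmetric]], of ?g]
    by simp
  also have "\<dots> = (\<Sum>p\<in>{..<n} \<times> {..<d}. ?g p)"
    by (rule sum.mono_neutral_left) (auto simp: support_def)
  also have "\<dots> = (\<Sum>i<n. \<Sum>j<d. ?g (i, j))"
    by (simp add: sum.cartesian_product')
  also have "\<dots> = (\<Sum>i<n. A $$ (i, r) * x i)"
    using assms by (intro sum.cong) auto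
  also have "\<dots> = lin_adj A x r"
    using assms by (simp add: lin_adj_def)
  finally show ?thesis .
qed

lemma entry_bounds: "k < length es \<Longrightarrow> fst (es ! k) < n \<and> snd (es ! k) < d"
  using nth_mem[of k es] set_es by (auto simp: support_def)

lemma add_entries_correct:
  assumes "sim \<sigma> s" "a \<noteq> 0" "a \<noteq> c" and rc: "(r = 0 \<and> q = 1 \<and> p1 = fst \<and> p2 = snd) \<or> (r = 1 \<and> q = 0 \<and> p1 = snd \<and> p2 = fst)"
  shows "det A T (for_nat 2 (add_entries r q a c)) s (\<lambda>s'. sim (\<sigma>\<lparr>mem := (mem \<sigma>)(a := (\<lambda>i. mem \<sigma> a i +
      (\<Sum>k<length es. if p1 (es ! k) = i then A $$ (es ! k) * mem \<sigma> c (p2 (es ! k)) else 0)))\<rparr>) s' \<and>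
     clock s' \<le> clock s + 3 + real (length es) * 10 \<and> (\<forall>x<100. rvar s' x = rvar s x))"
proof -
  have lim: "lim 2 = length es" by (auto simp: lim_def)
  define J where "J = (\<lambda>l \<rho> m. (\<forall>x<100. \<rho> x = rvar s x) \<and> m = (mem \<sigma>)(a := (\<lambda>i. mem \<sigma> a i +
      (\<Sum>k<l. if p1 (es ! k) = i then A $$ (es ! k) * mem \<sigma> c (p2 (es ! k)) else 0))))"
  show ?thesis
    apply (rule det_mono, rule for_nat_correct[where J = J and c = "8"])
    using assms(1) apply (simp add: sim_def)
    apply simp
    using assms(1) apply (simp add: sim_def J_def)
    subgoal for i s
    proof -
      assume h: "i < lim 2" "base s" "nvar s 3 = i" "nvar s 4 = 1" "J i (rvar s) (rarr s)"
      then have "narr s r i = p1 (es ! i)" "narr s q i = p2 (es ! i)" "rarr s 0 i = A $$ (es ! i)"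
        using rc by (auto simp: base_def lim)
      with h assms(2,3) show ?thesis
        unfolding add_entries_def lim
        apply -
        apply (rule det_Seq, simp)+
        by (auto simp: J_def fun_eq_iff)
    qed
    subgoal for s'
      using assms(1) by (auto simp: sim_def J_def lim algebra_simps fun_eq_iff)
    done
qed

lemma cost_ge: "1 \<le> cost A c \<sigma>"
proof (induction c arbitrary: \<sigma>)
  case (Then c1 c2)
  show ?case using Then(1)[of \<sigma>] Then(2)[of "run A c1 \<sigma>"] by simp
next
  case (Branch e1 e2 c1 c2)
  show ?case using Branch(1)[of \<sigma>] Branch(2)[of \<sigma>] exp_cost_ge[of e1] exp_cost_ge[of e2] by auto
next
  case (Loop e c)
  have "0 \<le> (\<Sum>k<nat \<lceil>eval e (reg \<sigma>) (mem \<sigma>) 0\<rceil>. cost A c ((run A c ^^ k) \<sigma>) + 4)"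
    by (rule sum_nonneg) (use Loop[of "(run A c ^^ k) \<sigma>" for k] in \<open>smt\<close>)
  then show ?case using exp_cost_ge[of e] by simp
next
  case (Assign x e) show ?case using exp_cost_ge[of e] by simp
next
  case (Fill m a e) show ?case using exp_cost_ge[of e] by simp
next
  case (Acc x e) show ?case using exp_cost_ge[of e] by simp
qed auto

lemma T_mult: "0 \<le> x \<Longrightarrow> x \<le> x * T"
  using T_ge_1 by (simp add: mult_le_cancel_left1)

text \<open>For a natural number \<open>k\<close>, \<open>k < v\<close> is equivalent to
  \<open>k < nat \<lceil>v\<rceil>\<close>, so counting in reals performs exactly the rounds of
  \<open>run\<close>. The body has to preserve the counters of this level too, while the conclusion
  protects only those of enclosing levels.\<close>

lemma for_real_correct:
  assumes "sim \<sigma> s" "wf_exp e" "l < 20"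
    and body: "\<And>\<sigma> s. sim \<sigma> s \<Longrightarrow> det A T p s (\<lambda>s'. sim (f \<sigma>) s' \<and> clock s' \<le> clock s + c \<sigma> * T \<and>
       (\<forall>x. 50 \<le> x \<and> x < 50 + 2 * Suc l \<longrightarrow> rvar s' x = rvar s x))"
    and c_nonneg: "\<And>\<sigma>. 0 \<le> c \<sigma>"
  shows "det A T (for_real l e p) s (\<lambda>s'. sim ((f ^^ nat \<lceil>eval e (reg \<sigma>) (mem \<sigma>) 0\<rceil>) \<sigma>) s' \<and>
     clock s' \<le> clock s + (exp_cost e + 8 +
       (\<Sum>k<nat \<lceil>eval e (reg \<sigma>) (mem \<sigma>) 0\<rceil>. c ((f ^^ k) \<sigma>) + 4)) * T \<and>
     (\<forall>x. 50 \<le> x \<and> x < 50 + 2 * l \<longrightarrow> rvar s' x = rvar s x))"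
proof -
  define v where "v = eval e (reg \<sigma>) (mem \<sigma>) 0"
  let ?cn = "50 + 2 * l" and ?bd = "51 + 2 * l"
  let ?W = "While (RLess ?cn ?bd) (Seq p (Seq (RConst 100 1) (ROp RAdd ?cn ?cn 100)))"
  have *: "det A T ?W s1
      (\<lambda>s'. sim ((f ^^ nat \<lceil>v\<rceil>) \<sigma>) s' \<and> clock s' \<le> clock s1 + (1 + (\<Sum>k=nat \<lceil>v\<rceil>-r..<nat \<lceil>v\<rceil>. c ((f ^^ k) \<sigma>) + 4)) * T \<and>
       (\<forall>x. 50 \<le> x \<and> x < 50 + 2 * l \<longrightarrow> rvar s' x = rvar s1 x))"
    if "r \<le> nat \<lceil>v\<rceil>" "sim ((f ^^ (nat \<lceil>v\<rceil> - r)) \<sigma>) s1" "rvar s1 ?cn = real (nat \<lceil>v\<rceil> - r)" "rvar s1 ?bd = v" for r s1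
    using that
  proof (induction r arbitrary: s1)
    case 0
    show ?case
    proof (rule det_While_False)
      show "\<not> test_sem (RLess ?cn ?bd) s1"
        using 0 by simp linarith
    qed (use 0 T_ge_1 in \<open>auto simp: sim_def\<close>)
  next
    case (Suc r)
    let ?k = "nat \<lceil>v\<rceil> - Suc r"
    have lt: "real ?k < v" using Suc.prems(1) by linarith
    have k1: "Suc ?k = nat \<lceil>v\<rceil> - r" using Suc.prems(1) by simp
    show ?case
    proof (rule det_While_True)
      show "test_sem (RLess ?cn ?bd) s1" using Suc.prems lt by simp
      show "det A T (Seq p (Seq (RConst 100 1) (ROp RAdd ?cn ?cn 100))) (tick 1 s1)
        (\<lambda>s'. det A T ?W s' (\<lambda>s'. sim ((f ^^ nat \<lceil>v\<rceil>) \<sigma>) s' \<and>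
            clock s' \<le> clock s1 + (1 + (\<Sum>k=nat \<lceil>v\<rceil>-Suc r..<nat \<lceil>v\<rceil>. c ((f ^^ k) \<sigma>) + 4)) * T \<and>
       (\<forall>x. 50 \<le> x \<and> x < 50 + 2 * l \<longrightarrow> rvar s' x = rvar s1 x)))"
      proof (rule det_Seq, rule det_mono, rule body[of "(f ^^ ?k) \<sigma>"], goal_cases)
        case 1
        then show ?case using Suc.prems by (simp add: sim_def)
      next
        case (2 s2)
        then have s2: "sim (f ((f ^^ ?k) \<sigma>)) s2" "clock s2 \<le> clock s1 + 1 + c ((f ^^ ?k) \<sigma>) * T"
          "rvar s2 ?cn = real ?k" "rvar s2 ?bd = v" "\<And>x. 50 \<le> x \<Longrightarrow> x < 50 + 2 * l \<Longrightarrow> rvar s2 x = rvar s1 x"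
          using Suc.prems by auto
        have fk: "f ((f ^^ ?k) \<sigma>) = (f ^^ (nat \<lceil>v\<rceil> - r)) \<sigma>" by (simp flip: k1)
        define s3 where "s3 = tick 1 (set_rvar ?cn (real ?k + 1) (tick 1 (set_rvar 100 1 s2)))"
        have sm: "(\<Sum>k=nat \<lceil>v\<rceil>-Suc r..<nat \<lceil>v\<rceil>. c ((f ^^ k) \<sigma>) + 4) =
            c ((f ^^ ?k) \<sigma>) + 4 + (\<Sum>k=nat \<lceil>v\<rceil>-r..<nat \<lceil>v\<rceil>. c ((f ^^ k) \<sigma>) + 4)"
          using Suc.prems(1) by (subst sum.atLeast_Suc_lessThan) (auto simp: k1)
        have "det A T ?W s3 (\<lambda>s'. sim ((f ^^ nat \<lceil>v\<rceil>) \<sigma>) s' \<and> clock s' \<le> clock s3 + (1 + (\<Sum>k=nat \<lceil>v\<rceil>-r..<nat \<lceil>v\<rceil>. c ((f ^^ k) \<sigma>) + 4)) * T \<and>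
       (\<forall>x. 50 \<le> x \<and> x < 50 + 2 * l \<longrightarrow> rvar s' x = rvar s3 x))"
        proof (rule Suc.IH)
          show "sim ((f ^^ (nat \<lceil>v\<rceil> - r)) \<sigma>) s3" using s2(1) by (auto simp: s3_def sim_def fk)
          show "rvar s3 ?cn = real (nat \<lceil>v\<rceil> - r)" using assms(3) by (simp add: s3_def flip: k1)
        qed (use Suc.prems(1) assms(3) s2 in \<open>auto simp: s3_def\<close>)
        then have "det A T ?W s3 (\<lambda>s'. sim ((f ^^ nat \<lceil>v\<rceil>) \<sigma>) s' \<and>
            clock s' \<le> clock s1 + (1 + (\<Sum>k=nat \<lceil>v\<rceil>-Suc r..<nat \<lceil>v\<rceil>. c ((f ^^ k) \<sigma>) + 4)) * T \<and>
       (\<forall>x. 50 \<le> x \<and> x < 50 + 2 * l \<longrightarrow> rvar s' x = rvar s1 x))"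
          apply (rule det_mono)
          unfolding sm
          using s2 T_ge_1 assms(3) by (auto simp: s3_def algebra_simps)
        then show ?case
          apply (intro det_Seq)
          using s2(3) assms(3) by (simp add: s3_def)
      qed
    qed
  qed
  define Q where "Q = (\<lambda>s'. sim ((f ^^ nat \<lceil>v\<rceil>) \<sigma>) s' \<and>
     clock s' \<le> clock s + (exp_cost e + 8 + (\<Sum>k<nat \<lceil>v\<rceil>. c ((f ^^ k) \<sigma>) + 4)) * T \<and>
     (\<forall>x. 50 \<le> x \<and> x < 50 + 2 * l \<longrightarrow> rvar s' x = rvar s x))"
  have fin: "det A T ?W s1 Q" if s1: "sim \<sigma> s1" "rvar s1 ?cn = 0" "rvar s1 ?bd = v"
      "clock s1 \<le> clock s + exp_cost e + 3" "\<And>x. 50 \<le> x \<Longrightarrow> x < 50 + 2 * l \<Longrightarrow> rvar s1 x = rvar s x" for s1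
  proof (rule det_mono, rule *[of "nat \<lceil>v\<rceil>"])
    fix s'
    assume h: "sim ((f ^^ nat \<lceil>v\<rceil>) \<sigma>) s' \<and>
       clock s' \<le> clock s1 + (1 + (\<Sum>k = nat \<lceil>v\<rceil> - nat \<lceil>v\<rceil>..<nat \<lceil>v\<rceil>. c ((f ^^ k) \<sigma>) + 4)) * T \<and>
       (\<forall>x. 50 \<le> x \<and> x < 50 + 2 * l \<longrightarrow> rvar s' x = rvar s1 x)"
    define Sm where "Sm = (\<Sum>k<nat \<lceil>v\<rceil>. c ((f ^^ k) \<sigma>) + 4)"
    have "clock s' \<le> clock s + exp_cost e + 3 + (1 + Sm) * T"
      using h s1(4) unfolding Sm_def by (simp add: lessThan_atLeast0)
    moreover have "exp_cost e \<le> exp_cost e * T" using exp_cost_ge[of e] by (intro T_mult) simp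
    ultimately have "clock s' \<le> clock s + (exp_cost e + 8 + Sm) * T"
      using T_ge_1 unfolding distrib_right by linarith
    then show "Q s'" using h s1(5) unfolding Q_def Sm_def by simp
  qed (use s1 in auto)
  show ?thesis
    unfolding v_def[symmetric] Q_def[symmetric] for_real_def
  proof (rule det_Seq, simp, rule det_Seq, rule cexp_correct[OF assms(2)], simp, goal_cases)
    case (1 \<rho>' c')
    then show ?case
      apply -
      apply (rule det_Seq, simp only: det_prims, rule det_Seq, simp only: det_prims)
      apply (rule fin)
      using assms(1,3) apply (auto simp: sim_def v_def)
      apply (rule eval_cong[OF assms(2)], simp)
      done
  qed
qed

lemma compile_correct:
  assumes "sim \<sigma> s" "wf_cmd l c" "l \<le> 20"
  shows "det A T (compile l c) s (\<lambda>s'. sim (run A c \<sigma>) s' \<and> clock s' \<le> clock s + cost A c \<sigma> * T \<and>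
     (\<forall>x. 50 \<le> x \<and> x < 50 + 2 * l \<longrightarrow> rvar s' x = rvar s x))"
  using assms
proof (induction c arbitrary: l \<sigma> s)
  case Nop
  then show ?case using T_ge_1 by (auto simp: sim_def)
next
  case (Assign x e)
  have c: "exp_cost e + 4 \<le> cost A (Assign x e) \<sigma> * T"
    using exp_cost_ge[of e] unfolding cost.simps by (intro T_mult) simp
  show ?case
    apply (simp only: compile.simps)
    apply (rule det_Seq, simp only: det_prims, rule det_Seq, rule cexp_correct)
    using Assign.prems apply simp apply simp
    apply (rule det_Seq, simp only: det_prims)
    subgoal for \<rho>' c'
      using Assign.prems eval_cong[of e "rvar s" "reg \<sigma>"] c
      by (auto simp: sim_def simp del: cost.simps)
    done
next
  case (Fill m a e)
  have dm: "real (dim_of A m) \<le> T" using T_ge_n T_ge_d by (cases m) auto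
  have "3 + real (dim_of A m) * (exp_cost e + 3) \<le> 3 * T + T * (exp_cost e + 3)"
    using T_ge_1 exp_cost_ge[of e] dm by (intro add_mono mult_right_mono) auto
  also have "\<dots> \<le> (exp_cost e + 10) * T" using T_ge_1 by (simp add: algebra_simps)
  finally have c: "3 + real (dim_of A m) * (exp_cost e + 3) \<le> (exp_cost e + 10) * T" .
  show ?case
    apply (simp only: compile.simps)
    apply (rule det_mono, rule fill_correct[OF Fill.prems(1)])
    using Fill.prems(2) apply simp
    using Fill.prems(2) apply simp
    subgoal for s'
      using c Fill.prems(2,3) by auto
    done
next
  case (Acc x e)
  define J where "J = (\<lambda>i \<rho> m. \<rho> x = acc_iter x e \<sigma> i \<and> (\<forall>y<100. y \<noteq> x \<longrightarrow> \<rho> y = rvar s y) \<and> m = mem \<sigma>)"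
  have "3 + real n * (4 + exp_cost e) \<le> 3 * T + T * (4 + exp_cost e)"
    using T_ge_1 exp_cost_ge[of e] T_ge_n by (intro add_mono mult_right_mono) auto
  also have "\<dots> \<le> (exp_cost e + 10) * T" using T_ge_1 by (simp add: algebra_simps)
  finally have c: "3 + real n * (4 + exp_cost e) \<le> (exp_cost e + 10) * T" .
  show ?case
    apply (simp only: compile.simps)
    apply (rule det_mono, rule for_nat_correct[where J = J and c = "exp_cost e + 2"])
    using Acc.prems apply (simp add: sim_def)
    apply simp
    using Acc.prems apply (simp add: sim_def J_def)
     apply (rule det_Seq, rule cexp_correct)
    using Acc.prems apply simp apply simp
     apply (rule det_Seq, simp)
    subgoal for i s1 \<rho>' c'
      using Acc.prems eval_cong[of e "rvar s1" "(reg \<sigma>)(x := acc_iter x e \<sigma> i)"]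
      by (auto simp: J_def sim_def)
    subgoal for s'
      using Acc.prems c by (auto simp: sim_def J_def lim_def)
    done
next
  case (MulA a c)
  have c: "3 + real n * 4 + (3 + real (length es) * 10) \<le> 40 * T"
    using T_ge_n T_ge_es T_ge_1 by linarith
  show ?case
    apply (simp only: compile.simps)
    apply (rule det_Seq, rule det_mono, rule fill_correct[OF MulA.prems(1)])
    using MulA.prems(2) apply simp
    apply simp
    apply (elim conjE)
    apply (rule det_mono, rule add_entries_correct[where ?p1.0 = fst and ?p2.0 = snd])
        apply assumption
    using MulA.prems(2) apply simp
    using MulA.prems(2) apply simp
     apply simp
    subgoal for s1 s2
      using c MulA.prems(2,3) sum_entries entry_bounds
      apply (auto simp: sim_def fun_eq_iff)
      apply (rule sum.neutral, fastforce)
      done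
    done
next
  case (MulAT a c)
  have c: "3 + real d * 4 + (3 + real (length es) * 10) \<le> 40 * T"
    using T_ge_d T_ge_es T_ge_1 by linarith
  show ?case
    apply (simp only: compile.simps)
    apply (rule det_Seq, rule det_mono, rule fill_correct[OF MulAT.prems(1)])
    using MulAT.prems(2) apply simp
    apply simp
    apply (elim conjE)
    apply (rule det_mono, rule add_entries_correct[where ?p1.0 = snd and ?p2.0 = fst])
        apply assumption
    using MulAT.prems(2) apply simp
    using MulAT.prems(2) apply simp
     apply simp
    subgoal for s1 s2
      using c MulAT.prems(2,3) sum_entries_adj entry_bounds
      apply (auto simp: sim_def fun_eq_iff)
      apply (rule sum.neutral, fastforce)
      done
    done
next
  case (Lin w v z)
  then show ?case
    by (auto simp: sim_def base_def oracle_solve_def solve_arr_def Let_def fun_upd_def intro!: ext)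
next
  case (Then c1 c2)
  show ?case
    apply (simp only: compile.simps)
    apply (rule det_Seq, rule det_mono, rule Then.IH(1)[OF Then.prems(1)])
    using Then.prems(2,3) apply simp
    using Then.prems(2,3) apply simp
    apply (elim conjE)
    apply (rule det_mono, rule Then.IH(2), assumption)
    using Then.prems(2,3) apply simp
    using Then.prems(2,3) apply simp
    apply (auto simp: algebra_simps)
    done
next
  case (Branch e1 e2 c1 c2)
  have T1: "exp_cost e1 + exp_cost e2 + 4 \<le> exp_cost e1 * T + exp_cost e2 * T + 4 * T"
    using exp_cost_ge[of e1] exp_cost_ge[of e2] by (intro add_mono T_mult) auto
  show ?case
    apply (simp only: compile.simps)
    apply (rule det_Seq, simp only: det_prims, rule det_Seq, rule cexp_correct)
    using Branch.prems apply simp apply simp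
    apply (rule det_Seq, rule cexp_correct)
    using Branch.prems apply simp apply simp
    subgoal for \<rho>1 t1 \<rho>2 t2
    proof -
      assume h: "\<rho>1 100 = eval e1 (rvar (tick 1 (set_nvar 3 0 s))) (rarr (tick 1 (set_nvar 3 0 s))) (nvar (tick 1 (set_nvar 3 0 s)) 3)"
        "\<And>x. x < 100 \<Longrightarrow> \<rho>1 x = rvar (tick 1 (set_nvar 3 0 s)) x"
        "t1 \<le> clock (tick 1 (set_nvar 3 0 s)) + exp_cost e1"
        "\<rho>2 101 = eval e2 (rvar (tick 1 (set_nvar 3 0 s)\<lparr>rvar := \<rho>1, clock := t1\<rparr>))
          (rarr (tick 1 (set_nvar 3 0 s)\<lparr>rvar := \<rho>1, clock := t1\<rparr>)) (nvar (tick 1 (set_nvar 3 0 s)\<lparr>rvar := \<rho>1, clock := t1\<rparr>) 3)"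
        "\<And>x. x < 101 \<Longrightarrow> \<rho>2 x = rvar (tick 1 (set_nvar 3 0 s)\<lparr>rvar := \<rho>1, clock := t1\<rparr>) x"
        "t2 \<le> clock (tick 1 (set_nvar 3 0 s)\<lparr>rvar := \<rho>1, clock := t1\<rparr>) + exp_cost e2"
      define s1 where "s1 = tick 1 (tick 1 (set_nvar 3 0 s)\<lparr>rvar := \<rho>2, clock := t2\<rparr>)"
      have s1: "sim \<sigma> s1" "clock s1 \<le> clock s + exp_cost e1 + exp_cost e2 + 2" "\<And>x. x < 100 \<Longrightarrow> rvar s1 x = rvar s x"
        using h Branch.prems by (auto simp: s1_def sim_def)
      have t: "(\<rho>2 100 < \<rho>2 101) = (eval e1 (reg \<sigma>) (mem \<sigma>) 0 < eval e2 (reg \<sigma>) (mem \<sigma>) 0)"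
        using h Branch.prems eval_cong[of e1 "rvar s" "reg \<sigma>"] eval_cong[of e2 "\<rho>1" "reg \<sigma>"] by (simp add: sim_def)
      have d1: "det A T (compile l c1) s1 (\<lambda>s'. sim (run A c1 \<sigma>) s' \<and> clock s' \<le> clock s1 + cost A c1 \<sigma> * T \<and>
          (\<forall>x. 50 \<le> x \<and> x < 50 + 2 * l \<longrightarrow> rvar s' x = rvar s1 x))"
        using Branch.prems by (intro Branch.IH(1) s1) auto
      have d2: "det A T (compile l c2) s1 (\<lambda>s'. sim (run A c2 \<sigma>) s' \<and> clock s' \<le> clock s1 + cost A c2 \<sigma> * T \<and>
          (\<forall>x. 50 \<le> x \<and> x < 50 + 2 * l \<longrightarrow> rvar s' x = rvar s1 x))"
        using Branch.prems by (intro Branch.IH(2) s1) auto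
      show ?thesis
        using t T1 s1(2,3) Branch.prems(3)
        by (auto simp: det_Cond s1_def[symmetric] algebra_simps intro!: det_mono[OF d1] det_mono[OF d2])
    qed
    done
next
  case (Loop e c)
  have "0 \<le> cost A c \<sigma>" for \<sigma> using cost_ge[of c \<sigma>] by simp
  then show ?case
    using for_real_correct[OF Loop.prems(1), of e l "compile (Suc l) c" "run A c" "cost A c"] Loop.prems(2)
      Loop.IH[of _ _ "Suc l"] Loop.prems(3)
    by simp
qed

end

section \<open>Weighted least squares\<close>

definition ip :: "nat \<Rightarrow> (nat \<Rightarrow> real) \<Rightarrow> (nat \<Rightarrow> real) \<Rightarrow> (nat \<Rightarrow> real) \<Rightarrow> real" where
  "ip n D u v = (\<Sum>i<n. D i * u i * v i)"

lemma ip_commute: "ip n D u v = ip n D v u"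
  by (simp add: ip_def mult_ac)

lemma ip_nonneg: "\<forall>i<n. 0 \<le> D i \<Longrightarrow> 0 \<le> ip n D u u"
  unfolding ip_def by (intro sum_nonneg) (simp add: mult.assoc)

lemma ip_lin: "ip n D (\<lambda>i. a * u i + b * u' i) v = a * ip n D u v + b * ip n D u' v"
  "ip n D v (\<lambda>i. a * u i + b * u' i) = a * ip n D v u + b * ip n D v u'"
  by (simp_all add: ip_def sum_distrib_left sum.distrib algebra_simps)

lemma ip_CS:
  assumes "\<forall>i<n. 0 \<le> D i"
  shows "(ip n D u v)\<^sup>2 \<le> ip n D u u * ip n D v v"
proof -
  have "ip n D u v = (\<Sum>i<n. (sqrt (D i) * u i) * (sqrt (D i) * v i))"
    unfolding ip_def using assms by (intro sum.cong) (auto simp: mult_ac)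
  moreover have "ip n D u u = (\<Sum>i<n. (sqrt (D i) * u i)\<^sup>2)" for u
    unfolding ip_def using assms by (intro sum.cong) (auto simp: power_mult_distrib power2_eq_square mult_ac)
  ultimately show ?thesis
    using Cauchy_Schwarz_ineq_sum[of "\<lambda>i. sqrt (D i) * u i" "\<lambda>i. sqrt (D i) * v i" "{..<n}"] by simp
qed

lemma ip_CS_sqrt:
  assumes "\<forall>i<n. 0 \<le> D i"
  shows "\<bar>ip n D u v\<bar> \<le> sqrt (ip n D u u) * sqrt (ip n D v v)"
  using real_sqrt_le_mono[OF ip_CS[OF assms, of u v]] by (simp add: real_sqrt_mult)

lemma ip_CS_abs:
  assumes "\<forall>i<n. 0 \<le> D i"
  shows "(\<Sum>i<n. D i * \<bar>u i\<bar> * \<bar>v i\<bar>) \<le> sqrt (ip n D u u) * sqrt (ip n D v v)"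
  using ip_CS_sqrt[OF assms, where u = "\<lambda>i. \<bar>u i\<bar>" and v = "\<lambda>i. \<bar>v i\<bar>"]
  by (simp add: ip_def mult.assoc)

lemma lin_app_lin: "lin_app A (\<lambda>j. a * x j + b * y j) = (\<lambda>i. a * lin_app A x i + b * lin_app A y i)"
  by (rule ext) (simp add: lin_app_def sum_distrib_left sum.distrib algebra_simps)

lemma lin_app_cong: "(\<And>j. j < dim_col A \<Longrightarrow> x j = y j) \<Longrightarrow> lin_app A x = lin_app A y"
  by (auto simp: lin_app_def fun_eq_iff intro!: sum.cong)

lemma lin_app_adj: "(\<Sum>j<dim_col A. lin_adj A c j * x j) = (\<Sum>i<dim_row A. c i * lin_app A x i)"
  unfolding lin_adj_def lin_app_def sum_distrib_right sum_distrib_left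
  by (subst sum.swap) (simp add: mult_ac)

section \<open>The column space and weighted projections onto it\<close>

locale regression = machine +
  assumes full_rank: "vec_space.rank n A = d"
begin

text \<open>The rank counts independent elements of the set of columns, and a repeated column would
  leave fewer than \<open>d\<close> of them. Distinctness is the side condition for passing from the
  rank to linear independence, and from there to injectivity.\<close>

lemma distinct_cols: "distinct (cols A)"
proof (rule ccontr)
  interpret vec_space "TYPE(real)" n .
  assume nd: "\<not> distinct (cols A)"
  obtain S where S: "maximal S (\<lambda>T. T \<subseteq> set (cols A) \<and> lin_indpt T)"
    using maximal_exists[of "(\<lambda>T. T \<subseteq> set (cols A) \<and> lin_indpt T)" "card (set (cols A))" "{}"]
    by (meson List.finite_set card_mono empty_iff empty_subsetI finite_lin_indpt2 rev_finite_subset)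
  then have "card S \<le> card (set (cols A))" by (simp add: card_mono maximal_def)
  moreover have "card (set (cols A)) < d"
    using nd carrier card_distinct[of "cols A"] card_length[of "cols A"] by (auto simp: le_less)
  moreover have "rank A = card S" using rank_card_indpt[OF carrier S] .
  ultimately show False using full_rank by simp
qed

lemma mult_mat_vec_lin_app: "i < n \<Longrightarrow> (A *\<^sub>v Matrix.vec d x) $ i = lin_app A x i"
  using carrier by (simp add: lin_app_def scalar_prod_def lessThan_atLeast0)

lemma lin_app_inj:
  assumes "\<And>i. i < n \<Longrightarrow> lin_app A x i = 0" "j < d"
  shows "x j = 0"
proof (rule ccontr)
  interpret vec_space "TYPE(real)" n .
  assume nz: "x j \<noteq> 0"
  let ?v = "Matrix.vec d x"
  have "A *\<^sub>v ?v = 0\<^sub>v n"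
    using carrier mult_mat_vec_lin_app[of _ x] assms(1) by (intro eq_vecI) auto
  moreover have "?v \<noteq> 0\<^sub>v d"
    using nz assms(2) by (metis index_vec index_zero_vec(1))
  ultimately have "lin_dep (set (cols A))"
    using lin_depI[OF carrier _ _ _ distinct_cols, of ?v] by simp
  then show False using full_rank_lin_indpt[OF carrier full_rank distinct_cols] by simp
qed

definition gram :: "(nat \<Rightarrow> real) \<Rightarrow> real mat" where
  "gram D = transpose_mat A * mat_diag n D * A"

lemma gram_carrier [simp]: "gram D \<in> carrier_mat d d"
  using carrier by (auto simp: gram_def)

lemma gram_dims [simp]: "dim_row (gram D) = d" "dim_col (gram D) = d"
  using gram_carrier[of D] by blast+

lemma gram_mult:
  assumes "j < d"
  shows "(gram D *\<^sub>v Matrix.vec d x) $ j = (\<Sum>i<n. A $$ (i, j) * (D i * lin_app A x i))"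
proof -
  let ?v = "Matrix.vec d x"
  have v: "?v \<in> carrier_vec d" by simp
  have c1: "A *\<^sub>v ?v \<in> carrier_vec n" using carrier by simp
  have dg: "mat_diag n D \<in> carrier_mat n n" by (simp add: mat_diag_def)
  have "gram D *\<^sub>v ?v = transpose_mat A *\<^sub>v (mat_diag n D *\<^sub>v (A *\<^sub>v ?v))"
    unfolding gram_def using carrier dg
    by (simp add: assoc_mult_mat_vec[of _ d n _ d] assoc_mult_mat_vec[of _ d n _ n])
  moreover have "(mat_diag n D *\<^sub>v (A *\<^sub>v ?v)) $ i = D i * lin_app A x i" if "i < n" for i
  proof -
    have "(mat_diag n D *\<^sub>v (A *\<^sub>v ?v)) $ i = (\<Sum>k<n. (if i = k then D k else 0) * (A *\<^sub>v ?v) $ k)"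
      using that c1 by (simp add: mat_diag_def scalar_prod_def lessThan_atLeast0)
    also have "\<dots> = (\<Sum>k<n. if i = k then D k * (A *\<^sub>v ?v) $ k else 0)"
      by (intro sum.cong) auto
    also have "\<dots> = D i * lin_app A x i"
      using that mult_mat_vec_lin_app by simp
    finally show ?thesis .
  qed
  ultimately show ?thesis
    using assms carrier by (auto simp: scalar_prod_def lessThan_atLeast0 mat_diag_def intro!: sum.cong)
qed

text \<open>Pairing \<open>A^T D A v = 0\<close> with \<open>v\<close> gives a vanishing sum of the
  terms \<open>D_i (A v)_i^2\<close>, so \<open>A v = 0\<close>, and injectivity finishes.\<close>

lemma gram_pos:
  assumes D: "\<forall>i<n. 0 < D i" and v: "v \<in> carrier_vec d" "gram D *\<^sub>v v = 0\<^sub>v d"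
  shows "v = 0\<^sub>v d"
proof -
  define x where "x = vec_index v"
  have vx: "v = Matrix.vec d x" unfolding x_def using v(1) by (intro eq_vecI) auto
  have z: "(\<Sum>i<n. A $$ (i, j) * (D i * lin_app A x i)) = 0" if "j < d" for j
    using gram_mult[OF that, of D x] v(2) that unfolding vx by simp
  have "(\<Sum>i<n. D i * (lin_app A x i)\<^sup>2) = (\<Sum>j<d. lin_adj A (\<lambda>i. D i * lin_app A x i) j * x j)"
    using lin_app_adj[of A "\<lambda>i. D i * lin_app A x i" x] by (simp add: power2_eq_square mult_ac)
  also have "\<dots> = 0"
    using z by (intro sum.neutral) (auto simp: lin_adj_def)
  finally have "\<And>i. i < n \<Longrightarrow> D i * (lin_app A x i)\<^sup>2 = 0"
    using D by (subst (asm) sum_nonneg_eq_0_iff) (auto intro: less_imp_le)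
  then have "lin_app A x i = 0" if "i < n" for i using D that by fastforce
  then have "x j = 0" if "j < d" for j using lin_app_inj that by blast
  then show ?thesis unfolding vx by auto
qed

lemma gram_inverse:
  assumes D: "\<forall>i<n. 0 < D i"
  obtains B where "B \<in> carrier_mat d d" "B * gram D = 1\<^sub>m d" "gram D * B = 1\<^sub>m d"
proof -
  have "Determinant.det (gram D) \<noteq> 0"
    using det_0_iff_vec_prod_zero_field[OF gram_carrier] gram_pos[OF D] by blast
  then have "gram D \<in> Units (ring_mat TYPE(real) d ())"
    by (rule det_non_zero_imp_unit[OF gram_carrier])
  then show thesis using that by (auto simp: Units_def ring_mat_def)
qed

lemma weighted_solution_correct:
  assumes D: "\<forall>i<n. 0 < D i" and v: "v \<in> carrier_vec d"
    and B: "B \<in> carrier_mat d d" "B * gram D = 1\<^sub>m d" "gram D * B = 1\<^sub>m d"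
  shows "weighted_solution A D v = B *\<^sub>v v" "gram D *\<^sub>v weighted_solution A D v = v"
proof -
  have sol: "gram D *\<^sub>v (B *\<^sub>v v) = v"
    using B v assoc_mult_mat_vec[OF gram_carrier B(1) v, of D] by simp
  have uniq: "x = B *\<^sub>v v" if "x \<in> carrier_vec d" "gram D *\<^sub>v x = v" for x
    using B that assoc_mult_mat_vec[OF B(1) gram_carrier, of x D] by simp
  show 1: "weighted_solution A D v = B *\<^sub>v v"
    unfolding weighted_solution_def
    by (rule the_equality) (use sol uniq B v in \<open>auto simp: gram_def\<close>)
  show "gram D *\<^sub>v weighted_solution A D v = v" unfolding 1 by (rule sol)
qed

text \<open>Vectors are functions on all naturals. Inner products and norms read only indices below
  \<open>n\<close>, so the unspecified matrix entries beyond the dimension do no harm.\<close>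

definition colspace :: "(nat \<Rightarrow> real) set" where
  "colspace = range (lin_app A)"

lemma colspace_lin: "u \<in> colspace \<Longrightarrow> v \<in> colspace \<Longrightarrow> (\<lambda>i. a * u i + b * v i) \<in> colspace"
  unfolding colspace_def by (auto simp flip: lin_app_lin)

lemma lin_app_in [simp]: "lin_app A x \<in> colspace"
  by (simp add: colspace_def)

text \<open>The normal equations in variational form: an oracle call returns the Riesz representer
  of a linear functional on the column space. Apart from the trace computation below, oracle results
  are used only through this property.\<close>

lemma solve_arr_gram:
  assumes D: "\<forall>i<n. 0 < D i"
  shows "ip n D (lin_app A (solve_arr A D v z)) (lin_app A x) = (\<Sum>j<d. v j * x j)"
proof -
  obtain B where B: "B \<in> carrier_mat d d" "B * gram D = 1\<^sub>m d" "gram D * B = 1\<^sub>m d"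
    using gram_inverse[OF D] by blast
  let ?v = "Matrix.vec d v"
  define y where "y = solve_arr A D v z"
  have ws: "weighted_solution A D ?v \<in> carrier_vec d" "gram D *\<^sub>v weighted_solution A D ?v = ?v"
    using weighted_solution_correct[OF D _ B, of ?v] B by auto
  have "Matrix.vec d y = weighted_solution A D ?v"
    using D ws(1) by (intro eq_vecI) (auto simp: y_def solve_arr_def)
  then have eq: "v j = lin_adj A (\<lambda>i. D i * lin_app A y i) j" if "j < d" for j
    using gram_mult[OF that, of D y] ws(2) that by (simp add: lin_adj_def)
  have "(\<Sum>j<d. v j * x j) = (\<Sum>j<d. lin_adj A (\<lambda>i. D i * lin_app A y i) j * x j)"
    using eq by simp
  also have "\<dots> = ip n D (lin_app A y) (lin_app A x)"
    using lin_app_adj[of A "\<lambda>i. D i * lin_app A y i" x] by (simp add: ip_def)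
  finally show ?thesis by (simp add: y_def)
qed

lemma solve_arr_adj:
  assumes D: "\<forall>i<n. 0 < D i" and v: "\<And>j. j < d \<Longrightarrow> v j = lin_adj A c j" and u: "u \<in> colspace"
  shows "ip n D (lin_app A (solve_arr A D v z)) u = (\<Sum>i<n. c i * u i)"
proof -
  obtain x where x: "u = lin_app A x" using u by (auto simp: colspace_def)
  have "ip n D (lin_app A (solve_arr A D v z)) u = (\<Sum>j<d. lin_adj A c j * x j)"
    unfolding x solve_arr_gram[OF D] using v by simp
  also have "\<dots> = (\<Sum>i<n. c i * u i)" using lin_app_adj[of A c x] x by simp
  finally show ?thesis .
qed

text \<open>\<open>G i\<close> represents evaluation at coordinate \<open>i\<close> in the weighted
  inner product, so \<open>G i i\<close> is the largest value of \<open>(u i)^2\<close> over the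
  weighted unit ball and \<open>D i * G i i\<close> is the leverage score. The scores sum to the
  trace of a projection of rank \<open>d\<close>, computed here as the trace of
  \<open>B * gram D\<close>.\<close>

lemma leverage_representers:
  assumes D: "\<forall>i<n. 0 < D i"
  obtains G where "\<And>i. G i \<in> colspace" "\<And>i u. i < n \<Longrightarrow> u \<in> colspace \<Longrightarrow> ip n D (G i) u = u i"
    "(\<Sum>i<n. D i * G i i) = real d"
proof -
  obtain B where B: "B \<in> carrier_mat d d" "B * gram D = 1\<^sub>m d" "gram D * B = 1\<^sub>m d"
    using gram_inverse[OF D] by blast
  define G where "G i = lin_app A (solve_arr A D (\<lambda>j. A $$ (i, j)) (\<lambda>_. 0))" for i
  have 2: "ip n D (G i) u = u i" if "i < n" and u: "u \<in> colspace" for i u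
  proof -
    obtain x where x: "u = lin_app A x" using u by (auto simp: colspace_def)
    show ?thesis unfolding G_def x solve_arr_gram[OF D] by (simp add: lin_app_def)
  qed
  have Gii: "G i i = (\<Sum>j<d. A $$ (i, j) * (\<Sum>k<d. B $$ (j, k) * A $$ (i, k)))" if "i < n" for i
  proof -
    have "solve_arr A D (\<lambda>j. A $$ (i, j)) (\<lambda>_. 0) j = (\<Sum>k<d. B $$ (j, k) * A $$ (i, k))" if "j < d" for j
      using that D B weighted_solution_correct(1)[OF D _ B, of "Matrix.vec d (\<lambda>j. A $$ (i, j))"]
      by (simp add: solve_arr_def scalar_prod_def lessThan_atLeast0)
    then show ?thesis unfolding G_def lin_app_def by simp
  qed
  have gent: "gram D $$ (k, j) = (\<Sum>i<n. A $$ (i, k) * (D i * A $$ (i, j)))" if "k < d" "j < d" for k j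
  proof -
    have "gram D $$ (k, j) = (gram D *\<^sub>v Matrix.vec d (\<lambda>l. if l = j then 1 else 0)) $ k"
    proof -
      have "(\<Sum>l<d. gram D $$ (k, l) * (if l = j then 1 else 0)) = (\<Sum>l<d. if l = j then gram D $$ (k, l) else 0)"
        by (intro sum.cong) auto
      then show ?thesis
        using that by (simp add: scalar_prod_def lessThan_atLeast0)
    qed
    moreover have "lin_app A (\<lambda>l. if l = j then 1 else 0) i = A $$ (i, j)" for i
    proof -
      have "lin_app A (\<lambda>l. if l = j then 1 else 0) i = (\<Sum>l<d. if l = j then A $$ (i, l) else 0)"
        unfolding lin_app_def by (intro sum.cong) auto
      then show ?thesis using that by simp
    qed
    ultimately show ?thesis using gram_mult[OF that(1), of D "\<lambda>l. if l = j then 1 else 0"] by simp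
  qed
  have "(\<Sum>i<n. D i * G i i) = (\<Sum>i<n. \<Sum>j<d. \<Sum>k<d. B $$ (j, k) * (A $$ (i, k) * (D i * A $$ (i, j))))"
    using Gii by (intro sum.cong) (auto simp: sum_distrib_left mult_ac)
  also have "\<dots> = (\<Sum>j<d. \<Sum>i<n. \<Sum>k<d. B $$ (j, k) * (A $$ (i, k) * (D i * A $$ (i, j))))"
    by (rule sum.swap)
  also have "\<dots> = (\<Sum>j<d. \<Sum>k<d. \<Sum>i<n. B $$ (j, k) * (A $$ (i, k) * (D i * A $$ (i, j))))"
    by (rule sum.cong[OF refl], rule sum.swap)
  also have "\<dots> = (\<Sum>j<d. \<Sum>k<d. B $$ (j, k) * gram D $$ (k, j))"
    using gent by (intro sum.cong refl) (auto simp: sum_distrib_left)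
  also have "\<dots> = (\<Sum>j<d. (B * gram D) $$ (j, j))"
    using B(1) by (intro sum.cong refl) (simp add: scalar_prod_def lessThan_atLeast0)
  also have "\<dots> = real d" unfolding B(2) by simp
  finally show thesis using that[of G] 2 by (auto simp: G_def)
qed

end

section \<open>Acceleration with a proximal point oracle\<close>

text \<open>The exponential, continued quadratically to the right of 0: its second derivative is
  bounded by 1 and changes by at most a factor \<open>exp \<delta>\<close> over a distance \<open>\<delta>\<close>.\<close>

definition hx :: "real \<Rightarrow> real" where "hx u = (if u \<le> 0 then exp u else 1 + u + u\<^sup>2 / 2)"
definition hx1 :: "real \<Rightarrow> real" where "hx1 u = (if u \<le> 0 then exp u else 1 + u)"
definition hx2 :: "real \<Rightarrow> real" where "hx2 u = exp (min u 0)"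

lemma DERIV_glue:
  fixes f g :: "real \<Rightarrow> real"
  assumes f: "(f has_real_derivative D) (at c)" and g: "(g has_real_derivative D) (at c)" and eq: "f c = g c"
  shows "((\<lambda>u. if u \<le> c then f u else g u) has_real_derivative D) (at c)"
  unfolding has_field_derivative_iff
proof (rule filterlim_split_at)
  have "((\<lambda>y. (f y - f c) / (y - c)) \<longlongrightarrow> D) (at_left c)"
    using f unfolding has_field_derivative_iff by (rule tendsto_mono[rotated]) (simp add: at_le)
  then show "((\<lambda>y. ((if y \<le> c then f y else g y) - (if c \<le> c then f c else g c)) / (y - c)) \<longlongrightarrow> D) (at_left c)"
    by (rule Lim_transform_eventually) (auto simp: eventually_at_left_field intro: exI[of _ "c - 1"])
  have "((\<lambda>y. (g y - g c) / (y - c)) \<longlongrightarrow> D) (at_right c)"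
    using g unfolding has_field_derivative_iff by (rule tendsto_mono[rotated]) (simp add: at_le)
  then show "((\<lambda>y. ((if y \<le> c then f y else g y) - (if c \<le> c then f c else g c)) / (y - c)) \<longlongrightarrow> D) (at_right c)"
    by (rule Lim_transform_eventually) (auto simp: eventually_at_right_field eq intro: exI[of _ "c + 1"])
qed

lemma DERIV_hx: "(hx has_real_derivative hx1 u) (at u)"
proof -
  have l: "(exp has_real_derivative exp u) (at u)" by (rule DERIV_exp)
  have r: "((\<lambda>u. 1 + u + u\<^sup>2 / 2) has_real_derivative 1 + u) (at u)"
    by (auto intro!: derivative_eq_intros)
  consider "u < 0" | "u = 0" | "u > 0" by linarith
  then show ?thesis
  proof cases
    case 1
    show ?thesis
      using 1 l by (subst DERIV_cong_ev[OF refl eventually_mono[OF eventually_nhds_in_open[of "{..<0}" u]] refl])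
        (auto simp: hx_def hx1_def)
  next
    case 2
    show ?thesis using DERIV_glue[of exp 1 0 "\<lambda>u. 1 + u + u\<^sup>2 / 2"] l r 2
      unfolding hx_def[abs_def] hx1_def by simp
  next
    case 3
    show ?thesis
      using 3 r by (subst DERIV_cong_ev[OF refl eventually_mono[OF eventually_nhds_in_open[of "{0<..}" u]] refl])
        (auto simp: hx_def hx1_def)
  qed
qed

lemma DERIV_hx1: "(hx1 has_real_derivative hx2 u) (at u)"
proof -
  have l: "(exp has_real_derivative exp u) (at u)" by (rule DERIV_exp)
  have r: "((\<lambda>u. 1 + u) has_real_derivative 1) (at u)"
    by (auto intro!: derivative_eq_intros)
  consider "u < 0" | "u = 0" | "u > 0" by linarith
  then show ?thesis
  proof cases
    case 1
    show ?thesis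
      using 1 l by (subst DERIV_cong_ev[OF refl eventually_mono[OF eventually_nhds_in_open[of "{..<0}" u]] refl])
        (auto simp: hx1_def hx2_def)
  next
    case 2
    show ?thesis using DERIV_glue[of exp 1 0 "\<lambda>u. 1 + u"] l r 2
      unfolding hx1_def[abs_def] hx2_def by simp
  next
    case 3
    show ?thesis
      using 3 r by (subst DERIV_cong_ev[OF refl eventually_mono[OF eventually_nhds_in_open[of "{0<..}" u]] refl])
        (auto simp: hx1_def hx2_def)
  qed
qed

lemma hx_mvt: "\<exists>z. min u v \<le> z \<and> z \<le> max u v \<and> hx v - hx u = hx1 z * (v - u)"
proof (cases "u = v")
  case False
  consider "u < v" | "v < u" using False by linarith
  then show ?thesis
  proof cases
    case 1
    obtain z where "z > u" "z < v" "hx v - hx u = (v - u) * hx1 z"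
      using MVT2[OF 1 DERIV_hx] by blast
    then show ?thesis using 1 by (intro exI[of _ z]) (auto simp: mult_ac)
  next
    case 2
    obtain z where "z > v" "z < u" "hx u - hx v = (u - v) * hx1 z"
      using MVT2[OF 2 DERIV_hx] by blast
    then show ?thesis using 2 by (intro exI[of _ z]) (auto simp: algebra_simps)
  qed
qed auto

lemma hx1_mvt: "\<exists>z. min u v \<le> z \<and> z \<le> max u v \<and> hx1 v - hx1 u = hx2 z * (v - u)"
proof (cases "u = v")
  case False
  consider "u < v" | "v < u" using False by linarith
  then show ?thesis
  proof cases
    case 1
    obtain z where "z > u" "z < v" "hx1 v - hx1 u = (v - u) * hx2 z"
      using MVT2[OF 1 DERIV_hx1] by blast
    then show ?thesis using 1 by (intro exI[of _ z]) (auto simp: mult_ac)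
  next
    case 2
    obtain z where "z > v" "z < u" "hx1 u - hx1 v = (u - v) * hx2 z"
      using MVT2[OF 2 DERIV_hx1] by blast
    then show ?thesis using 2 by (intro exI[of _ z]) (auto simp: algebra_simps)
  qed
qed auto

lemma hx2_pos: "0 < hx2 u" and hx2_le: "hx2 u \<le> 1"
  by (auto simp: hx2_def)

text \<open>The logarithm of \<open>hx2\<close> is \<open>min u 0\<close>, a 1-Lipschitz
  function.\<close>

lemma hx2_stable: "hx2 u \<le> exp \<bar>v - u\<bar> * hx2 v"
  unfolding hx2_def exp_add[symmetric] by simp

lemma hx1_mono: "u \<le> v \<Longrightarrow> hx1 u \<le> hx1 v"
  using hx1_mvt[of u v] hx2_pos by (smt (verit) mult_nonneg_nonneg)

lemma hx_convex: "hx u + hx1 u * (v - u) \<le> hx v"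
proof -
  obtain z where z: "min u v \<le> z" "z \<le> max u v" "hx v - hx u = hx1 z * (v - u)"
    using hx_mvt by blast
  have "0 \<le> (hx1 z - hx1 u) * (v - u)"
    using z hx1_mono[of u z] hx1_mono[of z u] by (cases "u \<le> v") (auto intro: mult_nonneg_nonneg mult_nonpos_nonpos)
  then show ?thesis using z(3) by (simp add: algebra_simps)
qed

text \<open>The mean value theorem brings in \<open>hx2\<close> at an intermediate point, which
  differs from \<open>hx2 u\<close> by a factor between \<open>exp (- \<delta>)\<close> and
  \<open>exp \<delta>\<close>, where \<open>\<delta>\<close> is the distance. The lower factor is
  weakened to \<open>2 - exp \<delta>\<close> so that the bound becomes symmetric.\<close>

lemma hx1_taylor: "\<bar>hx1 v - hx1 u - hx2 u * (v - u)\<bar> \<le> hx2 u * \<bar>v - u\<bar> * (exp \<bar>v - u\<bar> - 1)"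
proof -
  obtain z where z: "min u v \<le> z" "z \<le> max u v" "hx1 v - hx1 u = hx2 z * (v - u)"
    using hx1_mvt by blast
  let ?d = "\<bar>z - u\<bar>" and ?e = "\<bar>v - u\<bar>"
  have de: "?d \<le> ?e" using z by auto
  have 1: "hx2 z \<le> exp ?e * hx2 u"
    using hx2_stable[of z u] de hx2_pos[of u] by (smt (verit) exp_le_cancel_iff mult_right_mono abs_minus_commute)
  have "hx2 u \<le> exp ?e * hx2 z"
    using hx2_stable[of u z] de hx2_pos[of z] by (smt (verit) exp_le_cancel_iff mult_right_mono)
  then have "exp (- ?e) * hx2 u \<le> hx2 z"
    by (simp add: exp_minus field_simps)
  moreover have "2 - exp ?e \<le> exp (- ?e)"
  proof -
    have "0 \<le> (exp ?e - 1)\<^sup>2" by simp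
    then have "(2 - exp ?e) * exp ?e \<le> 1" by (simp add: power2_eq_square algebra_simps)
    then have "2 - exp ?e \<le> inverse (exp ?e)" by (simp add: field_simps)
    then show ?thesis by (simp add: exp_minus)
  qed
  ultimately have 2: "(2 - exp ?e) * hx2 u \<le> hx2 z"
    using hx2_pos[of u] by (smt (verit) mult_right_mono)
  have "\<bar>hx2 z - hx2 u\<bar> \<le> hx2 u * (exp ?e - 1)"
    using 1 2 by (auto simp: abs_le_iff algebra_simps)
  then have "\<bar>hx2 z - hx2 u\<bar> * ?e \<le> hx2 u * (exp ?e - 1) * ?e"
    by (rule mult_right_mono) simp
  moreover have "hx1 v - hx1 u - hx2 u * (v - u) = (hx2 z - hx2 u) * (v - u)"
    using z(3) by (simp add: algebra_simps)
  ultimately show ?thesis by (simp add: abs_mult mult_ac)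
qed

lemma hx_pos: "0 < hx u"
  by (auto simp: hx_def intro: add_pos_nonneg)

lemma hx_le: "hx u \<le> (1 + \<bar>u\<bar>)\<^sup>2"
proof (cases "u \<le> 0")
  case True
  have "1 \<le> (1 + \<bar>u\<bar>)\<^sup>2" by (simp add: one_le_power)
  moreover have "exp u \<le> 1" using True by simp
  ultimately have "exp u \<le> (1 + \<bar>u\<bar>)\<^sup>2" by linarith
  then show ?thesis using True unfolding hx_def by simp
next
  case False
  then show ?thesis by (simp add: hx_def power2_eq_square algebra_simps)
qed

lemma hx1_pos: "0 < hx1 u" and hx1_le: "hx1 u \<le> 1 + max u 0"
  by (auto simp: hx1_def)

section \<open>A smooth penalty for residuals above the level \<tau>\<close>

definition phi :: "real \<Rightarrow> real \<Rightarrow> real" where "phi \<tau> r = hx (r - \<tau>) + hx (- r - \<tau>)"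
definition phi1 :: "real \<Rightarrow> real \<Rightarrow> real" where "phi1 \<tau> r = hx1 (r - \<tau>) - hx1 (- r - \<tau>)"
definition phi2 :: "real \<Rightarrow> real \<Rightarrow> real" where "phi2 \<tau> r = hx2 (r - \<tau>) + hx2 (- r - \<tau>)"

lemma phi_pos: "0 < phi \<tau> r"
  using hx_pos by (simp add: phi_def add_pos_pos)

lemma phi2_pos: "0 < phi2 \<tau> r" and phi2_le: "phi2 \<tau> r \<le> 2"
  using hx2_pos[of "r - \<tau>"] hx2_pos[of "- r - \<tau>"] hx2_le[of "r - \<tau>"] hx2_le[of "- r - \<tau>"]
  by (auto simp: phi2_def)

lemma phi_convex: "phi \<tau> r + phi1 \<tau> r * (s - r) \<le> phi \<tau> s"
  using hx_convex[of "r - \<tau>" "s - \<tau>"] hx_convex[of "- r - \<tau>" "- s - \<tau>"]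
  by (simp add: phi_def phi1_def algebra_simps)

lemma phi2_stable: "phi2 \<tau> r \<le> exp \<bar>s - r\<bar> * phi2 \<tau> s"
  using hx2_stable[of "r - \<tau>" "s - \<tau>"] hx2_stable[of "- r - \<tau>" "- s - \<tau>"]
  by (simp add: phi2_def algebra_simps abs_minus_commute)

lemma phi1_taylor: "\<bar>phi1 \<tau> s - phi1 \<tau> r - phi2 \<tau> r * (s - r)\<bar> \<le> phi2 \<tau> r * \<bar>s - r\<bar> * (exp \<bar>s - r\<bar> - 1)"
proof -
  let ?X = "hx1 (s - \<tau>) - hx1 (r - \<tau>) - hx2 (r - \<tau>) * (s - r)"
  let ?Y = "hx1 (- s - \<tau>) - hx1 (- r - \<tau>) - hx2 (- r - \<tau>) * (r - s)"
  have "\<bar>?X\<bar> \<le> hx2 (r - \<tau>) * \<bar>s - r\<bar> * (exp \<bar>s - r\<bar> - 1)"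
    using hx1_taylor[of "s - \<tau>" "r - \<tau>"] by simp
  moreover have "\<bar>?Y\<bar> \<le> hx2 (- r - \<tau>) * \<bar>s - r\<bar> * (exp \<bar>s - r\<bar> - 1)"
    using hx1_taylor[of "- s - \<tau>" "- r - \<tau>"] by (simp add: abs_minus_commute)
  moreover have "phi1 \<tau> s - phi1 \<tau> r - phi2 \<tau> r * (s - r) = ?X - ?Y"
    by (simp add: phi1_def phi2_def algebra_simps)
  moreover have "\<bar>?X - ?Y\<bar> \<le> \<bar>?X\<bar> + \<bar>?Y\<bar>" by (rule abs_triangle_ineq4)
  ultimately show ?thesis unfolding phi2_def distrib_right by linarith
qed

lemma phi1_le: "0 \<le> \<tau> \<Longrightarrow> \<bar>phi1 \<tau> r\<bar> \<le> 1 + \<bar>r\<bar>"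
  using hx1_pos[of "r - \<tau>"] hx1_pos[of "- r - \<tau>"] hx1_le[of "r - \<tau>"] hx1_le[of "- r - \<tau>"]
  by (auto simp: phi1_def)

lemma hx_gt_1: "0 < u \<Longrightarrow> 1 < hx u"
  using zero_le_power2[of u] unfolding hx_def by (simp add: add_pos_nonneg)

text \<open>With \<open>phi_small\<close> this separates the two answers of the decision problem:
  one residual above \<open>\<tau>\<close> pushes the total penalty above 1, whereas residuals that
  all stay \<open>ln (4n)\<close> below \<open>\<tau>\<close> keep it at most 1/2.\<close>

lemma phi_gt_1: "\<tau> < \<bar>r\<bar> \<Longrightarrow> 1 < phi \<tau> r"
  using hx_gt_1[of "r - \<tau>"] hx_gt_1[of "- r - \<tau>"] hx_pos[of "r - \<tau>"] hx_pos[of "- r - \<tau>"]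
  by (auto simp: phi_def abs_if split: if_splits)

lemma phi_small: "\<bar>r\<bar> \<le> g \<Longrightarrow> g \<le> \<tau> \<Longrightarrow> phi \<tau> r \<le> 2 * exp (g - \<tau>)"
  by (auto simp: phi_def hx_def abs_le_iff intro!: order.trans[OF add_mono[of "exp (r - \<tau>)" "exp (g - \<tau>)" "exp (- r - \<tau>)" "exp (g - \<tau>)"]])

lemma phi_le: "0 \<le> \<tau> \<Longrightarrow> phi \<tau> r \<le> 2 * (1 + \<bar>r\<bar> + \<tau>)\<^sup>2"
proof -
  assume "0 \<le> \<tau>"
  have "hx (r - \<tau>) \<le> (1 + \<bar>r - \<tau>\<bar>)\<^sup>2" "hx (- r - \<tau>) \<le> (1 + \<bar>- r - \<tau>\<bar>)\<^sup>2" by (rule hx_le)+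
  moreover have "(1 + \<bar>r - \<tau>\<bar>)\<^sup>2 \<le> (1 + \<bar>r\<bar> + \<tau>)\<^sup>2" "(1 + \<bar>- r - \<tau>\<bar>)\<^sup>2 \<le> (1 + \<bar>r\<bar> + \<tau>)\<^sup>2"
    using \<open>0 \<le> \<tau>\<close> by (auto intro!: power_mono)
  ultimately show ?thesis by (simp add: phi_def)
qed

section \<open>Newton's method for proximal points\<close>

locale ball_problem =
  fixes n :: nat and S :: "(nat \<Rightarrow> real) set" and w b :: "nat \<Rightarrow> real" and \<tau> :: real
  assumes S_lin: "u \<in> S \<Longrightarrow> v \<in> S \<Longrightarrow> (\<lambda>i. a * u i + c * v i) \<in> S"
    and w_pos: "\<forall>i<n. 0 < w i"
    and norm_dom: "z \<in> S \<Longrightarrow> i < n \<Longrightarrow> (z i)\<^sup>2 \<le> ip n w z z"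
    and solvable: "\<forall>i<n. 0 < D i \<Longrightarrow> \<exists>h\<in>S. \<forall>z\<in>S. ip n D h z = (\<Sum>i<n. r i * z i)"
    and \<tau>_nonneg: "0 \<le> \<tau>"
begin

lemma w_nonneg: "\<forall>i<n. 0 \<le> w i"
  using w_pos by (auto intro: less_imp_le)

definition nrm :: "(nat \<Rightarrow> real) \<Rightarrow> real" where
  "nrm z = sqrt (ip n w z z)"

lemma nrm_nonneg [simp]: "0 \<le> nrm z"
  unfolding nrm_def using ip_nonneg[OF w_nonneg] by simp

lemma nrm_sq: "(nrm z)\<^sup>2 = ip n w z z"
  unfolding nrm_def using ip_nonneg[OF w_nonneg] by simp

text \<open>This is where good weights enter: a step that is short in the weighted norm moves no
  residual by more than its length, so stability of \<open>phi2\<close> applies to all coordinates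
  at once.\<close>

lemma abs_le_nrm: "z \<in> S \<Longrightarrow> i < n \<Longrightarrow> \<bar>z i\<bar> \<le> nrm z"
  unfolding nrm_def using norm_dom by (intro real_le_rsqrt) simp

lemma ip_le_nrm: "\<bar>ip n w u v\<bar> \<le> nrm u * nrm v"
  unfolding nrm_def by (rule ip_CS_sqrt[OF w_nonneg])

lemma nrm_scale: "nrm (\<lambda>i. c * u i) = \<bar>c\<bar> * nrm u"
proof -
  have "ip n w (\<lambda>i. c * u i) (\<lambda>i. c * u i) = c\<^sup>2 * ip n w u u"
    by (simp add: ip_def sum_distrib_left power2_eq_square mult_ac)
  then show ?thesis by (simp add: nrm_def real_sqrt_mult)
qed

lemma nrm_triangle: "nrm (\<lambda>i. u i + v i) \<le> nrm u + nrm v"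
proof -
  have "(nrm (\<lambda>i. u i + v i))\<^sup>2 = (nrm u)\<^sup>2 + 2 * ip n w u v + (nrm v)\<^sup>2"
    unfolding nrm_sq by (simp add: ip_def sum_distrib_left algebra_simps sum.distrib)
  also have "\<dots> \<le> (nrm u + nrm v)\<^sup>2"
    using ip_le_nrm[of u v] by (simp add: power2_sum)
  finally show ?thesis by (rule power2_le_imp_le) simp
qed

lemma nrm_cong: "(\<And>i. i < n \<Longrightarrow> u i = v i) \<Longrightarrow> nrm u = nrm v"
  unfolding nrm_def ip_def by simp

lemma S_diff: "u \<in> S \<Longrightarrow> v \<in> S \<Longrightarrow> (\<lambda>i. u i - v i) \<in> S"
  using S_lin[of u v 1 "-1"] by simp

definition obj :: "(nat \<Rightarrow> real) \<Rightarrow> real" where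
  "obj u = (\<Sum>i<n. phi \<tau> (u i - b i))"

text \<open>The Riesz representer in \<open>S\<close>, for the weighted inner product, of the
  derivative of \<open>obj\<close> at \<open>u\<close>.\<close>

definition is_grad :: "(nat \<Rightarrow> real) \<Rightarrow> (nat \<Rightarrow> real) \<Rightarrow> bool" where
  "is_grad u p \<longleftrightarrow> p \<in> S \<and> (\<forall>z\<in>S. ip n w p z = (\<Sum>i<n. phi1 \<tau> (u i - b i) * z i))"

definition hess :: "real \<Rightarrow> (nat \<Rightarrow> real) \<Rightarrow> nat \<Rightarrow> real" where
  "hess \<Lambda> u i = phi2 \<tau> (u i - b i) + \<Lambda> * w i"

text \<open>The Newton step at \<open>u\<close> for the proximal objective
  \<open>obj u + \<Lambda>/2 * (nrm (u - y))^2\<close> on \<open>S\<close>; the diagonal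
  \<open>hess \<Lambda> u\<close> is its Hessian.\<close>

definition is_newton :: "(nat \<Rightarrow> real) \<Rightarrow> real \<Rightarrow> (nat \<Rightarrow> real) \<Rightarrow> (nat \<Rightarrow> real) \<Rightarrow> bool" where
  "is_newton y \<Lambda> u h \<longleftrightarrow> h \<in> S \<and> (\<forall>z\<in>S. ip n (hess \<Lambda> u) h z =
     - ((\<Sum>i<n. phi1 \<tau> (u i - b i) * z i) + \<Lambda> * ip n w (\<lambda>i. u i - y i) z))"

definition decr :: "real \<Rightarrow> (nat \<Rightarrow> real) \<Rightarrow> (nat \<Rightarrow> real) \<Rightarrow> real" where
  "decr \<Lambda> u h = sqrt (ip n (hess \<Lambda> u) h h)"

text \<open>A bound on the Newton decrement. It is taken relative to \<open>sqrt \<Lambda>\<close>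
  because \<open>nrm_le_decr\<close> then turns it into a step of length at most
  \<open>c\<close>.\<close>

definition central :: "real \<Rightarrow> (nat \<Rightarrow> real) \<Rightarrow> real \<Rightarrow> (nat \<Rightarrow> real) \<Rightarrow> bool" where
  "central c y \<Lambda> u \<longleftrightarrow> (\<forall>h. is_newton y \<Lambda> u h \<longrightarrow> decr \<Lambda> u h \<le> c * sqrt \<Lambda>)"

lemma hess_pos: "0 < \<Lambda> \<Longrightarrow> \<forall>i<n. 0 < hess \<Lambda> u i"
  using phi2_pos w_pos by (auto simp: hess_def intro!: add_pos_pos mult_pos_pos)

lemma hess_nonneg: "0 < \<Lambda> \<Longrightarrow> \<forall>i<n. 0 \<le> hess \<Lambda> u i"
  using hess_pos by (auto intro: less_imp_le)

lemma decr_nonneg [simp]: "0 < \<Lambda> \<Longrightarrow> 0 \<le> decr \<Lambda> u h"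
  unfolding decr_def using ip_nonneg[OF hess_nonneg] by simp

lemma decr_sq: "0 < \<Lambda> \<Longrightarrow> (decr \<Lambda> u h)\<^sup>2 = ip n (hess \<Lambda> u) h h"
  unfolding decr_def using ip_nonneg[OF hess_nonneg] by simp

lemma ip_hess: "ip n (hess \<Lambda> u) h z = ip n (\<lambda>i. phi2 \<tau> (u i - b i)) h z + \<Lambda> * ip n w h z"
  by (simp add: ip_def hess_def sum_distrib_left sum.distrib algebra_simps)

lemma ip_phi2_nonneg: "0 \<le> ip n (\<lambda>i. phi2 \<tau> (u i - b i)) h h"
  by (rule ip_nonneg) (auto intro: less_imp_le phi2_pos)

lemma nrm_le_decr: "0 < \<Lambda> \<Longrightarrow> sqrt \<Lambda> * nrm h \<le> decr \<Lambda> u h"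
  unfolding nrm_def decr_def real_sqrt_mult[symmetric] ip_hess using ip_phi2_nonneg by simp

lemma ex_newton: "0 < \<Lambda> \<Longrightarrow> \<exists>h. is_newton y \<Lambda> u h"
proof -
  assume "0 < \<Lambda>"
  then obtain h where h: "h \<in> S" "\<And>z. z \<in> S \<Longrightarrow> ip n (hess \<Lambda> u) h z =
     (\<Sum>i<n. - (phi1 \<tau> (u i - b i) + \<Lambda> * w i * (u i - y i)) * z i)"
    using solvable[OF hess_pos[OF \<open>0 < \<Lambda>\<close>, of u], where r = "\<lambda>i. - (phi1 \<tau> (u i - b i) + \<Lambda> * w i * (u i - y i))"]
    by blast
  have "(\<Sum>i<n. - (phi1 \<tau> (u i - b i) + \<Lambda> * w i * (u i - y i)) * z i) =
     - ((\<Sum>i<n. phi1 \<tau> (u i - b i) * z i) + \<Lambda> * ip n w (\<lambda>i. u i - y i) z)" for z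
    unfolding ip_def sum_distrib_left sum.distrib[symmetric] sum_negf[symmetric]
    by (intro sum.cong) (auto simp: algebra_simps)
  then show ?thesis using h unfolding is_newton_def by (intro exI[of _ h]) simp
qed

text \<open>A step of length at most 1/16 changes second derivatives by a factor of at most 9/8. The
  new residual is thus at most 1/8 of the old decrement, and measuring it in the new Hessian costs
  at most a factor 2, which makes 1/4.\<close>

lemma newton_step:
  assumes \<Lambda>: "0 < \<Lambda>" and h: "is_newton y \<Lambda> u h" and c: "central c y \<Lambda> u" "c \<le> 1 / 16"
  shows "central (c / 4) y \<Lambda> (\<lambda>i. u i + h i)" "nrm h \<le> c"
proof -
  have dh: "decr \<Lambda> u h \<le> c * sqrt \<Lambda>" using h c by (auto simp: central_def)
  show hc: "nrm h \<le> c"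
  proof -
    have "sqrt \<Lambda> * nrm h \<le> sqrt \<Lambda> * c" using nrm_le_decr[OF \<Lambda>, of h u] dh by (simp add: mult_ac)
    then show ?thesis using \<Lambda> by simp
  qed
  have hS: "h \<in> S" using h by (simp add: is_newton_def)
  have hi: "\<bar>h i\<bar> \<le> 1 / 16" if "i < n" for i using abs_le_nrm[OF hS that] hc c(2) by linarith
  have e16: "exp (1 / 16) \<le> (9 / 8 :: real)"
    using exp_bound[of "1 / 16 :: real"] by (simp add: power2_eq_square)
  have exph: "exp \<bar>h i\<bar> \<le> 9 / 8" if "i < n" for i
    using hi[OF that] e16 by (meson exp_le_cancel_iff order.trans)
  let ?u = "\<lambda>i. u i + h i"
  show "central (c / 4) y \<Lambda> ?u"
    unfolding central_def
  proof (intro allI impI)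
    fix h2 assume h2: "is_newton y \<Lambda> ?u h2"
    then have h2S: "h2 \<in> S" by (simp add: is_newton_def)
    let ?ph = "\<lambda>i. phi2 \<tau> (u i - b i)"
    have pn: "\<forall>i<n. 0 \<le> ?ph i" by (auto intro: less_imp_le phi2_pos)
    \<comment> \<open>The old Newton equation cancels the linear terms, so only the Taylor error of
      \<open>phi1\<close> along \<open>h\<close> remains.\<close>
    have "ip n (hess \<Lambda> ?u) h2 h2 = - ((\<Sum>i<n. phi1 \<tau> (?u i - b i) * h2 i) + \<Lambda> * ip n w (\<lambda>i. ?u i - y i) h2)"
      using h2 h2S by (auto simp: is_newton_def)
    also have "ip n w (\<lambda>i. ?u i - y i) h2 = ip n w (\<lambda>i. u i - y i) h2 + ip n w h h2"
      unfolding ip_def sum.distrib[symmetric] by (intro sum.cong) (auto simp: algebra_simps)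
    also have "\<Lambda> * (ip n w (\<lambda>i. u i - y i) h2 + ip n w h h2) =
       - ip n (hess \<Lambda> u) h h2 - (\<Sum>i<n. phi1 \<tau> (u i - b i) * h2 i) + \<Lambda> * ip n w h h2"
      using h h2S by (auto simp: is_newton_def algebra_simps)
    also have "\<dots> = - ip n ?ph h h2 - (\<Sum>i<n. phi1 \<tau> (u i - b i) * h2 i)"
      by (simp add: ip_hess)
    also have "- ((\<Sum>i<n. phi1 \<tau> (?u i - b i) * h2 i) + (- ip n ?ph h h2 - (\<Sum>i<n. phi1 \<tau> (u i - b i) * h2 i)))
       = (\<Sum>i<n. - (phi1 \<tau> (?u i - b i) - phi1 \<tau> (u i - b i) - ?ph i * h i) * h2 i)"
      by (simp add: ip_def sum_subtractf sum_negf sum.distrib algebra_simps)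
    also have "\<dots> \<le> (\<Sum>i<n. 1 / 8 * (?ph i * \<bar>h i\<bar> * \<bar>h2 i\<bar>))"
    proof (rule sum_mono)
      fix i assume "i \<in> {..<n}"
      then have i: "i < n" by simp
      have "\<bar>phi1 \<tau> (?u i - b i) - phi1 \<tau> (u i - b i) - ?ph i * h i\<bar> \<le> ?ph i * \<bar>h i\<bar> * (exp \<bar>h i\<bar> - 1)"
        using phi1_taylor[of \<tau> "?u i - b i" "u i - b i"] by simp
      also have "\<dots> \<le> ?ph i * \<bar>h i\<bar> * (1 / 8)"
        using exph[OF i] pn i by (intro mult_left_mono) auto
      finally have "\<bar>phi1 \<tau> (?u i - b i) - phi1 \<tau> (u i - b i) - ?ph i * h i\<bar> * \<bar>h2 i\<bar> \<le> ?ph i * \<bar>h i\<bar> * (1 / 8) * \<bar>h2 i\<bar>"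
        by (rule mult_right_mono) simp
      moreover have "- (phi1 \<tau> (?u i - b i) - phi1 \<tau> (u i - b i) - ?ph i * h i) * h2 i \<le>
         \<bar>phi1 \<tau> (?u i - b i) - phi1 \<tau> (u i - b i) - ?ph i * h i\<bar> * \<bar>h2 i\<bar>"
        by (metis abs_ge_minus_self abs_mult mult_minus_left)
      ultimately show "- (phi1 \<tau> (?u i - b i) - phi1 \<tau> (u i - b i) - ?ph i * h i) * h2 i \<le> 1 / 8 * (?ph i * \<bar>h i\<bar> * \<bar>h2 i\<bar>)"
        by simp
    qed
    also have "\<dots> \<le> 1 / 8 * (sqrt (ip n ?ph h h) * sqrt (ip n ?ph h2 h2))"
      unfolding sum_distrib_left[symmetric] by (intro mult_left_mono ip_CS_abs pn) simp
    also have "\<dots> \<le> 1 / 8 * (decr \<Lambda> u h * (2 * decr \<Lambda> ?u h2))"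
    proof (intro mult_left_mono mult_mono)
      show "sqrt (ip n ?ph h h) \<le> decr \<Lambda> u h"
        unfolding decr_def ip_hess using \<Lambda> ip_nonneg[OF w_nonneg, of h] by simp
      have "ip n ?ph h2 h2 \<le> 4 * ip n (\<lambda>i. phi2 \<tau> (?u i - b i)) h2 h2"
        unfolding ip_def sum_distrib_left
      proof (rule sum_mono)
        fix i assume "i \<in> {..<n}"
        then have i: "i < n" by simp
        have "?ph i \<le> exp \<bar>h i\<bar> * phi2 \<tau> (?u i - b i)"
          using phi2_stable[of \<tau> "u i - b i" "?u i - b i"] by simp
        also have "\<dots> \<le> 4 * phi2 \<tau> (?u i - b i)"
          using exph[OF i] phi2_pos[of \<tau> "?u i - b i"] by (intro mult_right_mono) auto
        finally have "?ph i * (h2 i * h2 i) \<le> 4 * phi2 \<tau> (?u i - b i) * (h2 i * h2 i)"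
          by (rule mult_right_mono) simp
        then show "?ph i * h2 i * h2 i \<le> 4 * (phi2 \<tau> (?u i - b i) * h2 i * h2 i)" by (simp add: mult_ac)
      qed
      also have "\<dots> \<le> 4 * ip n (hess \<Lambda> ?u) h2 h2"
        unfolding ip_hess using \<Lambda> ip_nonneg[OF w_nonneg, of h2] by simp
      finally have "sqrt (ip n ?ph h2 h2) \<le> sqrt (4 * ip n (hess \<Lambda> ?u) h2 h2)" by simp
      then show "sqrt (ip n ?ph h2 h2) \<le> 2 * decr \<Lambda> ?u h2"
        by (simp add: decr_def real_sqrt_mult)
    qed (use \<Lambda> ip_phi2_nonneg in auto)
    finally have "(decr \<Lambda> ?u h2)\<^sup>2 \<le> decr \<Lambda> u h / 4 * decr \<Lambda> ?u h2"
      using decr_sq[OF \<Lambda>] by simp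
    then have "decr \<Lambda> ?u h2 \<le> decr \<Lambda> u h / 4"
      using \<Lambda> decr_nonneg[OF \<Lambda>, of ?u h2] decr_nonneg[OF \<Lambda>, of u h]
      by (cases "decr \<Lambda> ?u h2 = 0") (auto simp: power2_eq_square)
    then show "decr \<Lambda> ?u h2 \<le> c / 4 * sqrt \<Lambda>" using dh by simp
  qed
qed

text \<open>Changing the parameter adds \<open>(\<Lambda> - \<Lambda>') (u - y)\<close> to the
  residual, of norm at most \<open>\<Lambda>/16 * 1/2\<close> while \<open>u\<close> stays within
  1/2 of the centre. With a factor 16/15 for each passage between the two parameters, 1/64 grows to
  4/225 + 1/30, which is below 1/16.\<close>

lemma central_shrink:
  assumes \<Lambda>: "0 < \<Lambda>" and \<Lambda>': "15 / 16 * \<Lambda> \<le> \<Lambda>'" "\<Lambda>' \<le> \<Lambda>" and c: "central (1 / 64) y \<Lambda> u"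
    and s: "nrm (\<lambda>i. u i - y i) \<le> 1 / 2"
  shows "central (1 / 16) y \<Lambda>' u"
  unfolding central_def
proof (intro allI impI)
  fix h assume h: "is_newton y \<Lambda>' u h"
  then have hS: "h \<in> S" by (simp add: is_newton_def)
  have \<Lambda>'0: "0 < \<Lambda>'" using \<Lambda> \<Lambda>' by linarith
  obtain h2 where h2: "is_newton y \<Lambda> u h2" using ex_newton[OF \<Lambda>] by blast
  have d2: "decr \<Lambda> u h2 \<le> 1 / 64 * sqrt \<Lambda>" using c h2 by (auto simp: central_def)
  have sq: "sqrt x \<le> 16 / 15 * sqrt x'" if "x \<le> 16 / 15 * x'" "0 \<le> x'" for x x' :: real
  proof (rule real_le_lsqrt)
    show "x \<le> (16 / 15 * sqrt x')\<^sup>2" using that by (simp add: power_mult_distrib power2_eq_square)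
  qed (use that in auto)
  have sL: "sqrt \<Lambda> \<le> 16 / 15 * sqrt \<Lambda>'" using \<Lambda>' \<Lambda>'0 by (intro sq) auto
  have "ip n (hess \<Lambda>' u) h h = - ((\<Sum>i<n. phi1 \<tau> (u i - b i) * h i) + \<Lambda>' * ip n w (\<lambda>i. u i - y i) h)"
    using h hS by (auto simp: is_newton_def)
  also have "\<dots> = ip n (hess \<Lambda> u) h2 h + (\<Lambda> - \<Lambda>') * ip n w (\<lambda>i. u i - y i) h"
    using h2 hS by (auto simp: is_newton_def algebra_simps)
  also have "\<dots> \<le> decr \<Lambda> u h2 * decr \<Lambda> u h + \<Lambda> / 16 * (1 / 2 * nrm h)"
  proof (rule add_mono)
    show "ip n (hess \<Lambda> u) h2 h \<le> decr \<Lambda> u h2 * decr \<Lambda> u h"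
      using ip_CS_sqrt[OF hess_nonneg[OF \<Lambda>], of u h2 h] by (simp add: decr_def)
    have "(\<Lambda> - \<Lambda>') * ip n w (\<lambda>i. u i - y i) h \<le> (\<Lambda> - \<Lambda>') * (nrm (\<lambda>i. u i - y i) * nrm h)"
      using \<Lambda>' ip_le_nrm[of "\<lambda>i. u i - y i" h] by (intro mult_left_mono) auto
    also have "\<dots> \<le> \<Lambda> / 16 * (1 / 2 * nrm h)"
      using \<Lambda>' s \<Lambda> by (intro mult_mono) auto
    finally show "(\<Lambda> - \<Lambda>') * ip n w (\<lambda>i. u i - y i) h \<le> \<Lambda> / 16 * (1 / 2 * nrm h)" .
  qed
  also have "\<dots> \<le> (1 / 64 * (16 / 15 * sqrt \<Lambda>')) * (16 / 15 * decr \<Lambda>' u h) + 1 / 32 * (16 / 15 * sqrt \<Lambda>' * decr \<Lambda>' u h)"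
  proof (rule add_mono)
    have "decr \<Lambda> u h \<le> 16 / 15 * decr \<Lambda>' u h"
      unfolding decr_def
    proof (rule sq)
      have "\<Lambda> * ip n w h h \<le> 16 / 15 * \<Lambda>' * ip n w h h"
        using \<Lambda>' ip_nonneg[OF w_nonneg, of h] by (intro mult_right_mono) auto
      then show "ip n (hess \<Lambda> u) h h \<le> 16 / 15 * ip n (hess \<Lambda>' u) h h"
        unfolding ip_hess using ip_phi2_nonneg[of u h] by (simp add: algebra_simps)
    qed (rule ip_nonneg[OF hess_nonneg[OF \<Lambda>'0]])
    then show "decr \<Lambda> u h2 * decr \<Lambda> u h \<le> (1 / 64 * (16 / 15 * sqrt \<Lambda>')) * (16 / 15 * decr \<Lambda>' u h)"
      using d2 sL \<Lambda> \<Lambda>'0 by (intro mult_mono) auto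
    have "\<Lambda> * nrm h \<le> 16 / 15 * \<Lambda>' * nrm h" using \<Lambda>' by (intro mult_right_mono) auto
    also have "\<dots> = 16 / 15 * sqrt \<Lambda>' * (sqrt \<Lambda>' * nrm h)" using \<Lambda>'0 by simp
    also have "\<dots> \<le> 16 / 15 * sqrt \<Lambda>' * decr \<Lambda>' u h"
      using nrm_le_decr[OF \<Lambda>'0, of h u] \<Lambda>'0 by (intro mult_left_mono) auto
    finally show "\<Lambda> / 16 * (1 / 2 * nrm h) \<le> 1 / 32 * (16 / 15 * sqrt \<Lambda>' * decr \<Lambda>' u h)" by simp
  qed
  also have "\<dots> = (4 / 225 + 1 / 30) * (sqrt \<Lambda>' * decr \<Lambda>' u h)" by (simp add: algebra_simps)
  also have "\<dots> \<le> 1 / 16 * (sqrt \<Lambda>' * decr \<Lambda>' u h)"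
    using \<Lambda>'0 by (intro mult_right_mono) auto
  finally have "(decr \<Lambda>' u h)\<^sup>2 \<le> 1 / 16 * sqrt \<Lambda>' * decr \<Lambda>' u h"
    using decr_sq[OF \<Lambda>'0] by simp
  then show "decr \<Lambda>' u h \<le> 1 / 16 * sqrt \<Lambda>'"
    using \<Lambda>'0 decr_nonneg[OF \<Lambda>'0, of u h]
    by (cases "decr \<Lambda>' u h = 0") (auto simp: power2_eq_square)
qed

text \<open>At \<open>u = y\<close> the proximal term has no gradient, so a large parameter makes
  the gradient of \<open>obj\<close> small in comparison.\<close>

lemma central_start:
  assumes \<Lambda>: "0 < \<Lambda>" and p: "is_grad y p" and le: "16 * nrm p \<le> \<Lambda>"
  shows "central (1 / 16) y \<Lambda> y"
  unfolding central_def
proof (intro allI impI)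
  fix h assume h: "is_newton y \<Lambda> y h"
  then have hS: "h \<in> S" by (simp add: is_newton_def)
  have "ip n (hess \<Lambda> y) h h = - ip n w p h"
    using h hS p by (auto simp: is_newton_def is_grad_def ip_def)
  also have "\<dots> \<le> nrm p * nrm h" using ip_le_nrm[of p h] by simp
  also have "\<dots> \<le> \<Lambda> / 16 * nrm h" using le by (intro mult_right_mono) auto
  also have "\<dots> = 1 / 16 * sqrt \<Lambda> * (sqrt \<Lambda> * nrm h)" using \<Lambda> by simp
  also have "\<dots> \<le> 1 / 16 * sqrt \<Lambda> * decr \<Lambda> y h"
    using nrm_le_decr[OF \<Lambda>, of h y] \<Lambda> by (intro mult_left_mono) auto
  finally have "(decr \<Lambda> y h)\<^sup>2 \<le> 1 / 16 * sqrt \<Lambda> * decr \<Lambda> y h" using decr_sq[OF \<Lambda>] by simp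
  then show "decr \<Lambda> y h \<le> 1 / 16 * sqrt \<Lambda>"
    using \<Lambda> decr_nonneg[OF \<Lambda>, of y h]
    by (cases "decr \<Lambda> y h = 0") (auto simp: power2_eq_square)
qed

text \<open>The decrement bounds the residual only in the dual of the Hessian norm. Second
  derivatives are at most 2 and coordinates at most the weighted norm, so the Hessian is at most
  \<open>2n + \<Lambda>\<close> times the squared weighted norm; this converts the bound.\<close>

lemma residual_le:
  assumes \<Lambda>: "0 < \<Lambda>" and c: "central c y \<Lambda> u" and p: "is_grad u p" and S: "u \<in> S" "y \<in> S"
  shows "nrm (\<lambda>i. p i + \<Lambda> * (u i - y i)) \<le> \<bar>c\<bar> * (2 * real n + \<Lambda>)"
proof -
  let ?e = "\<lambda>i. p i + \<Lambda> * (u i - y i)"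
  obtain h where h: "is_newton y \<Lambda> u h" using ex_newton[OF \<Lambda>] by blast
  have dh: "decr \<Lambda> u h \<le> c * sqrt \<Lambda>" using h c by (auto simp: central_def)
  have eS: "?e \<in> S" using S_lin[of p "\<lambda>i. u i - y i" 1 \<Lambda>] S_diff[OF S] p by (simp add: is_grad_def)
  have "ip n w ?e ?e = ip n w p ?e + \<Lambda> * ip n w (\<lambda>i. u i - y i) ?e"
    unfolding ip_def sum_distrib_left sum.distrib[symmetric] by (intro sum.cong) (auto simp: algebra_simps)
  also have "\<dots> = - ip n (hess \<Lambda> u) h ?e" using p h eS by (auto simp: is_grad_def is_newton_def)
  also have "\<dots> \<le> decr \<Lambda> u h * sqrt (ip n (hess \<Lambda> u) ?e ?e)"
    using ip_CS_sqrt[OF hess_nonneg[OF \<Lambda>], of u h ?e] by (simp add: decr_def)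
  also have "\<dots> \<le> c * sqrt \<Lambda> * (sqrt (2 * real n + \<Lambda>) * nrm ?e)"
  proof (intro mult_mono dh)
    have "ip n (\<lambda>i. phi2 \<tau> (u i - b i)) ?e ?e \<le> (\<Sum>i<n. 2 * (nrm ?e)\<^sup>2)"
      unfolding ip_def
    proof (rule sum_mono)
      fix i assume "i \<in> {..<n}"
      then have "(?e i)\<^sup>2 \<le> (nrm ?e)\<^sup>2" unfolding nrm_sq using norm_dom[OF eS] by simp
      then show "phi2 \<tau> (u i - b i) * ?e i * ?e i \<le> 2 * (nrm ?e)\<^sup>2"
        using mult_mono[OF phi2_le[of \<tau> "u i - b i"], of "(?e i)\<^sup>2" "(nrm ?e)\<^sup>2"] by (simp add: power2_eq_square mult_ac)
    qed
    then have "ip n (hess \<Lambda> u) ?e ?e \<le> (2 * real n + \<Lambda>) * (nrm ?e)\<^sup>2"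
      unfolding ip_hess by (simp add: nrm_sq algebra_simps)
    then have "sqrt (ip n (hess \<Lambda> u) ?e ?e) \<le> sqrt ((2 * real n + \<Lambda>) * (nrm ?e)\<^sup>2)" by simp
    then show "sqrt (ip n (hess \<Lambda> u) ?e ?e) \<le> sqrt (2 * real n + \<Lambda>) * nrm ?e"
      by (simp add: real_sqrt_mult)
    show "0 \<le> c * sqrt \<Lambda>" using dh decr_nonneg[OF \<Lambda>, of u h] by linarith
  qed (use ip_nonneg[OF hess_nonneg[OF \<Lambda>]] in auto)
  also have "\<dots> \<le> \<bar>c\<bar> * (sqrt (2 * real n + \<Lambda>) * sqrt (2 * real n + \<Lambda>)) * nrm ?e"
  proof -
    have "c * sqrt \<Lambda> * sqrt (2 * real n + \<Lambda>) \<le> \<bar>c\<bar> * sqrt (2 * real n + \<Lambda>) * sqrt (2 * real n + \<Lambda>)"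
      using \<Lambda> by (intro mult_mono) auto
    then show ?thesis using mult_right_mono[OF _ nrm_nonneg[of ?e]] by (fastforce simp: mult_ac)
  qed
  finally have "(nrm ?e)\<^sup>2 \<le> \<bar>c\<bar> * (2 * real n + \<Lambda>) * nrm ?e"
    using \<Lambda> by (simp add: nrm_sq)
  then show ?thesis
    using \<Lambda> nrm_nonneg[of ?e] by (cases "nrm ?e = 0") (auto simp: power2_eq_square)
qed

lemma grad_le:
  assumes p: "is_grad u p" and r: "\<And>i. i < n \<Longrightarrow> \<bar>u i - b i\<bar> \<le> r"
  shows "nrm p \<le> real n * (1 + r)"
proof -
  have pS: "p \<in> S" using p by (simp add: is_grad_def)
  have "(nrm p)\<^sup>2 = (\<Sum>i<n. phi1 \<tau> (u i - b i) * p i)"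
    unfolding nrm_sq using p by (auto simp: is_grad_def)
  also have "\<dots> \<le> (\<Sum>i<n. (1 + r) * nrm p)"
  proof (rule sum_mono)
    fix i assume "i \<in> {..<n}"
    then have i: "i < n" by simp
    have "phi1 \<tau> (u i - b i) * p i \<le> \<bar>phi1 \<tau> (u i - b i)\<bar> * \<bar>p i\<bar>" by (metis abs_ge_self abs_mult)
    also have "\<dots> \<le> (1 + r) * nrm p"
      using phi1_le[OF \<tau>_nonneg, of "u i - b i"] r[OF i] abs_le_nrm[OF pS i] by (intro mult_mono) auto
    finally show "phi1 \<tau> (u i - b i) * p i \<le> (1 + r) * nrm p" .
  qed
  finally have "(nrm p)\<^sup>2 \<le> real n * (1 + r) * nrm p" by simp
  moreover have "0 \<le> real n * (1 + r)"
  proof (cases "n = 0")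
    case False
    then show ?thesis using r[of 0] by (auto intro!: mult_nonneg_nonneg)
  qed simp
  moreover have "0 \<le> nrm p" by simp
  ultimately show ?thesis
    by (cases "nrm p = 0") (simp_all add: power2_eq_square)
qed

lemma obj_tangent:
  assumes p: "is_grad u p" and S: "u \<in> S" "z \<in> S"
  shows "obj u - obj z \<le> ip n w p (\<lambda>i. u i - z i)"
proof -
  have "ip n w p (\<lambda>i. u i - z i) = (\<Sum>i<n. phi1 \<tau> (u i - b i) * (u i - z i))"
    using p S_diff[OF S] by (auto simp: is_grad_def)
  moreover have "obj u - obj z \<le> (\<Sum>i<n. phi1 \<tau> (u i - b i) * (u i - z i))"
    unfolding obj_def sum_subtractf[symmetric]
  proof (rule sum_mono)
    fix i
    show "phi \<tau> (u i - b i) - phi \<tau> (z i - b i) \<le> phi1 \<tau> (u i - b i) * (u i - z i)"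
      using phi_convex[of \<tau> "u i - b i" "z i - b i"] by (simp add: algebra_simps)
  qed
  ultimately show ?thesis by simp
qed

lemma obj_convex:
  assumes "0 \<le> s" "0 \<le> t" "s + t = 1"
  shows "obj (\<lambda>i. s * u i + t * v i) \<le> s * obj u + t * obj v"
  unfolding obj_def sum_distrib_left sum.distrib[symmetric]
proof (rule sum_mono)
  fix i
  let ?r = "u i - b i" and ?q = "v i - b i" and ?m = "s * u i + t * v i - b i"
  have "s * (phi \<tau> ?m + phi1 \<tau> ?m * (?r - ?m)) + t * (phi \<tau> ?m + phi1 \<tau> ?m * (?q - ?m)) \<le> s * phi \<tau> ?r + t * phi \<tau> ?q"
    using assms by (intro add_mono mult_left_mono phi_convex) auto
  moreover have "s * (phi \<tau> ?m + phi1 \<tau> ?m * (?r - ?m)) + t * (phi \<tau> ?m + phi1 \<tau> ?m * (?q - ?m))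
      = (s + t) * phi \<tau> ?m + phi1 \<tau> ?m * ((s * ?r + t * ?q) - (s + t) * ?m)" by (simp add: algebra_simps)
  moreover have "(s * ?r + t * ?q) - (s + t) * ?m = 0"
  proof -
    have "s * ?r + t * ?q = s * u i + t * v i - (s + t) * b i" by (simp add: algebra_simps)
    then show ?thesis unfolding assms(3) by simp
  qed
  ultimately show "phi \<tau> ?m \<le> s * phi \<tau> ?r + t * phi \<tau> ?q" using assms(3) by simp
qed

text \<open>By convexity the gradient cannot be small at a point of value above 1 while a point of
  value at most 1/2 is near. This lower bound turns the absolute accuracy of Newton's method into
  accuracy relative to the gradient.\<close>

lemma grad_ge:
  assumes p: "is_grad u p" and S: "u \<in> S" "z \<in> S" and "1 < obj u" "obj z \<le> 1 / 2"
  shows "1 / 2 < nrm p * nrm (\<lambda>i. u i - z i)"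
  using obj_tangent[OF p S] ip_le_nrm[of p "\<lambda>i. u i - z i"] assms(4,5) by linarith

text \<open>Up to half of its own norm the gradient \<open>p\<close> equals
  \<open>\<Lambda> (y - u)\<close>, so it correlates with the movement. For
  \<open>\<Lambda> = \<mu>\<close> this is the condition of a full step. A movement of at least 1/4
  forces \<open>\<Lambda> \<le> 6 * nrm p\<close>, and replacing \<open>\<Lambda>\<close> by this
  bound gives the condition of a damped step.\<close>

lemma prox_quality:
  assumes p: "is_grad u p" and \<mu>: "0 < \<mu>" "\<mu> \<le> \<Lambda>"
    and e: "nrm (\<lambda>i. p i + \<Lambda> * (u i - y i)) \<le> nrm p / 2"
    and s: "1 / 4 \<le> nrm (\<lambda>i. u i - y i) \<or> \<Lambda> = \<mu>"
  shows "(nrm p)\<^sup>2 \<le> 2 * \<mu> * ip n w p (\<lambda>i. y i - u i) \<or> nrm p \<le> 12 * ip n w p (\<lambda>i. y i - u i)"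
proof -
  let ?e = "\<lambda>i. p i + \<Lambda> * (u i - y i)"
  let ?q = "ip n w p (\<lambda>i. y i - u i)"
  have \<Lambda>: "0 < \<Lambda>" using \<mu> by linarith
  have "ip n w p ?e = ip n w p p - \<Lambda> * ?q"
    unfolding ip_def sum_distrib_left sum_subtractf[symmetric] by (intro sum.cong) (auto simp: algebra_simps)
  then have "\<Lambda> * ?q = (nrm p)\<^sup>2 - ip n w p ?e" by (simp add: nrm_sq)
  also have "\<dots> \<ge> (nrm p)\<^sup>2 - nrm p * (nrm p / 2)"
    using ip_le_nrm[of p ?e] mult_left_mono[OF e nrm_nonneg[of p]] by linarith
  finally have q: "(nrm p)\<^sup>2 \<le> 2 * \<Lambda> * ?q" by (simp add: power2_eq_square)
  show ?thesis
  proof (cases "\<Lambda> = \<mu>")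
    case True
    then show ?thesis using q by simp
  next
    case False
    then have s4: "1 / 4 \<le> nrm (\<lambda>i. u i - y i)" using s by simp
    have "nrm (\<lambda>i. \<Lambda> * (u i - y i)) = nrm (\<lambda>i. ?e i + (-1) * p i)" by (rule nrm_cong) simp
    also have "\<dots> \<le> nrm ?e + nrm p" using nrm_triangle[of ?e "\<lambda>i. (-1) * p i"] nrm_scale[of "-1" p] by simp
    finally have "\<Lambda> * nrm (\<lambda>i. u i - y i) \<le> 3 / 2 * nrm p"
      using e \<Lambda> nrm_scale[of \<Lambda> "\<lambda>i. u i - y i"] by simp
    moreover have "\<Lambda> * (1 / 4) \<le> \<Lambda> * nrm (\<lambda>i. u i - y i)" using s4 \<Lambda> by (intro mult_left_mono) auto
    ultimately have L: "\<Lambda> \<le> 6 * nrm p" by simp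
    then have pp: "0 < nrm p" using \<Lambda> by linarith
    have "0 \<le> ?q" using q \<Lambda> by (smt (verit) mult_neg_neg mult_pos_neg zero_le_power2 zero_less_mult_iff)
    then have "2 * \<Lambda> * ?q \<le> 2 * (6 * nrm p) * ?q" using L by (intro mult_right_mono) auto
    then have "nrm p * nrm p \<le> nrm p * (12 * ?q)" using q by (simp add: power2_eq_square)
    then show ?thesis using pp by simp
  qed
qed

section \<open>The potential of the accelerated method\<close>

definition pot :: "(nat \<Rightarrow> real) \<Rightarrow> real \<Rightarrow> (nat \<Rightarrow> real) \<Rightarrow> (nat \<Rightarrow> real) \<Rightarrow> real" where
  "pot z \<alpha> u v = \<alpha> * (obj u - obj z) + (nrm (\<lambda>i. v i - z i))\<^sup>2 / 2"

text \<open>The usual estimate for acceleration with accumulated weight \<open>\<alpha>\<close> and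
  mirror sequence \<open>v\<close>, for a fraction \<open>\<gamma>\<close> of a step: each of
  \<open>\<alpha>\<close>, \<open>\<alpha> u\<close> and \<open>v\<close> is interpolated between
  its old value and its value after a full step, which adds the weight \<open>\<alpha> / K\<close>
  and moves \<open>u\<close> to \<open>x\<close>.\<close>

lemma pot_step:
  assumes S: "u \<in> S" "v \<in> S" "z \<in> S" "x \<in> S" and K: "1 \<le> K" and \<alpha>: "0 < \<alpha>" and \<gamma>: "0 \<le> \<gamma>" "\<gamma> \<le> 1"
    and p: "is_grad x p" and y: "\<And>i. y i = (K * u i + v i) / (K + 1)"
  shows "pot z (\<alpha> * (1 + \<gamma> / K)) (\<lambda>i. ((1 - \<gamma>) * K * u i + \<gamma> * (K + 1) * x i) / (K + \<gamma>)) (\<lambda>i. v i - \<gamma> * (\<alpha> / K) * p i)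
     \<le> pot z \<alpha> u v - \<gamma> * (\<alpha> * (K + 1) / K) * ip n w p (\<lambda>i. y i - x i) + (\<gamma> * (\<alpha> / K))\<^sup>2 * (nrm p)\<^sup>2 / 2"
proof -
  let ?u = "\<lambda>i. ((1 - \<gamma>) * K * u i + \<gamma> * (K + 1) * x i) / (K + \<gamma>)"
  let ?v = "\<lambda>i. v i - \<gamma> * (\<alpha> / K) * p i"
  let ?s = "(1 - \<gamma>) * K / (K + \<gamma>)" and ?t = "\<gamma> * (K + 1) / (K + \<gamma>)"
  have Kg: "0 < K + \<gamma>" "0 < K" using K \<gamma> by linarith+
  have st: "0 \<le> ?s" "0 \<le> ?t" "?s + ?t = 1"
    using K \<gamma> Kg by (auto simp: add_divide_distrib[symmetric]) (auto simp: algebra_simps)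
  have "?u = (\<lambda>i. ?s * u i + ?t * x i)" by (auto simp: add_divide_distrib)
  then have "obj ?u \<le> ?s * obj u + ?t * obj x" using obj_convex[OF st] by simp
  then have "\<alpha> * (1 + \<gamma> / K) * obj ?u \<le> \<alpha> * (1 + \<gamma> / K) * (?s * obj u + ?t * obj x)"
    using \<alpha> \<gamma> Kg by (intro mult_left_mono) auto
  also have "\<dots> = \<alpha> * (1 - \<gamma>) * obj u + \<gamma> * (\<alpha> * (K + 1) / K) * obj x"
  proof -
    have "1 + \<gamma> / K = (K + \<gamma>) / K" using Kg by (simp add: add_divide_distrib)
    then have "(1 + \<gamma> / K) * ?s = 1 - \<gamma>" "(1 + \<gamma> / K) * ?t = \<gamma> * (K + 1) / K" using Kg by auto
    moreover have "e * f * (g * x + h * y) = e * (f * g) * x + e * (f * h) * y" for e f g h x y :: real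
      by (simp add: algebra_simps)
    ultimately show ?thesis by (simp only:) simp
  qed
  finally have 1: "\<alpha> * (1 + \<gamma> / K) * obj ?u \<le> \<alpha> * (1 - \<gamma>) * obj u + \<gamma> * (\<alpha> * (K + 1) / K) * obj x" .
  have "\<alpha> * (1 + \<gamma> / K) * (obj ?u - obj z) - \<alpha> * (obj u - obj z)
      \<le> \<gamma> * (\<alpha> * (obj x - obj u) + \<alpha> / K * (obj x - obj z))"
    using 1 Kg by (simp add: field_simps)
  also have "\<dots> \<le> \<gamma> * (\<alpha> * ip n w p (\<lambda>i. x i - u i) + \<alpha> / K * ip n w p (\<lambda>i. x i - z i))"
    using \<alpha> \<gamma> Kg S p by (intro mult_left_mono add_mono obj_tangent) auto
  also have "\<alpha> * ip n w p (\<lambda>i. x i - u i) + \<alpha> / K * ip n w p (\<lambda>i. x i - z i) =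
      ip n w p (\<lambda>i. - (\<alpha> * (K + 1) / K) * (y i - x i) + \<alpha> / K * (v i - z i))"
  proof -
    have "\<alpha> * ip n w p (\<lambda>i. x i - u i) + \<alpha> / K * ip n w p (\<lambda>i. x i - z i) =
       ip n w p (\<lambda>i. \<alpha> * (x i - u i) + \<alpha> / K * (x i - z i))" by (simp only: ip_lin)
    also have "(\<lambda>i. \<alpha> * (x i - u i) + \<alpha> / K * (x i - z i)) =
       (\<lambda>i. - (\<alpha> * (K + 1) / K) * (y i - x i) + \<alpha> / K * (v i - z i))"
    proof
      fix i
      have "(K + 1) * y i = K * u i + v i" using y[of i] K by simp
      then have yy: "u i = ((K + 1) * y i - v i) / K" using Kg by simp
      show "\<alpha> * (x i - u i) + \<alpha> / K * (x i - z i) = - (\<alpha> * (K + 1) / K) * (y i - x i) + \<alpha> / K * (v i - z i)"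
        unfolding yy using Kg by (simp add: field_simps)
    qed
    finally show ?thesis .
  qed
  also have "\<dots> = - (\<alpha> * (K + 1) / K) * ip n w p (\<lambda>i. y i - x i) + \<alpha> / K * ip n w p (\<lambda>i. v i - z i)"
    by (simp only: ip_lin)
  finally have 2: "\<alpha> * (1 + \<gamma> / K) * (obj ?u - obj z) - \<alpha> * (obj u - obj z) \<le>
     \<gamma> * (- (\<alpha> * (K + 1) / K) * ip n w p (\<lambda>i. y i - x i) + \<alpha> / K * ip n w p (\<lambda>i. v i - z i))" .
  define c where "c = \<gamma> * (\<alpha> / K)"
  have "(nrm (\<lambda>i. ?v i - z i))\<^sup>2 = (nrm (\<lambda>i. v i - z i))\<^sup>2 - 2 * (c * ip n w p (\<lambda>i. v i - z i)) + c\<^sup>2 * (nrm p)\<^sup>2"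
    unfolding nrm_sq ip_def c_def[symmetric] sum_distrib_left sum_subtractf[symmetric] sum.distrib[symmetric]
    by (intro sum.cong) (auto simp: power2_eq_square algebra_simps)
  moreover have "\<gamma> * (- B * q + \<alpha> / K * r) = - (\<gamma> * B * q) + c * r" for B q r
    by (simp add: c_def algebra_simps)
  moreover have "a - e \<le> - g + t \<Longrightarrow> a + (m - 2 * t + k) / 2 \<le> e + m / 2 - g + k / 2" for a e g t m k :: real
    by (simp add: diff_divide_distrib add_divide_distrib)
  ultimately show ?thesis
    using 2 unfolding pot_def c_def[symmetric] by (simp only:)
qed

text \<open>The value of \<open>\<mu>\<close> is the one for which the quadratic term
  \<open>(\<alpha> / K)^2 (nrm p)^2 / 2\<close> is covered by the linear gain.\<close>

lemma pot_step_full: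
  assumes "u \<in> S" "v \<in> S" "z \<in> S" "x \<in> S" "1 \<le> K" "0 < \<alpha>" "is_grad x p" "\<And>i. y i = (K * u i + v i) / (K + 1)"
    and \<mu>: "\<mu> = K * (K + 1) / \<alpha>" and q: "(nrm p)\<^sup>2 \<le> 2 * \<mu> * ip n w p (\<lambda>i. y i - x i)"
  shows "pot z (\<alpha> * (1 + 1 / K)) x (\<lambda>i. v i - \<alpha> / K * p i) \<le> pot z \<alpha> u v"
proof -
  let ?q = "ip n w p (\<lambda>i. y i - x i)"
  have K: "0 < K" "K + 1 \<noteq> 0" using assms(5) by linarith+
  have "(\<alpha> / K)\<^sup>2 * (nrm p)\<^sup>2 \<le> (\<alpha> / K)\<^sup>2 * (2 * \<mu> * ?q)" using q by (intro mult_left_mono) auto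
  also have "\<dots> = 2 * (\<alpha> * (K + 1) / K * ?q)"
    unfolding \<mu> using K assms(6) by (simp add: power2_eq_square field_simps)
  finally show ?thesis
    using pot_step[OF assms(1-6), of 1 p y] assms(7,8) K by simp
qed

text \<open>The chosen \<open>\<gamma>\<close> minimises the quadratic bound of
  \<open>pot_step\<close>, and the minimum keeps half of the linear gain. That half is
  \<open>(K + 1)^2 q^2 / (2 (nrm p)^2)\<close> for \<open>q\<close> the inner product, and
  \<open>nrm p \<le> 12 q\<close> yields 2 * 144 = 288.\<close>

lemma pot_step_damped:
  assumes "u \<in> S" "v \<in> S" "z \<in> S" "x \<in> S" "1 \<le> K" "0 < \<alpha>" "is_grad x p" "\<And>i. y i = (K * u i + v i) / (K + 1)"
    and \<mu>: "\<mu> = K * (K + 1) / \<alpha>" and q: "2 * \<mu> * ip n w p (\<lambda>i. y i - x i) < (nrm p)\<^sup>2"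
    and q12: "nrm p \<le> 12 * ip n w p (\<lambda>i. y i - x i)" and \<gamma>: "\<gamma> = \<mu> * ip n w p (\<lambda>i. y i - x i) / (nrm p)\<^sup>2"
  shows "0 \<le> \<gamma>" "\<gamma> \<le> 1" "pot z (\<alpha> * (1 + \<gamma> / K)) (\<lambda>i. ((1 - \<gamma>) * K * u i + \<gamma> * (K + 1) * x i) / (K + \<gamma>)) (\<lambda>i. v i - \<gamma> * (\<alpha> / K) * p i)
     \<le> pot z \<alpha> u v - (K + 1)\<^sup>2 / 288"
proof -
  let ?q = "ip n w p (\<lambda>i. y i - x i)"
  have K: "0 < K" "K + 1 \<noteq> 0" using assms(5) by linarith+
  have \<mu>p: "0 < \<mu>" unfolding \<mu> using K assms(5,6) by simp
  have q0: "0 \<le> ?q" using q12 nrm_nonneg[of p] by linarith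
  have N: "0 < (nrm p)\<^sup>2" using q q0 \<mu>p by (smt (verit) mult_nonneg_nonneg)
  show g0: "0 \<le> \<gamma>" unfolding \<gamma> using \<mu>p q0 by simp
  have "\<mu> * ?q \<le> 2 * \<mu> * ?q" using \<mu>p q0 by simp
  then have "\<mu> * ?q \<le> (nrm p)\<^sup>2" using q by linarith
  then show g1: "\<gamma> \<le> 1" unfolding \<gamma> using N by simp
  have gN: "\<gamma> * (nrm p)\<^sup>2 = \<mu> * ?q" unfolding \<gamma> using N by simp
  have "(\<gamma> * (\<alpha> / K))\<^sup>2 * (nrm p)\<^sup>2 / 2 = \<gamma> * (\<alpha> / K)\<^sup>2 * (\<gamma> * (nrm p)\<^sup>2) / 2"
    by (simp add: power2_eq_square)
  also have "\<dots> = \<gamma> * (\<alpha> * (K + 1) / K) * ?q / 2"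
    unfolding gN unfolding \<mu> using K assms(6) by (simp add: power2_eq_square field_simps)
  finally have 1: "(\<gamma> * (\<alpha> / K))\<^sup>2 * (nrm p)\<^sup>2 / 2 = \<gamma> * (\<alpha> * (K + 1) / K) * ?q / 2" .
  have "\<mu> * (\<alpha> * (K + 1) / K) = (K + 1)\<^sup>2"
    unfolding \<mu> using K assms(6) by (simp add: power2_eq_square)
  then have "\<gamma> * (\<alpha> * (K + 1) / K) * ?q = (K + 1)\<^sup>2 * (?q\<^sup>2 / (nrm p)\<^sup>2)"
  proof -
    have "\<mu> * ?q / N * X * ?q = \<mu> * X * (?q\<^sup>2 / N)" for N X
      by (simp add: power2_eq_square)
    then show "\<gamma> * (\<alpha> * (K + 1) / K) * ?q = (K + 1)\<^sup>2 * (?q\<^sup>2 / (nrm p)\<^sup>2)"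
      unfolding \<gamma> \<open>\<mu> * (\<alpha> * (K + 1) / K) = (K + 1)\<^sup>2\<close>[symmetric] by (simp only:)
  qed
  moreover have "(nrm p)\<^sup>2 \<le> (12 * ?q)\<^sup>2" using q12 by (intro power_mono) auto
  then have "1 / 144 \<le> ?q\<^sup>2 / (nrm p)\<^sup>2" using N by (simp add: field_simps power_mult_distrib)
  then have "(K + 1)\<^sup>2 * (1 / 144) \<le> (K + 1)\<^sup>2 * (?q\<^sup>2 / (nrm p)\<^sup>2)" by (intro mult_left_mono) auto
  ultimately have "(K + 1)\<^sup>2 / 144 \<le> \<gamma> * (\<alpha> * (K + 1) / K) * ?q" by simp
  define Z where "Z = \<gamma> * (\<alpha> * (K + 1) / K) * ?q"
  have "(K + 1)\<^sup>2 / 144 \<le> Z" unfolding Z_def by fact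
  then have "pot z \<alpha> u v - Z + Z / 2 \<le> pot z \<alpha> u v - (K + 1)\<^sup>2 / 288" by linarith
  then show "pot z (\<alpha> * (1 + \<gamma> / K)) (\<lambda>i. ((1 - \<gamma>) * K * u i + \<gamma> * (K + 1) * x i) / (K + \<gamma>)) (\<lambda>i. v i - \<gamma> * (\<alpha> / K) * p i)
     \<le> pot z \<alpha> u v - (K + 1)\<^sup>2 / 288"
    using pot_step[OF assms(1-6) g0 g1 assms(7,8)] unfolding 1 Z_def by (rule order.trans[rotated])
qed

end

section \<open>Path following with a logarithmic barrier\<close>

lemma le_of_square_le: "a * a \<le> c * a \<Longrightarrow> 0 \<le> a \<Longrightarrow> 0 \<le> c \<Longrightarrow> a \<le> c" for a c :: real
  by (cases "a = 0") auto

locale barrier_problem =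
  fixes n :: nat and S :: "(nat \<Rightarrow> real) set" and b :: "nat \<Rightarrow> real"
  assumes S_lin: "u \<in> S \<Longrightarrow> v \<in> S \<Longrightarrow> (\<lambda>i. a * u i + c * v i) \<in> S"
    and solvable: "\<forall>i<n. 0 < D i \<Longrightarrow> \<exists>h\<in>S. \<forall>z\<in>S. ip n D h z = (\<Sum>i<n. r i * z i)"
    and n_pos: "1 \<le> n"
begin

definition feas :: "real \<Rightarrow> (nat \<Rightarrow> real) \<Rightarrow> bool" where
  "feas t u \<longleftrightarrow> (\<forall>i<n. \<bar>u i - b i\<bar> < t)"

text \<open>The Hessian of the barrier \<open>- \<Sum> (ln (t - r_i) + ln (t + r_i))\<close> in the
  residuals \<open>r_i\<close>. The level \<open>t\<close> is a parameter that is lowered between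
  Newton steps, so the iterates follow the analytic centres of the level sets.\<close>

definition bwt :: "real \<Rightarrow> (nat \<Rightarrow> real) \<Rightarrow> nat \<Rightarrow> real" where
  "bwt t u i = (1 / (t - (u i - b i)))\<^sup>2 + (1 / (t + (u i - b i)))\<^sup>2"

definition is_step :: "real \<Rightarrow> (nat \<Rightarrow> real) \<Rightarrow> (nat \<Rightarrow> real) \<Rightarrow> bool" where
  "is_step t u h \<longleftrightarrow> h \<in> S \<and> (\<forall>z\<in>S. ip n (bwt t u) h z =
     (\<Sum>i<n. (1 / (t + (u i - b i)) - 1 / (t - (u i - b i))) * z i))"

definition centered :: "real \<Rightarrow> real \<Rightarrow> (nat \<Rightarrow> real) \<Rightarrow> bool" where
  "centered c t u \<longleftrightarrow> (\<forall>h. is_step t u h \<longrightarrow> sqrt (ip n (bwt t u) h h) \<le> c)"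

lemma feasD: "feas t u \<Longrightarrow> i < n \<Longrightarrow> 0 < t - (u i - b i) \<and> 0 < t + (u i - b i)"
  unfolding feas_def by (auto simp: abs_less_iff)

lemma bwt_pos: "feas t u \<Longrightarrow> \<forall>i<n. 0 < bwt t u i"
  using feasD unfolding bwt_def by (auto intro!: add_pos_pos zero_less_power)

lemma bwt_nonneg: "\<forall>i<n. 0 \<le> bwt t u i"
  by (auto simp: bwt_def)

lemma ex_step: "feas t u \<Longrightarrow> \<exists>h. is_step t u h"
  using solvable[OF bwt_pos, of t u "\<lambda>i. 1 / (t + (u i - b i)) - 1 / (t - (u i - b i))"]
  unfolding is_step_def by blast

lemma coord_le: "i < n \<Longrightarrow> sqrt (bwt t u i) * \<bar>h i\<bar> \<le> sqrt (ip n (bwt t u) h h)"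
proof -
  assume "i < n"
  then have "bwt t u i * h i * h i \<le> ip n (bwt t u) h h"
    unfolding ip_def using bwt_nonneg by (intro member_le_sum) (auto simp: mult.assoc)
  then have "sqrt (bwt t u i * (h i * h i)) \<le> sqrt (ip n (bwt t u) h h)" by (simp add: mult.assoc)
  then show ?thesis by (simp add: real_sqrt_mult)
qed

lemma inv_le_sqrt_bwt:
  "feas t u \<Longrightarrow> i < n \<Longrightarrow> 1 / (t - (u i - b i)) \<le> sqrt (bwt t u i)"
  "feas t u \<Longrightarrow> i < n \<Longrightarrow> 1 / (t + (u i - b i)) \<le> sqrt (bwt t u i)"
  unfolding bwt_def by (intro real_le_rsqrt; simp)+

text \<open>A decrement of 1/4 means that no slack changes by more than a quarter. After the step
  the residual consists of second-order remainders of reciprocal slacks, and bounding one of the two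
  relative changes in each by 1/4 leaves a quarter of the old decrement.\<close>

lemma barrier_newton:
  assumes f: "feas t u" and h: "is_step t u h" and c: "centered (1 / 4) t u"
  shows "feas t (\<lambda>i. u i + h i)" "centered (1 / 16) t (\<lambda>i. u i + h i)"
proof -
  let ?u = "\<lambda>i. u i + h i"
  let ?p = "\<lambda>i. t - (u i - b i)" and ?m = "\<lambda>i. t + (u i - b i)"
  let ?\<nu> = "sqrt (ip n (bwt t u) h h)"
  have \<nu>: "?\<nu> \<le> 1 / 4" using h c by (auto simp: centered_def)
  have pm: "0 < ?p i" "0 < ?m i" if "i < n" for i using feasD[OF f that] by auto
  have hp: "\<bar>h i\<bar> \<le> ?p i / 4" "\<bar>h i\<bar> \<le> ?m i / 4" if i: "i < n" for i
  proof -
    have "1 / ?p i * \<bar>h i\<bar> \<le> sqrt (bwt t u i) * \<bar>h i\<bar>" "1 / ?m i * \<bar>h i\<bar> \<le> sqrt (bwt t u i) * \<bar>h i\<bar>"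
      using inv_le_sqrt_bwt[OF f i] by (intro mult_right_mono; simp)+
    then have "1 / ?p i * \<bar>h i\<bar> \<le> 1 / 4" "1 / ?m i * \<bar>h i\<bar> \<le> 1 / 4"
      using coord_le[OF i, of t u h] \<nu> by linarith+
    then show "\<bar>h i\<bar> \<le> ?p i / 4" "\<bar>h i\<bar> \<le> ?m i / 4" using pm[OF i] by (auto simp: field_simps)
  qed
  show f': "feas t ?u"
    unfolding feas_def
  proof (intro allI impI)
    fix i assume i: "i < n"
    show "\<bar>?u i - b i\<bar> < t" using hp[OF i] pm[OF i] by (auto simp: abs_less_iff abs_le_iff)
  qed
  show "centered (1 / 16) t ?u"
    unfolding centered_def
  proof (intro allI impI)
    fix h2 assume h2: "is_step t ?u h2"
    let ?\<nu>2 = "sqrt (ip n (bwt t ?u) h2 h2)"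
    have h2S: "h2 \<in> S" using h2 by (simp add: is_step_def)
    let ?p' = "\<lambda>i. t - (?u i - b i)" and ?m' = "\<lambda>i. t + (?u i - b i)"
    have "ip n (bwt t ?u) h2 h2 = (\<Sum>i<n. (1 / ?m' i - 1 / ?p' i) * h2 i)"
      using h2 h2S by (auto simp: is_step_def)
    also have "\<dots> = (\<Sum>i<n. (1 / ?m' i - 1 / ?p' i) * h2 i) - (\<Sum>i<n. (1 / ?m i - 1 / ?p i) * h2 i) + ip n (bwt t u) h h2"
      using h h2S by (auto simp: is_step_def)
    also have "\<dots> = (\<Sum>i<n. ((1 / ?m' i - 1 / ?p' i) - (1 / ?m i - 1 / ?p i) + bwt t u i * h i) * h2 i)"
      unfolding ip_def sum_subtractf[symmetric] sum.distrib[symmetric] by (intro sum.cong) (auto simp: algebra_simps)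
    also have "\<dots> \<le> (\<Sum>i<n. 1 / 4 * ((sqrt (bwt t u i) * \<bar>h i\<bar>) * (sqrt (bwt t ?u i) * \<bar>h2 i\<bar>)))"
    proof (rule sum_mono)
      fix i assume "i \<in> {..<n}"
      then have i: "i < n" by simp
      define p m p' m' x where "p = ?p i" and "m = ?m i" and "p' = ?p' i" and "m' = ?m' i" and "x = h i"
      have pos: "0 < p" "0 < m" "0 < p'" "0 < m'" using pm[OF i] feasD[OF f' i] by (auto simp: p_def m_def p'_def m'_def)
      have eq: "p' = p - x" "m' = m + x" by (auto simp: p'_def m'_def p_def m_def x_def)
      have x: "\<bar>x\<bar> \<le> p / 4" "\<bar>x\<bar> \<le> m / 4" using hp[OF i] by (auto simp: p_def m_def x_def)
      \<comment> \<open>The exact second-order remainder of the reciprocal. Its linear terms are the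
        part that the Newton equation removes through \<open>bwt t u i * x\<close>.\<close>
      have id: "1 / (q + e) - 1 / q + e / q\<^sup>2 = (e / q) * (e / q) / (q + e)" if "q \<noteq> 0" "q + e \<noteq> 0" for q e :: real
        using that by (simp add: divide_simps) (simp add: power2_eq_square algebra_simps)
      have id1: "1 / m' - 1 / m + x / m\<^sup>2 = (x / m) * (x / m) / m'"
        using pos id[of m x] unfolding eq by simp
      have id2: "1 / p' - 1 / p - x / p\<^sup>2 = (x / p) * (x / p) / p'"
        using pos id[of p "- x"] unfolding eq by simp
      have "(1 / m' - 1 / p') - (1 / m - 1 / p) + bwt t u i * x = (x / m) * (x / m) / m' - (x / p) * (x / p) / p'"
        unfolding bwt_def p_def[symmetric] m_def[symmetric] id1[symmetric] id2[symmetric]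
        by (simp add: power_one_over algebra_simps power_divide)
      also have "\<bar>\<dots>\<bar> \<le> (\<bar>x\<bar> / m) * (\<bar>x\<bar> / m) / m' + (\<bar>x\<bar> / p) * (\<bar>x\<bar> / p) / p'"
        using pos by (intro order.trans[OF abs_triangle_ineq4]) (simp add: abs_mult)
      also have "\<dots> \<le> 1 / 4 * (\<bar>x\<bar> / m) / m' + 1 / 4 * (\<bar>x\<bar> / p) / p'"
        using pos x by (intro add_mono divide_right_mono mult_right_mono) (auto simp: field_simps)
      also have "\<dots> = 1 / 4 * (\<bar>x\<bar> * ((1 / m) * (1 / m') + (1 / p) * (1 / p')))" by (simp add: algebra_simps)
      \<comment> \<open>Cauchy-Schwarz for the pair of slacks of coordinate \<open>i\<close>, before
        and after the step.\<close>
      also have "(1 / m) * (1 / m') + (1 / p) * (1 / p') \<le> sqrt (bwt t u i) * sqrt (bwt t ?u i)"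
      proof -
        have "((1 / m) * (1 / m') + (1 / p) * (1 / p'))\<^sup>2 \<le> ((1 / p)\<^sup>2 + (1 / m)\<^sup>2) * ((1 / p')\<^sup>2 + (1 / m')\<^sup>2)"
          using zero_le_power2[of "(1 / m) * (1 / p') - (1 / p) * (1 / m')"] by (simp add: power2_eq_square algebra_simps)
        then show ?thesis
          unfolding bwt_def p_def[symmetric] m_def[symmetric] p'_def[symmetric] m'_def[symmetric] real_sqrt_mult[symmetric]
          by (rule real_le_rsqrt)
      qed
      finally have c1: "\<bar>(1 / m' - 1 / p') - (1 / m - 1 / p) + bwt t u i * x\<bar> * \<bar>h2 i\<bar> \<le>
         1 / 4 * (\<bar>x\<bar> * (sqrt (bwt t u i) * sqrt (bwt t ?u i))) * \<bar>h2 i\<bar>"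
        by (intro mult_right_mono) (auto simp: mult_left_mono)
      have c2: "((1 / m' - 1 / p') - (1 / m - 1 / p) + bwt t u i * x) * h2 i \<le>
          \<bar>(1 / m' - 1 / p') - (1 / m - 1 / p) + bwt t u i * x\<bar> * \<bar>h2 i\<bar>"
        by (metis abs_ge_self abs_mult)
      have F: "((1 / m' - 1 / p') - (1 / m - 1 / p) + bwt t u i * x) * h2 i \<le>
         1 / 4 * ((sqrt (bwt t u i) * \<bar>x\<bar>) * (sqrt (bwt t ?u i) * \<bar>h2 i\<bar>))"
        by (rule order.trans[OF order.trans[OF c2 c1]]) (simp add: mult_ac)
      show "((1 / ?m' i - 1 / ?p' i) - (1 / ?m i - 1 / ?p i) + bwt t u i * h i) * h2 i \<le>
         1 / 4 * ((sqrt (bwt t u i) * \<bar>h i\<bar>) * (sqrt (bwt t ?u i) * \<bar>h2 i\<bar>))"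
        by (rule F[unfolded p_def m_def p'_def m'_def x_def])
    qed
    also have "\<dots> = 1 / 4 * (\<Sum>i<n. (sqrt (bwt t u i) * \<bar>h i\<bar>) * (sqrt (bwt t ?u i) * \<bar>h2 i\<bar>))"
      by (simp add: sum_distrib_left)
    also have "\<dots> \<le> 1 / 4 * (?\<nu> * ?\<nu>2)"
    proof (intro mult_left_mono)
      have e: "(\<Sum>i<n. (sqrt (bwt t u i) * \<bar>h i\<bar>)\<^sup>2) = ip n (bwt t u) h h" for u h
        unfolding ip_def using bwt_nonneg by (intro sum.cong) (auto simp: power_mult_distrib power2_eq_square mult_ac)
      have "(\<Sum>i<n. (sqrt (bwt t u i) * \<bar>h i\<bar>) * (sqrt (bwt t ?u i) * \<bar>h2 i\<bar>))\<^sup>2 \<le> ip n (bwt t u) h h * ip n (bwt t ?u) h2 h2"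
        using Cauchy_Schwarz_ineq_sum[of "\<lambda>i. sqrt (bwt t u i) * \<bar>h i\<bar>" "\<lambda>i. sqrt (bwt t ?u i) * \<bar>h2 i\<bar>" "{..<n}"]
        unfolding e .
      then show "(\<Sum>i<n. (sqrt (bwt t u i) * \<bar>h i\<bar>) * (sqrt (bwt t ?u i) * \<bar>h2 i\<bar>)) \<le> ?\<nu> * ?\<nu>2"
        unfolding real_sqrt_mult[symmetric] by (rule real_le_rsqrt)
    qed simp
    also have "\<dots> \<le> 1 / 4 * (1 / 4 * ?\<nu>2)"
      using \<nu> ip_nonneg[OF bwt_nonneg, of t ?u h2] by (intro mult_left_mono mult_right_mono) auto
    finally have "?\<nu>2 * ?\<nu>2 \<le> 1 / 16 * ?\<nu>2"
      using ip_nonneg[OF bwt_nonneg, of t ?u h2] by simp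
    then show "?\<nu>2 \<le> 1 / 16"
      by (rule le_of_square_le) (use ip_nonneg[OF bwt_nonneg, of t ?u h2] in auto)
  qed
qed

text \<open>All slacks at the old level are at least \<open>t - r\<close>, so this decrease changes
  each reciprocal slack by at most \<open>1 / (16 n)\<close> of its new value. Over
  \<open>2 n\<close> slacks that adds 1/8 to the old decrement 1/16.\<close>

lemma barrier_shift:
  assumes f: "feas t u" and c: "centered (1 / 16) t u" and r: "\<And>i. i < n \<Longrightarrow> \<bar>u i - b i\<bar> \<le> r" "r < t"
    and t': "t' = t - (t - r) / (16 * real n)"
  shows "feas t' u" "centered (1 / 4) t' u"
proof -
  define \<delta> where "\<delta> = (t - r) / (16 * real n)"
  have n0: "0 < real n" using n_pos by simp
  have d0: "0 < \<delta>" unfolding \<delta>_def using r n0 by simp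
  have d1: "16 * real n * \<delta> = t - r" unfolding \<delta>_def using n0 by simp
  have "\<delta> \<le> 16 * real n * \<delta>" using d0 n_pos by (simp add: mult_le_cancel_right1)
  moreover have "2 * \<delta> \<le> 16 * real n * \<delta>" using d0 n_pos by (intro mult_right_mono) auto
  ultimately have d2: "2 * \<delta> \<le> t - r" using d1 by linarith
  have tt: "t' = t - \<delta>" by (simp add: t' \<delta>_def)
  show f': "feas t' u" unfolding feas_def tt using r d2 d0 by fastforce
  show "centered (1 / 4) t' u"
    unfolding centered_def
  proof (intro allI impI)
    fix h2 assume h2: "is_step t' u h2"
    let ?\<nu>2 = "sqrt (ip n (bwt t' u) h2 h2)"
    have h2S: "h2 \<in> S" using h2 by (simp add: is_step_def)
    obtain h where h: "is_step t u h" using ex_step[OF f] by blast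
    have \<nu>: "sqrt (ip n (bwt t u) h h) \<le> 1 / 16" using c h by (auto simp: centered_def)
    let ?p = "\<lambda>i. t - (u i - b i)" and ?m = "\<lambda>i. t + (u i - b i)"
    let ?p' = "\<lambda>i. t' - (u i - b i)" and ?m' = "\<lambda>i. t' + (u i - b i)"
    have "ip n (bwt t' u) h2 h2 = (\<Sum>i<n. (1 / ?m' i - 1 / ?p' i) * h2 i)"
      using h2 h2S by (auto simp: is_step_def)
    also have "\<dots> = (\<Sum>i<n. (1 / ?m' i - 1 / ?p' i) * h2 i) - (\<Sum>i<n. (1 / ?m i - 1 / ?p i) * h2 i) + ip n (bwt t u) h h2"
      using h h2S by (auto simp: is_step_def)
    also have "\<dots> = (\<Sum>i<n. ((1 / ?m' i - 1 / ?p' i) - (1 / ?m i - 1 / ?p i)) * h2 i) + ip n (bwt t u) h h2"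
      unfolding sum_subtractf[symmetric] by (simp add: algebra_simps)
    also have "\<dots> \<le> (\<Sum>i<n. 1 / (8 * real n) * ?\<nu>2) + 1 / 16 * ?\<nu>2"
    proof (rule add_mono)
      show "(\<Sum>i<n. ((1 / ?m' i - 1 / ?p' i) - (1 / ?m i - 1 / ?p i)) * h2 i) \<le> (\<Sum>i<n. 1 / (8 * real n) * ?\<nu>2)"
      proof (rule sum_mono)
        fix i assume "i \<in> {..<n}"
        then have i: "i < n" by simp
        define p m p' m' where "p = ?p i" and "m = ?m i" and "p' = ?p' i" and "m' = ?m' i"
        have pos: "0 < p" "0 < m" "0 < p'" "0 < m'" using feasD[OF f i] feasD[OF f' i] by (auto simp: p_def m_def p'_def m'_def)
        have eq: "p' = p - \<delta>" "m' = m - \<delta>" by (auto simp: p'_def m'_def p_def m_def tt)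
        have dp: "16 * real n * \<delta> \<le> p" "16 * real n * \<delta> \<le> m"
          using r(1)[OF i] unfolding d1 p_def m_def by (auto simp: abs_le_iff)
        have b1: "0 \<le> 1 / q' - 1 / q \<and> 1 / q' - 1 / q \<le> 1 / (16 * real n) * (1 / q')" if "0 < q" "0 < q'" "q' = q - \<delta>" "16 * real n * \<delta> \<le> q" for q q'
        proof -
          have "1 / q' - 1 / q = (\<delta> / q) * (1 / q')" using that by (simp add: field_simps)
          moreover have "\<delta> / q \<le> 1 / (16 * real n)" using that n0 by (simp add: field_simps)
          then have "(\<delta> / q) * (1 / q') \<le> 1 / (16 * real n) * (1 / q')" using that by (intro mult_right_mono) auto
          moreover have "0 \<le> (\<delta> / q) * (1 / q')" using that d0 by simp
          ultimately show ?thesis by simp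
        qed
        have "\<bar>(1 / m' - 1 / p') - (1 / m - 1 / p)\<bar> \<le> 1 / (16 * real n) * (1 / m') + 1 / (16 * real n) * (1 / p')"
          using b1[of m m'] b1[of p p'] pos eq dp by (auto simp: abs_le_iff)
        also have "\<dots> \<le> 1 / (16 * real n) * sqrt (bwt t' u i) + 1 / (16 * real n) * sqrt (bwt t' u i)"
          using inv_le_sqrt_bwt[OF f' i] n0 unfolding p'_def m'_def by (intro add_mono mult_left_mono) auto
        also have "\<dots> = 1 / (8 * real n) * sqrt (bwt t' u i)" by simp
        finally have "\<bar>(1 / m' - 1 / p') - (1 / m - 1 / p)\<bar> * \<bar>h2 i\<bar> \<le> 1 / (8 * real n) * sqrt (bwt t' u i) * \<bar>h2 i\<bar>"
          by (rule mult_right_mono) simp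
        also have "\<dots> \<le> 1 / (8 * real n) * ?\<nu>2"
          using coord_le[OF i, of t' u h2] n0 by (simp only: mult.assoc) (intro mult_left_mono, auto)
        finally have "\<bar>((1 / m' - 1 / p') - (1 / m - 1 / p)) * h2 i\<bar> \<le> 1 / (8 * real n) * ?\<nu>2" by (simp only: abs_mult)
        then show "((1 / ?m' i - 1 / ?p' i) - (1 / ?m i - 1 / ?p i)) * h2 i \<le> 1 / (8 * real n) * ?\<nu>2"
          unfolding p_def m_def p'_def m'_def by linarith
      qed
      have "ip n (bwt t u) h h2 \<le> sqrt (ip n (bwt t u) h h) * sqrt (ip n (bwt t u) h2 h2)"
        using ip_CS_sqrt[OF bwt_nonneg, of t u h h2] by linarith
      also have "\<dots> \<le> 1 / 16 * ?\<nu>2"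
      proof (intro mult_mono \<nu>)
        have "ip n (bwt t u) h2 h2 \<le> ip n (bwt t' u) h2 h2"
          unfolding ip_def
        proof (rule sum_mono)
          fix i assume "i \<in> {..<n}"
          then have i: "i < n" by simp
          have "bwt t u i \<le> bwt t' u i"
            unfolding bwt_def using feasD[OF f' i] feasD[OF f i] d0 tt
            by (intro add_mono power_mono divide_left_mono) auto
          then have "bwt t u i * (h2 i * h2 i) \<le> bwt t' u i * (h2 i * h2 i)" by (rule mult_right_mono) simp
          then show "bwt t u i * h2 i * h2 i \<le> bwt t' u i * h2 i * h2 i" by (simp add: mult.assoc)
        qed
        then show "sqrt (ip n (bwt t u) h2 h2) \<le> ?\<nu>2" by simp
      qed (use ip_nonneg[OF bwt_nonneg] in auto)
      finally show "ip n (bwt t u) h h2 \<le> 1 / 16 * ?\<nu>2" .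
    qed
    also have "\<dots> = 3 / 16 * ?\<nu>2" using n0 by simp
    finally have "?\<nu>2 * ?\<nu>2 \<le> 3 / 16 * ?\<nu>2"
      using ip_nonneg[OF bwt_nonneg, of t' u h2] by simp
    then have "?\<nu>2 \<le> 3 / 16"
      by (rule le_of_square_le) (use ip_nonneg[OF bwt_nonneg, of t' u h2] in auto)
    then show "?\<nu>2 \<le> 1 / 4" by linarith
  qed
qed

text \<open>At an exact analytic centre the ratios of the slacks of \<open>z\<close> to those of
  \<open>u\<close> sum to \<open>2 n\<close>. A decrement of 1/4 perturbs their sum \<open>Q\<close>
  by at most \<open>(2 n + Q) / 4\<close>, so \<open>Q \<le> 4 n\<close>, and \<open>4 n\<close>
  bounds every single ratio.\<close>

lemma barrier_gap:
  assumes f: "feas t u" and c: "centered (1 / 4) t u" and S: "u \<in> S" "z \<in> S"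
    and m: "\<And>i. i < n \<Longrightarrow> \<bar>z i - b i\<bar> \<le> m" and k: "k < n"
  shows "t - m \<le> 4 * real n * (t - \<bar>u k - b k\<bar>)"
proof (cases "m \<le> t")
  case False
  then show ?thesis using f k unfolding feas_def by (smt (verit) mult_nonneg_nonneg of_nat_0_le_iff)
next
  case True
  obtain h where h: "is_step t u h" using ex_step[OF f] by blast
  have \<nu>: "sqrt (ip n (bwt t u) h h) \<le> 1 / 4" using c h by (auto simp: centered_def)
  let ?p = "\<lambda>i. t - (u i - b i)" and ?m = "\<lambda>i. t + (u i - b i)"
  let ?zp = "\<lambda>i. t - (z i - b i)" and ?zm = "\<lambda>i. t + (z i - b i)"
  let ?d = "\<lambda>i. z i - u i"
  have dS: "?d \<in> S" using S_lin[OF S(2,1), of 1 "-1"] by simp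
  define Q where "Q = (\<Sum>i<n. ?zp i / ?p i + ?zm i / ?m i)"
  have pm: "0 < ?p i" "0 < ?m i" if "i < n" for i using feasD[OF f that] by auto
  have zpm: "t - m \<le> ?zp i" "t - m \<le> ?zm i" if "i < n" for i using m[OF that] by (auto simp: abs_le_iff)
  have e1: "?zp i / ?p i = 1 - ?d i / ?p i" "?zm i / ?m i = 1 + ?d i / ?m i" if "i < n" for i
    using pm[OF that] by (auto simp: field_simps)
  have "Q = (\<Sum>i<n. 2 + (1 / ?m i - 1 / ?p i) * ?d i)"
    unfolding Q_def using e1 by (intro sum.cong) (auto simp: algebra_simps)
  also have "\<dots> = 2 * real n + ip n (bwt t u) h ?d"
    using h dS by (auto simp: is_step_def sum.distrib)
  also have "\<dots> \<le> 2 * real n + real n / 2 + Q / 4"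
  proof -
    have "sqrt (ip n (bwt t u) ?d ?d) \<le> 2 * real n + Q"
    proof (rule real_le_lsqrt)
      have zz: "0 \<le> ?zp i / ?p i" "0 \<le> ?zm i / ?m i" if "i < n" for i
        using pm[OF that] zpm[OF that] True by auto
      then show Q0: "0 \<le> 2 * real n + Q" unfolding Q_def by (intro add_nonneg_nonneg sum_nonneg) auto
      have "ip n (bwt t u) ?d ?d = (\<Sum>i<n. (?d i / ?p i)\<^sup>2 + (?d i / ?m i)\<^sup>2)"
        unfolding ip_def bwt_def by (intro sum.cong) (auto simp: power_divide algebra_simps power2_eq_square)
      also have "\<dots> \<le> (\<Sum>i<n. (2 + (?zp i / ?p i + ?zm i / ?m i))\<^sup>2)"
      proof (rule sum_mono)
        fix i assume "i \<in> {..<n}"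
        then have i: "i < n" by simp
        have "0 \<le> 1 - x \<Longrightarrow> \<bar>x\<bar> \<le> 1 + (1 - x)" "0 \<le> 1 + x \<Longrightarrow> \<bar>x\<bar> \<le> 1 + (1 + x)" for x :: real
          by linarith+
        then have "\<bar>?d i / ?p i\<bar> \<le> 1 + ?zp i / ?p i" "\<bar>?d i / ?m i\<bar> \<le> 1 + ?zm i / ?m i"
          using zz[OF i] unfolding e1[OF i] by blast+
        then have "(?d i / ?p i)\<^sup>2 \<le> (1 + ?zp i / ?p i)\<^sup>2" "(?d i / ?m i)\<^sup>2 \<le> (1 + ?zm i / ?m i)\<^sup>2"
          by (metis abs_ge_zero power2_abs power_mono)+
        moreover have "(1 + a)\<^sup>2 + (1 + c)\<^sup>2 \<le> (2 + (a + c))\<^sup>2" if "0 \<le> a" "0 \<le> c" for a c :: real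
          using that by (simp add: power2_eq_square algebra_simps)
        ultimately show "(?d i / ?p i)\<^sup>2 + (?d i / ?m i)\<^sup>2 \<le> (2 + (?zp i / ?p i + ?zm i / ?m i))\<^sup>2"
          using zz[OF i] by (smt (verit))
      qed
      also have "\<dots> \<le> (\<Sum>i<n. 2 + (?zp i / ?p i + ?zm i / ?m i))\<^sup>2"
      proof -
        have sqs: "(\<Sum>i<k. (g i)\<^sup>2) \<le> (\<Sum>i<k. g i)\<^sup>2" if "\<And>i. i < k \<Longrightarrow> 0 \<le> g i" for k :: nat and g :: "nat \<Rightarrow> real"
          using that
        proof (induction k)
          case (Suc k)
          have "0 \<le> (\<Sum>i<k. g i)" using Suc.prems by (intro sum_nonneg) auto
          then have "0 \<le> 2 * (\<Sum>i<k. g i) * g k" using Suc.prems[of k] by simp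
          then show ?case
            using Suc.IH Suc.prems unfolding sum.lessThan_Suc power2_sum by (smt (verit) less_Suc_eq)
        qed simp
        show ?thesis by (rule sqs) (use zz in \<open>auto intro!: add_nonneg_nonneg\<close>)
      qed
      also have "(\<Sum>i<n. 2 + (?zp i / ?p i + ?zm i / ?m i)) = 2 * real n + Q"
        unfolding Q_def by (simp add: sum.distrib)
      finally show "ip n (bwt t u) ?d ?d \<le> (2 * real n + Q)\<^sup>2" .
    qed
    have g1: "ip n (bwt t u) h ?d \<le> sqrt (ip n (bwt t u) h h) * sqrt (ip n (bwt t u) ?d ?d)"
      using ip_CS_sqrt[OF bwt_nonneg, of t u h ?d] by linarith
    have g2: "sqrt (ip n (bwt t u) h h) * sqrt (ip n (bwt t u) ?d ?d) \<le> 1 / 4 * sqrt (ip n (bwt t u) ?d ?d)"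
      using \<nu> ip_nonneg[OF bwt_nonneg, of t u ?d] by (intro mult_right_mono) auto
    have "ip n (bwt t u) h ?d \<le> 1 / 4 * sqrt (ip n (bwt t u) ?d ?d)" by (rule order.trans[OF g1 g2])
    then show ?thesis using \<open>sqrt (ip n (bwt t u) ?d ?d) \<le> 2 * real n + Q\<close> by linarith
  qed
  finally have Q4: "Q \<le> 4 * real n" by linarith
  have tk: "?zp k / ?p k + ?zm k / ?m k \<le> Q"
  proof -
    have "0 \<le> ?zp i / ?p i + ?zm i / ?m i" if i: "i < n" for i
    proof -
      have "0 \<le> ?zp i" "0 \<le> ?zm i" using zpm[OF i] True by linarith+
      then have "0 \<le> ?zp i / ?p i" "0 \<le> ?zm i / ?m i" using pm[OF i] by (auto intro: divide_nonneg_pos)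
      then show ?thesis by linarith
    qed
    then show ?thesis unfolding Q_def using k
      by (intro member_le_sum[where f = "\<lambda>i. ?zp i / ?p i + ?zm i / ?m i"]) auto
  qed
  have zk: "0 \<le> ?zp k / ?p k" "0 \<le> ?zm k / ?m k" using zpm[OF k] pm[OF k] True by auto
  have "?zp k / ?p k \<le> 4 * real n" "?zm k / ?m k \<le> 4 * real n" using tk Q4 zk by linarith+
  then have "?zp k \<le> 4 * real n * ?p k" "?zm k \<le> 4 * real n * ?m k"
    using pm[OF k] by (auto simp: divide_le_eq)
  then have "t - m \<le> 4 * real n * ?p k" "t - m \<le> 4 * real n * ?m k" using zpm[OF k] by linarith+
  moreover have "t - \<bar>u k - b k\<bar> = ?p k \<or> t - \<bar>u k - b k\<bar> = ?m k" by linarith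
  ultimately show ?thesis by (elim disjE) (simp_all only:)
qed

text \<open>The least squares residual is orthogonal to the column space, so the part of the barrier
  gradient that is linear in it drops out and a cubic remainder is left. At
  \<open>t = 8 n \<rho>\<close> the remainders add up to a decrement of at most 1/128.\<close>

lemma barrier_start:
  assumes u: "\<forall>z\<in>S. (\<Sum>i<n. (u i - b i) * z i) = 0" and r: "\<And>i. i < n \<Longrightarrow> \<bar>u i - b i\<bar> \<le> \<rho>" "0 < \<rho>"
    and t: "t = 8 * real n * \<rho>"
  shows "feas t u" "centered (1 / 4) t u"
proof -
  have n0: "1 \<le> real n" using n_pos by simp
  have t8: "8 * \<rho> \<le> t" unfolding t using n0 r(2) by (intro mult_right_mono) auto
  have t0: "0 < t" using t8 r(2) by linarith
  show f: "feas t u" unfolding feas_def using r t8 by fastforce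
  show "centered (1 / 4) t u"
    unfolding centered_def
  proof (intro allI impI)
    fix h assume h: "is_step t u h"
    let ?\<nu> = "sqrt (ip n (bwt t u) h h)"
    have hS: "h \<in> S" using h by (simp add: is_step_def)
    let ?r = "\<lambda>i. u i - b i"
    have "ip n (bwt t u) h h = (\<Sum>i<n. (1 / (t + ?r i) - 1 / (t - ?r i)) * h i) + 2 / t\<^sup>2 * (\<Sum>i<n. ?r i * h i)"
      using h hS u by (auto simp: is_step_def)
    also have "\<dots> = (\<Sum>i<n. ((1 / (t + ?r i) - 1 / (t - ?r i)) + 2 / t\<^sup>2 * ?r i) * h i)"
      unfolding sum_distrib_left sum.distrib[symmetric] by (intro sum.cong refl) (simp only: distrib_right mult.assoc)
    also have "\<dots> \<le> (\<Sum>i<n. 4 * \<rho>^3 / t^3 * ?\<nu>)"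
    proof (rule sum_mono)
      fix i assume "i \<in> {..<n}"
      then have i: "i < n" by simp
      define x where "x = ?r i"
      have x: "\<bar>x\<bar> \<le> \<rho>" using r(1)[OF i] by (simp add: x_def)
      have pos: "0 < t + x" "0 < t - x" using feasD[OF f i] by (auto simp: x_def)
      have x2: "x\<^sup>2 \<le> t\<^sup>2 / 2"
      proof -
        have "\<bar>x\<bar>\<^sup>2 \<le> (t / 8)\<^sup>2" using x t8 by (intro power_mono) auto
        then have "x\<^sup>2 \<le> t\<^sup>2 / 64" by (simp add: power_divide)
        then show ?thesis using zero_le_power2[of x] by linarith
      qed
      have "(1 / (t + x) - 1 / (t - x)) + 2 / t\<^sup>2 * x = - (2 * x ^ 3 / (t\<^sup>2 * (t\<^sup>2 - x\<^sup>2)))"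
      proof -
        have tx: "t\<^sup>2 - x\<^sup>2 = (t + x) * (t - x)" by (simp add: power2_eq_square algebra_simps)
        then have ne: "t\<^sup>2 - x\<^sup>2 \<noteq> 0" using pos by simp
        have "1 / (t + x) - 1 / (t - x) = - (2 * x) / (t\<^sup>2 - x\<^sup>2)" unfolding tx using pos by (simp add: field_simps)
        moreover have "- (2 * x) / (t\<^sup>2 - x\<^sup>2) + 2 / t\<^sup>2 * x = - (2 * x ^ 3 / (t\<^sup>2 * (t\<^sup>2 - x\<^sup>2)))"
          using ne t0 by (simp add: divide_simps) (simp add: power2_eq_square power3_eq_cube algebra_simps)
        ultimately show ?thesis by simp
      qed
      moreover have "0 \<le> t\<^sup>2 - x\<^sup>2" using x2 zero_le_power2[of t] by linarith
      ultimately have "\<bar>(1 / (t + x) - 1 / (t - x)) + 2 / t\<^sup>2 * x\<bar> = 2 * \<bar>x\<bar> ^ 3 / (t\<^sup>2 * (t\<^sup>2 - x\<^sup>2))"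
        by (simp add: abs_mult power_abs)
      also have "\<dots> \<le> 2 * \<rho> ^ 3 / (t\<^sup>2 * (t\<^sup>2 / 2))"
        using x x2 t0 r(2) by (intro frac_le mult_left_mono power_mono) auto
      also have "\<dots> = 4 * \<rho> ^ 3 / t ^ 4" using t0 by (simp add: field_simps flip: power_add)
      finally have a: "\<bar>(1 / (t + x) - 1 / (t - x)) + 2 / t\<^sup>2 * x\<bar> \<le> 4 * \<rho> ^ 3 / t ^ 4" .
      have "1 / t \<le> sqrt (bwt t u i)"
      proof (cases "0 \<le> x")
        case True
        then have "1 / t \<le> 1 / (t - x)" using pos t0 by (intro divide_left_mono) auto
        then show ?thesis using inv_le_sqrt_bwt(1)[OF f i] by (simp add: x_def)
      next
        case False
        then have "1 / t \<le> 1 / (t + x)" using pos t0 by (intro divide_left_mono) auto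
        then show ?thesis using inv_le_sqrt_bwt(2)[OF f i] by (simp add: x_def)
      qed
      then have "1 / t * \<bar>h i\<bar> \<le> sqrt (bwt t u i) * \<bar>h i\<bar>" by (intro mult_right_mono) auto
      then have "1 / t * \<bar>h i\<bar> \<le> ?\<nu>" using coord_le[OF i, of t u h] by linarith
      then have hb: "\<bar>h i\<bar> \<le> t * ?\<nu>" using t0 by (simp add: field_simps)
      have "((1 / (t + x) - 1 / (t - x)) + 2 / t\<^sup>2 * x) * h i \<le> \<bar>(1 / (t + x) - 1 / (t - x)) + 2 / t\<^sup>2 * x\<bar> * \<bar>h i\<bar>"
        by (metis abs_ge_self abs_mult)
      also have "\<dots> \<le> 4 * \<rho> ^ 3 / t ^ 4 * (t * ?\<nu>)"
        using a hb r(2) t0 by (intro mult_mono) auto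
      also have "\<dots> = 4 * \<rho>^3 / t^3 * ?\<nu>" using t0 by (simp add: power4_eq_xxxx power3_eq_cube)
      finally show "((1 / (t + ?r i) - 1 / (t - ?r i)) + 2 / t\<^sup>2 * ?r i) * h i \<le> 4 * \<rho>^3 / t^3 * ?\<nu>"
        by (simp add: x_def)
    qed
    also have "\<dots> = real n * (4 * \<rho>^3 / t^3) * ?\<nu>" by simp
    also have "\<dots> \<le> 1 / 4 * ?\<nu>"
    proof (rule mult_right_mono)
      have "real n * (4 * \<rho>^3 / t^3) = (real n / real n ^ 3) * (1 / 128)"
        unfolding t using r(2) n0 by (simp add: power_mult_distrib)
      also have "\<dots> \<le> 1 * (1 / 128)"
        using n0 by (intro mult_right_mono) (auto simp: divide_le_eq self_le_power)
      finally show "real n * (4 * \<rho>^3 / t^3) \<le> 1 / 4" by simp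
    qed (use ip_nonneg[OF bwt_nonneg] in auto)
    finally have "?\<nu> * ?\<nu> \<le> 1 / 4 * ?\<nu>"
      using ip_nonneg[OF bwt_nonneg, of t u h] by simp
    then show "?\<nu> \<le> 1 / 4"
      by (rule le_of_square_le) (use ip_nonneg[OF bwt_nonneg, of t u h] in auto)
  qed
qed

end

section \<open>Overestimates of the Lewis weights by random sketches\<close>

text \<open>Average over the values \<open>1\<close> and \<open>- 1\<close> of the last \<open>r\<close> of the \<open>n\<close> coordinates.\<close>

primrec avg :: "nat \<Rightarrow> nat \<Rightarrow> ((nat \<Rightarrow> real) \<Rightarrow> real) \<Rightarrow> (nat \<Rightarrow> real) \<Rightarrow> real" where
  "avg n 0 F g = F g"
| "avg n (Suc r) F g = (avg n r F (g(n - Suc r := 1)) + avg n r F (g(n - Suc r := - 1))) / 2"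

lemma avg_mono: "(\<And>g. F g \<le> G g) \<Longrightarrow> avg n r F g \<le> avg n r G g"
  by (induction r arbitrary: g) (auto intro!: divide_right_mono add_mono)

lemma avg_lin: "avg n r (\<lambda>g. a * F g + b * G g) g = a * avg n r F g + b * avg n r G g"
  by (induction r arbitrary: g) (auto simp: field_simps)

lemma avg_const: "avg n r (\<lambda>g. c) g = c"
  by (induction r arbitrary: g) auto

lemma avg_scale: "avg n r (\<lambda>g. a * F g) g = a * avg n r F g"
  using avg_lin[of n r a F 0 F g] by simp

lemma avg_sum: "finite I \<Longrightarrow> avg n r (\<lambda>g. \<Sum>i\<in>I. F i g) g = (\<Sum>i\<in>I. avg n r (F i) g)"
proof (induction I rule: finite_induct)
  case (insert i I)
  then show ?case using avg_lin[of n r 1 "F i" 1 "\<lambda>g. \<Sum>i\<in>I. F i g" g] by simp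
qed (simp add: avg_const)

lemma sum_upd_split:
  fixes p g :: "nat \<Rightarrow> real"
  assumes "Suc r \<le> n"
  shows "(\<Sum>i<n - r. p i * (g(n - Suc r := x)) i) = (\<Sum>i<n - Suc r. p i * g i) + p (n - Suc r) * x"
proof -
  have e: "n - r = Suc (n - Suc r)" using assms by simp
  show ?thesis unfolding e sum.lessThan_Suc by (auto intro!: sum.cong)
qed

lemma sum_tail_split:
  fixes p :: "nat \<Rightarrow> real"
  assumes "Suc r \<le> n"
  shows "(\<Sum>i=n - Suc r..<n. (p i)\<^sup>2) = (p (n - Suc r))\<^sup>2 + (\<Sum>i=n - r..<n. (p i)\<^sup>2)"
  using assms by (subst sum.atLeast_Suc_lessThan) (auto simp: Suc_diff_Suc)

text \<open>The first \<open>n - r\<close> signs are fixed; cross terms with averaged signs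
  cancel.\<close>

lemma avg_square:
  "r \<le> n \<Longrightarrow> avg n r (\<lambda>g. (\<Sum>i<n. p i * g i)\<^sup>2) g = (\<Sum>i<n - r. p i * g i)\<^sup>2 + (\<Sum>i=n - r..<n. (p i)\<^sup>2)"
proof (induction r arbitrary: g)
  case (Suc r)
  have i: "((c + q * 1)\<^sup>2 + s + ((c + q * - 1)\<^sup>2 + s)) / 2 = c\<^sup>2 + (q\<^sup>2 + s)" for c q s :: real
    by (simp add: power2_eq_square algebra_simps)
  have r: "r \<le> n" using Suc.prems by simp
  show ?case
    unfolding avg.simps(2) Suc.IH[OF r] sum_upd_split[OF Suc.prems] sum_tail_split[OF Suc.prems] by (rule i)
qed simp

text \<open>For \<open>r = n\<close> this is the fourth moment bound, with constant 3, of a sum of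
  random signs. The mixed term with factor 6 makes the induction close, with a slack of
  \<open>2 q^4\<close> for each new coefficient \<open>q\<close>.\<close>

lemma avg_fourth:
  "r \<le> n \<Longrightarrow> avg n r (\<lambda>g. (\<Sum>i<n. p i * g i) ^ 4) g \<le> (\<Sum>i<n - r. p i * g i) ^ 4 +
     6 * (\<Sum>i<n - r. p i * g i)\<^sup>2 * (\<Sum>i=n - r..<n. (p i)\<^sup>2) + 3 * (\<Sum>i=n - r..<n. (p i)\<^sup>2)\<^sup>2"
proof (induction r arbitrary: g)
  case (Suc r)
  have i: "((c + q * 1) ^ 4 + 6 * (c + q * 1)\<^sup>2 * s + 3 * s\<^sup>2 + ((c + q * - 1) ^ 4 + 6 * (c + q * - 1)\<^sup>2 * s + 3 * s\<^sup>2)) / 2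
     \<le> c ^ 4 + 6 * c\<^sup>2 * (q\<^sup>2 + s) + 3 * (q\<^sup>2 + s)\<^sup>2" for c q s :: real
  proof -
    have "c ^ 4 + 6 * c\<^sup>2 * (q\<^sup>2 + s) + 3 * (q\<^sup>2 + s)\<^sup>2 -
      ((c + q * 1) ^ 4 + 6 * (c + q * 1)\<^sup>2 * s + 3 * s\<^sup>2 + ((c + q * - 1) ^ 4 + 6 * (c + q * - 1)\<^sup>2 * s + 3 * s\<^sup>2)) / 2 = 2 * (q\<^sup>2)\<^sup>2"
      by (simp add: power2_eq_square power4_eq_xxxx algebra_simps)
    moreover have "0 \<le> 2 * (q\<^sup>2)\<^sup>2" by simp
    ultimately show ?thesis by linarith
  qed
  have r: "r \<le> n" using Suc.prems by simp
  show ?case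
    unfolding avg.simps(2) sum_tail_split[OF Suc.prems]
    by (rule order.trans[OF divide_right_mono[OF add_mono[OF Suc.IH[OF r, of "g(n - Suc r := 1)", unfolded sum_upd_split[OF Suc.prems]]
          Suc.IH[OF r, of "g(n - Suc r := - 1)", unfolded sum_upd_split[OF Suc.prems]]]] i]) simp
qed simp

section \<open>One random reweighting step\<close>

context regression
begin

text \<open>For positive weights this says that the leverage representer of \<open>i\<close>
  satisfies \<open>G i i > 1\<close>: some vector of the weighted unit ball leaves the box at
  coordinate \<open>i\<close>.\<close>

definition bad :: "(nat \<Rightarrow> real) \<Rightarrow> nat \<Rightarrow> bool" where
  "bad w i \<longleftrightarrow> (\<exists>z\<in>colspace. ip n w z z < (z i)\<^sup>2)"

definition badness :: "(nat \<Rightarrow> real) \<Rightarrow> real" where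
  "badness w = (\<Sum>i<n. if bad w i then 1 / w i else 0)"

text \<open>\<open>h\<close> is the weighted projection of the vector with entries
  \<open>g i / sqrt (w i)\<close>; for random signs the second moment of \<open>h i\<close> is
  therefore \<open>G i i\<close>.\<close>

definition sketch :: "(nat \<Rightarrow> real) \<Rightarrow> (nat \<Rightarrow> real) \<Rightarrow> (nat \<Rightarrow> real) \<Rightarrow> bool" where
  "sketch w g h \<longleftrightarrow> h \<in> colspace \<and> (\<forall>u\<in>colspace. ip n w h u = (\<Sum>i<n. g i * sqrt (w i) * u i))"

text \<open>A weight at least doubles once \<open>h i\<close> reaches 1/2 in absolute value.
  Sketches whose squared norm exceeds 16 times its mean \<open>d\<close> are discarded, so the
  growth of the total weight is bounded with certainty and not just on average.\<close>

definition lewis_step :: "(nat \<Rightarrow> real) \<Rightarrow> (nat \<Rightarrow> real) \<Rightarrow> nat \<Rightarrow> real" where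
  "lewis_step w h i = (if 16 * real d < ip n w h h then w i else w i * (1 + 4 * (h i)\<^sup>2))"

lemma lewis_step_ge: "0 \<le> w i \<Longrightarrow> w i \<le> lewis_step w h i"
  by (simp add: lewis_step_def mult_le_cancel_left1)

lemma lewis_step_pos: "\<forall>i<n. 0 < w i \<Longrightarrow> \<forall>i<n. 0 < lewis_step w h i"
  using lewis_step_ge by (meson less_imp_le less_le_trans)

lemma lewis_step_sum: "\<forall>i<n. 0 < w i \<Longrightarrow> (\<Sum>i<n. lewis_step w h i) \<le> (\<Sum>i<n. w i) + 64 * real d"
proof (cases "16 * real d < ip n w h h")
  case False
  then have e: "lewis_step w h i = w i * (1 + 4 * (h i)\<^sup>2)" for i by (simp add: lewis_step_def)
  have "(\<Sum>i<n. lewis_step w h i) = (\<Sum>i<n. w i) + 4 * ip n w h h"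
    unfolding e ip_def sum_distrib_left sum.distrib[symmetric]
    by (intro sum.cong) (auto simp: power2_eq_square algebra_simps)
  then show ?thesis using False by simp
qed (simp add: lewis_step_def)

lemma bad_antimono:
  assumes "\<forall>i<n. 0 < w i" "bad (lewis_step w h) i" shows "bad w i"
proof -
  obtain z where z: "z \<in> colspace" "ip n (lewis_step w h) z z < (z i)\<^sup>2" using assms(2) by (auto simp: bad_def)
  have "ip n w z z \<le> ip n (lewis_step w h) z z"
    unfolding ip_def
  proof (rule sum_mono)
    fix j assume "j \<in> {..<n}"
    then have "w j * (z j * z j) \<le> lewis_step w h j * (z j * z j)"
      using lewis_step_ge[of w j h] assms(1) by (intro mult_right_mono) (auto intro: less_imp_le)
    then show "w j * z j * z j \<le> lewis_step w h j * z j * z j" by (simp add: mult.assoc)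
  qed
  then show ?thesis using z unfolding bad_def by force
qed

text \<open>At a violated coordinate the second moment \<open>l i\<close> of \<open>h i\<close>
  exceeds 1, and the fourth moment is at most \<open>3 (l i)^2\<close>. So \<open>h i\<close> is of
  order \<open>sqrt (l i)\<close> with constant probability, and then the weight doubles. This is a
  Paley-Zygmund argument; as \<open>avg\<close> gives access to moments only, it is carried out with
  a polynomial majorant \<open>F\<close> of the old weight divided by the new one.\<close>

lemma badness_step:
  assumes w: "\<forall>i<n. 0 < w i" and h: "\<And>g. sketch w g (h g)"
  shows "avg n n (\<lambda>g. badness (lewis_step w (h g))) g0 \<le> 15 / 16 * badness w"
proof -
  obtain G where G: "\<And>i. G i \<in> colspace" "\<And>i u. i < n \<Longrightarrow> u \<in> colspace \<Longrightarrow> ip n w (G i) u = u i"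
    "(\<Sum>i<n. w i * G i i) = real d" using leverage_representers[OF w] by blast
  have w0: "\<forall>i<n. 0 \<le> w i" using w by (auto intro: less_imp_le)
  define p where "p i k = sqrt (w k) * G i k" for i k
  have hi: "h g i = (\<Sum>k<n. p i k * g k)" if "i < n" for g i
  proof -
    have "h g i = ip n w (h g) (G i)"
      using G(2)[OF that, of "h g"] h[of g] ip_commute[of n w "h g" "G i"] by (simp add: sketch_def)
    also have "\<dots> = (\<Sum>k<n. p i k * g k)" using h[of g] G(1) by (auto simp: sketch_def p_def mult_ac)
    finally show ?thesis .
  qed
  define l where "l i = G i i" for i
  have pl: "(\<Sum>k<n. (p i k)\<^sup>2) = l i" if "i < n" for i
  proof -
    have "(\<Sum>k<n. (p i k)\<^sup>2) = ip n w (G i) (G i)"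
      unfolding p_def ip_def using w0 by (intro sum.cong) (auto simp: power_mult_distrib power2_eq_square)
    then show ?thesis using G that by (simp add: l_def)
  qed
  have E2: "avg n n (\<lambda>g. (h g i)\<^sup>2) g0 = l i" if "i < n" for i
    using avg_square[of n n "p i" g0] pl[OF that] hi[OF that] by (simp add: lessThan_atLeast0)
  have E4: "avg n n (\<lambda>g. (h g i) ^ 4) g0 \<le> 3 * (l i)\<^sup>2" if "i < n" for i
    using avg_fourth[of n n "p i" g0] pl[OF that] hi[OF that] by (simp add: lessThan_atLeast0)
  have EZ: "avg n n (\<lambda>g. ip n w (h g) (h g)) g0 = real d"
  proof -
    have "avg n n (\<lambda>g. ip n w (h g) (h g)) g0 = avg n n (\<lambda>g. \<Sum>i<n. w i * (h g i)\<^sup>2) g0"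
      by (simp add: ip_def power2_eq_square mult.assoc)
    also have "\<dots> = (\<Sum>i<n. w i * l i)"
      using E2 by (simp add: avg_sum avg_scale)
    finally show ?thesis using G(3) by (simp add: l_def)
  qed
  have d0: "0 < real d" using d_pos by simp
  have coord: "avg n n (\<lambda>g. 1 / lewis_step w (h g) i) g0 \<le> 15 / 16 * (1 / w i)" if i: "i < n" and bad: "bad w i" for i
  proof -
    obtain z where z: "z \<in> colspace" "ip n w z z < (z i)\<^sup>2" using bad by (auto simp: bad_def)
    have "(z i)\<^sup>2 \<le> l i * ip n w z z"
      using ip_CS[OF w0, of "G i" z] G i z(1) by (simp add: l_def)
    then have l1: "1 < l i"
      using z(2) ip_nonneg[OF w0, of z] by (smt (verit) mult_left_le_one_le mult_le_0_iff)
    have wi: "0 < w i" using w i by simp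
    \<comment> \<open>With \<open>Y = (h g i)^2 / l i\<close> and
      \<open>Z = ip n w (h g) (h g) / (16 d)\<close> this is
      \<open>1 - ((Y - 1/4) (7 - Y) / 12 - Z) / 2\<close>. It is at least 1 if
      \<open>Y < 1/4\<close> or \<open>Z \<ge> 1\<close>, and always at least 1/2. Its mean is at
      most \<open>1 - (5/24 - 1/16) / 2 = 89/96\<close>.\<close>
    define F where "F g = 1 * (103 / 96) + 1 * (1 / (32 * real d) * ip n w (h g) (h g) +
       1 * (- (29 / 96) / l i * (h g i)\<^sup>2 + 1 / 24 / (l i)\<^sup>2 * (h g i) ^ 4))" for g
    have "1 / lewis_step w (h g) i \<le> 1 / w i * F g" for g
    proof -
      define Y where "Y = (h g i)\<^sup>2 / l i"
      define Z where "Z = ip n w (h g) (h g) / (16 * real d)"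
      have Y0: "0 \<le> Y" using l1 by (simp add: Y_def)
      have Z0: "0 \<le> Z" using ip_nonneg[OF w0] d0 by (simp add: Z_def)
      have F: "F g = 1 - 1 / 2 * ((Y - 1 / 4) * (7 - Y) / 12 - Z)"
      proof -
        have "1 / 24 / (l i)\<^sup>2 * (h g i) ^ 4 = Y * Y / 24" unfolding Y_def by (simp add: power2_eq_square power4_eq_xxxx)
        moreover have "- (29 / 96) / l i * (h g i)\<^sup>2 = - (29 / 96) * Y" unfolding Y_def by simp
        moreover have "1 / (32 * real d) * ip n w (h g) (h g) = Z / 2" unfolding Z_def by simp
        ultimately show ?thesis unfolding F_def by (simp only:) (simp add: field_simps)
      qed
      have q1: "(Y - 1 / 4) * (7 - Y) \<le> 12"
      proof -
        have "(Y - 1 / 4) * (7 - Y) = 12 - ((Y - 29 / 8)\<^sup>2 + 39 / 64)"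
          by (simp add: power2_eq_square field_simps)
        then show ?thesis using zero_le_power2[of "Y - 29 / 8"] by linarith
      qed
      show ?thesis
      proof (cases "16 * real d < ip n w (h g) (h g)")
        case True
        then have "1 \<le> Z" using d0 by (simp add: Z_def)
        then have "1 \<le> F g" using q1 unfolding F by simp
        then show ?thesis using True wi by (simp add: lewis_step_def field_simps)
      next
        case False
        show ?thesis
        proof (cases "Y < 1 / 4")
          case True
          then have "(Y - 1 / 4) * (7 - Y) \<le> 0" by (intro mult_nonpos_nonneg) auto
          then have "1 \<le> F g" unfolding F using Z0 by simp
          then have "1 / w i * 1 \<le> 1 / w i * F g" using wi by (intro mult_left_mono) auto
          moreover have "1 / lewis_step w (h g) i \<le> 1 / w i"
            using lewis_step_ge[of w i "h g"] wi by (intro divide_left_mono) auto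
          ultimately show ?thesis by simp
        next
          case Y: False
          have "x \<le> 12 \<Longrightarrow> 1 / 2 \<le> 1 - 1 / 2 * (x / 12 - Z)" for x :: real using Z0 by (simp add: field_simps)
          then have "1 / 2 \<le> F g" unfolding F using q1 by blast
          then have a: "1 / w i * (1 / 2) \<le> 1 / w i * F g" using wi by (intro mult_left_mono) auto
          have "l i / 4 \<le> (h g i)\<^sup>2" using Y l1 by (simp add: Y_def field_simps)
          then have "1 \<le> 4 * (h g i)\<^sup>2" using l1 by simp
          then have "w i * 2 \<le> lewis_step w (h g) i" using False wi by (simp add: lewis_step_def)
          then have "1 / lewis_step w (h g) i \<le> 1 / (w i * 2)" using wi by (intro divide_left_mono) auto
          then show ?thesis using a by simp
        qed
      qed
    qed
    then have "avg n n (\<lambda>g. 1 / lewis_step w (h g) i) g0 \<le> avg n n (\<lambda>g. 1 / w i * F g) g0" by (rule avg_mono)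
    also have "\<dots> = 1 / w i * avg n n F g0" by (rule avg_scale)
    also have "\<dots> \<le> 1 / w i * (15 / 16)"
    proof (rule mult_left_mono)
      let ?A = "\<lambda>F. avg n n F g0"
      have "?A F = 103 / 96 + (1 / (32 * real d) * real d + (- (29 / 96) / l i * l i + 1 / 24 / (l i)\<^sup>2 * ?A (\<lambda>g. (h g i) ^ 4)))"
        unfolding F_def avg_lin avg_const EZ E2[OF i] by simp
      also have "\<dots> \<le> 103 / 96 + (1 / (32 * real d) * real d + (- (29 / 96) / l i * l i + 1 / 24 / (l i)\<^sup>2 * (3 * (l i)\<^sup>2)))"
        using E4[OF i] by (intro add_left_mono mult_left_mono) auto
      also have "\<dots> \<le> 15 / 16" using l1 d0 by simp
      finally show "?A F \<le> 15 / 16" .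
    qed (use wi in simp)
    finally show ?thesis by simp
  qed
  \<comment> \<open>Weights only grow, so no coordinate becomes violated anew and the sum may run
    over the coordinates violated at present.\<close>
  have "avg n n (\<lambda>g. badness (lewis_step w (h g))) g0 \<le>
     avg n n (\<lambda>g. \<Sum>i<n. if bad w i then 1 / lewis_step w (h g) i else 0) g0"
  proof (rule avg_mono)
    fix g
    show "badness (lewis_step w (h g)) \<le> (\<Sum>i<n. if bad w i then 1 / lewis_step w (h g) i else 0)"
      unfolding badness_def
      using bad_antimono[OF w, of "h g"] lewis_step_pos[OF w, of "h g"] by (intro sum_mono) (auto intro: less_imp_le)
  qed
  also have "\<dots> = (\<Sum>i<n. avg n n (\<lambda>g. if bad w i then 1 / lewis_step w (h g) i else 0) g0)"
    by (rule avg_sum) simp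
  also have "\<dots> \<le> (\<Sum>i<n. 15 / 16 * (if bad w i then 1 / w i else 0))"
  proof (rule sum_mono)
    fix i assume "i \<in> {..<n}"
    then have i: "i < n" by simp
    show "avg n n (\<lambda>g. if bad w i then 1 / lewis_step w (h g) i else 0) g0 \<le> 15 / 16 * (if bad w i then 1 / w i else 0)"
    proof (cases "bad w i")
      case True
      show ?thesis unfolding if_P[OF True] by (rule coord[OF i True])
    next
      case False
      show ?thesis unfolding if_not_P[OF False] avg_const by simp
    qed
  qed
  also have "\<dots> = 15 / 16 * badness w" by (simp add: badness_def sum_distrib_left)
  finally show ?thesis .
qed

text \<open>Serves as Markov's inequality: the probability that a violated coordinate remains is at
  most \<open>B\<close> times the expected badness.\<close>

lemma badness_ge:
  assumes w: "\<forall>i<n. 0 < w i" and i: "i < n" "bad w i" and B: "(\<Sum>i<n. w i) \<le> B"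
  shows "1 \<le> B * badness w"
proof -
  have wi: "0 < w i" using w i by simp
  have "w i \<le> (\<Sum>i<n. w i)" using w i by (intro member_le_sum) (auto intro: less_imp_le)
  then have "w i \<le> B" using B by linarith
  then have "1 \<le> B * (1 / w i)" using wi by simp
  also have "1 / w i \<le> badness w"
  proof -
    have "(if bad w i then 1 / w i else 0) \<le> badness w"
      unfolding badness_def using w i by (intro member_le_sum) (auto intro: less_imp_le)
    then show ?thesis using i by simp
  qed
  finally show ?thesis using \<open>w i \<le> B\<close> wi by (simp add: mult_left_mono)
qed

end

section \<open>The program\<close>

primrec wr_reg :: "cmd \<Rightarrow> nat set" where
  "wr_reg Nop = {}"
| "wr_reg (Assign x e) = {x}"
| "wr_reg (Fill m a e) = {}"
| "wr_reg (Acc x e) = {x}"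
| "wr_reg (MulA a c) = {}"
| "wr_reg (MulAT a c) = {}"
| "wr_reg (Lin w v z) = {}"
| "wr_reg (c1 ;; c2) = wr_reg c1 \<union> wr_reg c2"
| "wr_reg (Branch e1 e2 c1 c2) = wr_reg c1 \<union> wr_reg c2"
| "wr_reg (Loop e c) = wr_reg c"

primrec wr_mem :: "cmd \<Rightarrow> nat set" where
  "wr_mem Nop = {}"
| "wr_mem (Assign x e) = {}"
| "wr_mem (Fill m a e) = {a}"
| "wr_mem (Acc x e) = {}"
| "wr_mem (MulA a c) = {a}"
| "wr_mem (MulAT a c) = {a}"
| "wr_mem (Lin w v z) = {z}"
| "wr_mem (c1 ;; c2) = wr_mem c1 \<union> wr_mem c2"
| "wr_mem (Branch e1 e2 c1 c2) = wr_mem c1 \<union> wr_mem c2"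
| "wr_mem (Loop e c) = wr_mem c"

lemma run_reg_frame: "x \<notin> wr_reg c \<Longrightarrow> reg (run A c \<sigma>) x = reg \<sigma> x"
proof (induction c arbitrary: \<sigma>)
  case (Loop e c)
  have "reg ((run A c ^^ k) \<sigma>) x = reg \<sigma> x" for k
    using Loop by (induction k) auto
  then show ?case by simp
qed auto

lemma run_mem_frame: "a \<notin> wr_mem c \<Longrightarrow> mem (run A c \<sigma>) a = mem \<sigma> a"
proof (induction c arbitrary: \<sigma>)
  case (Loop e c)
  have "mem ((run A c ^^ k) \<sigma>) a = mem \<sigma> a" for k
    using Loop by (induction k) auto
  then show ?case by simp
qed auto

abbreviation e_add (infixl "[+]" 65) where "a [+] b \<equiv> Bin RAdd a b"
abbreviation e_sub (infixl "[-]" 65) where "a [-] b \<equiv> Bin RSub a b"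
abbreviation e_mul (infixl "[*]" 70) where "a [*] b \<equiv> Bin RMul a b"
abbreviation e_div (infixl "['/]" 70) where "a [/] b \<equiv> Bin RDiv a b"
abbreviation e_exp where "e_exp e \<equiv> Fn RExp e"
abbreviation e_ln where "e_ln e \<equiv> Fn RLn e"
abbreviation e_max where "e_max a b \<equiv> Ite a b b a"
abbreviation e_abs where "e_abs e \<equiv> Ite e (Cst 0) (Cst 0 [-] e) e"
abbreviation e_hx1 where "e_hx1 e \<equiv> Ite (Cst 0) e (Cst 1 [+] e) (e_exp e)"
abbreviation e_hx2 where "e_hx2 e \<equiv> e_exp (Ite (Cst 0) e (Cst 0) e)"
abbreviation e_phi1 where "e_phi1 t r \<equiv> e_hx1 (r [-] t) [-] e_hx1 (Cst 0 [-] r [-] t)"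
abbreviation e_phi2 where "e_phi2 t r \<equiv> e_hx2 (r [-] t) [+] e_hx2 (Cst 0 [-] r [-] t)"

text \<open>The right-hand side is \<open>A^T c\<close>, with array 6 as scratch space.\<close>

definition SOLVE :: "nat \<Rightarrow> nat \<Rightarrow> nat \<Rightarrow> cmd" where
  "SOLVE w c z = MulAT 6 c ;; Lin w 6 z"

definition SUMR :: "nat \<Rightarrow> rexp \<Rightarrow> cmd" where
  "SUMR x e = Assign x (Cst 0) ;; Acc x (V x [+] e)"

definition MAXABS :: "nat \<Rightarrow> rexp \<Rightarrow> cmd" where
  "MAXABS x e = Assign x (Cst 0) ;; Acc x (e_max (V x) (e_abs e))"

text \<open>
  Real registers: 0 accuracy, 1 exponent, 2 and 3 the dimensions, 4 total weight, 6 and 7 upper and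
  lower bound of the optimum, 8 inner accuracy, 9 \<open>ln (4n)\<close>, 10 target level, 11 threshold \<open>\<tau>\<close>,
  12 squared radius, 13 \<open>K\<close>, 14 bound of the initial objective, 15 number of accelerated steps,
  16 number of Newton steps, 17 initial \<open>\<alpha>\<close>, 18 \<open>\<alpha>\<close>, 19 success flag, 21 and 23 proximal
  parameters, 22 squared gradient norm, 27 damping factor, 28 scale, 29 trial level.
  Arrays: 1 right-hand side, 2 output, 3 Lewis weights, 10 initial point, 11 scaled right-hand
  side, 12 and 13 the two sequences of the accelerated method, 14 solution found, 15 and 19
  proximal centre and its image, 16 proximal point, 17 and 18 gradient and its image, 20 signs.
\<close>

definition NEWTON :: cmd where
  "NEWTON = MulA 8 16 ;;
     Fill Rows 4 (e_phi2 (V 11) (At 8 [-] At 11) [+] V 23 [*] At 3) ;;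
     Fill Rows 5 (Cst 0 [-] (e_phi1 (V 11) (At 8 [-] At 11) [+] V 23 [*] At 3 [*] (At 8 [-] At 19))) ;;
     SOLVE 4 5 7 ;; Fill Cols 16 (At 16 [+] At 7)"

definition GRAD :: cmd where
  "GRAD = MulA 8 16 ;; Fill Rows 5 (e_phi1 (V 11) (At 8 [-] At 11)) ;; SOLVE 3 5 17 ;; MulA 18 17 ;;
     SUMR 22 (At 3 [*] At 18 [*] At 18)"

text \<open>Register 24 is the flag that ends the path following, and register 25 is the squared
  distance to the centre.\<close>

definition SHRINK :: cmd where
  "SHRINK = Branch (V 24) (Cst (1/2))
     (NEWTON ;; MulA 8 16 ;; SUMR 25 (At 3 [*] (At 8 [-] At 19) [*] (At 8 [-] At 19)) ;;
      Branch (Cst (1/4)) (V 25) (Assign 24 (Cst 1)) (Assign 23 (e_max (V 21) (Cst (15/16) [*] V 23))))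
     Nop"

text \<open>The starting parameter exceeds 16 times the gradient norm because
  \<open>x \<le> 1 + x^2\<close>; this spares a square root of register 22. The second loop polishes
  the point at the final parameter.\<close>

definition PROX :: cmd where
  "PROX = Fill Cols 16 (At 15) ;; MulA 19 15 ;; GRAD ;;
     Assign 23 (V 21 [+] Cst 16 [+] Cst 16 [*] V 22) ;; Assign 24 (Cst 0) ;;
     Loop (V 16) SHRINK ;; Loop (V 16) NEWTON"

definition CHECK :: "nat \<Rightarrow> cmd" where
  "CHECK a = MulA 8 a ;; MAXABS 20 (At 8 [-] At 11) ;;
     Branch (V 11) (V 20) Nop (Assign 19 (Cst 1) ;; Fill Cols 14 (At a))"

text \<open>Register 26 is the inner product of the gradient with the movement \<open>y - x\<close>.
  The comparison decides between the damped step and the full one.\<close>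

definition UPDATE :: cmd where
  "UPDATE = GRAD ;; SUMR 26 (At 3 [*] At 18 [*] (At 19 [-] At 8)) ;;
     Branch (Cst 2 [*] V 21 [*] V 26) (V 22) (Assign 27 (V 21 [*] V 26 [/] V 22)) (Assign 27 (Cst 1)) ;;
     Fill Cols 13 (At 13 [-] V 27 [*] (V 18 [/] V 13) [*] At 17) ;;
     Fill Cols 12 (((Cst 1 [-] V 27) [*] V 13 [*] At 12 [+] V 27 [*] (V 13 [+] Cst 1) [*] At 16) [/] (V 13 [+] V 27)) ;;
     Assign 18 (V 18 [*] (Cst 1 [+] V 27 [/] V 13)) ;; CHECK 12"

definition STEP :: cmd where
  "STEP = Branch (V 19) (Cst (1/2))
     (Assign 21 (V 13 [*] (V 13 [+] Cst 1) [/] V 18) ;;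
      Fill Cols 15 ((V 13 [*] At 12 [+] At 13) [/] (V 13 [+] Cst 1)) ;; PROX ;; CHECK 16 ;;
      Branch (V 19) (Cst (1/2)) UPDATE Nop)
     Nop"

text \<open>Dividing by register 28 turns the trial level into \<open>ln (4n) / \<epsilon>\<close>
  for the inner accuracy \<open>\<epsilon>\<close>. The additive error \<open>ln (4n)\<close> of the
  softened maximum is then the fraction \<open>\<epsilon>\<close> of that level.\<close>

definition DECIDE :: cmd where
  "DECIDE = Fill Rows 11 (At 1 [/] V 28) ;; Fill Cols 12 (At 10 [/] V 28) ;; Fill Cols 13 (At 12) ;;
     Assign 18 (V 17) ;; Assign 19 (Cst 0) ;; CHECK 12 ;; Loop (V 15) STEP"

text \<open>The midpoint is geometric because the goal is a bound on the ratio of the two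
  levels.\<close>

definition BISECT :: cmd where
  "BISECT = Assign 29 (e_exp ((e_ln (V 7) [+] e_ln (V 6)) [/] Cst 2)) ;;
     Assign 28 (V 8 [*] V 29 [/] V 9) ;; DECIDE ;;
     Branch (V 19) (Cst (1/2)) (Assign 7 (V 29)) (Assign 6 (V 11 [*] V 28) ;; Fill Cols 2 (At 14 [*] V 28))"

text \<open>With total weight \<open>W\<close> and scaled level \<open>g\<close>, register 12 bounds
  the squared distance from the least squares start to a solution, and register 14 the objective at
  the start. Register 17 makes each of the two terms of the initial potential at most half of
  register 12.\<close>

definition SETUP :: cmd where
  "SETUP = Assign 6 (V 5) ;; Assign 7 (V 5 [/] (Cst 2 [+] V 4)) ;; Assign 8 (V 0 [/] Cst 6) ;;
     Assign 9 (e_ln (Cst 4 [*] V 2)) ;; Assign 10 (V 9 [/] V 8) ;; Assign 11 (V 10 [+] V 9) ;;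
     Assign 12 (V 4 [*] V 10 [*] V 10) ;; Assign 13 (e_exp (e_ln (V 12) [/] Cst 3)) ;;
     Assign 14 (Cst 2 [*] V 2 [*] (Cst 1 [+] (Cst 4 [+] V 4) [*] V 10) [*] (Cst 1 [+] (Cst 4 [+] V 4) [*] V 10)) ;;
     Assign 15 (Cst 288 [*] V 13 [+] Cst 2 [*] V 13 [*] e_ln (Cst 4 [*] V 14) [+] Cst 2) ;;
     Assign 16 (Cst 96 [*] e_ln (Cst 2000 [*] V 12 [*] V 14)) ;; Assign 17 (V 12 [/] (Cst 2 [*] V 14))"

definition INIT :: cmd where
  "INIT = SUMR 4 (At 3) ;; Fill Rows 5 (At 3 [*] At 1) ;; SOLVE 3 5 10 ;; MulA 8 10 ;;
     MAXABS 5 (At 8 [-] At 1) ;; Fill Cols 2 (At 10)"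

definition MAIN :: cmd where
  "MAIN = INIT ;; Branch (Cst 0) (V 5) (SETUP ;; Loop (Cst 2 [*] e_ln ((Cst 2 [+] V 4) [/] V 8)) BISECT) Nop"

definition BARRIER_STEP :: cmd where
  "BARRIER_STEP = MulA 8 2 ;;
     Fill Rows 4 (Cst 1 [/] (V 5 [-] (At 8 [-] At 1)) [*] (Cst 1 [/] (V 5 [-] (At 8 [-] At 1))) [+]
       Cst 1 [/] (V 5 [+] (At 8 [-] At 1)) [*] (Cst 1 [/] (V 5 [+] (At 8 [-] At 1)))) ;;
     Fill Rows 5 (Cst 1 [/] (V 5 [+] (At 8 [-] At 1)) [-] Cst 1 [/] (V 5 [-] (At 8 [-] At 1))) ;;
     SOLVE 4 5 7 ;; Fill Cols 2 (At 2 [+] At 7) ;; MulA 8 2 ;; MAXABS 4 (At 8 [-] At 1) ;;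
     Assign 5 (V 5 [-] (V 5 [-] V 4) [/] (Cst 16 [*] V 2))"

definition BARRIER :: cmd where
  "BARRIER = Fill Rows 4 (Cst 1) ;; SOLVE 4 1 2 ;; MulA 8 2 ;; MAXABS 4 (At 8 [-] At 1) ;;
     Branch (Cst 0) (V 4) (Assign 5 (Cst 8 [*] V 2 [*] V 4) ;;
       Loop (Cst 64 [*] V 2 [*] V 2 [*] e_ln (Cst 24 [*] V 2 [*] V 2 [/] V 0)) BARRIER_STEP) Nop"

definition REST :: cmd where
  "REST = Branch (V 0 [*] V 2 [*] V 2 [*] V 2 [*] V 2) (Cst 1) BARRIER MAIN"

definition LEWIS :: cmd where
  "LEWIS = Fill Rows 5 (At 20 [*] e_exp (e_ln (At 3) [/] Cst 2)) ;; SOLVE 3 5 7 ;; MulA 8 7 ;;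
     SUMR 4 (At 3 [*] At 8 [*] At 8) ;;
     Branch (Cst 16 [*] V 3) (V 4) Nop (Fill Rows 3 (At 3 [*] (Cst 1 [+] Cst 4 [*] At 8 [*] At 8)))"

text \<open>A coin value \<open>c\<close> becomes the sign \<open>2 c - 1\<close>.\<close>

definition FLIPS :: prog where
  "FLIPS = for_nat 0 (Seq (Flip 5) (Seq (ROfNat 100 5) (Seq (ROp RAdd 100 100 100) (Seq (RConst 101 1)
     (Seq (ROp RSub 100 100 101) (RStore 20 3 100))))))"

text \<open>Enough rounds for \<open>(15/16)^N\<close> to outweigh \<open>n^3 N\<close> and still
  leave \<open>n^(-C)\<close>; see \<open>failure_bound\<close>.\<close>

definition LEWIS_COUNT :: rexp where
  "LEWIS_COUNT = Cst 32 [*] ((V 1 [+] Cst 3) [*] e_ln (V 2) [+] Cst 8)"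

definition REGRESSION :: prog where
  "REGRESSION = Seq (ROfNat 2 0) (Seq (ROfNat 3 1) (Seq (compile 0 (Fill Rows 3 (Cst 1 [/] V 2)))
     (Seq (for_real 0 LEWIS_COUNT (Seq FLIPS (compile 1 LEWIS))) (compile 0 REST))))"

lemmas block_defs = SOLVE_def SUMR_def MAXABS_def NEWTON_def GRAD_def SHRINK_def PROX_def CHECK_def UPDATE_def
  STEP_def DECIDE_def BISECT_def SETUP_def INIT_def MAIN_def BARRIER_STEP_def BARRIER_def REST_def LEWIS_def

lemma wf_REST: "wf_cmd 0 REST"
  by (simp add: block_defs)

lemma wf_LEWIS: "wf_cmd 1 LEWIS"
  by (simp add: block_defs)

lemma SUMR_run:
  assumes ev: "\<And>r i. eval e ((reg \<sigma>)(x := r)) (mem \<sigma>) i = eval e (reg \<sigma>) (mem \<sigma>) i"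
  shows "run A (SUMR x e) \<sigma> = \<sigma>\<lparr>reg := (reg \<sigma>)(x := (\<Sum>i<dim_row A. eval e (reg \<sigma>) (mem \<sigma>) i))\<rparr>"
proof -
  let ?\<sigma> = "\<sigma>\<lparr>reg := (reg \<sigma>)(x := 0)\<rparr>"
  have upd: "(\<lambda>a. if a = x then 0 else reg \<sigma> a)(x := r) = (reg \<sigma>)(x := r)" for r
    by auto
  have "acc_iter x (V x [+] e) ?\<sigma> k = (\<Sum>i<k. eval e (reg \<sigma>) (mem \<sigma>) i)" for k
    by (induction k) (auto simp: ev upd)
  then show ?thesis by (simp add: SUMR_def)
qed

text \<open>The maximum as the fold that \<open>MAXABS\<close> computes, started at 0.\<close>

primrec max_abs :: "nat \<Rightarrow> (nat \<Rightarrow> real) \<Rightarrow> real" where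
  "max_abs 0 f = 0"
| "max_abs (Suc k) f = max (max_abs k f) \<bar>f k\<bar>"

lemma max_abs_nonneg: "0 \<le> max_abs k f"
  by (induction k) auto

lemma max_abs_ge: "i < k \<Longrightarrow> \<bar>f i\<bar> \<le> max_abs k f"
  by (induction k) (auto simp: less_Suc_eq le_max_iff_disj)

lemma max_abs_le_iff: "0 \<le> c \<Longrightarrow> max_abs k f \<le> c \<longleftrightarrow> (\<forall>i<k. \<bar>f i\<bar> \<le> c)"
  by (induction k) (auto simp: less_Suc_eq)

lemma max_abs_attained: "0 < k \<Longrightarrow> \<exists>i<k. max_abs k f = \<bar>f i\<bar>"
proof (induction k)
  case (Suc k)
  show ?case
  proof (cases "k = 0")
    case False
    then obtain i where i: "i < k" "max_abs k f = \<bar>f i\<bar>" using Suc by auto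
    show ?thesis
    proof (cases "max_abs k f \<le> \<bar>f k\<bar>")
      case True
      then show ?thesis by (intro exI[of _ k]) simp
    next
      case False
      then show ?thesis using i by (intro exI[of _ i]) simp
    qed
  qed (auto intro: exI[of _ 0])
qed simp

lemma max_abs_cong: "(\<And>i. i < k \<Longrightarrow> f i = g i) \<Longrightarrow> max_abs k f = max_abs k g"
  by (induction k) auto

lemma MAXABS_run:
  assumes ev: "\<And>r i. eval e ((reg \<sigma>)(x := r)) (mem \<sigma>) i = eval e (reg \<sigma>) (mem \<sigma>) i"
  shows "run A (MAXABS x e) \<sigma> = \<sigma>\<lparr>reg := (reg \<sigma>)(x := max_abs (dim_row A) (\<lambda>i. eval e (reg \<sigma>) (mem \<sigma>) i))\<rparr>"
proof -
  let ?\<sigma> = "\<sigma>\<lparr>reg := (reg \<sigma>)(x := 0)\<rparr>"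
  have upd: "(\<lambda>a. if a = x then 0 else reg \<sigma> a)(x := r) = (reg \<sigma>)(x := r)" for r
    by auto
  have "acc_iter x (e_max (V x) (e_abs e)) ?\<sigma> k = max_abs k (\<lambda>i. eval e (reg \<sigma>) (mem \<sigma>) i)" for k
    by (induction k) (auto simp: ev upd max_def abs_if)
  then show ?thesis by (simp add: MAXABS_def)
qed

lemma eval_phi1 [simp]: "eval (e_phi1 t r) \<rho> m i = phi1 (eval t \<rho> m i) (eval r \<rho> m i)"
  by (auto simp: phi1_def hx1_def not_less)

lemma eval_phi2 [simp]: "eval (e_phi2 t r) \<rho> m i = phi2 (eval t \<rho> m i) (eval r \<rho> m i)"
  by (auto simp: phi2_def hx2_def min_def not_less)

section \<open>Correctness of the deterministic part\<close>

context regression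
begin

lemma SOLVE_spec:
  assumes "\<forall>i<n. 0 < mem \<sigma> w i" "w \<noteq> 6"
  shows "u \<in> colspace \<Longrightarrow> ip n (mem \<sigma> w) (lin_app A (mem (run A (SOLVE w c z) \<sigma>) z)) u = (\<Sum>i<n. mem \<sigma> c i * u i)"
    and "reg (run A (SOLVE w c z) \<sigma>) = reg \<sigma>"
    and "a \<noteq> 6 \<Longrightarrow> a \<noteq> z \<Longrightarrow> mem (run A (SOLVE w c z) \<sigma>) a = mem \<sigma> a"
  using assms by (auto simp: SOLVE_def intro!: solve_arr_adj)

end

section \<open>The proximal point oracle as a program\<close>

locale engine = regression A T es n d + ball_problem n "regression.colspace A" w b \<tau>
  for A T es n d w b \<tau>
begin

definition env :: "store \<Rightarrow> bool" where
  "env \<sigma> \<longleftrightarrow> mem \<sigma> 3 = w \<and> mem \<sigma> 11 = b \<and> reg \<sigma> 11 = \<tau>"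

abbreviation img :: "store \<Rightarrow> nat \<Rightarrow> nat \<Rightarrow> real" where
  "img \<sigma> a \<equiv> lin_app A (mem \<sigma> a)"

lemma NEWTON_spec:
  assumes e: "env \<sigma>" and \<Lambda>: "0 < reg \<sigma> 23" and y: "\<forall>i<n. mem \<sigma> 19 i = y i"
  obtains h where "is_newton y (reg \<sigma> 23) (img \<sigma> 16) h" "img (run A NEWTON \<sigma>) 16 = (\<lambda>i. img \<sigma> 16 i + h i)"
proof -
  define \<sigma>1 where "\<sigma>1 = run A (MulA 8 16) \<sigma>"
  define \<sigma>2 where "\<sigma>2 = run A (Fill Rows 4 (e_phi2 (V 11) (At 8 [-] At 11) [+] V 23 [*] At 3)) \<sigma>1"
  define \<sigma>3 where "\<sigma>3 = run A (Fill Rows 5 (Cst 0 [-] (e_phi1 (V 11) (At 8 [-] At 11) [+] V 23 [*] At 3 [*] (At 8 [-] At 19)))) \<sigma>2"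
  define \<sigma>4 where "\<sigma>4 = run A (SOLVE 4 5 7) \<sigma>3"
  let ?u = "img \<sigma> 16" and ?\<Lambda> = "reg \<sigma> 23"
  have r: "run A NEWTON \<sigma> = run A (Fill Cols 16 (At 16 [+] At 7)) \<sigma>4"
    by (simp only: NEWTON_def run.simps(8) \<sigma>1_def \<sigma>2_def \<sigma>3_def \<sigma>4_def)
  have m1: "mem \<sigma>1 8 i = ?u i" if "i < n" for i using that by (simp add: \<sigma>1_def)
  have f1: "a \<noteq> 8 \<Longrightarrow> mem \<sigma>1 a = mem \<sigma> a" "reg \<sigma>1 = reg \<sigma>" for a by (auto simp: \<sigma>1_def)
  have m2: "mem \<sigma>2 4 i = hess ?\<Lambda> ?u i" if "i < n" for i
    using that m1[OF that] e by (auto simp: \<sigma>2_def hess_def env_def f1 phi2_def hx2_def min_def not_less)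
  have f2: "a \<noteq> 8 \<Longrightarrow> a \<noteq> 4 \<Longrightarrow> mem \<sigma>2 a = mem \<sigma> a" "reg \<sigma>2 = reg \<sigma>" "mem \<sigma>2 8 = mem \<sigma>1 8" for a
    by (auto simp: \<sigma>2_def f1)
  have m3: "mem \<sigma>3 5 i = - (phi1 \<tau> (?u i - b i) + ?\<Lambda> * w i * (?u i - y i))" if "i < n" for i
    using that m1[OF that] e y by (auto simp: \<sigma>3_def env_def f2 phi1_def hx1_def not_less)
  have m34: "mem \<sigma>3 4 = mem \<sigma>2 4" by (simp add: \<sigma>3_def)
  have f3: "a \<noteq> 8 \<Longrightarrow> a \<noteq> 4 \<Longrightarrow> a \<noteq> 5 \<Longrightarrow> mem \<sigma>3 a = mem \<sigma> a" "reg \<sigma>3 = reg \<sigma>" for a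
    by (auto simp: \<sigma>3_def f2)
  have pos: "\<forall>i<n. 0 < mem \<sigma>3 4 i" unfolding m34 using m2 hess_pos[OF \<Lambda>] by simp
  define h where "h = img \<sigma>4 7"
  have "is_newton y ?\<Lambda> ?u h"
    unfolding is_newton_def
  proof (intro conjI ballI)
    show "h \<in> colspace" by (simp add: h_def)
    fix z assume z: "z \<in> colspace"
    have "ip n (hess ?\<Lambda> ?u) h z = ip n (mem \<sigma>3 4) h z"
      unfolding ip_def m34 using m2 by (intro sum.cong) auto
    also have "\<dots> = (\<Sum>i<n. mem \<sigma>3 5 i * z i)"
      unfolding h_def \<sigma>4_def by (rule SOLVE_spec(1)[OF pos _ z]) simp
    also have "\<dots> = - ((\<Sum>i<n. phi1 \<tau> (?u i - b i) * z i) + ?\<Lambda> * ip n w (\<lambda>i. ?u i - y i) z)"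
      unfolding ip_def sum_distrib_left sum.distrib[symmetric] sum_negf[symmetric]
      by (intro sum.cong refl) (simp add: m3 algebra_simps)
    finally show "ip n (hess ?\<Lambda> ?u) h z = - ((\<Sum>i<n. phi1 \<tau> (?u i - b i) * z i) + ?\<Lambda> * ip n w (\<lambda>i. ?u i - y i) z)" .
  qed
  moreover have "img (run A NEWTON \<sigma>) 16 = (\<lambda>i. ?u i + h i)"
  proof -
    have "mem \<sigma>4 16 = mem \<sigma> 16" using SOLVE_spec(3)[OF pos, of 16 7 5] by (simp add: \<sigma>4_def f3)
    then have "img (run A NEWTON \<sigma>) 16 = lin_app A (\<lambda>j. 1 * mem \<sigma> 16 j + 1 * mem \<sigma>4 7 j)"
      unfolding r by (intro lin_app_cong) simp
    then show ?thesis unfolding lin_app_lin by (simp add: h_def)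
  qed
  ultimately show thesis using that by blast
qed

lemma GRAD_spec:
  assumes e: "env \<sigma>"
  shows "is_grad (img \<sigma> 16) (img (run A GRAD \<sigma>) 17)"
    and "reg (run A GRAD \<sigma>) 22 = (nrm (img (run A GRAD \<sigma>) 17))\<^sup>2"
    and "\<forall>i<n. mem (run A GRAD \<sigma>) 18 i = img (run A GRAD \<sigma>) 17 i"
    and "\<forall>i<n. mem (run A GRAD \<sigma>) 8 i = img \<sigma> 16 i"
proof -
  define \<sigma>1 where "\<sigma>1 = run A (MulA 8 16) \<sigma>"
  define \<sigma>2 where "\<sigma>2 = run A (Fill Rows 5 (e_phi1 (V 11) (At 8 [-] At 11))) \<sigma>1"
  define \<sigma>3 where "\<sigma>3 = run A (SOLVE 3 5 17) \<sigma>2"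
  define \<sigma>4 where "\<sigma>4 = run A (MulA 18 17) \<sigma>3"
  let ?u = "img \<sigma> 16"
  have r: "run A GRAD \<sigma> = run A (SUMR 22 (At 3 [*] At 18 [*] At 18)) \<sigma>4"
    by (simp only: GRAD_def run.simps(8) \<sigma>1_def \<sigma>2_def \<sigma>3_def \<sigma>4_def)
  also have "\<dots> = \<sigma>4\<lparr>reg := (reg \<sigma>4)(22 := (\<Sum>i<n. mem \<sigma>4 3 i * mem \<sigma>4 18 i * mem \<sigma>4 18 i))\<rparr>"
    by (subst SUMR_run) simp_all
  finally have r: "run A GRAD \<sigma> = \<sigma>4\<lparr>reg := (reg \<sigma>4)(22 := (\<Sum>i<n. mem \<sigma>4 3 i * mem \<sigma>4 18 i * mem \<sigma>4 18 i))\<rparr>" .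
  have m1: "mem \<sigma>1 8 i = ?u i" if "i < n" for i using that by (simp add: \<sigma>1_def)
  have f1: "a \<noteq> 8 \<Longrightarrow> mem \<sigma>1 a = mem \<sigma> a" "reg \<sigma>1 = reg \<sigma>" for a by (auto simp: \<sigma>1_def)
  have m2: "mem \<sigma>2 5 i = phi1 \<tau> (?u i - b i)" if "i < n" for i
    using that m1[OF that] e by (auto simp: \<sigma>2_def env_def f1 phi1_def hx1_def not_less)
  have f2: "a \<noteq> 5 \<Longrightarrow> mem \<sigma>2 a = mem \<sigma>1 a" for a by (auto simp: \<sigma>2_def)
  have w2: "mem \<sigma>2 3 = w" using e by (simp add: f2 f1 env_def)
  have pos: "\<forall>i<n. 0 < mem \<sigma>2 3 i" unfolding w2 by (rule w_pos)
  have m4: "mem \<sigma>4 18 i = img \<sigma>4 17 i" if "i < n" for i using that by (simp add: \<sigma>4_def)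
  have m17: "mem \<sigma>4 17 = mem \<sigma>3 17" by (simp add: \<sigma>4_def)
  show "is_grad (img \<sigma> 16) (img (run A GRAD \<sigma>) 17)"
    unfolding is_grad_def
  proof (intro conjI ballI)
    show "img (run A GRAD \<sigma>) 17 \<in> colspace" by simp
    fix z assume z: "z \<in> colspace"
    have "ip n w (img (run A GRAD \<sigma>) 17) z = (\<Sum>i<n. mem \<sigma>2 5 i * z i)"
      using SOLVE_spec(1)[OF pos _ z, of 5 17] by (simp add: r m17 w2 \<sigma>3_def)
    then show "ip n w (img (run A GRAD \<sigma>) 17) z = (\<Sum>i<n. phi1 \<tau> (img \<sigma> 16 i - b i) * z i)"
      using m2 by simp
  qed
  have w4: "mem \<sigma>4 3 = w"
    using SOLVE_spec(3)[OF pos, of 3 17 5] by (simp add: \<sigma>4_def \<sigma>3_def[symmetric] w2)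
  show "reg (run A GRAD \<sigma>) 22 = (nrm (img (run A GRAD \<sigma>) 17))\<^sup>2"
    unfolding nrm_sq ip_def using m4 by (simp add: r w4)
  show "\<forall>i<n. mem (run A GRAD \<sigma>) 18 i = img (run A GRAD \<sigma>) 17 i" using m4 by (simp add: r)
  have "mem \<sigma>4 8 = mem \<sigma>1 8"
    using SOLVE_spec(3)[OF pos, of 8 17 5] by (simp add: \<sigma>4_def \<sigma>3_def[symmetric] f2)
  then show "\<forall>i<n. mem (run A GRAD \<sigma>) 8 i = img \<sigma> 16 i" using m1 by (simp add: r)
qed

lemma frame_NEWTON:
  "reg (run A NEWTON \<sigma>) x = reg \<sigma> x" "a \<notin> {4, 5, 6, 7, 8, 16} \<Longrightarrow> mem (run A NEWTON \<sigma>) a = mem \<sigma> a"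
  by (rule run_reg_frame run_mem_frame; auto simp: NEWTON_def SOLVE_def)+

lemma frame_GRAD:
  "x \<noteq> 22 \<Longrightarrow> reg (run A GRAD \<sigma>) x = reg \<sigma> x" "a \<notin> {5, 6, 8, 17, 18} \<Longrightarrow> mem (run A GRAD \<sigma>) a = mem \<sigma> a"
  by (rule run_reg_frame run_mem_frame; auto simp: GRAD_def SOLVE_def SUMR_def)+

lemma env_NEWTON: "env \<sigma> \<Longrightarrow> env (run A NEWTON \<sigma>)"
  by (simp add: env_def frame_NEWTON)

lemma env_GRAD: "env \<sigma> \<Longrightarrow> env (run A GRAD \<sigma>)"
  by (simp add: env_def frame_GRAD)

lemma central_mono: "central c y \<Lambda> u \<Longrightarrow> c \<le> c' \<Longrightarrow> 0 < \<Lambda> \<Longrightarrow> central c' y \<Lambda> u"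
  unfolding central_def by (meson mult_right_mono order.trans real_sqrt_ge_zero less_imp_le)

text \<open>Invariant of the path following: as long as the flag is 0 the iterate stays within distance
  1/2 of the centre; it is raised once the iterate leaves that ball.\<close>

definition shrink_inv :: "(nat \<Rightarrow> real) \<Rightarrow> real \<Rightarrow> real \<Rightarrow> nat \<Rightarrow> store \<Rightarrow> bool" where
  "shrink_inv y \<mu> \<Lambda>0 k \<sigma> \<longleftrightarrow> env \<sigma> \<and> (\<forall>i<n. mem \<sigma> 19 i = y i) \<and> reg \<sigma> 21 = \<mu> \<and> \<mu> \<le> reg \<sigma> 23 \<and> reg \<sigma> 23 \<le> \<Lambda>0 \<and>
     central (1 / 16) y (reg \<sigma> 23) (img \<sigma> 16) \<and> nrm (\<lambda>i. img \<sigma> 16 i - y i) \<le> 9 / 16 \<and>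
     ((reg \<sigma> 24 = 0 \<and> nrm (\<lambda>i. img \<sigma> 16 i - y i) \<le> 1 / 2 \<and> reg \<sigma> 23 \<le> max \<mu> ((15 / 16) ^ k * \<Lambda>0)) \<or>
      (reg \<sigma> 24 = 1 \<and> 1 / 2 \<le> nrm (\<lambda>i. img \<sigma> 16 i - y i)))"

text \<open>One Newton step improves centrality from 1/16 to 1/64, which pays for the next decrease
  of the parameter. The distance bound 9/16 is 1/2 plus one step of length 1/16.\<close>

lemma SHRINK_spec:
  assumes \<mu>: "0 < \<mu>" and inv: "shrink_inv y \<mu> \<Lambda>0 k \<sigma>"
  shows "shrink_inv y \<mu> \<Lambda>0 (Suc k) (run A SHRINK \<sigma>)"
proof (cases "reg \<sigma> 24 = 0")
  case False
  then have f: "reg \<sigma> 24 = 1" using inv by (auto simp: shrink_inv_def)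
  then have "run A SHRINK \<sigma> = \<sigma>" by (simp add: SHRINK_def of_rat_divide)
  then show ?thesis using inv f by (auto simp: shrink_inv_def)
next
  case True
  let ?\<Lambda> = "reg \<sigma> 23"
  have e: "env \<sigma>" and y: "\<forall>i<n. mem \<sigma> 19 i = y i" and r21: "reg \<sigma> 21 = \<mu>" and L: "\<mu> \<le> ?\<Lambda>" "?\<Lambda> \<le> \<Lambda>0"
    and c: "central (1 / 16) y ?\<Lambda> (img \<sigma> 16)" and s: "nrm (\<lambda>i. img \<sigma> 16 i - y i) \<le> 1 / 2"
    and Lk: "?\<Lambda> \<le> max \<mu> ((15 / 16) ^ k * \<Lambda>0)"
    using inv True by (auto simp: shrink_inv_def)
  have \<Lambda>: "0 < ?\<Lambda>" using \<mu> L by linarith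
  define \<sigma>1 where "\<sigma>1 = run A NEWTON \<sigma>"
  obtain h where h: "is_newton y ?\<Lambda> (img \<sigma> 16) h" "img \<sigma>1 16 = (\<lambda>i. img \<sigma> 16 i + h i)"
    using NEWTON_spec[OF e \<Lambda> y] unfolding \<sigma>1_def by blast
  have c1: "central (1 / 64) y ?\<Lambda> (img \<sigma>1 16)" and nh: "nrm h \<le> 1 / 16"
    using newton_step[OF \<Lambda> h(1) c] by (simp_all add: h(2))
  have s1: "nrm (\<lambda>i. img \<sigma>1 16 i - y i) \<le> 9 / 16"
  proof -
    have "nrm (\<lambda>i. img \<sigma>1 16 i - y i) = nrm (\<lambda>i. (img \<sigma> 16 i - y i) + h i)" by (rule nrm_cong) (simp add: h(2))
    then show ?thesis using nrm_triangle[of "\<lambda>i. img \<sigma> 16 i - y i" h] s nh by linarith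
  qed
  define \<sigma>2 where "\<sigma>2 = run A (MulA 8 16) \<sigma>1"
  have m2: "\<And>i. i < n \<Longrightarrow> mem \<sigma>2 8 i = img \<sigma>1 16 i" "\<And>a. a \<noteq> 8 \<Longrightarrow> mem \<sigma>2 a = mem \<sigma>1 a" "reg \<sigma>2 = reg \<sigma>"
    by (auto simp: \<sigma>2_def \<sigma>1_def frame_NEWTON)
  have m1: "mem \<sigma>1 19 = mem \<sigma> 19" "mem \<sigma>1 3 = w" using e by (auto simp: \<sigma>1_def frame_NEWTON env_def)
  define q where "q = (nrm (\<lambda>i. img \<sigma>1 16 i - y i))\<^sup>2"
  define \<sigma>3 where "\<sigma>3 = run A (SUMR 25 (At 3 [*] (At 8 [-] At 19) [*] (At 8 [-] At 19))) \<sigma>2"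
  have "\<sigma>3 = \<sigma>2\<lparr>reg := (reg \<sigma>2)(25 := (\<Sum>i<n. mem \<sigma>2 3 i * (mem \<sigma>2 8 i - mem \<sigma>2 19 i) * (mem \<sigma>2 8 i - mem \<sigma>2 19 i)))\<rparr>"
    unfolding \<sigma>3_def by (subst SUMR_run) simp_all
  also have "(\<Sum>i<n. mem \<sigma>2 3 i * (mem \<sigma>2 8 i - mem \<sigma>2 19 i) * (mem \<sigma>2 8 i - mem \<sigma>2 19 i)) = q"
    unfolding q_def nrm_sq ip_def using y by (intro sum.cong) (auto simp: m2 m1)
  finally have s3: "\<sigma>3 = \<sigma>2\<lparr>reg := (reg \<sigma>2)(25 := q)\<rparr>" .
  have r: "run A SHRINK \<sigma> = run A (Branch (Cst (1/4)) (V 25) (Assign 24 (Cst 1)) (Assign 23 (e_max (V 21) (Cst (15/16) [*] V 23)))) \<sigma>3"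
    using True by (simp add: SHRINK_def of_rat_divide \<sigma>3_def \<sigma>2_def \<sigma>1_def)
  have q4: "q \<le> 1 / 4 \<longleftrightarrow> nrm (\<lambda>i. img \<sigma>1 16 i - y i) \<le> 1 / 2"
    unfolding q_def using power2_le_iff_abs_le[of "1 / 2" "nrm (\<lambda>i. img \<sigma>1 16 i - y i)"] by (simp add: power_divide)
  have m16: "mem \<sigma>3 16 = mem \<sigma>1 16" "mem \<sigma>3 19 = mem \<sigma> 19" "mem \<sigma>3 3 = w" "mem \<sigma>3 11 = b" "reg \<sigma>3 11 = \<tau>"
    using e by (auto simp: s3 m2 m1 env_def \<sigma>1_def frame_NEWTON)
  show ?thesis
  proof (cases "1 / 4 < q")
    case big: True
    then have "run A SHRINK \<sigma> = \<sigma>3\<lparr>reg := (reg \<sigma>3)(24 := 1)\<rparr>" by (simp add: r s3 of_rat_divide)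
    then show ?thesis
      using big q4 m16 y r21 L central_mono[OF c1 _ \<Lambda>] s1 by (auto simp: shrink_inv_def env_def s3 m2)
  next
    case small: False
    let ?\<Lambda>' = "max \<mu> (15 / 16 * ?\<Lambda>)"
    have mx: "(if \<mu> < x then x else \<mu>) = max \<mu> x" for x by auto
    have rr: "run A SHRINK \<sigma> = \<sigma>3\<lparr>reg := (reg \<sigma>3)(23 := ?\<Lambda>')\<rparr>"
      using small r21 unfolding mx[symmetric] by (simp add: r s3 of_rat_divide m2)
    have s2: "nrm (\<lambda>i. img \<sigma>1 16 i - y i) \<le> 1 / 2" using small q4 by simp
    have c2: "central (1 / 16) y ?\<Lambda>' (img \<sigma>1 16)"
      using L \<Lambda> by (intro central_shrink[OF \<Lambda> _ _ c1 s2]) auto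
    have "15 / 16 * ?\<Lambda> \<le> max \<mu> ((15 / 16) ^ Suc k * \<Lambda>0)"
    proof -
      have "15 / 16 * ?\<Lambda> \<le> 15 / 16 * max \<mu> ((15 / 16) ^ k * \<Lambda>0)" using Lk by simp
      also have "\<dots> \<le> max \<mu> ((15 / 16) ^ Suc k * \<Lambda>0)" using \<mu> by (auto simp: max_def)
      finally show ?thesis .
    qed
    then show ?thesis
      using True m16 y r21 L \<Lambda> c2 s1 s2 by (auto simp: shrink_inv_def env_def rr s3 m2)
  qed
qed

lemma SHRINK_loop:
  assumes "0 < \<mu>" "shrink_inv y \<mu> \<Lambda>0 0 \<sigma>"
  shows "shrink_inv y \<mu> \<Lambda>0 k ((run A SHRINK ^^ k) \<sigma>)"
  using assms by (induction k) (auto intro: SHRINK_spec)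

text \<open>The step lengths form a geometric series with sum below 1/12. Polishing therefore cannot
  bring a point that left the ball of radius 1/2 back to distance 1/4.\<close>

lemma NEWTON_loop:
  assumes e: "env \<sigma>" and \<Lambda>: "0 < reg \<sigma> 23" and y: "\<forall>i<n. mem \<sigma> 19 i = y i"
    and c: "central (1 / 16) y (reg \<sigma> 23) (img \<sigma> 16)"
  shows "env ((run A NEWTON ^^ k) \<sigma>) \<and> (\<forall>x. reg ((run A NEWTON ^^ k) \<sigma>) x = reg \<sigma> x) \<and>
    (\<forall>i<n. mem ((run A NEWTON ^^ k) \<sigma>) 19 i = y i) \<and>
    central (1 / 16 / 4 ^ k) y (reg \<sigma> 23) (img ((run A NEWTON ^^ k) \<sigma>) 16) \<and>
    nrm (\<lambda>i. img ((run A NEWTON ^^ k) \<sigma>) 16 i - img \<sigma> 16 i) \<le> 1 / 12 * (1 - 1 / 4 ^ k)"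
proof (induction k)
  case 0
  have "nrm (\<lambda>i. img \<sigma> 16 i - img \<sigma> 16 i) = 0" by (simp add: nrm_def ip_def)
  then show ?case using assms by simp
next
  case (Suc k)
  let ?\<sigma> = "(run A NEWTON ^^ k) \<sigma>"
  have I: "env ?\<sigma>" "\<And>x. reg ?\<sigma> x = reg \<sigma> x" "\<forall>i<n. mem ?\<sigma> 19 i = y i"
    "central (1 / 16 / 4 ^ k) y (reg \<sigma> 23) (img ?\<sigma> 16)"
    "nrm (\<lambda>i. img ?\<sigma> 16 i - img \<sigma> 16 i) \<le> 1 / 12 * (1 - 1 / 4 ^ k)" using Suc by auto
  have \<Lambda>': "0 < reg ?\<sigma> 23" using \<Lambda> I(2) by simp
  obtain h where h: "is_newton y (reg \<sigma> 23) (img ?\<sigma> 16) h" "img (run A NEWTON ?\<sigma>) 16 = (\<lambda>i. img ?\<sigma> 16 i + h i)"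
    using NEWTON_spec[OF I(1) \<Lambda>' I(3)] unfolding I(2) by blast
  have "1 / 16 / 4 ^ k \<le> (1 / 16 :: real)" by (simp add: divide_le_eq)
  from newton_step[OF \<Lambda> h(1) I(4) this]
  have c1: "central (1 / 16 / 4 ^ k / 4) y (reg \<sigma> 23) (img (run A NEWTON ?\<sigma>) 16)" "nrm h \<le> 1 / 16 / 4 ^ k"
    by (simp_all add: h(2))
  have "nrm (\<lambda>i. img (run A NEWTON ?\<sigma>) 16 i - img \<sigma> 16 i) = nrm (\<lambda>i. (img ?\<sigma> 16 i - img \<sigma> 16 i) + h i)"
    by (rule nrm_cong) (simp add: h(2))
  then have "nrm (\<lambda>i. img (run A NEWTON ?\<sigma>) 16 i - img \<sigma> 16 i) \<le> 1 / 12 * (1 - 1 / 4 ^ k) + 1 / 16 / 4 ^ k"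
    using nrm_triangle[of "\<lambda>i. img ?\<sigma> 16 i - img \<sigma> 16 i" h] I(5) c1(2) by linarith
  also have "\<dots> = 1 / 12 * (1 - 1 / 4 ^ Suc k)" by (simp add: field_simps)
  finally show ?case using I c1(1) env_NEWTON[OF I(1)] by (simp add: frame_NEWTON)
qed

text \<open>Assumption \<open>L0\<close> says that \<open>J\<close> reductions by 15/16 carry the
  starting parameter down to the target. If the stop flag stayed down, the target parameter was
  reached; otherwise the movement is large.\<close>

lemma PROX_spec:
  fixes \<sigma> :: store
  defines "\<sigma>' \<equiv> run A PROX \<sigma>" and "y \<equiv> img \<sigma> 15" and "J \<equiv> nat \<lceil>reg \<sigma> 16\<rceil>"
  assumes e: "env \<sigma>" and \<mu>: "0 < reg \<sigma> 21"
    and L0: "\<And>p. is_grad y p \<Longrightarrow> (15 / 16) ^ J * (reg \<sigma> 21 + 16 + 16 * (nrm p)\<^sup>2) \<le> reg \<sigma> 21"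
  obtains \<Lambda> p where "is_grad y p" "reg \<sigma> 21 \<le> \<Lambda>" "\<Lambda> \<le> reg \<sigma> 21 + 16 + 16 * (nrm p)\<^sup>2"
    "central (1 / 16 / 4 ^ J) y \<Lambda> (img \<sigma>' 16)" "1 / 4 \<le> nrm (\<lambda>i. img \<sigma>' 16 i - y i) \<or> \<Lambda> = reg \<sigma> 21"
    "nrm (\<lambda>i. img \<sigma>' 16 i - y i) \<le> 1" "env \<sigma>'" "\<forall>i<n. mem \<sigma>' 19 i = y i"
proof -
  define \<sigma>1 where "\<sigma>1 = run A (MulA 19 15) (run A (Fill Cols 16 (At 15)) \<sigma>)"
  define \<sigma>2 where "\<sigma>2 = run A GRAD \<sigma>1"
  define \<sigma>3 where "\<sigma>3 = run A (Assign 24 (Cst 0)) (run A (Assign 23 (V 21 [+] Cst 16 [+] Cst 16 [*] V 22)) \<sigma>2)"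
  define \<sigma>4 where "\<sigma>4 = (run A SHRINK ^^ J) \<sigma>3"
  have e1: "env \<sigma>1" using e by (simp add: \<sigma>1_def env_def)
  have u1: "img \<sigma>1 16 = y" unfolding y_def by (rule lin_app_cong) (simp add: \<sigma>1_def)
  have y1: "mem \<sigma>1 19 i = y i" if "i < n" for i using that by (simp add: \<sigma>1_def y_def)
  have r1: "reg \<sigma>1 = reg \<sigma>" by (simp add: \<sigma>1_def)
  define p where "p = img \<sigma>2 17"
  have p: "is_grad y p" "reg \<sigma>2 22 = (nrm p)\<^sup>2" using GRAD_spec[OF e1] by (simp_all add: p_def \<sigma>2_def u1)
  have f2: "x \<noteq> 22 \<Longrightarrow> reg \<sigma>2 x = reg \<sigma> x" "mem \<sigma>2 16 = mem \<sigma>1 16" "mem \<sigma>2 19 = mem \<sigma>1 19" for x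
    by (simp_all add: \<sigma>2_def frame_GRAD r1)
  have e2: "env \<sigma>2" unfolding \<sigma>2_def by (rule env_GRAD[OF e1])
  define \<Lambda>0 where "\<Lambda>0 = reg \<sigma> 21 + 16 + 16 * (nrm p)\<^sup>2"
  have r3: "reg \<sigma>3 23 = \<Lambda>0" "reg \<sigma>3 24 = 0" "x \<noteq> 22 \<Longrightarrow> x \<noteq> 23 \<Longrightarrow> x \<noteq> 24 \<Longrightarrow> reg \<sigma>3 x = reg \<sigma> x" "mem \<sigma>3 = mem \<sigma>2" for x
    by (simp_all add: \<sigma>3_def \<Lambda>0_def p(2) f2)
  have e3: "env \<sigma>3" using e2 by (simp add: env_def r3 f2)
  have \<Lambda>0: "reg \<sigma> 21 \<le> \<Lambda>0" "0 < \<Lambda>0" using \<mu> by (auto simp: \<Lambda>0_def intro: add_pos_nonneg)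
  have "16 * nrm p \<le> \<Lambda>0"
  proof -
    have "0 \<le> (nrm p - 1)\<^sup>2 + (nrm p)\<^sup>2 + 1" by simp
    then have "2 * nrm p \<le> 2 + 2 * (nrm p)\<^sup>2" by (simp add: power2_diff)
    then show ?thesis using \<mu> unfolding \<Lambda>0_def by linarith
  qed
  then have c3: "central (1 / 16) y \<Lambda>0 y" by (rule central_start[OF \<Lambda>0(2) p(1)])
  have n0: "nrm (\<lambda>i. y i - y i) = 0" by (simp add: nrm_def ip_def)
  have inv3: "shrink_inv y (reg \<sigma> 21) \<Lambda>0 0 \<sigma>3"
    using e3 y1 \<Lambda>0 c3 n0 by (auto simp: shrink_inv_def r3 f2 u1)
  have inv4: "shrink_inv y (reg \<sigma> 21) \<Lambda>0 J \<sigma>4"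
    unfolding \<sigma>4_def by (rule SHRINK_loop[OF \<mu> inv3])
  define \<Lambda> where "\<Lambda> = reg \<sigma>4 23"
  have I4: "env \<sigma>4" "\<forall>i<n. mem \<sigma>4 19 i = y i" "reg \<sigma> 21 \<le> \<Lambda>" "\<Lambda> \<le> \<Lambda>0" "central (1 / 16) y \<Lambda> (img \<sigma>4 16)"
    "nrm (\<lambda>i. img \<sigma>4 16 i - y i) \<le> 9 / 16"
    using inv4 by (auto simp: shrink_inv_def \<Lambda>_def)
  have alt: "1 / 2 \<le> nrm (\<lambda>i. img \<sigma>4 16 i - y i) \<or> \<Lambda> = reg \<sigma> 21"
    using inv4 L0[OF p(1)] by (auto simp: shrink_inv_def \<Lambda>_def \<Lambda>0_def)
  have r16: "reg \<sigma>4 16 = reg \<sigma> 16"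
  proof -
    have f: "reg (run A SHRINK \<sigma>) 16 = reg \<sigma> 16" for \<sigma> by (rule run_reg_frame) (simp add: block_defs)
    have "reg ((run A SHRINK ^^ k) \<sigma>3) 16 = reg \<sigma>3 16" for k
      by (induction k) (simp_all add: f)
    then show ?thesis by (simp add: \<sigma>4_def r3)
  qed
  have s': "\<sigma>' = (run A NEWTON ^^ J) \<sigma>4"
  proof -
    have "\<sigma>' = run A (Loop (V 16) NEWTON) (run A (Loop (V 16) SHRINK) \<sigma>3)"
      by (simp only: \<sigma>'_def PROX_def run.simps(8) \<sigma>3_def \<sigma>2_def \<sigma>1_def)
    also have "run A (Loop (V 16) SHRINK) \<sigma>3 = \<sigma>4"
      using r3(3)[of 16] by (simp add: \<sigma>4_def J_def)
    also have "run A (Loop (V 16) NEWTON) \<sigma>4 = (run A NEWTON ^^ J) \<sigma>4"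
      using r16 by (simp add: J_def)
    finally show ?thesis .
  qed
  have \<Lambda>p: "0 < reg \<sigma>4 23" using I4(3) \<mu> by (simp add: \<Lambda>_def)
  note N = NEWTON_loop[OF I4(1) \<Lambda>p I4(2) I4(5)[unfolded \<Lambda>_def], of J, folded s' \<Lambda>_def]
  have dist: "nrm (\<lambda>i. img \<sigma>' 16 i - img \<sigma>4 16 i) \<le> 1 / 12"
  proof -
    have "1 / 12 * (1 - 1 / 4 ^ J) \<le> (1 / 12 :: real)" by simp
    then show ?thesis using N by linarith
  qed
  have t1: "nrm (\<lambda>i. img \<sigma>' 16 i - y i) \<le> nrm (\<lambda>i. img \<sigma>' 16 i - img \<sigma>4 16 i) + nrm (\<lambda>i. img \<sigma>4 16 i - y i)"
    using nrm_triangle[of "\<lambda>i. img \<sigma>' 16 i - img \<sigma>4 16 i" "\<lambda>i. img \<sigma>4 16 i - y i"] by simp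
  have t2: "nrm (\<lambda>i. img \<sigma>4 16 i - y i) \<le> nrm (\<lambda>i. img \<sigma>' 16 i - img \<sigma>4 16 i) + nrm (\<lambda>i. img \<sigma>' 16 i - y i)"
  proof -
    have "nrm (\<lambda>i. img \<sigma>4 16 i - y i) = nrm (\<lambda>i. (-1) * (img \<sigma>' 16 i - img \<sigma>4 16 i) + (img \<sigma>' 16 i - y i))"
      by (rule nrm_cong) simp
    also have "\<dots> \<le> nrm (\<lambda>i. (-1) * (img \<sigma>' 16 i - img \<sigma>4 16 i)) + nrm (\<lambda>i. img \<sigma>' 16 i - y i)" by (rule nrm_triangle)
    finally show ?thesis unfolding nrm_scale by simp
  qed
  show thesis
  proof (rule that[OF p(1) I4(3)])
    show "\<Lambda> \<le> reg \<sigma> 21 + 16 + 16 * (nrm p)\<^sup>2" using I4(4) by (simp add: \<Lambda>0_def)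
    show "central (1 / 16 / 4 ^ J) y \<Lambda> (img \<sigma>' 16)" "env \<sigma>'" "\<forall>i<n. mem \<sigma>' 19 i = y i" using N by auto
    show "1 / 4 \<le> nrm (\<lambda>i. img \<sigma>' 16 i - y i) \<or> \<Lambda> = reg \<sigma> 21" using alt t2 dist by linarith
    show "nrm (\<lambda>i. img \<sigma>' 16 i - y i) \<le> 1" using t1 dist I4(6) by linarith
  qed
qed

definition found :: "store \<Rightarrow> bool" where
  "found \<sigma> \<longleftrightarrow> (\<forall>i<n. \<bar>img \<sigma> 14 i - b i\<bar> \<le> \<tau>)"

text \<open>A failed test is recorded as \<open>1 < obj\<close>, the form in which
  \<open>grad_ge\<close> needs it.\<close>

lemma CHECK_spec:
  assumes e: "env \<sigma>" and a: "a \<notin> {8, 14}"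
  shows "(reg (run A (CHECK a) \<sigma>) 19 = 1 \<and> found (run A (CHECK a) \<sigma>)) \<or>
      (reg (run A (CHECK a) \<sigma>) 19 = reg \<sigma> 19 \<and> 1 < obj (img \<sigma> a))"
    and "x \<noteq> 19 \<Longrightarrow> x \<noteq> 20 \<Longrightarrow> reg (run A (CHECK a) \<sigma>) x = reg \<sigma> x"
    and "c \<noteq> 8 \<Longrightarrow> c \<noteq> 14 \<Longrightarrow> mem (run A (CHECK a) \<sigma>) c = mem \<sigma> c"
    and "env (run A (CHECK a) \<sigma>)"
proof -
  show f1: "x \<noteq> 19 \<Longrightarrow> x \<noteq> 20 \<Longrightarrow> reg (run A (CHECK a) \<sigma>) x = reg \<sigma> x" for x
    by (rule run_reg_frame) (simp add: CHECK_def MAXABS_def)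
  show f2: "c \<noteq> 8 \<Longrightarrow> c \<noteq> 14 \<Longrightarrow> mem (run A (CHECK a) \<sigma>) c = mem \<sigma> c" for c
    by (rule run_mem_frame) (simp add: CHECK_def MAXABS_def)
  show "env (run A (CHECK a) \<sigma>)" using e by (simp add: env_def f1 f2)
  define \<sigma>1 where "\<sigma>1 = run A (MulA 8 a) \<sigma>"
  define m where "m = max_abs n (\<lambda>i. img \<sigma> a i - b i)"
  have "run A (MAXABS 20 (At 8 [-] At 11)) \<sigma>1 = \<sigma>1\<lparr>reg := (reg \<sigma>1)(20 := max_abs n (eval (At 8 [-] At 11) (reg \<sigma>1) (mem \<sigma>1)))\<rparr>"
    by (subst MAXABS_run) simp_all
  also have "max_abs n (eval (At 8 [-] At 11) (reg \<sigma>1) (mem \<sigma>1)) = m"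
    unfolding m_def using e by (intro max_abs_cong) (simp add: \<sigma>1_def env_def)
  finally have r2: "run A (MAXABS 20 (At 8 [-] At 11)) \<sigma>1 = \<sigma>1\<lparr>reg := (reg \<sigma>1)(20 := m)\<rparr>" .
  have r: "run A (CHECK a) \<sigma> = run A (Branch (V 11) (V 20) Nop (Assign 19 (Cst 1) ;; Fill Cols 14 (At a))) (\<sigma>1\<lparr>reg := (reg \<sigma>1)(20 := m)\<rparr>)"
    by (simp only: CHECK_def run.simps(8) \<sigma>1_def[symmetric] r2)
  have f: "reg \<sigma>1 = reg \<sigma>" "mem \<sigma>1 a = mem \<sigma> a" using a by (auto simp: \<sigma>1_def)
  show "(reg (run A (CHECK a) \<sigma>) 19 = 1 \<and> found (run A (CHECK a) \<sigma>)) \<or>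
      (reg (run A (CHECK a) \<sigma>) 19 = reg \<sigma> 19 \<and> 1 < obj (img \<sigma> a))"
  proof (cases "\<tau> < m")
    case True
    have "1 < obj (img \<sigma> a)"
    proof -
      have "0 < n" using n_pos by simp
      then obtain i where i: "i < n" "m = \<bar>img \<sigma> a i - b i\<bar>"
        unfolding m_def using max_abs_attained by blast
      then have "1 < phi \<tau> (img \<sigma> a i - b i)" using True phi_gt_1 by simp
      also have "\<dots> \<le> obj (img \<sigma> a)"
        unfolding obj_def using i phi_pos by (intro member_le_sum) (auto intro: less_imp_le)
      finally show ?thesis .
    qed
    then show ?thesis using True e by (simp add: r f env_def)
  next
    case False
    have "\<bar>img \<sigma> a i - b i\<bar> \<le> \<tau>" if "i < n" for i
      using max_abs_ge[OF that, of "\<lambda>i. img \<sigma> a i - b i"] False by (simp add: m_def)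
    moreover have "img (run A (CHECK a) \<sigma>) 14 = img \<sigma> a"
      using False e by (intro lin_app_cong) (simp add: r f env_def)
    ultimately show ?thesis using False e by (simp add: r f env_def found_def)
  qed
qed

end

section \<open>The accelerated iteration finds a solution if one exists\<close>

locale accelerated = engine A T es n d w b \<tau> for A T es n d w b \<tau> +
  fixes z :: "nat \<Rightarrow> real" and K R F g :: real
  assumes z_in: "z \<in> colspace" and z_obj: "obj z \<le> 1 / 2" and z_lev: "\<forall>i<n. \<bar>z i - b i\<bar> \<le> g"
    and K_ge: "1 \<le> K" and K_cube: "K ^ 3 = R" and F_ge: "1 \<le> F" and n_le_F: "real n \<le> F" and g_le: "g \<le> R"
begin

lemma R_ge: "1 \<le> R"
  using K_ge K_cube one_le_power by blast

lemma K_le_R: "K \<le> R"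
  using K_ge K_cube self_le_power[of K 3] by simp

text \<open>The quantities that determine the inner accuracy are bounded by monomials of degree at
  most 6 in each of \<open>R\<close> and \<open>F\<close>, with constants below
  \<open>2000^6\<close>, so \<open>B1 ^ 6\<close> serves as common bound.\<close>

definition B1 :: real where "B1 = 2000 * R * F"

text \<open>Of the \<open>t\<close> steps so far, \<open>l\<close> were damped and \<open>s\<close>
  full. Each damped step is charged to a drop \<open>K^2 / 288\<close> of the potential, each full
  step to a growth of \<open>\<alpha>\<close> by the factor \<open>1 + 1 / K\<close>. The distance
  of \<open>u\<close> to \<open>z\<close> may drift by 1 per step.\<close>

definition running :: "nat \<Rightarrow> store \<Rightarrow> bool" where
  "running t \<sigma> \<longleftrightarrow> reg \<sigma> 19 = 0 \<and> 0 < reg \<sigma> 18 \<and> 1 < obj (img \<sigma> 12) \<and> nrm (\<lambda>i. img \<sigma> 12 i - z i) \<le> 2 * R + real t \<and>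
     (\<exists>l s. t = l + s \<and> pot z (reg \<sigma> 18) (img \<sigma> 12) (img \<sigma> 13) + real l * (K\<^sup>2 / 288) \<le> R \<and>
        R / (2 * F) * (1 + 1 / K) ^ s \<le> reg \<sigma> 18)"

definition ms_inv :: "nat \<Rightarrow> store \<Rightarrow> bool" where
  "ms_inv t \<sigma> \<longleftrightarrow> env \<sigma> \<and> reg \<sigma> 13 = K \<and> reg \<sigma> 16 = 96 * ln B1 \<and> ((reg \<sigma> 19 = 1 \<and> found \<sigma>) \<or> running t \<sigma>)"

lemma pot_bounds:
  assumes "running t \<sigma>"
  shows "reg \<sigma> 18 \<le> 2 * R" "nrm (\<lambda>i. img \<sigma> 13 i - z i) \<le> 2 * R"
proof -
  let ?\<alpha> = "reg \<sigma> 18" and ?P = "pot z (reg \<sigma> 18) (img \<sigma> 12) (img \<sigma> 13)"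
  obtain l where l: "?P + real l * (K\<^sup>2 / 288) \<le> R" using assms by (auto simp: running_def)
  have "0 \<le> real l * (K\<^sup>2 / 288)" by simp
  then have P: "?P \<le> R" using l by linarith
  have \<alpha>: "0 < ?\<alpha>" and o: "1 < obj (img \<sigma> 12)" using assms by (auto simp: running_def)
  have "?\<alpha> * (1 / 2) \<le> ?\<alpha> * (obj (img \<sigma> 12) - obj z)"
    using \<alpha> o z_obj by (intro mult_left_mono) auto
  then have 1: "?\<alpha> / 2 + (nrm (\<lambda>i. img \<sigma> 13 i - z i))\<^sup>2 / 2 \<le> R"
    using P by (simp add: pot_def)
  then show "?\<alpha> \<le> 2 * R" using zero_le_power2[of "nrm (\<lambda>i. img \<sigma> 13 i - z i)"] by linarith
  have "(nrm (\<lambda>i. img \<sigma> 13 i - z i))\<^sup>2 \<le> 2 * R" using 1 \<alpha> by linarith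
  also have "\<dots> \<le> 2 * R * (2 * R)" using R_ge by (simp add: mult_le_cancel_left1)
  finally have "(nrm (\<lambda>i. img \<sigma> 13 i - z i))\<^sup>2 \<le> (2 * R)\<^sup>2" unfolding power2_eq_square[of "2 * R"] .
  then show "nrm (\<lambda>i. img \<sigma> 13 i - z i) \<le> 2 * R"
    by (rule power2_le_imp_le) (use R_ge in simp)
qed

text \<open>Both parts follow from \<open>15/16 \<le> exp (- 1/16)\<close>,
  \<open>exp 1 \<le> 4\<close> and \<open>96 / 16 = 6\<close>.\<close>

lemma power_le_exp: "(15 / 16) ^ nat \<lceil>96 * ln B1\<rceil> * B1 ^ 6 \<le> 1" "B1 ^ 6 \<le> 4 ^ nat \<lceil>96 * ln B1\<rceil>"
proof -
  let ?J = "nat \<lceil>96 * ln B1\<rceil>"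
  have B: "1 \<le> B1" unfolding B1_def using R_ge F_ge mult_mono[of 1 R 1 F] by simp
  then have J: "96 * ln B1 \<le> real ?J" by linarith
  have e: "exp (6 * ln B1) = B1 ^ 6"
    using B exp_of_nat_mult[of 6 "ln B1"] by simp
  have l0: "0 \<le> ln B1" using B by simp
  have "(15 / 16 :: real) \<le> exp (- 1 / 16)" using exp_ge_add_one_self[of "- 1 / 16 :: real"] by simp
  then have "(15 / 16 :: real) ^ ?J \<le> exp (- 1 / 16) ^ ?J" by (intro power_mono) auto
  also have "\<dots> = exp (real ?J * (- 1 / 16))" by (rule exp_of_nat_mult[symmetric])
  also have "\<dots> \<le> exp (- (6 * ln B1))" using J by simp
  finally have "(15 / 16) ^ ?J * B1 ^ 6 \<le> exp (- (6 * ln B1)) * B1 ^ 6"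
    using B by (intro mult_right_mono) auto
  then show "(15 / 16) ^ ?J * B1 ^ 6 \<le> 1" unfolding e[symmetric] by (simp flip: exp_add)
  have "exp 1 \<le> (4 :: real)" using exp_le by linarith
  then have "exp 1 ^ ?J \<le> (4 :: real) ^ ?J" by (intro power_mono) auto
  moreover have "6 * ln B1 \<le> real ?J * 1" using J l0 by linarith
  then have "exp (6 * ln B1) \<le> exp (real ?J * 1)" by (simp only: exp_le_cancel_iff)
  ultimately show "B1 ^ 6 \<le> 4 ^ ?J" unfolding e exp_of_nat_mult by linarith
qed

lemma mono_bound:
  assumes "i \<le> k" "j \<le> m" "0 \<le> c" "c \<le> c'" shows "c * R ^ i * F ^ j \<le> c' * R ^ k * F ^ m"
  using assms R_ge F_ge by (intro mult_mono power_increasing) auto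

text \<open>The a priori bounds come first: the bound on \<open>t\<close> limits the drift, so
  distances, gradients, the parameter \<open>\<mu>\<close> and its inverse are polynomial in
  \<open>R\<close> and \<open>F\<close>, and the fixed number \<open>96 ln B1\<close> of inner
  rounds suffices for both loops of \<open>PROX\<close>. After that one of the two potential
  estimates applies.\<close>

lemma STEP_spec:
  assumes inv: "ms_inv t \<sigma>" and t: "real t \<le> 299 * R * F"
  shows "ms_inv (Suc t) (run A STEP \<sigma>)"
proof (cases "reg \<sigma> 19 = 1")
  case True
  then have "run A STEP \<sigma> = \<sigma>" by (simp add: STEP_def of_rat_divide)
  then show ?thesis using inv True by (auto simp: ms_inv_def running_def)
next
  case False
  then have run: "running t \<sigma>" and e: "env \<sigma>" and r13: "reg \<sigma> 13 = K" and r16: "reg \<sigma> 16 = 96 * ln B1"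
    using inv by (auto simp: ms_inv_def)
  define \<alpha> u v where "\<alpha> = reg \<sigma> 18" and "u = img \<sigma> 12" and "v = img \<sigma> 13"
  have f0: "reg \<sigma> 19 = 0" and \<alpha>: "0 < \<alpha>" and ou: "1 < obj u" and du: "nrm (\<lambda>i. u i - z i) \<le> 2 * R + real t"
    using run by (auto simp: running_def \<alpha>_def u_def)
  obtain l s where ls: "t = l + s" "pot z \<alpha> u v + real l * (K\<^sup>2 / 288) \<le> R" "R / (2 * F) * (1 + 1 / K) ^ s \<le> \<alpha>"
    using run by (auto simp: running_def \<alpha>_def u_def v_def)
  have \<alpha>2: "\<alpha> \<le> 2 * R" and dv: "nrm (\<lambda>i. v i - z i) \<le> 2 * R"
    using pot_bounds[OF run] by (auto simp: \<alpha>_def v_def)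
  have K0: "0 < K" "0 < K + 1" using K_ge by linarith+
  define \<mu> where "\<mu> = K * (K + 1) / \<alpha>"
  have \<mu>0: "0 < \<mu>" unfolding \<mu>_def using K0 \<alpha> by simp
  define J where "J = nat \<lceil>96 * ln B1\<rceil>"
  define \<sigma>1 where "\<sigma>1 = run A (Fill Cols 15 ((V 13 [*] At 12 [+] At 13) [/] (V 13 [+] Cst 1)))
     (run A (Assign 21 (V 13 [*] (V 13 [+] Cst 1) [/] V 18)) \<sigma>)"
  define \<sigma>2 where "\<sigma>2 = run A PROX \<sigma>1"
  define \<sigma>3 where "\<sigma>3 = run A (CHECK 16) \<sigma>2"
  have r: "run A STEP \<sigma> = run A (Branch (V 19) (Cst (1/2)) UPDATE Nop) \<sigma>3"
    using f0 by (simp only: STEP_def run.simps(8,9) \<sigma>1_def \<sigma>2_def \<sigma>3_def) (simp add: of_rat_divide)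
  have r21: "reg \<sigma>1 21 = \<mu>" by (simp add: \<sigma>1_def \<mu>_def r13 \<alpha>_def)
  have f1: "x \<noteq> 21 \<Longrightarrow> reg \<sigma>1 x = reg \<sigma> x" "a \<noteq> 15 \<Longrightarrow> mem \<sigma>1 a = mem \<sigma> a" for x a by (auto simp: \<sigma>1_def)
  have e1: "env \<sigma>1" using e by (simp add: env_def f1)
  define y where "y = img \<sigma>1 15"
  have y: "y i = (K * u i + v i) / (K + 1)" for i
  proof -
    have "y = lin_app A (\<lambda>j. K / (K + 1) * mem \<sigma> 12 j + 1 / (K + 1) * mem \<sigma> 13 j)"
      unfolding y_def by (rule lin_app_cong) (simp add: \<sigma>1_def r13 add_divide_distrib)
    then show ?thesis unfolding lin_app_lin by (simp add: u_def v_def add_divide_distrib)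
  qed
  define D where "D = 2 * R + real t"
  have D0: "0 \<le> D" using R_ge by (simp add: D_def)
  have dy: "nrm (\<lambda>i. y i - z i) \<le> D"
  proof -
    have "nrm (\<lambda>i. y i - z i) = nrm (\<lambda>i. K / (K + 1) * (u i - z i) + 1 / (K + 1) * (v i - z i))"
    proof (rule nrm_cong)
      fix i
      have "z i = (K + 1) * z i / (K + 1)" using K0 by simp
      then have "y i - z i = ((K * u i + v i) - (K + 1) * z i) / (K + 1)" unfolding y by (simp add: diff_divide_distrib)
      also have "(K * u i + v i) - (K + 1) * z i = K * (u i - z i) + 1 * (v i - z i)" by (simp add: algebra_simps)
      finally show "y i - z i = K / (K + 1) * (u i - z i) + 1 / (K + 1) * (v i - z i)" by (simp add: add_divide_distrib)
    qed
    also have "\<dots> \<le> K / (K + 1) * nrm (\<lambda>i. u i - z i) + 1 / (K + 1) * nrm (\<lambda>i. v i - z i)"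
    proof -
      have a: "\<bar>K / (K + 1)\<bar> = K / (K + 1)" "\<bar>1 / (K + 1)\<bar> = 1 / (K + 1)" using K0 by auto
      show ?thesis
        using nrm_triangle[of "\<lambda>i. K / (K + 1) * (u i - z i)" "\<lambda>i. 1 / (K + 1) * (v i - z i)"]
        unfolding nrm_scale[of "K / (K + 1)"] nrm_scale[of "1 / (K + 1)"] a .
    qed
    also have "\<dots> \<le> K / (K + 1) * D + 1 / (K + 1) * D"
      using du dv K0 by (intro add_mono mult_left_mono) (auto simp: D_def)
    also have "\<dots> = D"
    proof -
      have "K / (K + 1) + 1 / (K + 1) = 1" using K0 by (simp add: add_divide_distrib[symmetric])
      then show ?thesis by (metis distrib_right mult_1)
    qed
    finally show ?thesis .
  qed
  have yS: "y \<in> colspace" "u \<in> colspace" "v \<in> colspace" by (auto simp: y_def u_def v_def)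
  have RF: "1 \<le> R * F" using R_ge F_ge mult_mono[of 1 R 1 F] by simp
  have RRF: "R \<le> R * F" "F \<le> R * F" using R_ge F_ge by (auto simp: mult_le_cancel_left1 mult_le_cancel_right1)
  have D302: "D \<le> 301 * (R * F)" using t RRF by (simp add: D_def)
  have grad_y: "(nrm p)\<^sup>2 \<le> 92416 * R ^ 2 * F ^ 4" if p: "is_grad y p" for p
  proof -
    have "\<bar>y i - b i\<bar> \<le> D + g" if i: "i < n" for i
    proof -
      have "\<bar>y i - z i\<bar> \<le> D" using abs_le_nrm[OF S_diff[OF yS(1) z_in] i] dy by linarith
      then show ?thesis using z_lev i by (smt (verit))
    qed
    then have "nrm p \<le> real n * (1 + (D + g))" by (rule grad_le[OF p])
    also have "\<dots> \<le> F * (304 * (R * F))"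
    proof (intro mult_mono n_le_F)
      show "1 + (D + g) \<le> 304 * (R * F)" using D302 RF RRF g_le by linarith
      have "\<bar>z 0 - b 0\<bar> \<le> g" using z_lev n_pos by auto
      then have "0 \<le> g" by linarith
      then show "0 \<le> 1 + (D + g)" using D0 by simp
    qed (use F_ge in auto)
    finally have "(nrm p)\<^sup>2 \<le> (F * (304 * (R * F)))\<^sup>2" by (intro power_mono) auto
    then show ?thesis by (simp add: power_mult_distrib power2_eq_square power4_eq_xxxx mult_ac)
  qed
  \<comment> \<open>\<open>\<alpha>\<close> never falls below its initial value
    \<open>R / (2 F)\<close>, and \<open>K^2 \<le> R\<close>.\<close>
  have \<mu>4: "\<mu> \<le> 4 * F"
  proof -
    have "R / (2 * F) * 1 \<le> R / (2 * F) * (1 + 1 / K) ^ s"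
      using R_ge F_ge K0 by (intro mult_left_mono one_le_power) auto
    then have a: "R / (2 * F) \<le> \<alpha>" using ls(3) by linarith
    have "\<mu> \<le> K * (K + K) / (R / (2 * F))"
      unfolding \<mu>_def using K_ge R_ge F_ge a K0 \<alpha> by (intro frac_le mult_mono) auto
    also have "\<dots> = 4 * F * (K\<^sup>2 / R)" by (simp add: power2_eq_square field_simps)
    also have "\<dots> \<le> 4 * F * 1"
    proof (intro mult_left_mono)
      have "K\<^sup>2 \<le> K ^ 3" using K_ge by (intro power_increasing) auto
      then show "K\<^sup>2 / R \<le> 1" using R_ge K_cube by simp
    qed (use F_ge in auto)
    finally show ?thesis by simp
  qed
  \<comment> \<open>Conversely \<open>\<alpha> \<le> 2 R\<close>: the potential is at most
    \<open>R\<close> and the objective gap to \<open>z\<close> at least 1/2.\<close>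
  have \<mu>R: "1 \<le> 2 * R * \<mu>"
  proof -
    have "1 * \<alpha> \<le> (K * (K + 1)) * (2 * R)"
    proof (rule mult_mono)
      show "1 \<le> K * (K + 1)" using K_ge mult_mono[of 1 K 1 "K + 1"] by simp
    qed (use \<alpha>2 \<alpha> K0 in auto)
    then show ?thesis unfolding \<mu>_def using \<alpha> by (simp add: field_simps)
  qed
  define Lm where "Lm = 1500000 * R ^ 2 * F ^ 4"
  have Lm: "\<mu> + 16 + 16 * (nrm p)\<^sup>2 \<le> Lm" if "is_grad y p" for p
  proof -
    have "4 * F \<le> 4 * R ^ 2 * F ^ 4" using mono_bound[of 0 2 1 4 4 4] by simp
    moreover have "16 \<le> 16 * R ^ 2 * F ^ 4" using mono_bound[of 0 2 0 4 16 16] by simp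
    moreover have "16 * (nrm p)\<^sup>2 \<le> 1478656 * R ^ 2 * F ^ 4" using grad_y[OF that] by simp
    ultimately have "\<mu> + 16 + 16 * (nrm p)\<^sup>2 \<le> 1478676 * R ^ 2 * F ^ 4" using \<mu>4 unfolding mult.assoc by linarith
    also have "\<dots> \<le> Lm" unfolding Lm_def by (rule mono_bound) auto
    finally show ?thesis .
  qed
  have B6: "B1 ^ 6 = 64000000000000000000 * R ^ 6 * F ^ 6" by (simp add: B1_def power_mult_distrib)
  have L0: "(15 / 16) ^ nat \<lceil>reg \<sigma>1 16\<rceil> * (reg \<sigma>1 21 + 16 + 16 * (nrm p)\<^sup>2) \<le> reg \<sigma>1 21" if p: "is_grad (img \<sigma>1 15) p" for p
  proof -
    have "(15 / 16) ^ J * (\<mu> + 16 + 16 * (nrm p)\<^sup>2) \<le> (15 / 16) ^ J * Lm"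
      using Lm[of p] p by (intro mult_left_mono) (auto simp: y_def)
    also have "\<dots> \<le> (15 / 16) ^ J * (\<mu> * B1 ^ 6)"
    proof (intro mult_left_mono)
      have "Lm * 1 \<le> Lm * (2 * R * \<mu>)" using \<mu>R R_ge F_ge by (intro mult_left_mono) (auto simp: Lm_def)
      also have "\<dots> = \<mu> * (3000000 * R ^ 3 * F ^ 4)" by (simp add: Lm_def power2_eq_square power3_eq_cube mult_ac)
      also have "\<dots> \<le> \<mu> * B1 ^ 6" unfolding B6 using \<mu>0 by (intro mult_left_mono mono_bound) auto
      finally show "Lm \<le> \<mu> * B1 ^ 6" by simp
    qed simp
    also have "\<dots> = \<mu> * ((15 / 16) ^ J * B1 ^ 6)" by simp
    also have "\<dots> \<le> \<mu> * 1" using power_le_exp(1) \<mu>0 unfolding J_def by (intro mult_left_mono) auto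
    finally show ?thesis by (simp add: r21 f1 r16 J_def)
  qed
  have J1: "nat \<lceil>reg \<sigma>1 16\<rceil> = J" by (simp add: f1 r16 J_def)
  have \<mu>1: "0 < reg \<sigma>1 21" by (simp add: r21 \<mu>0)
  define x where "x = img \<sigma>2 16"
  obtain \<Lambda> py where py: "is_grad y py" and \<Lambda>: "\<mu> \<le> \<Lambda>" "\<Lambda> \<le> \<mu> + 16 + 16 * (nrm py)\<^sup>2"
    and c: "central (1 / 16 / 4 ^ J) y \<Lambda> x" and s: "1 / 4 \<le> nrm (\<lambda>i. x i - y i) \<or> \<Lambda> = \<mu>"
    and s1: "nrm (\<lambda>i. x i - y i) \<le> 1" and e2: "env \<sigma>2" and y2: "\<forall>i<n. mem \<sigma>2 19 i = y i"
    using PROX_spec[OF e1 \<mu>1 L0] unfolding r21 J1 y_def[symmetric] \<sigma>2_def[symmetric] x_def by blast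
  have \<Lambda>m: "\<Lambda> \<le> Lm" using \<Lambda>(2) Lm[OF py] by linarith
  have \<Lambda>0: "0 < \<Lambda>" using \<mu>0 \<Lambda> by linarith
  have fP: "a \<in> {18, 19, 13, 16, 21} \<Longrightarrow> reg \<sigma>2 a = reg \<sigma>1 a" "a \<in> {12, 13} \<Longrightarrow> mem \<sigma>2 a = mem \<sigma>1 a" for a
    unfolding \<sigma>2_def by (rule run_reg_frame run_mem_frame; auto simp: PROX_def GRAD_def SHRINK_def NEWTON_def SOLVE_def SUMR_def)+
  have xS: "x \<in> colspace" by (simp add: x_def)
  have dx: "nrm (\<lambda>i. x i - z i) \<le> 1 + D"
  proof -
    have "nrm (\<lambda>i. x i - z i) = nrm (\<lambda>i. (x i - y i) + (y i - z i))" by (rule nrm_cong) simp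
    then show ?thesis using nrm_triangle[of "\<lambda>i. x i - y i" "\<lambda>i. y i - z i"] s1 dy by linarith
  qed
  note C3 = CHECK_spec[OF e2, of 16, folded \<sigma>3_def, simplified]
  have r3: "reg \<sigma>3 13 = K" "reg \<sigma>3 16 = 96 * ln B1" "reg \<sigma>3 18 = \<alpha>" "reg \<sigma>3 21 = \<mu>"
    by (simp_all add: C3 fP f1 r13 r16 r21 \<alpha>_def)
  have m3: "img \<sigma>3 12 = u" "img \<sigma>3 13 = v" "mem \<sigma>3 16 = mem \<sigma>2 16" "mem \<sigma>3 19 = mem \<sigma>2 19"
    by (simp_all add: C3 fP f1 u_def v_def)
  have e3: "env \<sigma>3" by (rule C3)
  from C3(1) consider "reg \<sigma>3 19 = 1" "found \<sigma>3" | "reg \<sigma>3 19 = 0" "1 < obj x"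
    by (auto simp: fP f1 f0 x_def)
  then show ?thesis
  proof cases
    case 1
    then have "run A STEP \<sigma> = \<sigma>3" by (simp add: r of_rat_divide)
    then show ?thesis using 1 e3 r3 by (simp add: ms_inv_def)
  next
    case 2
    then have ru: "run A STEP \<sigma> = run A UPDATE \<sigma>3" by (simp add: r of_rat_divide)
    define \<sigma>4 where "\<sigma>4 = run A GRAD \<sigma>3"
    define p where "p = img \<sigma>4 17"
    have x3: "img \<sigma>3 16 = x" by (simp add: x_def m3)
    have p: "is_grad x p" "reg \<sigma>4 22 = (nrm p)\<^sup>2" "\<forall>i<n. mem \<sigma>4 18 i = p i" "\<forall>i<n. mem \<sigma>4 8 i = x i"
      using GRAD_spec[OF e3] by (simp_all add: \<sigma>4_def p_def x3)
    have f4: "a \<noteq> 22 \<Longrightarrow> reg \<sigma>4 a = reg \<sigma>3 a" "a \<notin> {5, 6, 8, 17, 18} \<Longrightarrow> mem \<sigma>4 a = mem \<sigma>3 a" for a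
      by (simp_all add: \<sigma>4_def frame_GRAD)
    have e4: "env \<sigma>4" unfolding \<sigma>4_def by (rule env_GRAD[OF e3])
    define q where "q = ip n w p (\<lambda>i. y i - x i)"
    have "run A (SUMR 26 (At 3 [*] At 18 [*] (At 19 [-] At 8))) \<sigma>4 =
       \<sigma>4\<lparr>reg := (reg \<sigma>4)(26 := (\<Sum>i<n. mem \<sigma>4 3 i * mem \<sigma>4 18 i * (mem \<sigma>4 19 i - mem \<sigma>4 8 i)))\<rparr>"
      by (subst SUMR_run) simp_all
    also have "(\<Sum>i<n. mem \<sigma>4 3 i * mem \<sigma>4 18 i * (mem \<sigma>4 19 i - mem \<sigma>4 8 i)) = q"
      unfolding q_def ip_def using p e4 y2 by (intro sum.cong) (auto simp: env_def f4 m3)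
    finally have r5: "run A (SUMR 26 (At 3 [*] At 18 [*] (At 19 [-] At 8))) \<sigma>4 = \<sigma>4\<lparr>reg := (reg \<sigma>4)(26 := q)\<rparr>" .
    define \<gamma> where "\<gamma> = (if 2 * \<mu> * q < (nrm p)\<^sup>2 then \<mu> * q / (nrm p)\<^sup>2 else 1)"
    define \<sigma>6 where "\<sigma>6 = \<sigma>4\<lparr>reg := (reg \<sigma>4)(26 := q, 27 := \<gamma>)\<rparr>"
    have r6: "run A (Branch (Cst 2 [*] V 21 [*] V 26) (V 22) (Assign 27 (V 21 [*] V 26 [/] V 22)) (Assign 27 (Cst 1)))
       (\<sigma>4\<lparr>reg := (reg \<sigma>4)(26 := q)\<rparr>) = \<sigma>6"
      by (simp add: \<sigma>6_def \<gamma>_def f4 r3 p(2))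
    define \<sigma>7 where "\<sigma>7 = run A (Assign 18 (V 18 [*] (Cst 1 [+] V 27 [/] V 13)))
       (run A (Fill Cols 12 (((Cst 1 [-] V 27) [*] V 13 [*] At 12 [+] V 27 [*] (V 13 [+] Cst 1) [*] At 16) [/] (V 13 [+] V 27)))
       (run A (Fill Cols 13 (At 13 [-] V 27 [*] (V 18 [/] V 13) [*] At 17)) \<sigma>6))"
    have ru7: "run A STEP \<sigma> = run A (CHECK 12) \<sigma>7"
      unfolding ru UPDATE_def run.simps(8) \<sigma>4_def[symmetric] r5 r6 \<sigma>7_def ..
    have R6: "reg \<sigma>6 27 = \<gamma>" "reg \<sigma>6 13 = K" "reg \<sigma>6 18 = \<alpha>" "reg \<sigma>6 16 = 96 * ln B1" "reg \<sigma>6 11 = \<tau>" "reg \<sigma>6 19 = 0" "mem \<sigma>6 = mem \<sigma>4"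
      using e4 2 by (simp_all add: \<sigma>6_def f4 r3 env_def)
    have e7: "env \<sigma>7" using e4 by (simp add: \<sigma>7_def env_def R6)
    have R7: "reg \<sigma>7 18 = \<alpha> * (1 + \<gamma> / K)" "reg \<sigma>7 13 = K" "reg \<sigma>7 16 = 96 * ln B1" "reg \<sigma>7 19 = 0"
      by (simp_all add: \<sigma>7_def R6)
    define u' where "u' = (\<lambda>i. ((1 - \<gamma>) * K * u i + \<gamma> * (K + 1) * x i) / (K + \<gamma>))"
    define v' where "v' = (\<lambda>i. v i - \<gamma> * (\<alpha> / K) * p i)"
    have u7: "img \<sigma>7 12 = u'"
    proof -
      have "img \<sigma>7 12 = lin_app A (\<lambda>j. (1 - \<gamma>) * K / (K + \<gamma>) * mem \<sigma>3 12 j + \<gamma> * (K + 1) / (K + \<gamma>) * mem \<sigma>3 16 j)"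
        by (rule lin_app_cong) (simp add: \<sigma>7_def R6 f4 add_divide_distrib)
      then show ?thesis unfolding lin_app_lin x3 m3(1) u'_def by (simp add: add_divide_distrib)
    qed
    have v7: "img \<sigma>7 13 = v'"
    proof -
      have "img \<sigma>7 13 = lin_app A (\<lambda>j. 1 * mem \<sigma>3 13 j + (- (\<gamma> * (\<alpha> / K))) * mem \<sigma>4 17 j)"
        by (rule lin_app_cong) (simp add: \<sigma>7_def R6 f4)
      then show ?thesis unfolding lin_app_lin m3(2) v'_def p_def by simp
    qed
    \<comment> \<open>The residual bound is absolute, of order \<open>4 ^ (- J)\<close>; the lower
      bound of \<open>grad_ge\<close> on the gradient makes it relative.\<close>
    have res: "nrm (\<lambda>i. p i + \<Lambda> * (x i - y i)) \<le> nrm p / 2"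
    proof -
      have "nrm (\<lambda>i. p i + \<Lambda> * (x i - y i)) \<le> 1 / 16 / 4 ^ J * (2 * real n + \<Lambda>)"
        using residual_le[OF \<Lambda>0 c p(1) xS yS(1)] by simp
      also have "\<dots> \<le> 1 / 16 / 4 ^ J * (2 * F + Lm)" using n_le_F \<Lambda>m by (intro mult_left_mono) auto
      finally have r1: "nrm (\<lambda>i. p i + \<Lambda> * (x i - y i)) \<le> 1 / 16 / 4 ^ J * (2 * F + Lm)" .
      have "1 / 2 < nrm p * nrm (\<lambda>i. x i - z i)" by (rule grad_ge[OF p(1) xS z_in 2(2) z_obj])
      also have "\<dots> \<le> nrm p * (302 * R * F)"
        using dx D302 RF by (intro mult_left_mono) auto
      finally have "1 / 2 < nrm p * (302 * R * F)" .
      moreover have "nrm p * (604 * R * F) = 2 * (nrm p * (302 * R * F))" by simp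
      ultimately have g1: "1 \<le> nrm p * (604 * R * F)" by linarith
      have "2 * F + Lm \<le> 1500002 * R ^ 2 * F ^ 4"
        using mono_bound[of 0 2 1 4 2 2, simplified] unfolding Lm_def mult.assoc by linarith
      then have "(2 * F + Lm) * 1 \<le> (1500002 * R ^ 2 * F ^ 4) * (nrm p * (604 * R * F))"
        using g1 F_ge R_ge by (intro mult_mono) (auto simp: Lm_def)
      also have "\<dots> = nrm p * (906001208 * R ^ 3 * F ^ 5)"
      proof -
        have "F ^ 5 = F ^ 4 * F" "R ^ 3 = R ^ 2 * R" by (simp_all add: eval_nat_numeral)
        then show ?thesis by (simp add: mult_ac)
      qed
      also have "\<dots> \<le> nrm p * B1 ^ 6"
        unfolding B6 by (intro mult_left_mono mono_bound) auto
      also have "\<dots> \<le> nrm p * 4 ^ J" using power_le_exp(2) by (intro mult_left_mono) (auto simp: J_def)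
      finally have "1 / 16 / 4 ^ J * (2 * F + Lm) \<le> 1 / 16 / 4 ^ J * (nrm p * 4 ^ J)" by (intro mult_left_mono) auto
      also have "\<dots> = nrm p / 16" by simp
      also have "\<dots> \<le> nrm p / 2" by simp
      finally show ?thesis using r1 by linarith
    qed
    have qual: "(nrm p)\<^sup>2 \<le> 2 * \<mu> * q \<or> nrm p \<le> 12 * q"
      unfolding q_def by (rule prox_quality[OF p(1) \<mu>0 \<Lambda>(1) res s])
    have main: "0 \<le> \<gamma> \<and> \<gamma> \<le> 1 \<and> (\<exists>l' s'. Suc t = l' + s' \<and> pot z (\<alpha> * (1 + \<gamma> / K)) u' v' + real l' * (K\<^sup>2 / 288) \<le> R \<and>
        R / (2 * F) * (1 + 1 / K) ^ s' \<le> \<alpha> * (1 + \<gamma> / K))"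
    proof (cases "2 * \<mu> * q < (nrm p)\<^sup>2")
      case True
      then have q12: "nrm p \<le> 12 * q" using qual by linarith
      have \<gamma>: "\<gamma> = \<mu> * q / (nrm p)\<^sup>2" using True by (simp add: \<gamma>_def)
      note PD = pot_step_damped[OF yS(2,3) z_in xS K_ge \<alpha> p(1) y \<mu>_def, folded q_def, OF True q12 \<gamma>, folded u'_def v'_def]
      have "K\<^sup>2 \<le> (K + 1)\<^sup>2" using K_ge by (intro power_mono) auto
      then have k1: "K\<^sup>2 / 288 \<le> (K + 1)\<^sup>2 / 288" by (rule divide_right_mono) simp
      have k2: "real (Suc l) * (K\<^sup>2 / 288) = K\<^sup>2 / 288 + real l * (K\<^sup>2 / 288)" by (simp add: field_simps)
      have "pot z (\<alpha> * (1 + \<gamma> / K)) u' v' + real (Suc l) * (K\<^sup>2 / 288) \<le> R"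
        unfolding k2 using PD(3) ls(2) k1 by linarith
      moreover have "\<alpha> * 1 \<le> \<alpha> * (1 + \<gamma> / K)" using \<alpha> PD(1) K0 by (intro mult_left_mono) auto
      then have "R / (2 * F) * (1 + 1 / K) ^ s \<le> \<alpha> * (1 + \<gamma> / K)" using ls(3) by linarith
      moreover have "Suc t = Suc l + s" using ls(1) by simp
      ultimately show ?thesis using PD(1,2) by blast
    next
      case False
      then have \<gamma>: "\<gamma> = 1" by (simp add: \<gamma>_def)
      have "(nrm p)\<^sup>2 \<le> 2 * \<mu> * q" using False by simp
      note PF = pot_step_full[OF yS(2,3) z_in xS K_ge \<alpha> p(1) y \<mu>_def, folded q_def, OF this]
      have "u' = x" "v' = (\<lambda>i. v i - \<alpha> / K * p i)" using K0 by (auto simp: u'_def v'_def \<gamma>)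
      then have "pot z (\<alpha> * (1 + \<gamma> / K)) u' v' + real l * (K\<^sup>2 / 288) \<le> R" using PF ls(2) by (simp add: \<gamma>)
      moreover have "R / (2 * F) * (1 + 1 / K) ^ Suc s \<le> \<alpha> * (1 + \<gamma> / K)"
      proof -
        have "R / (2 * F) * (1 + 1 / K) ^ s * (1 + 1 / K) \<le> \<alpha> * (1 + 1 / K)"
          using ls(3) K0 by (intro mult_right_mono) auto
        then show ?thesis by (simp add: \<gamma> mult_ac)
      qed
      moreover have "Suc t = l + Suc s" using ls(1) by simp
      ultimately show ?thesis unfolding \<gamma> by (smt (verit))
    qed
    then have \<gamma>01: "0 \<le> \<gamma>" "\<gamma> \<le> 1" by auto
    \<comment> \<open>The new point is a convex combination of \<open>u\<close> and
      \<open>x\<close>, and \<open>x\<close> is within 1 of \<open>y\<close>; this is the drift of 1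
      per step.\<close>
    have du': "nrm (\<lambda>i. u' i - z i) \<le> D + 1"
    proof -
      let ?s = "(1 - \<gamma>) * K / (K + \<gamma>)" and ?t = "\<gamma> * (K + 1) / (K + \<gamma>)"
      have Kg: "0 < K + \<gamma>" using K0 \<gamma>01 by linarith
      have st: "0 \<le> ?s" "0 \<le> ?t" using K0 \<gamma>01 by auto
      have st1: "?s + ?t = 1" using Kg by (auto simp: add_divide_distrib[symmetric]) (auto simp: algebra_simps)
      have "nrm (\<lambda>i. u' i - z i) = nrm (\<lambda>i. ?s * (u i - z i) + ?t * (x i - z i))"
      proof (rule nrm_cong)
        fix i
        have "?s * (u i - z i) + ?t * (x i - z i) = ?s * u i + ?t * x i - (?s + ?t) * z i" by (simp only: algebra_simps)
        then show "u' i - z i = ?s * (u i - z i) + ?t * (x i - z i)"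
          unfolding st1 by (simp add: u'_def add_divide_distrib)
      qed
      also have "\<dots> \<le> nrm (\<lambda>i. ?s * (u i - z i)) + nrm (\<lambda>i. ?t * (x i - z i))" by (rule nrm_triangle)
      also have "\<dots> = ?s * nrm (\<lambda>i. u i - z i) + ?t * nrm (\<lambda>i. x i - z i)"
        unfolding nrm_scale[of ?s] nrm_scale[of ?t] using st by (simp only: abs_of_nonneg)
      also have "\<dots> \<le> ?s * (D + 1) + ?t * (D + 1)"
        using du dx st by (intro add_mono mult_left_mono) (auto simp: D_def)
      also have "\<dots> = D + 1" unfolding distrib_right[symmetric] st1 by simp
      finally show ?thesis .
    qed
    have \<alpha>': "0 < \<alpha> * (1 + \<gamma> / K)" using \<alpha> \<gamma>01 K0 by (intro mult_pos_pos add_pos_nonneg) auto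
    note C8 = CHECK_spec[OF e7, of 12, folded ru7, simplified]
    from C8(1) consider "reg (run A STEP \<sigma>) 19 = 1" "found (run A STEP \<sigma>)" | "reg (run A STEP \<sigma>) 19 = 0" "1 < obj u'"
      by (auto simp: R7 u7)
    then show ?thesis
    proof cases
      case 1
      then show ?thesis using C8 by (simp add: ms_inv_def R7)
    next
      case c2: 2
      have "img (run A STEP \<sigma>) 12 = u'" "img (run A STEP \<sigma>) 13 = v'" "reg (run A STEP \<sigma>) 18 = \<alpha> * (1 + \<gamma> / K)"
        by (simp_all add: C8 R7 u7 v7)
      then have "running (Suc t) (run A STEP \<sigma>)"
        unfolding running_def using c2 \<alpha>' main du' by (auto simp: D_def add_ac)
      then show ?thesis using C8 by (simp add: ms_inv_def R7)
    qed
  qed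
qed

text \<open>The number of steps lies within the drift allowance of \<open>STEP_spec\<close>, so the
  invariant survives the whole loop.\<close>

lemma steps_bound: "288 * K + 2 * K * ln (4 * F) + 3 \<le> 299 * R * F"
proof -
  have RF: "R * 1 \<le> R * F" using R_ge F_ge by (intro mult_left_mono) auto
  have KF: "K * F \<le> R * F" using K_le_R F_ge by (intro mult_right_mono) auto
  have "ln (4 * F) \<le> 4 * F" using ln_le_minus_one[of "4 * F"] F_ge by simp
  then have "K * ln (4 * F) \<le> K * (4 * F)" using K_ge by (intro mult_left_mono) auto
  then have "K * ln (4 * F) \<le> 4 * (K * F)" by simp
  then have "288 * K + 2 * (K * ln (4 * F)) + 3 \<le> 299 * (R * F)" using RF KF K_le_R R_ge by linarith
  then show ?thesis by (simp only: mult.assoc)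
qed

lemma STEP_loop:
  assumes "ms_inv 0 \<sigma>" "t \<le> nat \<lceil>288 * K + 2 * K * ln (4 * F) + 2\<rceil>"
  shows "ms_inv t ((run A STEP ^^ t) \<sigma>)"
  using assms(2)
proof (induction t)
  case (Suc t)
  have p: "0 \<le> 288 * K + 2 * K * ln (4 * F) + 2"
    using K_ge F_ge by (intro add_nonneg_nonneg mult_nonneg_nonneg) auto
  have "real t \<le> 288 * K + 2 * K * ln (4 * F) + 3" using Suc.prems p by linarith
  then have "real t \<le> 299 * R * F" using steps_bound by linarith
  then show ?case using STEP_spec[OF Suc.IH] Suc.prems by simp
qed (use assms in simp)

text \<open>The initial potential \<open>R = K^3\<close> pays for at most \<open>288 K\<close>
  damped steps. Full steps raise \<open>\<alpha>\<close> from \<open>R / (2 F)\<close> to at most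
  \<open>2 R\<close>, a factor \<open>4 F\<close>, and since
  \<open>ln (1 + 1 / K) \<ge> 1 / (2 K)\<close> there are at most \<open>2 K ln (4 F)\<close> of
  them.\<close>

lemma not_running:
  assumes "t = nat \<lceil>288 * K + 2 * K * ln (4 * F) + 2\<rceil>"
  shows "\<not> running t \<sigma>"
proof
  assume run: "running t \<sigma>"
  let ?\<alpha> = "reg \<sigma> 18" and ?P = "pot z (reg \<sigma> 18) (img \<sigma> 12) (img \<sigma> 13)"
  obtain l s where ls: "t = l + s" "?P + real l * (K\<^sup>2 / 288) \<le> R" "R / (2 * F) * (1 + 1 / K) ^ s \<le> ?\<alpha>"
    using run by (auto simp: running_def)
  have "0 \<le> ?P"
    unfolding pot_def using run z_obj by (intro add_nonneg_nonneg mult_nonneg_nonneg) (auto simp: running_def)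
  then have "real l * (K\<^sup>2 / 288) \<le> R" using ls(2) by linarith
  then have "real l * K\<^sup>2 \<le> 288 * K * K\<^sup>2" using K_cube by (simp add: power3_eq_cube power2_eq_square)
  then have l: "real l \<le> 288 * K" using K_ge by simp
  have "R / (2 * F) * (1 + 1 / K) ^ s \<le> 2 * R" using ls(3) pot_bounds(1)[OF run] by linarith
  then have "(1 + 1 / K) ^ s \<le> 4 * F" using R_ge F_ge by (simp add: field_simps)
  then have "ln ((1 + 1 / K) ^ s) \<le> ln (4 * F)" using K_ge F_ge by (subst ln_le_cancel_iff) (auto intro!: zero_less_power add_pos_pos)
  then have "real s * ln (1 + 1 / K) \<le> ln (4 * F)" using K_ge by (subst (asm) ln_realpow) (auto intro: add_pos_pos)
  moreover have "real s * (1 / (2 * K)) \<le> real s * ln (1 + 1 / K)"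
  proof (intro mult_left_mono)
    have K1: "1 + 1 / K = (K + 1) / K" using K_ge by (simp add: add_divide_distrib)
    have "ln (K / (K + 1)) \<le> K / (K + 1) - 1" using K_ge by (intro ln_le_minus_one) auto
    moreover have "ln (K / (K + 1)) = - ln (1 + 1 / K)" unfolding K1 using K_ge by (simp add: ln_div)
    moreover have "K / (K + 1) - 1 = - (1 / (K + 1))" using K_ge by (simp add: field_simps)
    moreover have "1 / (2 * K) \<le> 1 / (K + 1)" using K_ge by (intro divide_left_mono) auto
    ultimately show "1 / (2 * K) \<le> ln (1 + 1 / K)" by linarith
  qed simp
  ultimately have "real s * (1 / (2 * K)) \<le> ln (4 * F)" by linarith
  then have "real s \<le> 2 * K * ln (4 * F)" using K_ge by (simp add: field_simps)
  then have "real t \<le> 288 * K + 2 * K * ln (4 * F)" using l ls(1) by simp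
  moreover have "288 * K + 2 * K * ln (4 * F) + 2 \<le> real t" using assms by linarith
  ultimately show False by linarith
qed

end

section \<open>Soundness of the success flag\<close>

context engine
begin

text \<open>In contrast to \<open>ms_inv\<close> this refers to no comparison point: a raised flag
  comes with a solution even when the trial level lies below the optimum.\<close>

definition flag_inv :: "store \<Rightarrow> bool" where
  "flag_inv \<sigma> \<longleftrightarrow> env \<sigma> \<and> (reg \<sigma> 19 = 0 \<or> (reg \<sigma> 19 = 1 \<and> found \<sigma>))"

lemma env_frame:
  assumes "env \<sigma>" "11 \<notin> wr_reg c" "3 \<notin> wr_mem c" "11 \<notin> wr_mem c"
  shows "env (run A c \<sigma>)"
  using assms by (simp add: env_def run_reg_frame run_mem_frame)

lemma CHECK_flag: "env \<sigma> \<Longrightarrow> reg \<sigma> 19 = 0 \<Longrightarrow> a \<notin> {8, 14} \<Longrightarrow> flag_inv (run A (CHECK a) \<sigma>)"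
  using CHECK_spec[of \<sigma> a] by (auto simp: flag_inv_def)

lemma STEP_flag: "flag_inv \<sigma> \<Longrightarrow> flag_inv (run A STEP \<sigma>)"
proof (cases "reg \<sigma> 19 = 1")
  case True
  then have "run A STEP \<sigma> = \<sigma>" by (simp add: STEP_def of_rat_divide)
  then show "flag_inv \<sigma> \<Longrightarrow> flag_inv (run A STEP \<sigma>)" by simp
next
  case False
  assume I: "flag_inv \<sigma>"
  then have e: "env \<sigma>" and f0: "reg \<sigma> 19 = 0" using False by (auto simp: flag_inv_def)
  define c1 where "c1 = Assign 21 (V 13 [*] (V 13 [+] Cst 1) [/] V 18) ;;
      Fill Cols 15 ((V 13 [*] At 12 [+] At 13) [/] (V 13 [+] Cst 1)) ;; PROX"
  have w1: "11 \<notin> wr_reg c1" "19 \<notin> wr_reg c1" "3 \<notin> wr_mem c1" "11 \<notin> wr_mem c1"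
    by (simp_all add: c1_def block_defs)
  define \<sigma>1 where "\<sigma>1 = run A (CHECK 16) (run A c1 \<sigma>)"
  have r: "run A STEP \<sigma> = run A (Branch (V 19) (Cst (1/2)) UPDATE Nop) \<sigma>1"
    using f0 by (simp only: STEP_def run.simps(8,9) \<sigma>1_def c1_def) (simp add: of_rat_divide)
  have i1: "flag_inv \<sigma>1"
    unfolding \<sigma>1_def using w1 e f0 by (intro CHECK_flag env_frame) (auto simp: run_reg_frame)
  show "flag_inv (run A STEP \<sigma>)"
  proof (cases "reg \<sigma>1 19 = 1")
    case True
    then show ?thesis using i1 by (simp add: r of_rat_divide)
  next
    case False
    then have f1: "reg \<sigma>1 19 = 0" "env \<sigma>1" using i1 by (auto simp: flag_inv_def)
    define c2 where "c2 = GRAD ;; SUMR 26 (At 3 [*] At 18 [*] (At 19 [-] At 8)) ;;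
     Branch (Cst 2 [*] V 21 [*] V 26) (V 22) (Assign 27 (V 21 [*] V 26 [/] V 22)) (Assign 27 (Cst 1)) ;;
     Fill Cols 13 (At 13 [-] V 27 [*] (V 18 [/] V 13) [*] At 17) ;;
     Fill Cols 12 (((Cst 1 [-] V 27) [*] V 13 [*] At 12 [+] V 27 [*] (V 13 [+] Cst 1) [*] At 16) [/] (V 13 [+] V 27)) ;;
     Assign 18 (V 18 [*] (Cst 1 [+] V 27 [/] V 13))"
    have w2: "11 \<notin> wr_reg c2" "19 \<notin> wr_reg c2" "3 \<notin> wr_mem c2" "11 \<notin> wr_mem c2"
      by (simp_all add: c2_def block_defs)
    have "run A STEP \<sigma> = run A (CHECK 12) (run A c2 \<sigma>1)"
      using f1 unfolding r by (simp add: of_rat_divide) (simp only: UPDATE_def c2_def run.simps(8))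
    then show ?thesis using w2 f1 by (auto intro!: CHECK_flag env_frame simp: run_reg_frame)
  qed
qed

lemma STEP_loop_flag: "flag_inv \<sigma> \<Longrightarrow> flag_inv ((run A STEP ^^ k) \<sigma>)"
  by (induction k) (auto intro: STEP_flag)

end

section \<open>Least squares start, decision procedure and bisection\<close>

context regression
begin

text \<open>The lower bound on the total holds for the uniform start and persists because weights
  only grow. It allows \<open>sqrt W\<close> to be replaced by \<open>W\<close>.\<close>

definition good :: "(nat \<Rightarrow> real) \<Rightarrow> bool" where
  "good w \<longleftrightarrow> (\<forall>i<n. 0 < w i) \<and> (\<forall>i<n. \<not> bad w i) \<and> 1 \<le> (\<Sum>i<n. w i)"

definition res :: "(nat \<Rightarrow> real) \<Rightarrow> (nat \<Rightarrow> real) \<Rightarrow> real" where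
  "res b x = max_abs n (\<lambda>i. lin_app A x i - b i)"

lemma res_le_iff: "0 \<le> c \<Longrightarrow> res b x \<le> c \<longleftrightarrow> (\<forall>i<n. \<bar>lin_app A x i - b i\<bar> \<le> c)"
  unfolding res_def by (rule max_abs_le_iff)

lemma res_nonneg: "0 \<le> res b x"
  unfolding res_def by (rule max_abs_nonneg)

lemma abs_le_res: "i < n \<Longrightarrow> \<bar>lin_app A x i - b i\<bar> \<le> res b x"
  unfolding res_def by (rule max_abs_ge)

lemma good_engine:
  assumes "good w" "0 \<le> \<tau>"
  shows "engine A T es n d w \<tau>"
proof unfold_locales
  fix u v :: "nat \<Rightarrow> real" and a c assume "u \<in> colspace" "v \<in> colspace"
  then show "(\<lambda>i. a * u i + c * v i) \<in> colspace" by (rule colspace_lin)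
next
  show "\<forall>i<n. 0 < w i" using assms by (simp add: good_def)
  fix z i assume "z \<in> colspace" "i < n"
  then show "(z i)\<^sup>2 \<le> ip n w z z" using assms by (force simp: good_def bad_def not_less)
next
  fix D r :: "nat \<Rightarrow> real" assume D: "\<forall>i<n. 0 < D i"
  show "\<exists>h\<in>colspace. \<forall>z\<in>colspace. ip n D h z = (\<Sum>i<n. r i * z i)"
    using solve_arr_adj[OF D, of "lin_adj A r" r _ "\<lambda>_. 0"]
    by (intro bexI[of _ "lin_app A (solve_arr A D (lin_adj A r) (\<lambda>_. 0))"]) auto
qed (use assms in auto)

definition wls :: "(nat \<Rightarrow> real) \<Rightarrow> (nat \<Rightarrow> real) \<Rightarrow> (nat \<Rightarrow> real) \<Rightarrow> bool" where
  "wls w b x \<longleftrightarrow> (\<forall>u\<in>colspace. ip n w (lin_app A x) u = (\<Sum>i<n. w i * b i * u i))"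

text \<open>Pythagoras: the residual of the weighted least squares solution is orthogonal to the
  column space, so its distance to any \<open>y\<close> is at most the weighted norm of the residual
  of \<open>y\<close>.\<close>

lemma wls_dist:
  assumes w: "\<forall>i<n. 0 < w i" and x: "wls w b x"
  shows "ip n w (\<lambda>i. lin_app A y i - lin_app A x i) (\<lambda>i. lin_app A y i - lin_app A x i) \<le> (\<Sum>i<n. w i) * (res b y)\<^sup>2"
proof -
  have w0: "\<forall>i<n. 0 \<le> w i" using w by (auto intro: less_imp_le)
  let ?r = "\<lambda>i. lin_app A y i - b i" and ?s = "\<lambda>i. lin_app A x i - b i" and ?d = "\<lambda>i. lin_app A y i - lin_app A x i"
  have dS: "?d \<in> colspace" using colspace_lin[of "lin_app A y" "lin_app A x" 1 "-1"] by simp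
  have o: "ip n w ?s ?d = 0"
  proof -
    have "ip n w ?s ?d = ip n w (lin_app A x) ?d - (\<Sum>i<n. w i * b i * ?d i)"
      unfolding ip_def sum_subtractf[symmetric] by (intro sum.cong) (auto simp: algebra_simps)
    then show ?thesis using x dS by (simp add: wls_def)
  qed
  have "ip n w ?r ?r = ip n w ?s ?s + 2 * ip n w ?s ?d + ip n w ?d ?d"
    unfolding ip_def sum_distrib_left sum.distrib[symmetric] by (intro sum.cong) (auto simp: algebra_simps)
  then have "ip n w ?d ?d \<le> ip n w ?r ?r" using o ip_nonneg[OF w0, of ?s] by simp
  also have "\<dots> \<le> (\<Sum>i<n. w i * (res b y)\<^sup>2)"
    unfolding ip_def
  proof (rule sum_mono)
    fix i assume "i \<in> {..<n}"
    then have i: "i < n" by simp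
    have "\<bar>?r i\<bar>\<^sup>2 \<le> (res b y)\<^sup>2" using abs_le_res[OF i] by (intro power_mono) auto
    then have "w i * (?r i)\<^sup>2 \<le> w i * (res b y)\<^sup>2" using w0 i by (intro mult_left_mono) auto
    then show "w i * ?r i * ?r i \<le> w i * (res b y)\<^sup>2" by (simp add: power2_eq_square mult.assoc)
  qed
  also have "\<dots> = (\<Sum>i<n. w i) * (res b y)\<^sup>2" by (simp add: sum_distrib_right)
  finally show ?thesis .
qed

text \<open>Good weights bound the maximum norm of the difference by its weighted norm, hence by
  \<open>sqrt W\<close> times the residual of \<open>y\<close>. This gives bisection a starting
  interval of ratio \<open>2 + W\<close>.\<close>

lemma wls_res:
  assumes w: "good w" and x: "wls w b x"
  shows "res b x \<le> (2 + (\<Sum>i<n. w i)) * res b y"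
proof -
  let ?W = "\<Sum>i<n. w i"
  have W: "1 \<le> ?W" and w0: "\<forall>i<n. 0 < w i" using w by (auto simp: good_def)
  let ?d = "\<lambda>i. lin_app A y i - lin_app A x i"
  have dS: "?d \<in> colspace" using colspace_lin[of "lin_app A y" "lin_app A x" 1 "-1"] by simp
  have "\<bar>lin_app A x i - b i\<bar> \<le> (2 + ?W) * res b y" if i: "i < n" for i
  proof -
    have "(?d i)\<^sup>2 \<le> ip n w ?d ?d" using w i dS by (force simp: good_def bad_def not_less)
    also have "\<dots> \<le> ?W * (res b y)\<^sup>2" by (rule wls_dist[OF w0 x])
    also have "\<dots> \<le> ?W * ?W * (res b y)\<^sup>2" using W by (intro mult_right_mono) (auto simp: mult_le_cancel_left1)
    also have "\<dots> = (?W * res b y)\<^sup>2" by (simp add: power2_eq_square mult_ac)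
    finally have "\<bar>?d i\<bar> \<le> ?W * res b y"
      using W res_nonneg[of b y] by (metis abs_le_square_iff abs_of_nonneg mult_nonneg_nonneg order.trans zero_le_one)
    moreover have "\<bar>lin_app A y i - b i\<bar> \<le> res b y" by (rule abs_le_res[OF i])
    ultimately have "\<bar>lin_app A x i - b i\<bar> \<le> ?W * res b y + res b y" by linarith
    also have "\<dots> \<le> (2 + ?W) * res b y" using res_nonneg[of b y] by (simp add: algebra_simps)
    finally show ?thesis .
  qed
  then show ?thesis using W res_nonneg[of b y] by (subst res_le_iff) auto
qed

definition params :: "real \<Rightarrow> real \<Rightarrow> store \<Rightarrow> bool" where
  "params W \<epsilon> \<sigma> \<longleftrightarrow> reg \<sigma> 8 = \<epsilon> \<and> reg \<sigma> 9 = ln (4 * real n) \<and> reg \<sigma> 10 = reg \<sigma> 9 / \<epsilon> \<and> reg \<sigma> 11 = reg \<sigma> 10 + reg \<sigma> 9 \<and>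
     reg \<sigma> 12 = W * reg \<sigma> 10 * reg \<sigma> 10 \<and> reg \<sigma> 13 = exp (ln (reg \<sigma> 12) / 3) \<and>
     reg \<sigma> 14 = 2 * real n * (1 + (4 + W) * reg \<sigma> 10) * (1 + (4 + W) * reg \<sigma> 10) \<and>
     reg \<sigma> 15 = 288 * reg \<sigma> 13 + 2 * reg \<sigma> 13 * ln (4 * reg \<sigma> 14) + 2 \<and>
     reg \<sigma> 16 = 96 * ln (2000 * reg \<sigma> 12 * reg \<sigma> 14) \<and> reg \<sigma> 17 = reg \<sigma> 12 / (2 * reg \<sigma> 14)"

lemma ln4n: "1 \<le> ln (4 * real n)"
proof -
  have "exp 1 \<le> 4 * real n" using exp_le n_pos by (simp add: order.trans[of _ "4 :: real"])
  then show ?thesis using n_pos by (subst ln_ge_iff) auto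
qed

lemma params_facts:
  assumes p: "params W \<epsilon> \<sigma>" and W: "1 \<le> W" and \<epsilon>: "0 < \<epsilon>" "\<epsilon> \<le> 1 / 6"
  shows "6 \<le> reg \<sigma> 10" "reg \<sigma> 9 \<le> reg \<sigma> 10" "reg \<sigma> 10 \<le> reg \<sigma> 12" "1 \<le> reg \<sigma> 13" "reg \<sigma> 13 ^ 3 = reg \<sigma> 12"
    "1 \<le> reg \<sigma> 14" "real n \<le> reg \<sigma> 14"
proof -
  let ?g = "reg \<sigma> 10" and ?L = "reg \<sigma> 9"
  have L: "1 \<le> ?L" using p ln4n by (simp add: params_def)
  have ge: "?g = ?L / \<epsilon>" using p by (simp add: params_def)
  have "6 * ?L \<le> ?L / \<epsilon>"
  proof -
    have "6 * ?L * \<epsilon> \<le> 6 * ?L * (1 / 6)" using \<epsilon> L by (intro mult_left_mono) auto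
    then show ?thesis using \<epsilon> by (simp add: le_divide_eq)
  qed
  then show g6: "6 \<le> ?g" and "?L \<le> ?g" using L unfolding ge by linarith+
  have R: "reg \<sigma> 12 = W * ?g * ?g" using p by (simp add: params_def)
  have "?g * 1 * 1 \<le> ?g * ?g * W" using g6 W by (intro mult_mono) auto
  then show gR: "?g \<le> reg \<sigma> 12" unfolding R by (simp add: mult_ac)
  then have R1: "1 \<le> reg \<sigma> 12" using g6 by linarith
  have K: "reg \<sigma> 13 = exp (ln (reg \<sigma> 12) / 3)" using p by (simp add: params_def)
  show "1 \<le> reg \<sigma> 13" unfolding K using R1 by simp
  have "exp (ln (reg \<sigma> 12) / 3) ^ 3 = exp (real 3 * (ln (reg \<sigma> 12) / 3))" by (rule exp_of_nat_mult[symmetric])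
  then show "reg \<sigma> 13 ^ 3 = reg \<sigma> 12" unfolding K using R1 by simp
  have F: "reg \<sigma> 14 = 2 * real n * ((1 + (4 + W) * ?g) * (1 + (4 + W) * ?g))" using p by (simp add: params_def mult.assoc)
  have "1 \<le> 1 + (4 + W) * ?g" using g6 W by simp
  then have "1 * 1 \<le> (1 + (4 + W) * ?g) * (1 + (4 + W) * ?g)" by (intro mult_mono) auto
  then have "2 * real n * 1 \<le> reg \<sigma> 14" unfolding F by (intro mult_left_mono) auto
  then show "1 \<le> reg \<sigma> 14" "real n \<le> reg \<sigma> 14" using n_pos by linarith+
qed

text \<open>The second claim is soundness and comes from \<open>flag_inv\<close>. The third is
  completeness: \<open>x\<close>, scaled by \<open>1 / \<eta>\<close>, is the comparison point of
  the accelerated method.\<close>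

lemma DECIDE_spec:
  fixes \<sigma> :: store
  defines "\<sigma>' \<equiv> run A DECIDE \<sigma>" and "w \<equiv> mem \<sigma> 3" and "b \<equiv> mem \<sigma> 1" and "\<eta> \<equiv> reg \<sigma> 28"
  assumes good: "good w" and p: "params (\<Sum>i<n. w i) \<epsilon> \<sigma>" and \<epsilon>: "0 < \<epsilon>" "\<epsilon> \<le> 1 / 6" and \<eta>: "0 < \<eta>"
    and x0: "wls w b (mem \<sigma> 10)" "res b (mem \<sigma> 10) \<le> (2 + (\<Sum>i<n. w i)) * (reg \<sigma> 10 * \<eta>)"
  shows "reg \<sigma>' 19 = 0 \<or> reg \<sigma>' 19 = 1"
    and "reg \<sigma>' 19 = 1 \<Longrightarrow> \<forall>i<n. \<bar>lin_app A (mem \<sigma>' 14) i - b i / \<eta>\<bar> \<le> reg \<sigma> 11"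
    and "res b x \<le> reg \<sigma> 10 * \<eta> \<Longrightarrow> reg \<sigma>' 19 = 1"
proof -
  let ?W = "\<Sum>i<n. w i"
  have W: "1 \<le> ?W" using good by (simp add: good_def)
  note pf = params_facts[OF p W \<epsilon>]
  define \<sigma>1 where "\<sigma>1 = run A (Fill Rows 11 (At 1 [/] V 28) ;; Fill Cols 12 (At 10 [/] V 28) ;; Fill Cols 13 (At 12) ;;
     Assign 18 (V 17) ;; Assign 19 (Cst 0)) \<sigma>"
  define \<sigma>2 where "\<sigma>2 = run A (CHECK 12) \<sigma>1"
  define b' where "b' = mem \<sigma>1 11"
  define \<tau> where "\<tau> = reg \<sigma> 11"
  have b': "b' i = b i / \<eta>" if "i < n" for i using that by (simp add: b'_def \<sigma>1_def b_def \<eta>_def)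
  have r1: "x \<noteq> 18 \<Longrightarrow> x \<noteq> 19 \<Longrightarrow> reg \<sigma>1 x = reg \<sigma> x" "reg \<sigma>1 18 = reg \<sigma> 17" "reg \<sigma>1 19 = 0" for x
    by (auto simp: \<sigma>1_def)
  have \<tau>0: "0 \<le> \<tau>" using pf p ln4n by (simp add: \<tau>_def params_def)
  interpret E: engine A T es n d w b' \<tau> by (rule good_engine[OF good \<tau>0])
  have w1: "mem \<sigma>1 3 = w" by (simp add: \<sigma>1_def w_def)
  have e1: "E.env \<sigma>1" unfolding E.env_def using w1 r1(1)[of 11] by (simp add: b'_def[symmetric] \<tau>_def)
  have i2: "E.flag_inv \<sigma>2" unfolding \<sigma>2_def using e1 r1 by (intro E.CHECK_flag) auto
  have r2: "x \<noteq> 18 \<Longrightarrow> x \<noteq> 19 \<Longrightarrow> x \<noteq> 20 \<Longrightarrow> reg \<sigma>2 x = reg \<sigma> x" "reg \<sigma>2 18 = reg \<sigma> 17" for x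
    using E.CHECK_spec(2)[OF e1, of 12] by (simp_all add: \<sigma>2_def r1)
  let ?N = "nat \<lceil>reg \<sigma> 15\<rceil>"
  have s': "\<sigma>' = (run A STEP ^^ ?N) \<sigma>2"
  proof -
    have "\<sigma>' = run A (Loop (V 15) STEP) \<sigma>2"
      by (simp only: \<sigma>'_def DECIDE_def \<sigma>2_def \<sigma>1_def run.simps(8))
    then show ?thesis by (simp add: r2)
  qed
  have fi: "E.flag_inv \<sigma>'" unfolding s' by (rule E.STEP_loop_flag[OF i2])
  then show "reg \<sigma>' 19 = 0 \<or> reg \<sigma>' 19 = 1" by (auto simp: E.flag_inv_def)
  show "\<forall>i<n. \<bar>lin_app A (mem \<sigma>' 14) i - b i / \<eta>\<bar> \<le> reg \<sigma> 11" if "reg \<sigma>' 19 = 1"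
    using fi that b' unfolding E.flag_inv_def E.found_def by (auto simp: \<tau>_def)
  show "reg \<sigma>' 19 = 1" if x: "res b x \<le> reg \<sigma> 10 * \<eta>"
  proof -
    define g where "g = reg \<sigma> 10"
    define z where "z = (\<lambda>i. 1 / \<eta> * lin_app A x i + 0 * lin_app A x i)"
    have zS: "z \<in> colspace" unfolding z_def by (intro colspace_lin) auto
    have zl: "\<bar>z i - b' i\<bar> \<le> g" if i: "i < n" for i
    proof -
      have "z i - b' i = (lin_app A x i - b i) / \<eta>" using b'[OF i] by (simp add: z_def diff_divide_distrib)
      then have "\<bar>z i - b' i\<bar> = \<bar>lin_app A x i - b i\<bar> / \<eta>" using \<eta> by simp
      also have "\<dots> \<le> (g * \<eta>) / \<eta>" using abs_le_res[OF i, of x b] x \<eta> by (intro divide_right_mono) (auto simp: g_def)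
      finally show ?thesis using \<eta> by simp
    qed
    have g0: "6 \<le> g" using pf by (simp add: g_def)
    have \<tau>g: "\<tau> = g + ln (4 * real n)" using p by (simp add: \<tau>_def g_def params_def)
    \<comment> \<open>Each of the \<open>n\<close> penalties is at most
      \<open>2 exp (- ln (4 n)) = 1 / (2 n)\<close>; this is what fixes the gap between
      \<open>g\<close> and \<open>\<tau>\<close>.\<close>
    have zo: "E.obj z \<le> 1 / 2"
    proof -
      have "E.obj z \<le> (\<Sum>i<n. 2 * exp (g - \<tau>))"
        unfolding E.obj_def using zl ln4n by (intro sum_mono phi_small) (auto simp: \<tau>g)
      also have "\<dots> = 2 * real n * exp (- ln (4 * real n))" by (simp add: \<tau>g)
      also have "exp (- ln (4 * real n)) = 1 / (4 * real n)" using n_pos by (simp add: exp_minus inverse_eq_divide)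
      finally show ?thesis using n_pos by simp
    qed
    interpret M: accelerated A T es n d w b' \<tau> z "reg \<sigma> 13" "reg \<sigma> 12" "reg \<sigma> 14" g
      by unfold_locales (use zS zo zl pf in \<open>auto simp: g_def\<close>)
    define u0 where "u0 = lin_app A (mem \<sigma>1 12)"
    have u0: "u0 = (\<lambda>i. 1 / \<eta> * lin_app A (mem \<sigma> 10) i + 0 * lin_app A (mem \<sigma> 10) i)"
    proof -
      have "u0 = lin_app A (\<lambda>j. 1 / \<eta> * mem \<sigma> 10 j + 0 * mem \<sigma> 10 j)"
        unfolding u0_def by (rule lin_app_cong) (simp add: \<sigma>1_def \<eta>_def)
      then show ?thesis unfolding lin_app_lin .
    qed
    have v0: "lin_app A (mem \<sigma>1 13) = u0" unfolding u0_def by (rule lin_app_cong) (simp add: \<sigma>1_def)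
    have R: "reg \<sigma> 12 = ?W * g\<^sup>2" using p by (simp add: params_def g_def power2_eq_square)
    have dist: "(E.nrm (\<lambda>i. u0 i - z i))\<^sup>2 \<le> reg \<sigma> 12"
    proof -
      let ?d = "\<lambda>i. lin_app A x i - lin_app A (mem \<sigma> 10) i"
      have "(\<lambda>i. u0 i - z i) = (\<lambda>i. (- 1 / \<eta>) * ?d i)" unfolding u0 z_def by (auto simp: diff_divide_distrib)
      then have "(E.nrm (\<lambda>i. u0 i - z i))\<^sup>2 = (\<bar>- 1 / \<eta>\<bar> * E.nrm ?d)\<^sup>2" by (simp only: E.nrm_scale)
      also have "\<dots> = (1 / \<eta>)\<^sup>2 * ip n w ?d ?d" by (simp add: power_mult_distrib E.nrm_sq power_divide)
      also have "\<dots> \<le> (1 / \<eta>)\<^sup>2 * (?W * (res b x)\<^sup>2)"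
        using good by (intro mult_left_mono wls_dist[OF _ x0(1)]) (auto simp: good_def)
      also have "\<dots> \<le> (1 / \<eta>)\<^sup>2 * (?W * (g * \<eta>)\<^sup>2)"
        using x W res_nonneg[of b x] by (intro mult_left_mono power_mono) (auto simp: g_def)
      also have "\<dots> = reg \<sigma> 12" using \<eta> by (simp add: R power_mult_distrib power_divide)
      finally show ?thesis .
    qed
    \<comment> \<open>\<open>(2 + W) g\<close> bounds the initial residual and \<open>2 g\<close>
      the threshold \<open>\<tau>\<close>; together they are the factor \<open>4 + W\<close> in
      register 14.\<close>
    have ob: "E.obj u0 \<le> reg \<sigma> 14"
    proof -
      have "E.obj u0 \<le> (\<Sum>i<n. 2 * (1 + (4 + ?W) * g)\<^sup>2)"
        unfolding E.obj_def
      proof (rule sum_mono)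
        fix i assume "i \<in> {..<n}"
        then have i: "i < n" by simp
        have "u0 i - b' i = (lin_app A (mem \<sigma> 10) i - b i) / \<eta>" using b'[OF i] by (simp add: u0 diff_divide_distrib)
        then have "\<bar>u0 i - b' i\<bar> = \<bar>lin_app A (mem \<sigma> 10) i - b i\<bar> / \<eta>" using \<eta> by simp
        also have "\<dots> \<le> ((2 + ?W) * (g * \<eta>)) / \<eta>"
          using abs_le_res[OF i, of "mem \<sigma> 10" b] x0(2) \<eta> by (intro divide_right_mono) (auto simp: g_def)
        also have "\<dots> = (2 + ?W) * g" using \<eta> by simp
        finally have a: "\<bar>u0 i - b' i\<bar> \<le> (2 + ?W) * g" .
        have "\<tau> \<le> 2 * g" using pf(2) p by (simp add: \<tau>_def g_def params_def)
        then have "1 + \<bar>u0 i - b' i\<bar> + \<tau> \<le> 1 + ((2 + ?W) * g + 2 * g)" using a by linarith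
        also have "\<dots> = 1 + (4 + ?W) * g" by (simp add: algebra_simps)
        finally have "(1 + \<bar>u0 i - b' i\<bar> + \<tau>)\<^sup>2 \<le> (1 + (4 + ?W) * g)\<^sup>2" using \<tau>0 by (intro power_mono) auto
        then show "phi \<tau> (u0 i - b' i) \<le> 2 * (1 + (4 + ?W) * g)\<^sup>2" using phi_le[OF \<tau>0, of "u0 i - b' i"] by linarith
      qed
      also have "\<dots> = reg \<sigma> 14" using p by (simp add: params_def g_def power2_eq_square)
      finally show ?thesis .
    qed
    have inv: "M.ms_inv 0 \<sigma>2"
    proof -
      have e2: "E.env \<sigma>2" using i2 by (simp add: E.flag_inv_def)
      have m2: "lin_app A (mem \<sigma>2 12) = u0" "lin_app A (mem \<sigma>2 13) = u0"
        using E.CHECK_spec(3)[OF e1, of 12] by (simp_all add: \<sigma>2_def u0_def v0)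
      have R1: "1 \<le> reg \<sigma> 12" by (rule M.R_ge)
      have "M.running 0 \<sigma>2" if f: "reg \<sigma>2 19 \<noteq> 1"
      proof -
        have f0: "reg \<sigma>2 19 = 0" and o1: "1 < E.obj u0"
          using E.CHECK_spec(1)[OF e1, of 12] f by (auto simp: \<sigma>2_def[symmetric] r1 u0_def)
        have \<alpha>: "reg \<sigma>2 18 = reg \<sigma> 12 / (2 * reg \<sigma> 14)" using p by (simp add: r2 params_def)
        have \<alpha>0: "0 < reg \<sigma>2 18" unfolding \<alpha> using R1 pf by simp
        have "reg \<sigma>2 18 * (E.obj u0 - E.obj z) \<le> reg \<sigma>2 18 * reg \<sigma> 14"
        proof (intro mult_left_mono)
          have "0 \<le> E.obj z" unfolding E.obj_def by (intro sum_nonneg) (auto intro: less_imp_le phi_pos)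
          then show "E.obj u0 - E.obj z \<le> reg \<sigma> 14" using ob by linarith
        qed (use \<alpha>0 in simp)
        also have "\<dots> = reg \<sigma> 12 / 2" unfolding \<alpha> using pf by simp
        finally have "E.pot z (reg \<sigma>2 18) u0 u0 \<le> reg \<sigma> 12" using dist unfolding E.pot_def by linarith
        moreover have "E.nrm (\<lambda>i. u0 i - z i) \<le> 2 * reg \<sigma> 12"
        proof (rule power2_le_imp_le)
          have "reg \<sigma> 12 * 1 \<le> (2 * reg \<sigma> 12) * (2 * reg \<sigma> 12)" using R1 by (intro mult_mono) auto
          then show "(E.nrm (\<lambda>i. u0 i - z i))\<^sup>2 \<le> (2 * reg \<sigma> 12)\<^sup>2" using dist by (simp add: power2_eq_square)
        qed (use R1 in simp)
        ultimately show ?thesis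
          unfolding M.running_def using f0 o1 \<alpha>0 \<alpha> by (simp add: m2)
      qed
      moreover have "reg \<sigma>2 16 = 96 * ln M.B1"
      proof -
        have "reg \<sigma> 16 = 96 * ln (2000 * reg \<sigma> 12 * reg \<sigma> 14)" using p unfolding params_def by blast
        then show ?thesis unfolding M.B1_def using r2(1)[of 16] by simp
      qed
      ultimately show ?thesis using i2 e2 unfolding M.ms_inv_def E.flag_inv_def by (auto simp: r2)
    qed
    have N: "reg \<sigma> 15 = 288 * reg \<sigma> 13 + 2 * reg \<sigma> 13 * ln (4 * reg \<sigma> 14) + 2" using p unfolding params_def by blast
    have "M.ms_inv ?N \<sigma>'" unfolding s' using M.STEP_loop[OF inv, of ?N] unfolding N by simp
    then show ?thesis using M.not_running[of ?N \<sigma>'] unfolding N M.ms_inv_def by auto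
  qed
qed

text \<open>On the logarithmic scale a round maps the width \<open>x\<close> to at most
  \<open>x / 2 + \<epsilon>\<close>, whose fixed point is \<open>2 \<epsilon>\<close>. The initial
  width is \<open>ln (2 + W)\<close>.\<close>

definition bis_inv :: "real \<Rightarrow> real \<Rightarrow> real \<Rightarrow> (nat \<Rightarrow> real) \<Rightarrow> nat \<Rightarrow> store \<Rightarrow> bool" where
  "bis_inv W \<epsilon> \<rho> b k \<sigma> \<longleftrightarrow> good (mem \<sigma> 3) \<and> (\<Sum>i<n. mem \<sigma> 3 i) = W \<and> params W \<epsilon> \<sigma> \<and> mem \<sigma> 1 = b \<and>
     wls (mem \<sigma> 3) b (mem \<sigma> 10) \<and> res b (mem \<sigma> 10) = \<rho> \<and> 0 < reg \<sigma> 7 \<and> \<rho> \<le> (2 + W) * reg \<sigma> 7 \<and>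
     (\<forall>x. reg \<sigma> 7 \<le> res b x) \<and> res b (mem \<sigma> 2) \<le> reg \<sigma> 6 \<and>
     ln (reg \<sigma> 6) - ln (reg \<sigma> 7) \<le> (1 / 2) ^ k * ln (2 + W) + 2 * \<epsilon>"

lemma params_cong: "(\<And>x. x \<in> {8..17} \<Longrightarrow> reg \<sigma>' x = reg \<sigma> x) \<Longrightarrow> params W \<epsilon> \<sigma>' = params W \<epsilon> \<sigma>"
  by (simp add: params_def)

text \<open>If the flag stays down, completeness of \<open>DECIDE\<close> shows that every residual
  exceeds \<open>mid\<close>. If it is raised, the point found has level
  \<open>mid (1 + \<epsilon>)\<close>, and the extra factor costs
  \<open>ln (1 + \<epsilon>) \<le> \<epsilon>\<close>.\<close>

lemma BISECT_spec:
  assumes \<epsilon>: "0 < \<epsilon>" "\<epsilon> \<le> 1 / 6" and inv: "bis_inv W \<epsilon> \<rho> b k \<sigma>"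
  shows "bis_inv W \<epsilon> \<rho> b (Suc k) (run A BISECT \<sigma>)"
proof -
  define w where "w = mem \<sigma> 3"
  define lo hi where "lo = reg \<sigma> 7" and "hi = reg \<sigma> 6"
  have g: "good w" and W: "(\<Sum>i<n. w i) = W" and p: "params W \<epsilon> \<sigma>" and b: "mem \<sigma> 1 = b"
    and x0: "wls w b (mem \<sigma> 10)" "res b (mem \<sigma> 10) = \<rho>" and lo: "0 < lo" "\<rho> \<le> (2 + W) * lo" "\<And>x. lo \<le> res b x"
    and hi: "res b (mem \<sigma> 2) \<le> hi" and rat: "ln hi - ln lo \<le> (1 / 2) ^ k * ln (2 + W) + 2 * \<epsilon>"
    using inv by (auto simp: bis_inv_def w_def lo_def hi_def)
  note b1 = b[unfolded One_nat_def]
  have lohi: "lo \<le> hi" using lo(3)[of "mem \<sigma> 2"] hi by linarith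
  have hi0: "0 < hi" using lohi lo by linarith
  define mid where "mid = exp ((ln lo + ln hi) / 2)"
  have mid0: "0 < mid" by (simp add: mid_def)
  have lmid: "ln mid = (ln lo + ln hi) / 2" by (simp add: mid_def)
  have "ln lo \<le> ln hi" using lohi lo hi0 by simp
  then have "ln lo \<le> ln mid" unfolding lmid by simp
  then have midlo: "lo \<le> mid" using lo mid0 by simp
  have W1: "1 \<le> W" using g W by (simp add: good_def)
  note pf = params_facts[OF p W1 \<epsilon>]
  define \<eta> where "\<eta> = \<epsilon> * mid / reg \<sigma> 9"
  have L1: "1 \<le> reg \<sigma> 9" using p ln4n by (simp add: params_def)
  have \<eta>0: "0 < \<eta>" unfolding \<eta>_def using \<epsilon> mid0 L1 by simp
  have g\<eta>: "reg \<sigma> 10 * \<eta> = mid"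
  proof -
    have "reg \<sigma> 10 = reg \<sigma> 9 / \<epsilon>" using p by (simp add: params_def)
    then show ?thesis unfolding \<eta>_def using \<epsilon> L1 by simp
  qed
  define \<sigma>1 where "\<sigma>1 = run A (Assign 28 (V 8 [*] V 29 [/] V 9)) (run A (Assign 29 (e_exp ((e_ln (V 7) [+] e_ln (V 6)) [/] Cst 2))) \<sigma>)"
  have r1: "reg \<sigma>1 28 = \<eta>" "reg \<sigma>1 29 = mid" "x \<noteq> 28 \<Longrightarrow> x \<noteq> 29 \<Longrightarrow> reg \<sigma>1 x = reg \<sigma> x" "mem \<sigma>1 = mem \<sigma>" for x
  proof -
    have "reg \<sigma> 8 = \<epsilon>" using p by (simp add: params_def)
    then show "reg \<sigma>1 28 = \<eta>" "reg \<sigma>1 29 = mid" "x \<noteq> 28 \<Longrightarrow> x \<noteq> 29 \<Longrightarrow> reg \<sigma>1 x = reg \<sigma> x" "mem \<sigma>1 = mem \<sigma>"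
      by (simp_all add: \<sigma>1_def \<eta>_def mid_def lo_def hi_def)
  qed
  define \<sigma>2 where "\<sigma>2 = run A DECIDE \<sigma>1"
  have fr: "reg \<sigma>2 x = reg \<sigma>1 x" if "x \<in> {0..17} \<union> {28, 29}" for x
    unfolding \<sigma>2_def by (rule run_reg_frame) (use that in \<open>auto simp: block_defs\<close>)
  have fm: "mem \<sigma>2 a = mem \<sigma>1 a" if "a \<in> {1, 2, 3, 10}" for a
    unfolding \<sigma>2_def by (rule run_mem_frame) (use that in \<open>auto simp: block_defs\<close>)
  have p1: "params W \<epsilon> \<sigma>1" using p by (subst params_cong[of \<sigma>1 \<sigma>]) (auto simp: r1)
  have D: "reg \<sigma>2 19 = 0 \<or> reg \<sigma>2 19 = 1"
    "reg \<sigma>2 19 = 1 \<Longrightarrow> \<forall>i<n. \<bar>lin_app A (mem \<sigma>2 14) i - b i / \<eta>\<bar> \<le> reg \<sigma> 11"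
    "res b x \<le> mid \<Longrightarrow> reg \<sigma>2 19 = 1" for x
  proof -
    have "\<rho> \<le> (2 + W) * mid"
      using lo(2) mult_left_mono[OF midlo, of "2 + W"] W1 by linarith
    then have pre: "good (mem \<sigma>1 3)" "params (\<Sum>i<n. mem \<sigma>1 3 i) \<epsilon> \<sigma>1" "0 < reg \<sigma>1 28" "wls (mem \<sigma>1 3) (mem \<sigma>1 1) (mem \<sigma>1 10)"
      "res (mem \<sigma>1 1) (mem \<sigma>1 10) \<le> (2 + (\<Sum>i<n. mem \<sigma>1 3 i)) * (reg \<sigma>1 10 * reg \<sigma>1 28)"
      using g p1 \<eta>0 x0 b W by (auto simp: r1 w_def g\<eta>)
    note DS = DECIDE_spec[OF pre(1,2) \<epsilon> pre(3-5), folded \<sigma>2_def]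
    show "reg \<sigma>2 19 = 0 \<or> reg \<sigma>2 19 = 1" by (rule DS(1))
    show "reg \<sigma>2 19 = 1 \<Longrightarrow> \<forall>i<n. \<bar>lin_app A (mem \<sigma>2 14) i - b i / \<eta>\<bar> \<le> reg \<sigma> 11"
      using DS(2) by (simp add: r1 b1)
    show "res b x \<le> mid \<Longrightarrow> reg \<sigma>2 19 = 1" using DS(3)[of x] by (simp add: r1 b1 g\<eta>)
  qed
  have r: "run A BISECT \<sigma> = run A (Branch (V 19) (Cst (1/2)) (Assign 7 (V 29)) (Assign 6 (V 11 [*] V 28) ;; Fill Cols 2 (At 14 [*] V 28))) \<sigma>2"
    by (simp only: BISECT_def run.simps(8) \<sigma>1_def \<sigma>2_def)
  have half: "(ln hi - ln lo) / 2 \<le> (1 / 2) ^ Suc k * ln (2 + W) + \<epsilon>" using rat by simp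
  have p2: "params W \<epsilon> \<sigma>2" using p1 by (subst params_cong[of \<sigma>2 \<sigma>1]) (auto simp: fr)
  show ?thesis
  proof (cases "reg \<sigma>2 19 = 0")
    case True
    then have rr: "run A BISECT \<sigma> = \<sigma>2\<lparr>reg := (reg \<sigma>2)(7 := mid)\<rparr>" by (simp add: r of_rat_divide fr r1)
    have "mid \<le> res b x" for x using D(3)[of x] True by linarith
    moreover have "ln hi - ln mid \<le> (1 / 2) ^ Suc k * ln (2 + W) + 2 * \<epsilon>"
    proof -
      have "ln hi - ln mid = (ln hi - ln lo) / 2" unfolding lmid by (simp add: field_simps)
      then show ?thesis using half \<epsilon> by linarith
    qed
    moreover have "params W \<epsilon> (run A BISECT \<sigma>)" using p2 by (subst params_cong[of _ \<sigma>2]) (auto simp: rr)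
    moreover have "\<rho> \<le> (2 + W) * mid"
      using lo(2) mult_left_mono[OF midlo, of "2 + W"] W1 by linarith
    moreover have "mem (run A BISECT \<sigma>) 3 = w" "mem (run A BISECT \<sigma>) 1 = b" "mem (run A BISECT \<sigma>) 10 = mem \<sigma> 10"
      "mem (run A BISECT \<sigma>) 2 = mem \<sigma> 2" "reg (run A BISECT \<sigma>) 7 = mid" "reg (run A BISECT \<sigma>) 6 = hi"
      by (simp_all add: rr fm fr r1 w_def b1 hi_def)
    ultimately show ?thesis unfolding bis_inv_def using g W x0 mid0 hi by simp
  next
    case False
    then have f1: "reg \<sigma>2 19 = 1" using D(1) by blast
    define hi' where "hi' = reg \<sigma> 11 * \<eta>"
    have hi'm: "hi' = mid * (1 + \<epsilon>)"
    proof -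
      have "reg \<sigma> 11 = reg \<sigma> 10 + reg \<sigma> 9" using p by (simp add: params_def)
      then have "hi' = mid + reg \<sigma> 9 * \<eta>" unfolding hi'_def by (simp add: distrib_right g\<eta>)
      also have "reg \<sigma> 9 * \<eta> = mid * \<epsilon>" unfolding \<eta>_def using L1 by simp
      finally show ?thesis by (simp add: algebra_simps)
    qed
    define \<sigma>3 where "\<sigma>3 = run A BISECT \<sigma>"
    have rr: "\<sigma>3 = run A (Fill Cols 2 (At 14 [*] V 28)) (\<sigma>2\<lparr>reg := (reg \<sigma>2)(6 := hi')\<rparr>)"
      using f1 by (simp add: \<sigma>3_def r of_rat_divide fr r1 hi'_def)
    have out: "res b (mem \<sigma>3 2) \<le> hi'"
    proof (subst res_le_iff)
      show "0 \<le> hi'" unfolding hi'm using mid0 \<epsilon> by simp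
      have "lin_app A (mem \<sigma>3 2) = lin_app A (\<lambda>j. \<eta> * mem \<sigma>2 14 j + 0 * mem \<sigma>2 14 j)"
        by (rule lin_app_cong) (simp add: rr fr r1 mult.commute)
      then have im: "lin_app A (mem \<sigma>3 2) i = \<eta> * lin_app A (mem \<sigma>2 14) i" for i unfolding lin_app_lin by simp
      show "\<forall>i<n. \<bar>lin_app A (mem \<sigma>3 2) i - b i\<bar> \<le> hi'"
      proof (intro allI impI)
        fix i assume i: "i < n"
        have "lin_app A (mem \<sigma>3 2) i - b i = \<eta> * (lin_app A (mem \<sigma>2 14) i - b i / \<eta>)"
          unfolding im using \<eta>0 by (simp add: field_simps)
        then have "\<bar>lin_app A (mem \<sigma>3 2) i - b i\<bar> = \<eta> * \<bar>lin_app A (mem \<sigma>2 14) i - b i / \<eta>\<bar>"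
          using \<eta>0 by (simp add: abs_mult)
        also have "\<dots> \<le> \<eta> * reg \<sigma> 11" using D(2)[OF f1] i \<eta>0 by (intro mult_left_mono) auto
        finally show "\<bar>lin_app A (mem \<sigma>3 2) i - b i\<bar> \<le> hi'" by (simp add: hi'_def mult.commute)
      qed
    qed
    have "ln hi' - ln lo \<le> (1 / 2) ^ Suc k * ln (2 + W) + 2 * \<epsilon>"
    proof -
      have "ln hi' = ln mid + ln (1 + \<epsilon>)" unfolding hi'm using mid0 \<epsilon> by (simp add: ln_mult)
      moreover have "ln (1 + \<epsilon>) \<le> \<epsilon>" using \<epsilon> by (intro ln_add_one_self_le_self) simp
      moreover have "ln mid - ln lo = (ln hi - ln lo) / 2" unfolding lmid by (simp add: field_simps)
      ultimately show ?thesis using half by linarith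
    qed
    moreover have "params W \<epsilon> \<sigma>3" using p2 by (subst params_cong[of _ \<sigma>2]) (auto simp: rr)
    moreover have "mem \<sigma>3 3 = w" "mem \<sigma>3 1 = b" "mem \<sigma>3 10 = mem \<sigma> 10" "reg \<sigma>3 7 = lo" "reg \<sigma>3 6 = hi'"
      by (simp_all add: rr fm fr r1 w_def b1 lo_def)
    ultimately show ?thesis unfolding bis_inv_def \<sigma>3_def[symmetric] using g W x0 lo out by simp
  qed
qed

lemma BISECT_loop:
  assumes "0 < \<epsilon>" "\<epsilon> \<le> 1 / 6" "bis_inv W \<epsilon> \<rho> b 0 \<sigma>"
  shows "bis_inv W \<epsilon> \<rho> b k ((run A BISECT ^^ k) \<sigma>)"
  using assms by (induction k) (auto intro: BISECT_spec)

lemma INIT_spec: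
  fixes \<sigma> :: store
  defines "\<sigma>' \<equiv> run A INIT \<sigma>" and "w \<equiv> mem \<sigma> 3" and "b \<equiv> mem \<sigma> 1"
  assumes pos: "\<forall>i<n. 0 < w i"
  shows "reg \<sigma>' 4 = (\<Sum>i<n. w i)" "wls w b (mem \<sigma>' 10)" "reg \<sigma>' 5 = res b (mem \<sigma>' 10)"
    "res b (mem \<sigma>' 2) = res b (mem \<sigma>' 10)" "mem \<sigma>' 3 = w" "mem \<sigma>' 1 = b" "x \<noteq> 4 \<Longrightarrow> x \<noteq> 5 \<Longrightarrow> reg \<sigma>' x = reg \<sigma> x"
proof -
  show "x \<noteq> 4 \<Longrightarrow> x \<noteq> 5 \<Longrightarrow> reg \<sigma>' x = reg \<sigma> x"
    unfolding \<sigma>'_def by (rule run_reg_frame) (simp add: block_defs)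
  show "mem \<sigma>' 3 = w" "mem \<sigma>' 1 = b"
    unfolding \<sigma>'_def w_def b_def by (rule run_mem_frame; simp add: block_defs)+
  define \<sigma>1 where "\<sigma>1 = run A (SUMR 4 (At 3)) \<sigma>"
  have s1: "\<sigma>1 = \<sigma>\<lparr>reg := (reg \<sigma>)(4 := (\<Sum>i<n. w i))\<rparr>"
    unfolding \<sigma>1_def w_def by (subst SUMR_run) simp_all
  define \<sigma>2 where "\<sigma>2 = run A (Fill Rows 5 (At 3 [*] At 1)) \<sigma>1"
  have m2: "mem \<sigma>2 5 i = w i * b i" if "i < n" for i using that by (simp add: \<sigma>2_def s1 w_def b_def)
  have f2: "a \<noteq> 5 \<Longrightarrow> mem \<sigma>2 a = mem \<sigma> a" "reg \<sigma>2 4 = (\<Sum>i<n. w i)" for a by (auto simp: \<sigma>2_def s1)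
  have p2: "\<forall>i<n. 0 < mem \<sigma>2 3 i" using pos by (simp add: f2 w_def)
  define \<sigma>3 where "\<sigma>3 = run A (SOLVE 3 5 10) \<sigma>2"
  have f3: "a \<noteq> 6 \<Longrightarrow> a \<noteq> 10 \<Longrightarrow> mem \<sigma>3 a = mem \<sigma>2 a" "reg \<sigma>3 = reg \<sigma>2" for a
    by (simp_all add: \<sigma>3_def SOLVE_def)
  define \<sigma>4 where "\<sigma>4 = run A (MulA 8 10) \<sigma>3"
  have f4: "a \<noteq> 8 \<Longrightarrow> mem \<sigma>4 a = mem \<sigma>3 a" "reg \<sigma>4 = reg \<sigma>3" "\<And>i. i < n \<Longrightarrow> mem \<sigma>4 8 i = lin_app A (mem \<sigma>3 10) i" for a
    by (auto simp: \<sigma>4_def)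
  define \<sigma>5 where "\<sigma>5 = run A (MAXABS 5 (At 8 [-] At 1)) \<sigma>4"
  have s5: "\<sigma>5 = \<sigma>4\<lparr>reg := (reg \<sigma>4)(5 := max_abs n (eval (At 8 [-] At 1) (reg \<sigma>4) (mem \<sigma>4)))\<rparr>"
    unfolding \<sigma>5_def by (subst MAXABS_run) simp_all
  have mx: "max_abs n (eval (At 8 [-] At 1) (reg \<sigma>4) (mem \<sigma>4)) = res b (mem \<sigma>3 10)"
    unfolding res_def by (rule max_abs_cong) (simp add: f4 f3 f2 b_def)
  have r: "\<sigma>' = run A (Fill Cols 2 (At 10)) \<sigma>5"
    by (simp only: \<sigma>'_def INIT_def run.simps(8) \<sigma>1_def \<sigma>2_def \<sigma>3_def \<sigma>4_def \<sigma>5_def)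
  have m10: "mem \<sigma>' 10 = mem \<sigma>3 10" by (simp add: r s5 f4)
  show "reg \<sigma>' 4 = (\<Sum>i<n. w i)" by (simp add: r s5 f4 f3 f2)
  show "reg \<sigma>' 5 = res b (mem \<sigma>' 10)" unfolding m10 by (simp add: r s5 mx[unfolded One_nat_def])
  show "wls w b (mem \<sigma>' 10)"
    unfolding wls_def m10
  proof
    fix u assume u: "u \<in> colspace"
    have "mem \<sigma>2 3 = w" by (simp add: f2 w_def)
    then have "ip n w (lin_app A (mem \<sigma>3 10)) u = (\<Sum>i<n. mem \<sigma>2 5 i * u i)"
      using SOLVE_spec(1)[OF p2 _ u, of 5 10] unfolding \<sigma>3_def by simp
    then show "ip n w (lin_app A (mem \<sigma>3 10)) u = (\<Sum>i<n. w i * b i * u i)" using m2 by simp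
  qed
  have "lin_app A (mem \<sigma>' 2) = lin_app A (mem \<sigma>' 10)" by (rule lin_app_cong) (simp add: r)
  then show "res b (mem \<sigma>' 2) = res b (mem \<sigma>' 10)" by (simp add: res_def)
qed

lemma SETUP_spec:
  assumes "reg \<sigma> 2 = real n" "\<sigma>' = run A SETUP \<sigma>"
  shows "params (reg \<sigma> 4) (reg \<sigma> 0 / 6) \<sigma>'" "reg \<sigma>' 6 = reg \<sigma> 5" "reg \<sigma>' 7 = reg \<sigma> 5 / (2 + reg \<sigma> 4)"
    "mem \<sigma>' = mem \<sigma>" "x < 6 \<Longrightarrow> reg \<sigma>' x = reg \<sigma> x"
  using assms by (simp_all add: SETUP_def params_def)

text \<open>As \<open>1/2 \<le> exp (- 1/2)\<close>, twice the logarithm of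
  \<open>(2 + W) / \<epsilon>\<close> rounds bring the halving term below \<open>\<epsilon>\<close>.
  The final ratio is at most \<open>exp (3 \<epsilon>)\<close>, and \<open>3 \<epsilon>\<close> is
  half the required accuracy because of the division by 6 in \<open>SETUP\<close>.\<close>

lemma MAIN_spec:
  fixes \<sigma> :: store
  defines "\<sigma>' \<equiv> run A MAIN \<sigma>" and "b \<equiv> mem \<sigma> 1"
  assumes good: "good (mem \<sigma> 3)" and n: "reg \<sigma> 2 = real n" and eps: "0 < reg \<sigma> 0" "reg \<sigma> 0 < 1"
  shows "res b (mem \<sigma>' 2) \<le> (1 + reg \<sigma> 0) * res b x"
proof -
  define w where "w = mem \<sigma> 3"
  define W where "W = (\<Sum>i<n. w i)"
  define \<epsilon> where "\<epsilon> = reg \<sigma> 0 / 6"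
  have \<epsilon>: "0 < \<epsilon>" "\<epsilon> \<le> 1 / 6" using eps by (auto simp: \<epsilon>_def)
  have pos: "\<forall>i<n. 0 < mem \<sigma> 3 i" and W1: "1 \<le> W" using good by (auto simp: good_def W_def w_def)
  define \<sigma>1 where "\<sigma>1 = run A INIT \<sigma>"
  note I = INIT_spec[OF pos, folded \<sigma>1_def w_def b_def W_def]
  define \<rho> where "\<rho> = reg \<sigma>1 5"
  have r: "\<sigma>' = run A (Branch (Cst 0) (V 5) (SETUP ;; Loop (Cst 2 [*] e_ln ((Cst 2 [+] V 4) [/] V 8)) BISECT) Nop) \<sigma>1"
    by (simp only: \<sigma>'_def MAIN_def run.simps(8) \<sigma>1_def)
  show ?thesis
  proof (cases "0 < \<rho>")
    case False
    then have "\<sigma>' = \<sigma>1" by (simp add: r \<rho>_def)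
    then have "res b (mem \<sigma>' 2) \<le> 0" using False I by (simp add: \<rho>_def)
    also have "\<dots> \<le> (1 + reg \<sigma> 0) * res b x" using eps res_nonneg[of b x] by simp
    finally show ?thesis .
  next
    case True
    define \<sigma>2 where "\<sigma>2 = run A SETUP \<sigma>1"
    have n1: "reg \<sigma>1 2 = real n" using I(7)[of 2] n by simp
    note S = SETUP_spec[OF n1 \<sigma>2_def]
    have e1: "reg \<sigma>1 0 / 6 = \<epsilon>" using I(7)[of 0] by (simp add: \<epsilon>_def)
    have p2: "params W \<epsilon> \<sigma>2" using S(1) unfolding e1 I(1) .
    define N where "N = nat \<lceil>2 * ln ((2 + W) / \<epsilon>)\<rceil>"
    have "reg \<sigma>2 8 = \<epsilon>" using p2 by (simp add: params_def)
    moreover have "reg \<sigma>2 4 = W" using S(5)[of 4] I(1) by simp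
    ultimately have s': "\<sigma>' = (run A BISECT ^^ N) \<sigma>2"
      using True by (simp add: r \<rho>_def[symmetric] \<sigma>2_def[symmetric] N_def)
    have b0: "bis_inv W \<epsilon> \<rho> b 0 \<sigma>2"
      unfolding bis_inv_def
    proof (intro conjI allI)
      show "good (mem \<sigma>2 3)" "(\<Sum>i<n. mem \<sigma>2 3 i) = W" "mem \<sigma>2 1 = b" "wls (mem \<sigma>2 3) b (mem \<sigma>2 10)" "res b (mem \<sigma>2 10) = \<rho>"
        "res b (mem \<sigma>2 2) \<le> reg \<sigma>2 6"
        using good I by (simp_all add: S(2,4) w_def W_def \<rho>_def)
      show "params W \<epsilon> \<sigma>2" by (rule p2)
      have r7: "reg \<sigma>2 7 = \<rho> / (2 + W)" using S(3) I(1) by (simp add: \<rho>_def)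
      show "0 < reg \<sigma>2 7" "\<rho> \<le> (2 + W) * reg \<sigma>2 7" unfolding r7 using True W1 by auto
      show "reg \<sigma>2 7 \<le> res b x" for x
        using wls_res[of w b "mem \<sigma>1 10" x] I(2,3) good W1 unfolding r7 by (simp add: \<rho>_def w_def W_def field_simps)
      have "ln (reg \<sigma>2 7) = ln \<rho> - ln (2 + W)" unfolding r7 using True W1 by (simp add: ln_div)
      then show "ln (reg \<sigma>2 6) - ln (reg \<sigma>2 7) \<le> (1 / 2) ^ 0 * ln (2 + W) + 2 * \<epsilon>"
        using S(2) \<epsilon> by (simp add: \<rho>_def)
    qed
    have bN: "bis_inv W \<epsilon> \<rho> b N \<sigma>'" unfolding s' by (rule BISECT_loop[OF \<epsilon> b0])
    define lo hi where "lo = reg \<sigma>' 7" and "hi = reg \<sigma>' 6"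
    have lo: "0 < lo" "lo \<le> res b x" and hi: "res b (mem \<sigma>' 2) \<le> hi" and rat: "ln hi - ln lo \<le> (1 / 2) ^ N * ln (2 + W) + 2 * \<epsilon>"
      using bN by (auto simp: bis_inv_def lo_def hi_def)
    have hi0: "0 < hi"
    proof -
      have "lo \<le> res b (mem \<sigma>' 2)" using bN by (auto simp: bis_inv_def lo_def)
      then show ?thesis using hi lo by linarith
    qed
    have "(1 / 2) ^ N * ln (2 + W) \<le> \<epsilon>"
    proof -
      have q: "1 \<le> (2 + W) / \<epsilon>" using \<epsilon> W1 by (simp add: le_divide_eq)
      then have N: "2 * ln ((2 + W) / \<epsilon>) \<le> real N" unfolding N_def by linarith
      have "exp (1 / 2) \<le> (2 :: real)" using exp_bound[of "1 / 2 :: real"] by (simp add: power2_eq_square)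
      then have "1 / 2 \<le> exp (- 1 / 2 :: real)" by (simp add: exp_minus field_simps)
      then have "(1 / 2 :: real) ^ N \<le> exp (- 1 / 2) ^ N" by (intro power_mono) auto
      also have "\<dots> = exp (real N * (- 1 / 2))" by (rule exp_of_nat_mult[symmetric])
      also have "\<dots> \<le> exp (- ln ((2 + W) / \<epsilon>))" using N by simp
      also have "\<dots> = \<epsilon> / (2 + W)" using q \<epsilon> W1 by (simp add: exp_minus inverse_eq_divide)
      finally have "(1 / 2) ^ N * ln (2 + W) \<le> \<epsilon> / (2 + W) * (2 + W)"
        using ln_le_minus_one[of "2 + W"] W1 \<epsilon> by (intro mult_mono) auto
      then show ?thesis using W1 by simp
    qed
    then have "ln hi \<le> ln lo + 3 * \<epsilon>" using rat by linarith
    then have "hi \<le> exp (ln lo + 3 * \<epsilon>)" using hi0 by (simp add: ln_ge_iff[symmetric] ln_le_cancel_iff[symmetric] del: ln_le_cancel_iff)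
    also have "\<dots> = exp (3 * \<epsilon>) * lo" using lo by (simp add: exp_add)
    also have "\<dots> \<le> (1 + reg \<sigma> 0) * lo"
    proof (rule mult_right_mono)
      define e where "e = reg \<sigma> 0"
      have "exp (e / 2) \<le> 1 + e / 2 + (e / 2)\<^sup>2" using eps by (intro exp_bound) (auto simp: e_def)
      also have "(e / 2)\<^sup>2 \<le> e / 2"
        using eps by (simp add: e_def power2_eq_square mult_le_cancel_left1)
      finally have "exp (e / 2) \<le> 1 + e" by linarith
      moreover have e2: "3 * \<epsilon> = e / 2" by (simp add: \<epsilon>_def e_def)
      ultimately show "exp (3 * \<epsilon>) \<le> 1 + reg \<sigma> 0" unfolding e2 by (simp only: e_def)
    qed (use lo in simp)
    also have "\<dots> \<le> (1 + reg \<sigma> 0) * res b x" using lo eps by (intro mult_left_mono) auto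
    finally show ?thesis using hi by linarith
  qed
qed

section \<open>The barrier method as a program\<close>

lemma good_ones: "\<forall>i<n. w i = 1 \<Longrightarrow> good w"
proof -
  assume w: "\<forall>i<n. w i = 1"
  have "\<not> bad w i" if i: "i < n" for i
  proof -
    have "(z i)\<^sup>2 \<le> ip n w z z" for z
    proof -
      have "w i * z i * z i \<le> ip n w z z" unfolding ip_def using i w by (intro member_le_sum) auto
      then show ?thesis using w i by (simp add: power2_eq_square)
    qed
    then show ?thesis by (auto simp: bad_def not_less)
  qed
  moreover have "(\<Sum>i<n. w i) = real n" using w by simp
  ultimately show ?thesis using w n_pos by (simp add: good_def)
qed

sublocale bar: barrier_problem n colspace b for b
proof unfold_locales
  fix u v :: "nat \<Rightarrow> real" and a c assume "u \<in> colspace" "v \<in> colspace"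
  then show "(\<lambda>i. a * u i + c * v i) \<in> colspace" by (rule colspace_lin)
next
  fix D r :: "nat \<Rightarrow> real" assume D: "\<forall>i<n. 0 < D i"
  show "\<exists>h\<in>colspace. \<forall>z\<in>colspace. ip n D h z = (\<Sum>i<n. r i * z i)"
    using solve_arr_adj[OF D, of "lin_adj A r" r _ "\<lambda>_. 0"]
    by (intro bexI[of _ "lin_app A (solve_arr A D (lin_adj A r) (\<lambda>_. 0))"]) auto
qed (rule n_pos)

text \<open>The level is compared with the residual of every \<open>x\<close>, so the optimum, an
  infimum, need not be named.\<close>

definition bar_inv :: "(nat \<Rightarrow> real) \<Rightarrow> real \<Rightarrow> nat \<Rightarrow> store \<Rightarrow> bool" where
  "bar_inv b t0 k \<sigma> \<longleftrightarrow> mem \<sigma> 1 = b \<and> reg \<sigma> 2 = real n \<and> bar.feas b (reg \<sigma> 5) (lin_app A (mem \<sigma> 2)) \<and>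
     bar.centered b (1 / 4) (reg \<sigma> 5) (lin_app A (mem \<sigma> 2)) \<and>
     (\<forall>x. reg \<sigma> 5 - res b x \<le> (1 - 1 / (64 * (real n)\<^sup>2)) ^ k * t0)"

text \<open>By \<open>barrier_gap\<close> the decrease \<open>(t - r) / (16 n)\<close> of the level
  is at least the fraction \<open>1 / (64 n^2)\<close> of its distance to any attainable
  residual.\<close>

lemma BARRIER_STEP_spec:
  assumes inv: "bar_inv b t0 k \<sigma>"
  shows "bar_inv b t0 (Suc k) (run A BARRIER_STEP \<sigma>)"
proof -
  define t u where "t = reg \<sigma> 5" and "u = lin_app A (mem \<sigma> 2)"
  have b: "mem \<sigma> 1 = b" and n: "reg \<sigma> 2 = real n" and f: "bar.feas b t u" and c: "bar.centered b (1 / 4) t u"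
    and gap: "\<And>x. t - res b x \<le> (1 - 1 / (64 * (real n)\<^sup>2)) ^ k * t0"
    using inv by (auto simp: bar_inv_def t_def u_def)
  note b1 = b[unfolded One_nat_def]
  define \<sigma>1 where "\<sigma>1 = run A (MulA 8 2) \<sigma>"
  define \<sigma>2 where "\<sigma>2 = run A (Fill Rows 4 (Cst 1 [/] (V 5 [-] (At 8 [-] At 1)) [*] (Cst 1 [/] (V 5 [-] (At 8 [-] At 1))) [+]
       Cst 1 [/] (V 5 [+] (At 8 [-] At 1)) [*] (Cst 1 [/] (V 5 [+] (At 8 [-] At 1))))) \<sigma>1"
  define \<sigma>3 where "\<sigma>3 = run A (Fill Rows 5 (Cst 1 [/] (V 5 [+] (At 8 [-] At 1)) [-] Cst 1 [/] (V 5 [-] (At 8 [-] At 1)))) \<sigma>2"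
  define \<sigma>4 where "\<sigma>4 = run A (SOLVE 4 5 7) \<sigma>3"
  define \<sigma>5 where "\<sigma>5 = run A (Fill Cols 2 (At 2 [+] At 7)) \<sigma>4"
  define \<sigma>6 where "\<sigma>6 = run A (MulA 8 2) \<sigma>5"
  have f1: "a \<noteq> 8 \<Longrightarrow> mem \<sigma>1 a = mem \<sigma> a" "reg \<sigma>1 = reg \<sigma>" "\<And>i. i < n \<Longrightarrow> mem \<sigma>1 8 i = u i" for a
    by (auto simp: \<sigma>1_def u_def)
  have f2: "a \<noteq> 4 \<Longrightarrow> mem \<sigma>2 a = mem \<sigma>1 a" "reg \<sigma>2 = reg \<sigma>" for a by (auto simp: \<sigma>2_def f1)
  have m2: "mem \<sigma>2 4 i = bar.bwt b t u i" if "i < n" for i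
    using that by (simp add: \<sigma>2_def bar.bwt_def f1 b1 t_def power2_eq_square)
  have f3: "a \<noteq> 5 \<Longrightarrow> mem \<sigma>3 a = mem \<sigma>2 a" "reg \<sigma>3 = reg \<sigma>" for a by (auto simp: \<sigma>3_def f2)
  have m3: "mem \<sigma>3 5 i = 1 / (t + (u i - b i)) - 1 / (t - (u i - b i))" if "i < n" for i
    using that by (simp add: \<sigma>3_def f2 f1 b1 t_def)
  have pos: "\<forall>i<n. 0 < mem \<sigma>3 4 i" using bar.bwt_pos[OF f] m2 by (simp add: f3)
  have f4: "a \<noteq> 6 \<Longrightarrow> a \<noteq> 7 \<Longrightarrow> mem \<sigma>4 a = mem \<sigma>3 a" "reg \<sigma>4 = reg \<sigma>" for a
    by (simp_all add: \<sigma>4_def SOLVE_def f3)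
  define h where "h = lin_app A (mem \<sigma>4 7)"
  have h: "bar.is_step b t u h"
    unfolding bar.is_step_def
  proof (intro conjI ballI)
    show "h \<in> colspace" by (simp add: h_def)
    fix z assume z: "z \<in> colspace"
    have "ip n (bar.bwt b t u) h z = ip n (mem \<sigma>3 4) h z"
      unfolding ip_def using m2 by (intro sum.cong) (auto simp: f3)
    also have "\<dots> = (\<Sum>i<n. mem \<sigma>3 5 i * z i)"
      unfolding h_def \<sigma>4_def by (rule SOLVE_spec(1)[OF pos _ z]) simp
    finally show "ip n (bar.bwt b t u) h z = (\<Sum>i<n. (1 / (t + (u i - b i)) - 1 / (t - (u i - b i))) * z i)"
      using m3 by simp
  qed
  let ?u = "\<lambda>i. u i + h i"
  have N: "bar.feas b t ?u" "bar.centered b (1 / 16) t ?u" using bar.barrier_newton[OF f h c] .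
  have u5: "lin_app A (mem \<sigma>5 2) = ?u"
  proof -
    have "lin_app A (mem \<sigma>5 2) = lin_app A (\<lambda>j. 1 * mem \<sigma> 2 j + 1 * mem \<sigma>4 7 j)"
      by (rule lin_app_cong) (simp add: \<sigma>5_def f4 f3 f2 f1)
    then show ?thesis unfolding lin_app_lin by (simp add: u_def h_def)
  qed
  have f5: "a \<noteq> 2 \<Longrightarrow> mem \<sigma>5 a = mem \<sigma>4 a" "reg \<sigma>5 = reg \<sigma>" for a by (auto simp: \<sigma>5_def f4)
  have f6: "a \<noteq> 8 \<Longrightarrow> mem \<sigma>6 a = mem \<sigma>5 a" "reg \<sigma>6 = reg \<sigma>" "\<And>i. i < n \<Longrightarrow> mem \<sigma>6 8 i = ?u i" for a
    by (auto simp: \<sigma>6_def f5 u5)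
  define r where "r = res b (mem \<sigma>5 2)"
  have "run A (MAXABS 4 (At 8 [-] At 1)) \<sigma>6 = \<sigma>6\<lparr>reg := (reg \<sigma>6)(4 := max_abs n (eval (At 8 [-] At 1) (reg \<sigma>6) (mem \<sigma>6)))\<rparr>"
    by (subst MAXABS_run) simp_all
  also have "max_abs n (eval (At 8 [-] At 1) (reg \<sigma>6) (mem \<sigma>6)) = r"
    unfolding r_def res_def u5 by (rule max_abs_cong) (simp add: f6 f5 f4 f3 f2 f1 b1)
  finally have r7: "run A (MAXABS 4 (At 8 [-] At 1)) \<sigma>6 = \<sigma>6\<lparr>reg := (reg \<sigma>6)(4 := r)\<rparr>" .
  define \<sigma>' where "\<sigma>' = run A BARRIER_STEP \<sigma>"
  define t' where "t' = t - (t - r) / (16 * real n)"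
  have "\<sigma>' = run A (Assign 5 (V 5 [-] (V 5 [-] V 4) [/] (Cst 16 [*] V 2))) (\<sigma>6\<lparr>reg := (reg \<sigma>6)(4 := r)\<rparr>)"
    by (simp only: \<sigma>'_def BARRIER_STEP_def run.simps(8) \<sigma>1_def[symmetric] \<sigma>2_def[symmetric] \<sigma>3_def[symmetric] \<sigma>4_def[symmetric]
      \<sigma>5_def[symmetric] \<sigma>6_def[symmetric] r7)
  then have s': "reg \<sigma>' 5 = t'" "reg \<sigma>' 2 = real n" "mem \<sigma>' 1 = b" "mem \<sigma>' 2 = mem \<sigma>5 2"
    by (simp_all add: f6 f5 f4 f3 f2 f1 t'_def t_def n b1)
  have ri: "\<bar>?u i - b i\<bar> \<le> r" if "i < n" for i using abs_le_res[OF that, of "mem \<sigma>5 2" b] by (simp add: r_def u5)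
  have "0 < n" using n_pos by simp
  then obtain j where j: "j < n" "r = \<bar>?u j - b j\<bar>"
    unfolding r_def res_def u5 using max_abs_attained by blast
  have rt: "r < t" using N(1) j by (simp add: bar.feas_def)
  have SH: "bar.feas b t' ?u" "bar.centered b (1 / 4) t' ?u"
    using bar.barrier_shift[OF N ri rt t'_def] by simp_all
  have c4: "bar.centered b (1 / 4) t ?u" using N(2) unfolding bar.centered_def by force
  have n2: "1 \<le> (real n)\<^sup>2" using n_pos by (simp add: one_le_power)
  have "t' - res b x \<le> (1 - 1 / (64 * (real n)\<^sup>2)) ^ Suc k * t0" for x
  proof -
    have "t - res b x \<le> 4 * real n * (t - \<bar>?u j - b j\<bar>)"
    proof (rule bar.barrier_gap[OF N(1) c4 _ _ _ j(1)])
      show "?u \<in> colspace" unfolding u5[symmetric] by simp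
      show "lin_app A x \<in> colspace" by simp
      show "\<bar>lin_app A x i - b i\<bar> \<le> res b x" if "i < n" for i by (rule abs_le_res[OF that])
    qed
    then have "t - res b x \<le> 4 * real n * (t - r)" using j(2) by simp
    then have "(t - res b x) / (64 * (real n)\<^sup>2) \<le> 4 * real n * (t - r) / (64 * (real n)\<^sup>2)"
      by (rule divide_right_mono) simp
    also have "\<dots> = (t - r) / (16 * real n)" using n_pos by (simp add: power2_eq_square field_simps)
    finally have "t' - res b x \<le> (t - res b x) - (t - res b x) / (64 * (real n)\<^sup>2)" unfolding t'_def by linarith
    also have "\<dots> = (1 - 1 / (64 * (real n)\<^sup>2)) * (t - res b x)" by (simp add: algebra_simps)
    also have "\<dots> \<le> (1 - 1 / (64 * (real n)\<^sup>2)) * ((1 - 1 / (64 * (real n)\<^sup>2)) ^ k * t0)"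
      using gap[of x] n2 by (intro mult_left_mono) (auto simp: divide_le_eq)
    finally show ?thesis by (simp add: mult_ac)
  qed
  then show ?thesis unfolding bar_inv_def \<sigma>'_def[symmetric] s' u5 using SH by blast
qed

text \<open>Unit weights are good, so plain least squares is within a factor \<open>3 n\<close> of
  every residual and the initial level \<open>8 n \<rho>\<close> within \<open>24 n^2\<close>. The
  loop contracts this to the relative accuracy asked for.\<close>

lemma BARRIER_spec:
  fixes \<sigma> :: store
  defines "\<sigma>' \<equiv> run A BARRIER \<sigma>" and "b \<equiv> mem \<sigma> 1"
  assumes n: "reg \<sigma> 2 = real n" and eps: "0 < reg \<sigma> 0" "reg \<sigma> 0 < 1"
  shows "res b (mem \<sigma>' 2) \<le> (1 + reg \<sigma> 0) * res b x"
proof -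
  define \<sigma>1 where "\<sigma>1 = run A (Fill Rows 4 (Cst 1)) \<sigma>"
  define \<sigma>2 where "\<sigma>2 = run A (SOLVE 4 1 2) \<sigma>1"
  define \<sigma>3 where "\<sigma>3 = run A (MulA 8 2) \<sigma>2"
  have m1: "\<forall>i<n. mem \<sigma>1 4 i = 1" and f1: "a \<noteq> 4 \<Longrightarrow> mem \<sigma>1 a = mem \<sigma> a" "reg \<sigma>1 = reg \<sigma>" for a
    by (auto simp: \<sigma>1_def)
  define w where "w = mem \<sigma>1 4"
  have w1: "\<forall>i<n. w i = 1" using m1 by (simp add: w_def)
  have good: "good w" by (rule good_ones[OF w1])
  have pos: "\<forall>i<n. 0 < mem \<sigma>1 4 i" using m1 by simp
  have f2: "a \<noteq> 6 \<Longrightarrow> a \<noteq> 2 \<Longrightarrow> mem \<sigma>2 a = mem \<sigma>1 a" "reg \<sigma>2 = reg \<sigma>" for a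
    by (simp_all add: \<sigma>2_def SOLVE_def f1)
  define x0 where "x0 = mem \<sigma>2 2"
  have wl: "wls w b x0"
    unfolding wls_def
  proof
    fix u assume u: "u \<in> colspace"
    have "ip n w (lin_app A x0) u = (\<Sum>i<n. mem \<sigma>1 1 i * u i)"
      unfolding w_def x0_def \<sigma>2_def by (rule SOLVE_spec(1)[OF pos _ u]) simp
    then show "ip n w (lin_app A x0) u = (\<Sum>i<n. w i * b i * u i)" using w1 by (simp add: f1 b_def)
  qed
  define \<rho> where "\<rho> = res b x0"
  have f3: "a \<noteq> 8 \<Longrightarrow> mem \<sigma>3 a = mem \<sigma>2 a" "reg \<sigma>3 = reg \<sigma>" "\<And>i. i < n \<Longrightarrow> mem \<sigma>3 8 i = lin_app A x0 i" for a
    by (auto simp: \<sigma>3_def f2 x0_def)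
  have "run A (MAXABS 4 (At 8 [-] At 1)) \<sigma>3 = \<sigma>3\<lparr>reg := (reg \<sigma>3)(4 := max_abs n (eval (At 8 [-] At 1) (reg \<sigma>3) (mem \<sigma>3)))\<rparr>"
    by (subst MAXABS_run) simp_all
  also have "max_abs n (eval (At 8 [-] At 1) (reg \<sigma>3) (mem \<sigma>3)) = \<rho>"
    unfolding \<rho>_def res_def by (rule max_abs_cong) (simp add: f3 f2 f1 b_def)
  finally have r4: "run A (MAXABS 4 (At 8 [-] At 1)) \<sigma>3 = \<sigma>3\<lparr>reg := (reg \<sigma>3)(4 := \<rho>)\<rparr>" .
  define \<sigma>4 where "\<sigma>4 = \<sigma>3\<lparr>reg := (reg \<sigma>3)(4 := \<rho>)\<rparr>"
  have r: "\<sigma>' = run A (Branch (Cst 0) (V 4) (Assign 5 (Cst 8 [*] V 2 [*] V 4) ;;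
       Loop (Cst 64 [*] V 2 [*] V 2 [*] e_ln (Cst 24 [*] V 2 [*] V 2 [/] V 0)) BARRIER_STEP) Nop) \<sigma>4"
    by (simp only: \<sigma>'_def BARRIER_def run.simps(8) \<sigma>1_def[symmetric] \<sigma>2_def[symmetric] \<sigma>3_def[symmetric] r4 \<sigma>4_def)
  have m42: "mem \<sigma>4 2 = x0" by (simp add: \<sigma>4_def f3 x0_def)
  show ?thesis
  proof (cases "0 < \<rho>")
    case False
    then have "\<sigma>' = \<sigma>4" by (simp add: r \<sigma>4_def)
    then have "res b (mem \<sigma>' 2) \<le> 0" using False by (simp add: m42 \<rho>_def)
    also have "\<dots> \<le> (1 + reg \<sigma> 0) * res b x" using eps res_nonneg[of b x] by simp
    finally show ?thesis .
  next
    case True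
    define t0 where "t0 = 8 * real n * \<rho>"
    define \<sigma>5 where "\<sigma>5 = run A (Assign 5 (Cst 8 [*] V 2 [*] V 4)) \<sigma>4"
    have f5: "reg \<sigma>5 5 = t0" "reg \<sigma>5 2 = real n" "reg \<sigma>5 0 = reg \<sigma> 0" "mem \<sigma>5 2 = x0" "mem \<sigma>5 1 = b"
      by (simp_all add: \<sigma>5_def \<sigma>4_def f3 f2 f1 n t0_def x0_def b_def)
    define N where "N = nat \<lceil>64 * real n * real n * ln (24 * real n * real n / reg \<sigma> 0)\<rceil>"
    have s': "\<sigma>' = (run A BARRIER_STEP ^^ N) \<sigma>5"
    proof -
      have "\<sigma>' = run A (Loop (Cst 64 [*] V 2 [*] V 2 [*] e_ln (Cst 24 [*] V 2 [*] V 2 [/] V 0)) BARRIER_STEP) \<sigma>5"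
        using True by (simp add: r \<sigma>5_def \<sigma>4_def)
      then show ?thesis by (simp add: f5 N_def)
    qed
    have st: "bar.feas b t0 (lin_app A x0)" "bar.centered b (1 / 4) t0 (lin_app A x0)"
    proof -
      have o: "\<forall>z\<in>colspace. (\<Sum>i<n. (lin_app A x0 i - b i) * z i) = 0"
      proof
        fix z assume z: "z \<in> colspace"
        have "(\<Sum>i<n. (lin_app A x0 i - b i) * z i) = ip n w (lin_app A x0) z - (\<Sum>i<n. w i * b i * z i)"
          unfolding ip_def sum_subtractf[symmetric] using w1 by (intro sum.cong) (auto simp: algebra_simps)
        then show "(\<Sum>i<n. (lin_app A x0 i - b i) * z i) = 0" using wl z by (simp add: wls_def)
      qed
      have ri: "\<bar>lin_app A x0 i - b i\<bar> \<le> \<rho>" if "i < n" for i unfolding \<rho>_def by (rule abs_le_res[OF that])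
      show "bar.feas b t0 (lin_app A x0)" "bar.centered b (1 / 4) t0 (lin_app A x0)"
        using bar.barrier_start[OF o ri True t0_def] by simp_all
    qed
    have b0: "bar_inv b t0 0 \<sigma>5"
      unfolding bar_inv_def f5 using st res_nonneg by simp
    have "bar_inv b t0 k ((run A BARRIER_STEP ^^ k) \<sigma>5)" for k
      using b0 by (induction k) (auto intro: BARRIER_STEP_spec)
    then have bN: "bar_inv b t0 N \<sigma>'" unfolding s' .
    have n0: "1 \<le> real n" using n_pos by simp
    define q where "q = 1 / (64 * (real n)\<^sup>2)"
    define e where "e = reg \<sigma> 0"
    have e: "0 < e" "e < 1" using eps by (auto simp: e_def)
    have "res b (mem \<sigma>' 2) \<le> reg \<sigma>' 5"
    proof (subst res_le_iff)
      have fe: "bar.feas b (reg \<sigma>' 5) (lin_app A (mem \<sigma>' 2))" using bN by (simp add: bar_inv_def)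
      then show "\<forall>i<n. \<bar>lin_app A (mem \<sigma>' 2) i - b i\<bar> \<le> reg \<sigma>' 5" by (auto simp: bar.feas_def intro: less_imp_le)
      have "\<bar>lin_app A (mem \<sigma>' 2) 0 - b 0\<bar> < reg \<sigma>' 5" using fe n_pos by (auto simp: bar.feas_def)
      then show "0 \<le> reg \<sigma>' 5" by linarith
    qed
    also have "reg \<sigma>' 5 \<le> res b x + (1 - q) ^ N * t0"
    proof -
      have "reg \<sigma>' 5 - res b x \<le> (1 - q) ^ N * t0" using bN unfolding bar_inv_def q_def by blast
      then show ?thesis by linarith
    qed
    also have "(1 - q) ^ N * t0 \<le> e * res b x"
    proof -
      have nn: "1 \<le> real n * real n" using n0 mult_mono[of 1 "real n" 1 "real n"] by simp
      have big: "1 \<le> 24 * real n * real n / e" using e nn by (simp add: le_divide_eq)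
      have q0: "0 < q" "q \<le> 1" using nn by (auto simp: q_def power2_eq_square divide_le_eq)
      have NN: "64 * real n * real n * ln (24 * real n * real n / e) \<le> real N" unfolding N_def e_def by linarith
      have "(1 - q) ^ N \<le> exp (- q) ^ N"
        using exp_ge_add_one_self[of "- q"] q0 by (intro power_mono) auto
      also have "\<dots> = exp (real N * (- q))" by (rule exp_of_nat_mult[symmetric])
      also have "\<dots> \<le> exp (- ln (24 * real n * real n / e))"
      proof -
        have "q * (64 * real n * real n * ln (24 * real n * real n / e)) \<le> q * real N"
          using NN q0 by (intro mult_left_mono) auto
        moreover have "q * (64 * real n * real n * L) = L" for L using n0 by (simp add: q_def power2_eq_square)
        ultimately have "ln (24 * real n * real n / e) \<le> q * real N" by metis
        then show ?thesis by (simp add: mult.commute)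
      qed
      also have "\<dots> = e / (24 * (real n * real n))" using big e nn by (simp add: exp_minus inverse_eq_divide)
      finally have "(1 - q) ^ N * t0 \<le> e / (24 * (real n * real n)) * t0"
        using True n0 by (intro mult_right_mono) (auto simp: t0_def)
      also have "\<dots> = e / (3 * real n) * \<rho>" unfolding t0_def using n0 by simp
      also have "\<dots> \<le> e / (3 * real n) * (3 * real n * res b x)"
      proof (intro mult_left_mono)
        have "\<rho> \<le> (2 + real n) * res b x"
          using wls_res[OF good wl, of x] w1 by (simp add: \<rho>_def)
        also have "\<dots> \<le> 3 * real n * res b x" using n0 res_nonneg[of b x] by (intro mult_right_mono) auto
        finally show "\<rho> \<le> 3 * real n * res b x" .
      qed (use e n0 in auto)
      also have "\<dots> = e * res b x" using n0 by simp
      finally show ?thesis .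
    qed
    finally show ?thesis by (simp add: e_def algebra_simps)
  qed
qed

lemma REST_spec:
  assumes "good (mem \<sigma> 3)" "reg \<sigma> 2 = real n" "0 < reg \<sigma> 0" "reg \<sigma> 0 < 1"
  shows "res (mem \<sigma> 1) (mem (run A REST \<sigma>) 2) \<le> (1 + reg \<sigma> 0) * res (mem \<sigma> 1) x"
  using MAIN_spec[OF assms, of x] BARRIER_spec[OF assms(2-4), of x]
  by (simp add: REST_def)

end

section \<open>Probability of obtaining Lewis weights\<close>

primrec loop_exps :: "cmd \<Rightarrow> rexp set" where
  "loop_exps Nop = {}"
| "loop_exps (Assign x e) = {}"
| "loop_exps (Fill m a e) = {}"
| "loop_exps (Acc x e) = {}"
| "loop_exps (MulA a c) = {}"
| "loop_exps (MulAT a c) = {}"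
| "loop_exps (Lin w v z) = {}"
| "loop_exps (c1 ;; c2) = loop_exps c1 \<union> loop_exps c2"
| "loop_exps (Branch e1 e2 c1 c2) = loop_exps c1 \<union> loop_exps c2"
| "loop_exps (Loop e c) = insert e (loop_exps c)"

text \<open>\<open>f\<close> bounds the rounds of each loop by its count expression. A bound
  independent of the store is possible because \<open>cost_le_bound\<close> applies it to commands
  whose loop counts are registers that they never write.\<close>

primrec cost_bound :: "(rexp \<Rightarrow> real) \<Rightarrow> cmd \<Rightarrow> real" where
  "cost_bound f Nop = 1"
| "cost_bound f (Assign x e) = exp_cost e + 4"
| "cost_bound f (Fill m a e) = exp_cost e + 10"
| "cost_bound f (Acc x e) = exp_cost e + 10"
| "cost_bound f (MulA a c) = 40"
| "cost_bound f (MulAT a c) = 40"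
| "cost_bound f (Lin w v z) = 1"
| "cost_bound f (c1 ;; c2) = cost_bound f c1 + cost_bound f c2"
| "cost_bound f (Branch e1 e2 c1 c2) = exp_cost e1 + exp_cost e2 + 4 + max (cost_bound f c1) (cost_bound f c2)"
| "cost_bound f (Loop e c) = exp_cost e + 8 + f e * (cost_bound f c + 4)"

lemma cost_bound_ge: "(\<And>e. 0 \<le> f e) \<Longrightarrow> 1 \<le> cost_bound f c"
proof (induction c)
  case (Branch e1 e2 c1 c2)
  then show ?case using exp_cost_ge[of e1] exp_cost_ge[of e2] by (simp add: max_def)
next
  case (Loop e c)
  then have "0 \<le> f e * (cost_bound f c + 4)" by (intro mult_nonneg_nonneg) (auto intro: add_nonneg_nonneg order.trans[of 0 1])
  then show ?case using exp_cost_ge[of e] by simp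
qed (use exp_cost_ge in \<open>auto intro!: add_nonneg_nonneg add_increasing2 order.trans[OF zero_le_one]\<close>)

text \<open>For the outer loops, whose count is a composite expression. \<open>X\<close> collects
  the registers that fix the inner loop counts and stay constant during the loop.\<close>

lemma cost_Loop_le:
  assumes wr: "wr_reg c \<inter> X = {}" and c: "\<And>\<sigma>'. \<forall>x\<in>X. reg \<sigma>' x = reg \<sigma> x \<Longrightarrow> cost A c \<sigma>' \<le> B"
  shows "cost A (Loop e c) \<sigma> \<le> exp_cost e + 8 + real (nat \<lceil>eval e (reg \<sigma>) (mem \<sigma>) 0\<rceil>) * (B + 4)"
proof -
  have "\<forall>x\<in>X. reg ((run A c ^^ k) \<sigma>) x = reg \<sigma> x" for k
  proof (induction k)
    case (Suc k)
    have "reg (run A c ((run A c ^^ k) \<sigma>)) x = reg ((run A c ^^ k) \<sigma>) x" if "x \<in> X" for x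
      using wr that by (intro run_reg_frame) auto
    then show ?case using Suc by simp
  qed simp
  then have "(\<Sum>k<N. cost A c ((run A c ^^ k) \<sigma>) + 4) \<le> (\<Sum>k<N. B + 4)" for N
    using c by (intro sum_mono) simp
  then show ?thesis by simp
qed

lemma cost_le_bound:
  assumes "loop_exps c \<subseteq> V ` X" "wr_reg c \<inter> X = {}" "\<forall>x\<in>X. real (nat \<lceil>reg \<sigma> x\<rceil>) \<le> f (V x)" "\<And>e. 0 \<le> f e"
  shows "cost A c \<sigma> \<le> cost_bound f c"
  using assms(1-3)
proof (induction c arbitrary: \<sigma>)
  case (Then c1 c2)
  have "reg (run A c1 \<sigma>) x = reg \<sigma> x" if "x \<in> X" for x
    using Then.prems(2) that by (intro run_reg_frame) auto
  then have "cost A c2 (run A c1 \<sigma>) \<le> cost_bound f c2"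
    using Then.prems by (intro Then.IH(2)) auto
  moreover have "cost A c1 \<sigma> \<le> cost_bound f c1" using Then.prems by (intro Then.IH(1)) auto
  ultimately show ?case by simp
next
  case (Branch e1 e2 c1 c2)
  have "cost A c1 \<sigma> \<le> cost_bound f c1" "cost A c2 \<sigma> \<le> cost_bound f c2"
    using Branch.prems by (auto intro!: Branch.IH)
  then show ?case by (auto simp: le_max_iff_disj)
next
  case (Loop e c)
  obtain x where x: "x \<in> X" "e = V x" using Loop.prems(1) by auto
  have "cost A (Loop e c) \<sigma> \<le> exp_cost e + 8 + real (nat \<lceil>eval e (reg \<sigma>) (mem \<sigma>) 0\<rceil>) * (cost_bound f c + 4)"
    by (rule cost_Loop_le[of _ X]) (use Loop in auto)
  also have "\<dots> \<le> exp_cost e + 8 + f e * (cost_bound f c + 4)"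
    using Loop.prems(3) x cost_bound_ge[of f c] assms(4) by (intro add_left_mono mult_right_mono) auto
  finally show ?case by simp
qed auto

section \<open>Success probabilities, computed backwards\<close>

lemma measure_bind_coin:
  "measure (measure_spmf (bind_spmf coin_spmf f)) S =
     (measure (measure_spmf (f True)) S + measure (measure_spmf (f False)) S) / 2"
proof -
  have c: "coin_spmf = spmf_of_pmf (pmf_of_set UNIV)" by (simp add: spmf_of_pmf_pmf_of_set)
  have "emeasure (measure_pmf (bind_pmf (pmf_of_set UNIV) f)) X =
      (emeasure (measure_pmf (f True)) X + emeasure (measure_pmf (f False)) X) / 2" for X
    by (simp add: nn_integral_pmf_of_set UNIV_bool add.commute)
  then have "ennreal (measure (measure_pmf (bind_pmf (pmf_of_set UNIV) f)) X) =
      ennreal ((measure (measure_pmf (f True)) X + measure (measure_pmf (f False)) X) / 2)" for X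
    by (simp add: measure_pmf.emeasure_eq_measure ennreal_divide_numeral[symmetric] del: ennreal_plus flip: ennreal_plus)
  then have "measure (measure_pmf (bind_pmf (pmf_of_set UNIV) f)) X =
      (measure (measure_pmf (f True)) X + measure (measure_pmf (f False)) X) / 2" for X
    by (subst (asm) ennreal_inj) auto
  then show ?thesis
    unfolding c bind_spmf_of_pmf measure_measure_spmf_conv_measure_pmf by simp
qed

lemma exec_While: "exec A T (While t p) s =
    (if test_sem t s then bind_spmf (exec A T p (tick 1 s)) (exec A T (While t p)) else return_spmf (tick 1 s))"
proof -
  have "exec A T (While t p) = iterate (test_sem t) (exec A T p)" by (simp add: fun_eq_iff)
  then show ?thesis using iterate.simps[of "test_sem t" "exec A T p" s] by simp
qed

text \<open>Lower bounds on this probability are propagated backwards through continuations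
  \<open>k\<close>, so the distribution of intermediate states is never described.\<close>

definition hits :: "state spmf \<Rightarrow> state set \<Rightarrow> real" where
  "hits p S = measure (measure_spmf p) S"

lemma hits_nonneg: "0 \<le> hits p S"
  by (simp add: hits_def)

lemma hits_det:
  assumes "det A T p s Q" "\<And>s'. Q s' \<Longrightarrow> L \<le> hits (k s') S"
  shows "L \<le> hits (bind_spmf (exec A T p s) k) S"
  using assms by (auto simp: det_def)

context regression
begin

text \<open>\<open>L\<close> bounds the success probability once all signs are known. Conditioning
  on the next flip mirrors the recursion of \<open>avg\<close>, the index \<open>n - r\<close> being
  the next sign to draw.\<close>

lemma hits_flips:
  assumes "r \<le> n" "base s" "nvar s 3 = n - r" "nvar s 4 = 1"
    and "\<And>s'. base s' \<Longrightarrow> (\<exists>g. rarr s' = (rarr s)(20 := g)) \<Longrightarrow> (\<forall>x<100. rvar s' x = rvar s x) \<Longrightarrow>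
      clock s' \<le> clock s + 1 + 8 * real r \<Longrightarrow> L (rarr s' 20) \<le> hits (k s') S"
  shows "avg n r L (rarr s 20) \<le> hits (bind_spmf (exec A T (While (NLess 3 0) (Seq (Seq (Flip 5) (Seq (ROfNat 100 5)
     (Seq (ROp RAdd 100 100 100) (Seq (RConst 101 1) (Seq (ROp RSub 100 100 101) (RStore 20 3 100))))))
     (NOp NAdd 3 3 4))) s) k) S" (is "_ \<le> hits (bind_spmf (exec A T ?W s) k) S")
  using assms
proof (induction r arbitrary: s)
  case 0
  have "\<not> test_sem (NLess 3 0) s" using 0 by (simp add: base_def)
  then have "exec A T ?W s = return_spmf (tick 1 s)" by (subst exec_While) simp
  moreover have "L (rarr (tick 1 s) 20) \<le> hits (k (tick 1 s)) S"
    using 0 by (intro 0(5)) (auto intro!: exI[of _ "rarr s 20"])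
  ultimately show ?case by (simp del: exec.simps)
next
  case (Suc r)
  \<comment> \<open>The state after one round of the loop, with the successive values
    \<open>c\<close>, \<open>2 c\<close> and \<open>2 c - 1\<close> in register 100.\<close>
  define G where "G c = tick 1 (set_nvar 3 (n - r) (tick 1 (set_rarr 20 (n - Suc r) (if c then 1 else - 1) (tick 1
     (set_rvar 100 (if c then 1 else - 1) (tick 1 (set_rvar 101 1 (tick 1 (set_rvar 100 (if c then 2 else 0) (tick 1
     (set_rvar 100 (if c then 1 else 0) (tick 1 (set_nvar 5 (if c then 1 else 0) (tick 1 s))))))))))))))" for c
  have t: "test_sem (NLess 3 0) s" using Suc.prems by (simp add: base_def)
  have nr: "Suc (n - Suc r) = n - r" using Suc.prems(1) by simp
  have "exec A T ?W s = bind_spmf coin_spmf (\<lambda>c. exec A T ?W (G c))"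
    using t Suc.prems nr
    by (subst exec_While) (auto simp: map_spmf_conv_bind_spmf G_def intro!: bind_spmf_cong arg_cong[where f = "iterate _ _"]
      arg_cong[where f = "tick 1"])
  then have e: "hits (bind_spmf (exec A T ?W s) k) S =
      (hits (bind_spmf (exec A T ?W (G True)) k) S + hits (bind_spmf (exec A T ?W (G False)) k) S) / 2"
    by (simp add: hits_def measure_bind_coin del: exec.simps)
  have "avg n r L (rarr (G c) 20) \<le> hits (bind_spmf (exec A T ?W (G c)) k) S" for c
  proof (rule Suc.IH)
    fix s' assume h: "base s'" "\<exists>g. rarr s' = (rarr (G c))(20 := g)" "\<forall>x<100. rvar s' x = rvar (G c) x"
      "clock s' \<le> clock (G c) + 1 + 8 * real r"
    show "L (rarr s' 20) \<le> hits (k s') S"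
      by (rule Suc.prems(5)) (use h in \<open>auto simp: G_def\<close>)
  qed (use Suc.prems in \<open>auto simp: G_def\<close>)
  from this[of True] this[of False] show ?case unfolding e by (simp add: G_def)
qed

lemma badness_cong:
  assumes "\<forall>i<n. w i = w' i" shows "badness w = badness w'"
proof -
  have "ip n w z z = ip n w' z z" for z unfolding ip_def using assms by (intro sum.cong) auto
  then show ?thesis unfolding badness_def bad_def using assms by (intro sum.cong) auto
qed

lemma LEWIS_spec:
  assumes w: "\<forall>i<n. 0 < mem \<sigma> 3 i" and d: "reg \<sigma> 3 = real d"
  shows "\<exists>h. sketch (mem \<sigma> 3) (mem \<sigma> 20) h \<and> (\<forall>i<n. mem (run A LEWIS \<sigma>) 3 i = lewis_step (mem \<sigma> 3) h i)"
proof -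
  define \<sigma>1 where "\<sigma>1 = run A (Fill Rows 5 (At 20 [*] e_exp (e_ln (At 3) [/] Cst 2))) \<sigma>"
  define \<sigma>2 where "\<sigma>2 = run A (SOLVE 3 5 7) \<sigma>1"
  define \<sigma>3 where "\<sigma>3 = run A (MulA 8 7) \<sigma>2"
  have f1: "a \<noteq> 5 \<Longrightarrow> mem \<sigma>1 a = mem \<sigma> a" "reg \<sigma>1 = reg \<sigma>" for a by (auto simp: \<sigma>1_def)
  have m1: "mem \<sigma>1 5 i = mem \<sigma> 20 i * sqrt (mem \<sigma> 3 i)" if "i < n" for i
  proof -
    have w0: "0 < mem \<sigma> 3 i" using w that by simp
    then have "exp (ln (mem \<sigma> 3 i) / 2) = exp (ln (sqrt (mem \<sigma> 3 i)))" by (simp only: ln_sqrt)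
    also have "\<dots> = sqrt (mem \<sigma> 3 i)" using w0 by (intro exp_ln) simp
    finally show ?thesis using that by (simp add: \<sigma>1_def)
  qed
  have f2: "a \<noteq> 6 \<Longrightarrow> a \<noteq> 7 \<Longrightarrow> mem \<sigma>2 a = mem \<sigma>1 a" "reg \<sigma>2 = reg \<sigma>" for a by (simp_all add: \<sigma>2_def SOLVE_def f1)
  define h where "h = lin_app A (mem \<sigma>2 7)"
  have f3: "a \<noteq> 8 \<Longrightarrow> mem \<sigma>3 a = mem \<sigma>2 a" "reg \<sigma>3 = reg \<sigma>" "\<And>i. i < n \<Longrightarrow> mem \<sigma>3 8 i = h i" for a
    by (auto simp: \<sigma>3_def f2 h_def)
  have sk: "sketch (mem \<sigma> 3) (mem \<sigma> 20) h"
    unfolding sketch_def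
  proof (intro conjI ballI)
    show "h \<in> colspace" by (simp add: h_def)
    fix u assume u: "u \<in> colspace"
    have p: "\<forall>i<n. 0 < mem \<sigma>1 3 i" using w by (simp add: f1)
    have "ip n (mem \<sigma>1 3) h u = (\<Sum>i<n. mem \<sigma>1 5 i * u i)"
      unfolding h_def \<sigma>2_def by (rule SOLVE_spec(1)[OF p _ u]) simp
    then show "ip n (mem \<sigma> 3) h u = (\<Sum>i<n. mem \<sigma> 20 i * sqrt (mem \<sigma> 3 i) * u i)" using m1 by (simp add: f1)
  qed
  define Z where "Z = ip n (mem \<sigma> 3) h h"
  have "run A (SUMR 4 (At 3 [*] At 8 [*] At 8)) \<sigma>3 = \<sigma>3\<lparr>reg := (reg \<sigma>3)(4 := Z)\<rparr>"
    by (subst SUMR_run) (simp_all add: Z_def ip_def f3 f2 f1)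
  then have r: "run A LEWIS \<sigma> = run A (Branch (Cst 16 [*] V 3) (V 4) Nop
      (Fill Rows 3 (At 3 [*] (Cst 1 [+] Cst 4 [*] At 8 [*] At 8)))) (\<sigma>3\<lparr>reg := (reg \<sigma>3)(4 := Z)\<rparr>)"
    by (simp only: LEWIS_def run.simps(8) \<sigma>1_def \<sigma>2_def \<sigma>3_def)
  have "mem (run A LEWIS \<sigma>) 3 i = lewis_step (mem \<sigma> 3) h i" if "i < n" for i
    using that d unfolding r lewis_step_def Z_def[symmetric] by (simp add: f3 f2 f1 power2_eq_square mult.assoc)
  then show ?thesis using sk by blast
qed

definition lewis_state :: "real \<Rightarrow> real \<Rightarrow> (nat \<Rightarrow> real) \<Rightarrow> nat \<Rightarrow> state \<Rightarrow> bool" where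
  "lewis_state \<epsilon> C b t s \<longleftrightarrow> base s \<and> rvar s 0 = \<epsilon> \<and> rvar s 1 = C \<and> rvar s 2 = real n \<and> rvar s 3 = real d \<and> rarr s 1 = b \<and>
     (\<forall>i<n. 0 < rarr s 3 i) \<and> 1 \<le> (\<Sum>i<n. rarr s 3 i) \<and> (\<Sum>i<n. rarr s 3 i) \<le> 1 + 64 * real d * real t"

definition lewis_body :: prog where
  "lewis_body = Seq FLIPS (compile 1 LEWIS)"

text \<open>The guarantee \<open>1 - q * badness\<close> is affine in the badness, so it can be
  averaged over the signs, and the expected decrease of \<open>badness_step\<close> multiplies
  \<open>q\<close> by 15/16.\<close>

lemma lewis_body_hits:
  assumes st: "lewis_state \<epsilon> C b t s"
    and k: "\<And>s'. lewis_state \<epsilon> C b (Suc t) s' \<Longrightarrow> rvar s' 50 = rvar s 50 \<Longrightarrow> rvar s' 51 = rvar s 51 \<Longrightarrow>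
      clock s' \<le> clock s + (11 + cost_bound (\<lambda>_. 0) LEWIS) * T \<Longrightarrow> 1 - q * badness (rarr s' 3) \<le> hits (k s') S"
    and q: "0 \<le> q"
  shows "1 - 15 / 16 * q * badness (rarr s 3) \<le> hits (bind_spmf (exec A T lewis_body s) k) S"
proof -
  define \<sigma> where "\<sigma> g = \<lparr>reg = rvar s, mem = (rarr s)(20 := g)\<rparr>" for g
  define w where "w = rarr s 3"
  have w: "\<forall>i<n. 0 < w i" using st by (simp add: lewis_state_def w_def)
  have "\<exists>h. sketch w g h \<and> (\<forall>i<n. mem (run A LEWIS (\<sigma> g)) 3 i = lewis_step w h i)" for g
    using LEWIS_spec[of "\<sigma> g"] st by (auto simp: lewis_state_def \<sigma>_def w_def)
  then obtain h where h: "\<And>g. sketch w g (h g)" "\<And>g i. i < n \<Longrightarrow> mem (run A LEWIS (\<sigma> g)) 3 i = lewis_step w (h g) i"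
    by metis
  define L where "L g = 1 - q * badness (lewis_step w (h g))" for g
  define s1 where "s1 = tick 1 (set_nvar 4 1 (tick 1 (set_nvar 3 0 s)))"
  have "1 - 15 / 16 * q * badness w \<le> avg n n L (rarr s1 20)"
  proof -
    have "avg n n L g0 = 1 - q * avg n n (\<lambda>g. badness (lewis_step w (h g))) g0" for g0
      using avg_lin[of n n 1 "\<lambda>_. 1" "- q" "\<lambda>g. badness (lewis_step w (h g))" g0] by (simp add: L_def[abs_def] avg_const)
    moreover have "q * avg n n (\<lambda>g. badness (lewis_step w (h g))) g0 \<le> q * (15 / 16 * badness w)" for g0
      by (rule mult_left_mono[OF badness_step[OF w h(1)] q])
    moreover have "15 / 16 * q * badness w = q * (15 / 16 * badness w)" by simp
    ultimately show ?thesis by (metis diff_left_mono)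
  qed
  also have "\<dots> \<le> hits (bind_spmf (exec A T (While (NLess 3 0) (Seq (Seq (Flip 5) (Seq (ROfNat 100 5)
     (Seq (ROp RAdd 100 100 100) (Seq (RConst 101 1) (Seq (ROp RSub 100 100 101) (RStore 20 3 100))))))
     (NOp NAdd 3 3 4))) s1) (\<lambda>s'. bind_spmf (exec A T (compile 1 LEWIS) s') k)) S"
  proof (rule hits_flips)
    fix s' assume s': "base s'" "\<exists>g. rarr s' = (rarr s1)(20 := g)" "\<forall>x<100. rvar s' x = rvar s1 x"
      "clock s' \<le> clock s1 + 1 + 8 * real n"
    define g where "g = rarr s' 20"
    have sim: "sim (\<sigma> g) s'" using s' by (auto simp: sim_def \<sigma>_def s1_def g_def)
    show "L (rarr s' 20) \<le> hits (bind_spmf (exec A T (compile 1 LEWIS) s') k) S"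
      unfolding g_def[symmetric]
    proof (rule hits_det[OF compile_correct[OF sim wf_LEWIS]])
      fix s2 assume "sim (run A LEWIS (\<sigma> g)) s2 \<and> clock s2 \<le> clock s' + cost A LEWIS (\<sigma> g) * T \<and>
        (\<forall>x. 50 \<le> x \<and> x < 50 + 2 * 1 \<longrightarrow> rvar s2 x = rvar s' x)"
      then have s2: "sim (run A LEWIS (\<sigma> g)) s2" "clock s2 \<le> clock s' + cost A LEWIS (\<sigma> g) * T"
        "rvar s2 50 = rvar s 50" "rvar s2 51 = rvar s 51" using s' by (auto simp: s1_def)
      have w2: "rarr s2 3 i = lewis_step w (h g) i" if "i < n" for i using s2(1) h(2)[OF that] by (simp add: sim_def)
      have rg: "rvar s2 x = rvar s x" if "x < 4" for x
      proof -
        have "rvar s2 x = reg (run A LEWIS (\<sigma> g)) x" using s2(1) that by (simp add: sim_def)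
        also have "\<dots> = reg (\<sigma> g) x" by (rule run_reg_frame) (use that in \<open>auto simp: block_defs\<close>)
        finally show ?thesis by (simp add: \<sigma>_def)
      qed
      have b: "rarr s2 1 = rarr s 1"
      proof -
        have "rarr s2 1 = mem (run A LEWIS (\<sigma> g)) 1" using s2(1) by (simp add: sim_def)
        also have "\<dots> = mem (\<sigma> g) 1" by (rule run_mem_frame) (simp add: block_defs)
        finally show ?thesis by (simp add: \<sigma>_def)
      qed
      have sm: "(\<Sum>i<n. rarr s2 3 i) = (\<Sum>i<n. lewis_step w (h g) i)" using w2 by (intro sum.cong) auto
      have up: "(\<Sum>i<n. rarr s2 3 i) \<le> 1 + 64 * real d * real (Suc t)"
        using lewis_step_sum[OF w, of "h g"] st unfolding sm by (simp add: lewis_state_def w_def algebra_simps)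
      have "(\<Sum>i<n. w i) \<le> (\<Sum>i<n. lewis_step w (h g) i)"
        using w by (intro sum_mono lewis_step_ge) (auto intro: less_imp_le)
      then have lo: "1 \<le> (\<Sum>i<n. rarr s2 3 i)" using st unfolding sm by (simp add: lewis_state_def w_def)
      have ls: "lewis_state \<epsilon> C b (Suc t) s2"
        using st s2(1) rg[of 0] rg[of 1] rg[of 2] rg[of 3] b lo up lewis_step_pos[OF w, of "h g"] w2
        by (simp add: lewis_state_def sim_def)
      have "cost A LEWIS (\<sigma> g) * T \<le> cost_bound (\<lambda>_. 0) LEWIS * T"
        using T_nonneg cost_le_bound[of LEWIS "{}"] by (intro mult_right_mono) (auto simp: block_defs)
      moreover have "clock s' \<le> clock s + 3 + 8 * T" using s'(4) T_ge_n by (simp add: s1_def)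
      ultimately have cl: "clock s2 \<le> clock s + (11 + cost_bound (\<lambda>_. 0) LEWIS) * T" using s2(2) T_ge_1 unfolding distrib_right by linarith
      have "badness (rarr s2 3) = badness (lewis_step w (h g))" using w2 by (intro badness_cong) auto
      then show "L g \<le> hits (k s2) S" using k[OF ls s2(3,4) cl] by (simp add: L_def)
    qed simp
  qed (use st in \<open>auto simp: lewis_state_def s1_def\<close>)
  also have "\<dots> = hits (bind_spmf (exec A T lewis_body s) k) S"
    unfolding lewis_body_def FLIPS_def for_nat_def s1_def by simp
  finally show ?thesis by (simp add: w_def)
qed

text \<open>Backward induction on the number \<open>r\<close> of rounds left. The base case is
  Markov's inequality: after the last round \<open>1 - B * badness\<close> is at most 0 if a
  violated coordinate remains, and otherwise the continuation succeeds surely.\<close>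

lemma lewis_loop_hits:
  fixes v :: real and \<epsilon> C b S k and cl :: real
  defines "N \<equiv> nat \<lceil>v\<rceil>" and "c \<equiv> (14 + cost_bound (\<lambda>_. 0) LEWIS) * T"
  defines "B \<equiv> 1 + 64 * real d * real N"
  assumes k: "\<And>s'. lewis_state \<epsilon> C b N s' \<Longrightarrow> good (rarr s' 3) \<Longrightarrow> clock s' \<le> cl + real N * c + 1 \<Longrightarrow> 1 \<le> hits (k s') S"
    and "r \<le> N" "lewis_state \<epsilon> C b (N - r) s" "rvar s 50 = real (N - r)" "rvar s 51 = v" "clock s \<le> cl + real (N - r) * c"
  shows "1 - B * (15 / 16) ^ r * badness (rarr s 3) \<le>
    hits (bind_spmf (exec A T (While (RLess 50 51) (Seq lewis_body (Seq (RConst 100 1) (ROp RAdd 50 50 100)))) s) k) S"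
  using assms(5-)
proof (induction r arbitrary: s)
  case 0
  let ?W = "While (RLess 50 51) (Seq lewis_body (Seq (RConst 100 1) (ROp RAdd 50 50 100)))"
  have "v \<le> real N" unfolding N_def by linarith
  then have "exec A T ?W s = return_spmf (tick 1 s)" using 0 by (subst exec_While) simp
  then have e: "hits (bind_spmf (exec A T ?W s) k) S = hits (k (tick 1 s)) S" by (simp del: exec.simps)
  have ls: "lewis_state \<epsilon> C b N (tick 1 s)" using 0 by (simp add: lewis_state_def)
  have w: "\<forall>i<n. 0 < rarr s 3 i" "(\<Sum>i<n. rarr s 3 i) \<le> B" "1 \<le> (\<Sum>i<n. rarr s 3 i)"
    using 0 by (auto simp: lewis_state_def B_def)
  show ?case
  proof (cases "\<exists>i<n. bad (rarr s 3) i")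
    case True
    then have "1 \<le> B * badness (rarr s 3)" using badness_ge[OF w(1) _ _ w(2)] by blast
    then show ?thesis unfolding e using hits_nonneg[of "k (tick 1 s)" S] by simp
  next
    case False
    then have "good (rarr (tick 1 s) 3)" using w by (auto simp: good_def)
    then have "1 \<le> hits (k (tick 1 s)) S" using k[OF ls] 0 by simp
    moreover have "badness (rarr s 3) = 0" using False by (simp add: badness_def)
    ultimately show ?thesis unfolding e by simp
  qed
next
  case (Suc r)
  let ?W = "While (RLess 50 51) (Seq lewis_body (Seq (RConst 100 1) (ROp RAdd 50 50 100)))"
  let ?P = "Seq (RConst 100 1) (ROp RAdd 50 50 100)"
  have c: "11 * T + cost_bound (\<lambda>_. 0) LEWIS * T + 3 \<le> c" unfolding c_def using T_ge_1 by (simp add: distrib_right)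
  have k1: "Suc (N - Suc r) = N - r" using Suc.prems(1) by simp
  then have rk: "real (N - r) = real (N - Suc r) + 1" by linarith
  have "real (N - Suc r) < v" using Suc.prems(1) unfolding N_def by linarith
  then have e: "exec A T ?W s = bind_spmf (exec A T lewis_body (tick 1 s)) (\<lambda>s'. bind_spmf (exec A T ?P s') (exec A T ?W))"
    using Suc.prems by (subst exec_While) simp
  have "1 - 15 / 16 * (B * (15 / 16) ^ r) * badness (rarr (tick 1 s) 3) \<le>
     hits (bind_spmf (exec A T lewis_body (tick 1 s)) (\<lambda>s'. bind_spmf (exec A T ?P s') (\<lambda>s'. bind_spmf (exec A T ?W s') k))) S"
  proof (rule lewis_body_hits)
    show "lewis_state \<epsilon> C b (N - Suc r) (tick 1 s)" using Suc.prems by (simp add: lewis_state_def)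
    show "0 \<le> B * (15 / 16) ^ r" by (simp add: B_def)
    fix s' assume s': "lewis_state \<epsilon> C b (Suc (N - Suc r)) s'" "rvar s' 50 = rvar (tick 1 s) 50" "rvar s' 51 = rvar (tick 1 s) 51"
      "clock s' \<le> clock (tick 1 s) + (11 + cost_bound (\<lambda>_. 0) LEWIS) * T"
    define s2 where "s2 = tick 1 (set_rvar 50 (rvar s' 50 + 1) (tick 1 (set_rvar 100 1 s')))"
    have x: "exec A T ?P s' = return_spmf s2" by (simp add: s2_def)
    have "1 - B * (15 / 16) ^ r * badness (rarr s2 3) \<le> hits (bind_spmf (exec A T ?W s2) k) S"
    proof (rule Suc.IH)
      show "lewis_state \<epsilon> C b (N - r) s2" using s'(1) unfolding k1 by (simp add: lewis_state_def s2_def)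
      show "rvar s2 50 = real (N - r)" using s'(2) Suc.prems(3) rk by (simp add: s2_def)
      show "clock s2 \<le> cl + real (N - r) * c" using s'(4) Suc.prems(5) c unfolding rk by (simp add: s2_def distrib_right)
    qed (use Suc.prems s' in \<open>auto simp: s2_def\<close>)
    moreover have "rarr s2 = rarr s'" by (simp add: s2_def)
    ultimately show "1 - B * (15 / 16) ^ r * badness (rarr s' 3) \<le>
        hits (bind_spmf (exec A T ?P s') (\<lambda>s'. bind_spmf (exec A T ?W s') k)) S"
      unfolding x by simp
  qed
  then show ?case unfolding e by (simp add: mult_ac del: exec.simps)
qed

end

section \<open>Running time\<close>

text \<open>The bound \<open>ln a \<le> a\<close> is wasteful but keeps the constants explicit; what
  counts is that they are independent of \<open>n\<close>.\<close>

lemma ln_le_poly: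
  fixes x a n :: real
  assumes "0 < x" "x \<le> a * n ^ k" "1 \<le> a" "1 \<le> n"
  shows "ln x \<le> (a + real k) * (1 + ln n)"
proof -
  have "ln x \<le> ln (a * n ^ k)" using assms by simp
  also have "\<dots> = ln a + real k * ln n" using assms by (simp add: ln_mult ln_realpow)
  also have "\<dots> \<le> a * (1 + ln n) + real k * (1 + ln n)"
  proof (rule add_mono)
    have "ln a \<le> a" using ln_le_minus_one[of a] assms by simp
    also have "\<dots> \<le> a * (1 + ln n)" using assms by simp
    finally show "ln a \<le> a * (1 + ln n)" .
  qed (simp add: mult_left_mono)
  finally show ?thesis by (simp add: distrib_right)
qed

text \<open>\<open>K\<close> is compared with the claimed bound through cubes, as
  \<open>K ^ 3\<close> is free of roots.\<close>

lemma powr_third_cubed: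
  fixes d e :: real
  assumes "0 < d" "0 < e"
  shows "(d powr (1 / 3) * e powr (- 2 / 3)) ^ 3 = d / e\<^sup>2"
proof -
  have "(d powr (1 / 3)) ^ 3 = d" using assms by (simp add: powr_power)
  moreover have "(e powr (- 2 / 3)) ^ 3 = e powr (- 2)" using assms by (simp add: powr_power)
  moreover have "e powr (- 2) = 1 / e\<^sup>2" using assms by (simp add: powr_minus_divide)
  ultimately show ?thesis by (simp add: power_mult_distrib)
qed

lemma powr_third_ge_1:
  fixes d e :: real
  assumes "1 \<le> d" "0 < e" "e < 1"
  shows "1 \<le> d powr (1 / 3) * e powr (- 2 / 3)"
proof -
  have "1 \<le> e powr (- 2 / 3)" using powr_mono'[of "- 2 / 3" 0 e] assms by simp
  moreover have "1 \<le> d powr (1 / 3)" using assms by (simp add: ge_one_powr_ge_zero)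
  ultimately show ?thesis using mult_mono[of 1 "d powr (1 / 3)" 1 "e powr (- 2 / 3)"] by simp
qed

lemma nat_ceiling_le: "y \<le> z \<Longrightarrow> 0 \<le> z \<Longrightarrow> real (nat \<lceil>y\<rceil>) \<le> z + 1"
  by linarith

definition rounds_const :: "real \<Rightarrow> real" where
  "rounds_const D = 36 * D + 12"

definition steps_const :: "real \<Rightarrow> real" where
  "steps_const D = 324 * D * (288 + 2 * (66248 * D\<^sup>2 + 15)) + 2"

definition newton_const :: "real \<Rightarrow> real" where
  "newton_const D = 96 * (10732176000 * D ^ 3 + 27)"

text \<open>The assumption \<open>1 \<le> e * n ^ 4\<close> bounds \<open>1 / e\<close> by a power
  of \<open>n\<close>, so every logarithm is of order \<open>l\<close>. From
  \<open>g \<le> 18 l / e\<close> and \<open>W \<le> D d l\<close> follows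
  \<open>K ^ 3 = W g^2 \<le> 324 D l^3 d / e^2\<close>, the cube of the claimed rate up to constants
  and logarithms.\<close>

lemma main_counts:
  fixes n d e W D :: real
  defines "l \<equiv> 1 + ln n" and "X \<equiv> d powr (1 / 3) * e powr (- 2 / 3)" and "g \<equiv> ln (4 * n) / (e / 6)"
  defines "Q \<equiv> W * g * g"
  defines "K \<equiv> exp (ln Q / 3)" and "F \<equiv> 2 * n * (1 + (4 + W) * g) * (1 + (4 + W) * g)"
  assumes n: "1 \<le> n" and d: "1 \<le> d" "d \<le> n" and e: "0 < e" "e < 1" "1 \<le> e * n ^ 4" and D: "1 \<le> D"
    and W: "1 \<le> W" "W \<le> D * d * l"
  shows "2 * ln ((2 + W) / (e / 6)) \<le> rounds_const D * l"
    and "288 * K + 2 * K * ln (4 * F) + 2 \<le> steps_const D * l\<^sup>2 * X"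
    and "96 * ln (2000 * Q * F) \<le> newton_const D * l"
proof -
  have l1: "1 \<le> l" using n by (simp add: l_def)
  have ln: "l \<le> n" using ln_le_minus_one[of n] n by (simp add: l_def)
  have X1: "1 \<le> X" unfolding X_def using d e by (intro powr_third_ge_1) auto
  have "ln (4 * n) = ln 4 + ln n" using n by (simp add: ln_mult)
  then have "ln (4 * n) \<le> 3 * l" using ln_le_minus_one[of "4 :: real"] ln_ge_zero[OF n] by (simp add: l_def)
  then have gl: "g \<le> 18 * l / e" unfolding g_def using e by (simp add: field_simps)
  have g0: "0 < g" unfolding g_def using n e by simp
  have en: "1 / e \<le> n ^ 4" using e by (simp add: field_simps)
  have gn: "g \<le> 18 * n ^ 5"
  proof -
    have "18 * l / e = 18 * l * (1 / e)" by simp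
    also have "\<dots> \<le> 18 * n * n ^ 4" using ln l1 en e n by (intro mult_mono) auto
    finally show ?thesis using gl by (simp add: eval_nat_numeral mult.assoc)
  qed
  have Wn: "W \<le> D * n\<^sup>2"
  proof -
    have "D * d * l \<le> D * n * n" using d ln l1 D by (intro mult_mono) auto
    then show ?thesis using W by (simp add: power2_eq_square mult.assoc)
  qed
  have nn: "1 \<le> n\<^sup>2" "1 \<le> n ^ 7" using n by simp_all
  have Dn: "1 \<le> D * n\<^sup>2" "1 \<le> D * n ^ 7" using mult_mono[OF D nn(1)] mult_mono[OF D nn(2)] D by auto
  have Q0: "0 < Q" unfolding Q_def using W g0 by simp
  have gg: "1 \<le> 1 + (4 + W) * g" using W g0 by simp
  have F0: "0 < F" unfolding F_def using n gg by simp
  have Qn: "Q \<le> 324 * D * n ^ 12"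
  proof -
    have "Q \<le> D * n\<^sup>2 * (18 * n ^ 5) * (18 * n ^ 5)" unfolding Q_def using Wn gn W g0 n D by (intro mult_mono) auto
    also have "\<dots> = 324 * D * n ^ 12" by (simp add: eval_nat_numeral)
    finally show ?thesis .
  qed
  have Fn: "F \<le> 16562 * D\<^sup>2 * n ^ 15"
  proof -
    have "(4 + W) * g \<le> 5 * (D * n\<^sup>2) * (18 * n ^ 5)" using Wn gn W g0 Dn by (intro mult_mono) auto
    also have "\<dots> = 90 * (D * n ^ 7)" by (simp add: eval_nat_numeral)
    finally have u: "1 + (4 + W) * g \<le> 91 * (D * n ^ 7)" using Dn by linarith
    have "F \<le> 2 * n * (91 * (D * n ^ 7)) * (91 * (D * n ^ 7))" unfolding F_def using u gg n D by (intro mult_mono) auto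
    also have "\<dots> = 16562 * D\<^sup>2 * n ^ 15" by (simp add: eval_nat_numeral)
    finally show ?thesis .
  qed
  have D2: "1 \<le> D\<^sup>2" "1 \<le> D ^ 3" using D by simp_all
  show "2 * ln ((2 + W) / (e / 6)) \<le> rounds_const D * l"
  proof -
    have "(2 + W) / (e / 6) = (2 + W) * 6 * (1 / e)" by simp
    also have "\<dots> \<le> (3 * (D * n\<^sup>2)) * 6 * n ^ 4" using Wn Dn en W e n D by (intro mult_mono) auto
    also have "\<dots> = 18 * D * n ^ 6" by (simp add: eval_nat_numeral)
    finally have "ln ((2 + W) / (e / 6)) \<le> (18 * D + real 6) * l"
      unfolding l_def using e W D n by (intro ln_le_poly) auto
    then show ?thesis by (simp add: rounds_const_def algebra_simps)
  qed
  show "96 * ln (2000 * Q * F) \<le> newton_const D * l"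
  proof -
    have "2000 * Q * F \<le> 2000 * (324 * D * n ^ 12) * (16562 * D\<^sup>2 * n ^ 15)" using Qn Fn Q0 F0 D n by (intro mult_mono) auto
    also have "\<dots> = 10732176000 * D ^ 3 * n ^ 27" by (simp add: eval_nat_numeral)
    finally have "ln (2000 * Q * F) \<le> (10732176000 * D ^ 3 + real 27) * l"
      unfolding l_def using Q0 F0 D2 n by (intro ln_le_poly) auto
    then show ?thesis by (simp add: newton_const_def algebra_simps)
  qed
  have LF: "ln (4 * F) \<le> (66248 * D\<^sup>2 + 15) * l"
  proof -
    have "4 * F \<le> 66248 * D\<^sup>2 * n ^ 15" using Fn by simp
    then have "ln (4 * F) \<le> (66248 * D\<^sup>2 + real 15) * l" unfolding l_def using F0 D2 n by (intro ln_le_poly) auto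
    then show ?thesis by simp
  qed
  have K0: "0 < K" by (simp add: K_def)
  have KX: "K \<le> 324 * D * l * X"
  proof -
    have "K ^ 3 = exp (real 3 * (ln Q / 3))" unfolding K_def by (rule exp_of_nat_mult[symmetric])
    also have "\<dots> = Q" using Q0 by simp
    also have "\<dots> \<le> D * d * l * (18 * l / e) * (18 * l / e)" unfolding Q_def using W gl g0 D d l1 e by (intro mult_mono) auto
    also have "\<dots> = 324 * D * (l ^ 3 * (d / e\<^sup>2))" by (simp add: eval_nat_numeral)
    also have "d / e\<^sup>2 = X ^ 3" unfolding X_def using d e by (subst powr_third_cubed) auto
    also have "324 * D * (l ^ 3 * X ^ 3) \<le> (324 * D) ^ 3 * (l ^ 3 * X ^ 3)"
      using l1 X1 D self_le_power[of "324 * D" 3] by (intro mult_right_mono) auto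
    also have "\<dots> = (324 * D * l * X) ^ 3" by (simp add: power_mult_distrib)
    finally show ?thesis using l1 X1 D K0 by (simp add: power_mono_iff)
  qed
  show "288 * K + 2 * K * ln (4 * F) + 2 \<le> steps_const D * l\<^sup>2 * X"
  proof -
    have "288 * K + 2 * K * ln (4 * F) = K * (288 + 2 * ln (4 * F))" by (simp add: algebra_simps)
    also have "\<dots> \<le> K * ((288 + 2 * (66248 * D\<^sup>2 + 15)) * l)"
      using LF K0 l1 by (intro mult_left_mono) (auto simp: algebra_simps)
    also have "\<dots> \<le> (324 * D * l * X) * ((288 + 2 * (66248 * D\<^sup>2 + 15)) * l)"
      using KX l1 D2 by (intro mult_right_mono) auto
    also have "\<dots> = 324 * D * (288 + 2 * (66248 * D\<^sup>2 + 15)) * l\<^sup>2 * X" by (simp add: power2_eq_square)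
    finally have a: "288 * K + 2 * K * ln (4 * F) \<le> 324 * D * (288 + 2 * (66248 * D\<^sup>2 + 15)) * l\<^sup>2 * X" .
    have "1 * 1 \<le> l\<^sup>2 * X" using l1 X1 by (intro mult_mono) auto
    then show ?thesis using a by (simp add: steps_const_def distrib_right)
  qed
qed

text \<open>In terms of \<open>t = e powr (- 1/6)\<close> the assumption reads
  \<open>n^2 < t^3\<close>, the logarithm is at most \<open>33 t\<close>, and \<open>t^4\<close> is
  the claimed power of \<open>e\<close>. This is the origin of the threshold
  \<open>1 / n^4\<close>.\<close>

lemma barrier_count:
  fixes n d e :: real
  assumes n: "1 \<le> n" and d: "1 \<le> d" and e: "0 < e" "e < 1" "e * n ^ 4 < 1"
  shows "64 * n * n * ln (24 * n * n / e) \<le> 2112 * (d powr (1 / 3) * e powr (- 2 / 3))"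
proof -
  define t where "t = e powr (- 1 / 6)"
  have t1: "1 \<le> t" using powr_mono'[of "- 1 / 6" 0 e] e by (simp add: t_def)
  have t6: "t ^ 6 = 1 / e" unfolding t_def using e powr_minus_divide[of e 1] by (simp add: powr_power)
  have t4: "t ^ 4 = e powr (- 2 / 3)" unfolding t_def using e by (simp add: powr_power)
  have "(n * n)\<^sup>2 \<le> (t ^ 3)\<^sup>2"
  proof -
    have "n ^ 4 \<le> t ^ 6" unfolding t6 using e by (simp add: field_simps)
    moreover have "(n * n)\<^sup>2 = n ^ 4" by (simp add: eval_nat_numeral)
    moreover have "(t ^ 3)\<^sup>2 = t ^ 6" by (simp add: eval_nat_numeral)
    ultimately show ?thesis by linarith
  qed
  then have nt: "n * n \<le> t ^ 3" by (rule power2_le_imp_le) (use t1 in simp)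
  have "ln (24 * n * n / e) \<le> ln (24 * t ^ 9)"
  proof -
    have "24 * n * n / e = 24 * (n * n) * t ^ 6" by (simp add: t6)
    also have "\<dots> \<le> 24 * t ^ 3 * t ^ 6" using nt t1 by (intro mult_right_mono) auto
    also have "\<dots> = 24 * t ^ 9" by (simp add: power_add[symmetric])
    finally have "24 * n * n / e \<le> 24 * t ^ 9" .
    moreover have "0 < 24 * n * n / e" using n e by simp
    ultimately show ?thesis using t1 by simp
  qed
  also have "\<dots> = ln 24 + 9 * ln t" using t1 by (simp add: ln_mult ln_realpow)
  also have "\<dots> \<le> 33 * t" using ln_le_minus_one[of "24 :: real"] ln_le_minus_one[of t] t1 by simp
  finally have "64 * (n * n) * ln (24 * n * n / e) \<le> 64 * t ^ 3 * (33 * t)"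
  proof -
    assume a: "ln (24 * n * n / e) \<le> 33 * t"
    have "1 \<le> n * n" using n mult_mono[of 1 n 1 n] by simp
    then have "0 \<le> ln (24 * n * n / e)" using e by (intro ln_ge_zero) (simp add: le_divide_eq)
    then show ?thesis using a nt t1 by (intro mult_mono) auto
  qed
  also have "\<dots> = 2112 * (1 * e powr (- 2 / 3))" unfolding t4[symmetric] by (simp add: eval_nat_numeral)
  also have "\<dots> \<le> 2112 * (d powr (1 / 3) * e powr (- 2 / 3))"
    using d by (intro mult_left_mono mult_right_mono) (auto simp: ge_one_powr_ge_zero)
  finally show ?thesis by (simp add: mult.assoc)
qed

lemma cost_bound_PROX:
  "0 \<le> f (V 16) \<Longrightarrow> cost_bound f PROX \<le> 1000 + 2000 * f (V 16)" "cost_bound f UPDATE \<le> 2000" "cost_bound f (CHECK a) \<le> 500"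
  by (simp_all add: block_defs)

definition rest_const :: "real \<Rightarrow> real" where
  "rest_const D = 10000 * ((rounds_const D + 2) * (steps_const D + 2) * (newton_const D + 2)) + 3000000"

text \<open>From the total weight \<open>1 + 64 d N\<close> after
  \<open>N \<le> (32 C + 400) lg\<close> rounds.\<close>

definition lewis_const :: "real \<Rightarrow> real" where
  "lewis_const C = 1 + 64 * (32 * C + 400)"

definition time_const :: "real \<Rightarrow> real" where
  "time_const C = 50 + (32 * C + 400) * (14 + cost_bound (\<lambda>_. 0) LEWIS) + rest_const (lewis_const C)"

context regression
begin

abbreviation "lg \<equiv> 1 + ln (real n)"

lemma lg_ge_1: "1 \<le> lg"
  using n_pos by simp

text \<open>The loops are nested: of order \<open>lg\<close> bisection rounds, \<open>lg^2 X\<close>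
  accelerated steps and \<open>lg\<close> Newton steps, which together give the exponent 4 of the
  logarithm.\<close>

lemma MAIN_cost:
  assumes n: "reg \<sigma> 2 = real n" and e: "reg \<sigma> 0 = e" "0 < e" "e < 1" "1 \<le> e * real n ^ 4" and D: "1 \<le> D"
    and pos: "\<forall>i<n. 0 < mem \<sigma> 3 i" and W: "1 \<le> (\<Sum>i<n. mem \<sigma> 3 i)" "(\<Sum>i<n. mem \<sigma> 3 i) \<le> D * real d * lg"
  shows "cost A MAIN \<sigma> \<le> 9000 * ((rounds_const D + 2) * (steps_const D + 2) * (newton_const D + 2)) *
    (lg ^ 4 * (real d powr (1 / 3) * e powr (- 2 / 3)))"
proof -
  define X where "X = real d powr (1 / 3) * e powr (- 2 / 3)"
  define W where "W = (\<Sum>i<n. mem \<sigma> 3 i)"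
  define \<sigma>1 where "\<sigma>1 = run A INIT \<sigma>"
  define \<sigma>2 where "\<sigma>2 = run A SETUP \<sigma>1"
  note I = INIT_spec[OF pos, folded \<sigma>1_def W_def]
  have n1: "reg \<sigma>1 2 = real n" using I(7)[of 2] n by simp
  note S = SETUP_spec[OF n1 \<sigma>2_def]
  have e1: "reg \<sigma>1 0 / 6 = e / 6" using I(7)[of 0] e by simp
  have p: "params W (e / 6) \<sigma>2" using S(1) unfolding e1 I(1) .
  define r where "r = real (nat \<lceil>2 * ln ((2 + W) / (e / 6))\<rceil>)"
  define m where "m = real (nat \<lceil>reg \<sigma>2 15\<rceil>)"
  define j where "j = real (nat \<lceil>reg \<sigma>2 16\<rceil>)"
  have mj: "0 \<le> r" "0 \<le> m" "0 \<le> j" by (simp_all add: r_def m_def j_def)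
  have n1: "1 \<le> real n" "1 \<le> real d" "real d \<le> real n" using n_pos d_pos d_le_n by auto
  have X1: "1 \<le> X" unfolding X_def using n1 e by (intro powr_third_ge_1) auto
  have l2X: "1 * 1 \<le> lg\<^sup>2 * X" using lg_ge_1 X1 by (intro mult_mono) auto
  note M = main_counts[OF n1 e(2-4) D W[folded W_def], folded X_def]
  have cs: "0 \<le> rounds_const D" "0 \<le> steps_const D" "0 \<le> newton_const D"
    using D by (auto simp: rounds_const_def steps_const_def newton_const_def)
  have rb: "1 + r \<le> (rounds_const D + 2) * lg"
    using nat_ceiling_le[OF M(1)] cs lg_ge_1 by (simp add: r_def distrib_right)
  have mb: "1 + m \<le> (steps_const D + 2) * (lg\<^sup>2 * X)"
  proof -
    have "reg \<sigma>2 15 \<le> steps_const D * lg\<^sup>2 * X" using M(2) p by (simp add: params_def)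
    then have "m \<le> steps_const D * lg\<^sup>2 * X + 1" unfolding m_def using cs X1 by (intro nat_ceiling_le) auto
    then show ?thesis using l2X by (simp add: distrib_right mult.assoc)
  qed
  have jb: "1 + j \<le> (newton_const D + 2) * lg"
  proof -
    have "reg \<sigma>2 16 \<le> newton_const D * lg" using M(3) p by (simp add: params_def)
    then have "j \<le> newton_const D * lg + 1" unfolding j_def using cs lg_ge_1 by (intro nat_ceiling_le) auto
    then show ?thesis using lg_ge_1 by (simp add: distrib_right)
  qed
  define f where "f = (\<lambda>x. if x = V 15 then m else if x = V 16 then j else 0)"
  have f: "f (V 15) = m" "f (V 16) = j" "0 \<le> f x" for x using mj by (simp_all add: f_def)
  have st: "cost_bound f STEP \<le> 4000 + 2000 * j"
    using cost_bound_PROX(1)[of f, OF f(3)] cost_bound_PROX(2)[of f] cost_bound_PROX(3)[of f 16] mj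
    by (simp add: STEP_def f max_def)
  have "m * cost_bound f STEP \<le> m * (4000 + 2000 * j)" by (rule mult_left_mono[OF st mj(2)])
  then have bi: "cost_bound f BISECT \<le> 1000 + m * (4004 + 2000 * j)"
    using cost_bound_PROX(3)[of f 12] by (simp add: BISECT_def DECIDE_def f distrib_left)
  have dj: "loop_exps BISECT \<subseteq> V ` {15, 16}" "wr_reg BISECT \<inter> {15, 16} = {}" by (auto simp: block_defs)
  let ?e = "Cst 2 [*] e_ln ((Cst 2 [+] V 4) [/] V 8)"
  have lp: "cost A (Loop ?e BISECT) \<sigma>2 \<le> 20 + r * (1004 + m * (4004 + 2000 * j))"
  proof -
    have r4: "reg \<sigma>2 4 = W" "reg \<sigma>2 8 = e / 6" using S(5)[of 4] I(1) p by (simp_all add: params_def)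
    have "cost A BISECT \<sigma>' \<le> 1000 + m * (4004 + 2000 * j)" if "\<forall>x\<in>{15, 16}. reg \<sigma>' x = reg \<sigma>2 x" for \<sigma>'
      by (rule order.trans[OF cost_le_bound[OF dj] bi]) (use that f in \<open>auto simp: m_def j_def\<close>)
    then have "cost A (Loop ?e BISECT) \<sigma>2 \<le> exp_cost ?e + 8 +
        real (nat \<lceil>eval ?e (reg \<sigma>2) (mem \<sigma>2) 0\<rceil>) * (1000 + m * (4004 + 2000 * j) + 4)"
      by (intro cost_Loop_le[OF dj(2)]) blast
    then show ?thesis by (simp add: r4 r_def del: cost.simps)
  qed
  have "cost A MAIN \<sigma> \<le> 2000 + r * (1004 + m * (4004 + 2000 * j))"
  proof -
    have i: "cost A INIT \<sigma> \<le> 500"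
      by (rule order.trans[OF cost_le_bound[of _ "{}" _ "\<lambda>_. 0"]]) (auto simp: block_defs)
    have s: "cost A SETUP \<sigma>1 \<le> 500"
      by (rule order.trans[OF cost_le_bound[of _ "{}" _ "\<lambda>_. 0"]]) (auto simp: block_defs)
    have "0 \<le> r * (1004 + m * (4004 + 2000 * j))" using mj by simp
    then show ?thesis using i s lp by (simp add: MAIN_def \<sigma>1_def[symmetric] \<sigma>2_def[symmetric] del: cost.simps(10) run.simps(10))
  qed
  also have "\<dots> \<le> 9000 * ((1 + r) * (1 + m) * (1 + j))"
  proof -
    have "0 \<le> r * m" "0 \<le> r * j" "0 \<le> m * j" "0 \<le> r * (m * j)" using mj by simp_all
    then show ?thesis using mj by (simp add: algebra_simps)
  qed
  also have "\<dots> \<le> 9000 * ((rounds_const D + 2) * lg * ((steps_const D + 2) * (lg\<^sup>2 * X)) * ((newton_const D + 2) * lg))"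
    using rb mb jb mj cs lg_ge_1 X1 by (intro mult_left_mono mult_mono) auto
  also have "\<dots> = 9000 * ((rounds_const D + 2) * (steps_const D + 2) * (newton_const D + 2)) * (lg ^ 4 * X)"
  proof -
    have "9000 * (a * l * (b * (l\<^sup>2 * X)) * (c * l)) = 9000 * (a * b * c) * (l ^ 4 * X)" for a b c l :: real
      by (simp add: eval_nat_numeral mult_ac)
    then show ?thesis .
  qed
  finally show ?thesis by (simp only: X_def)
qed

lemma BARRIER_cost:
  assumes n: "reg \<sigma> 2 = real n" and e: "reg \<sigma> 0 = e" "0 < e" "e < 1" "e * real n ^ 4 < 1"
  shows "cost A BARRIER \<sigma> \<le> 2500000 * (real d powr (1 / 3) * e powr (- 2 / 3))"
proof -
  define X where "X = real d powr (1 / 3) * e powr (- 2 / 3)"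
  have n1: "1 \<le> real n" "1 \<le> real d" using n_pos d_pos by auto
  have X1: "1 \<le> X" unfolding X_def using n1 e by (intro powr_third_ge_1) auto
  let ?c1 = "Fill Rows 4 (Cst 1) ;; SOLVE 4 1 2 ;; MulA 8 2 ;; MAXABS 4 (At 8 [-] At 1)"
  let ?e = "Cst 64 [*] V 2 [*] V 2 [*] e_ln (Cst 24 [*] V 2 [*] V 2 [/] V 0)"
  define \<sigma>1 where "\<sigma>1 = run A (Assign 5 (Cst 8 [*] V 2 [*] V 4)) (run A ?c1 \<sigma>)"
  have r1: "reg \<sigma>1 2 = real n" "reg \<sigma>1 0 = e"
    unfolding \<sigma>1_def run.simps(8)[symmetric] by (simp_all add: run_reg_frame block_defs n e del: run.simps)
  have b: "cost A BARRIER_STEP \<sigma>' \<le> 1000" for \<sigma>'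
    by (rule order.trans[OF cost_le_bound[of _ "{}" _ "\<lambda>_. 0"]]) (auto simp: block_defs)
  have "cost A (Loop ?e BARRIER_STEP) \<sigma>1 \<le> 40 + real (nat \<lceil>64 * real n * real n * ln (24 * real n * real n / e)\<rceil>) * 1004"
    using cost_Loop_le[of BARRIER_STEP "{}" \<sigma>1 A 1000 ?e] b by (simp add: r1)
  also have "\<dots> \<le> 40 + (2112 * X + 1) * 1004"
    using barrier_count[OF n1 e(2-4)] X1 by (intro add_left_mono mult_right_mono nat_ceiling_le) (auto simp: X_def)
  finally have l: "cost A (Loop ?e BARRIER_STEP) \<sigma>1 \<le> 40 + (2112 * X + 1) * 1004" .
  have c: "cost A ?c1 \<sigma> \<le> 500"
    by (rule order.trans[OF cost_le_bound[of _ "{}" _ "\<lambda>_. 0"]]) (auto simp: block_defs)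
  have "cost A BARRIER \<sigma> \<le> 1000 + (40 + (2112 * X + 1) * 1004)"
    using c l X1 unfolding BARRIER_def \<sigma>1_def by (simp del: cost.simps(10) run.simps(10))
  also have "\<dots> \<le> 2500000 * X" using X1 by simp
  finally show ?thesis by (simp add: X_def)
qed

lemma REST_cost:
  assumes n: "reg \<sigma> 2 = real n" and e: "reg \<sigma> 0 = e" "0 < e" "e < 1" and D: "1 \<le> D"
    and pos: "\<forall>i<n. 0 < mem \<sigma> 3 i" and W: "1 \<le> (\<Sum>i<n. mem \<sigma> 3 i)" "(\<Sum>i<n. mem \<sigma> 3 i) \<le> D * real d * lg"
  shows "cost A REST \<sigma> \<le> rest_const D * (lg ^ 4 * (real d powr (1 / 3) * e powr (- 2 / 3)))"
proof -
  define X where "X = real d powr (1 / 3) * e powr (- 2 / 3)"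
  have X1: "1 \<le> X" unfolding X_def using d_pos e by (intro powr_third_ge_1) auto
  have l4: "1 \<le> lg ^ 4" using lg_ge_1 by simp
  then have Xl: "X \<le> lg ^ 4 * X" "1 \<le> lg ^ 4 * X" using X1 mult_mono[of 1 "lg ^ 4" 1 X] by auto
  have n4: "e * real n * real n * real n * real n = e * real n ^ 4" by (simp add: eval_nat_numeral)
  define P where "P = (rounds_const D + 2) * (steps_const D + 2) * (newton_const D + 2)"
  have cs: "0 \<le> P"
    using D by (auto simp: P_def rounds_const_def steps_const_def newton_const_def)
  show ?thesis
  proof (cases "e * real n ^ 4 < 1")
    case True
    then have "cost A REST \<sigma> \<le> 50 + cost A BARRIER \<sigma>" by (simp add: REST_def n e n4)
    also have "\<dots> \<le> 3000000 * (lg ^ 4 * X)" using BARRIER_cost[OF n e True] Xl by (simp add: X_def)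
    also have "\<dots> \<le> rest_const D * (lg ^ 4 * X)"
      using cs Xl unfolding rest_const_def P_def[symmetric] by (intro mult_right_mono) auto
    finally show ?thesis by (simp add: X_def)
  next
    case False
    then have "cost A REST \<sigma> \<le> 50 + cost A MAIN \<sigma>" by (simp add: REST_def n e n4)
    also have "\<dots> \<le> 50 * (lg ^ 4 * X) + 9000 * P * (lg ^ 4 * X)"
      using MAIN_cost[OF n e _ D pos W] False Xl unfolding P_def[symmetric] X_def[symmetric] by simp
    also have "\<dots> = (50 + 9000 * P) * (lg ^ 4 * X)"
      by (simp add: distrib_right)
    also have "\<dots> \<le> rest_const D * (lg ^ 4 * X)"
      using cs Xl unfolding rest_const_def P_def[symmetric] by (intro mult_right_mono) auto
    finally show ?thesis by (simp add: X_def)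
  qed
qed

section \<open>Failure probability and the final bound\<close>

lemma badness_uniform: "\<forall>i<n. w i = 1 / real n \<Longrightarrow> badness w \<le> (real n)\<^sup>2"
proof -
  assume w: "\<forall>i<n. w i = 1 / real n"
  have "badness w \<le> (\<Sum>i<n. real n)" unfolding badness_def using w by (intro sum_mono) auto
  then show ?thesis by (simp add: power2_eq_square)
qed

text \<open>\<open>(15/16)^N\<close> is at most the square of \<open>E = exp (- N / 32)\<close>. One
  factor reduces \<open>1 + N\<close> to the constant 33. The other is at most
  \<open>n^(-C-3) exp (-8)\<close>: here \<open>n^3\<close> pays for the total weight times the
  initial badness, and \<open>exp 8 \<ge> 65 * 33\<close> for the constants.\<close>

lemma failure_bound:
  fixes C :: real
  defines "N \<equiv> nat \<lceil>32 * ((C + 3) * ln (real n) + 8)\<rceil>"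
  assumes C: "0 < C"
  shows "(1 + 64 * real d * real N) * (15 / 16) ^ N * (real n)\<^sup>2 \<le> real n powr (- C)"
proof -
  define E where "E = exp (- (real N / 32))"
  have n1: "1 \<le> real n" "real d \<le> real n" using n_pos d_le_n by auto
  have N: "32 * ((C + 3) * ln (real n) + 8) \<le> real N" unfolding N_def by linarith
  have a: "1 + 64 * real d * real N \<le> 65 * real n * (1 + real N)"
  proof -
    have "real d * real N \<le> real n * real N" using n1 by (intro mult_right_mono) auto
    moreover have "0 \<le> real n * real N" by simp
    moreover have "65 * real n * (1 + real N) = 65 * real n + 65 * (real n * real N)" "64 * real d * real N = 64 * (real d * real N)"
      by (simp_all add: algebra_simps)
    ultimately show ?thesis using n1 by linarith
  qed
  have b: "(15 / 16) ^ N \<le> E * E"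
  proof -
    have "(15 / 16 :: real) ^ N \<le> exp (- 1 / 16) ^ N" using exp_ge_add_one_self[of "- 1 / 16 :: real"] by (intro power_mono) auto
    also have "\<dots> = exp (real N * (- 1 / 16))" by (rule exp_of_nat_mult[symmetric])
    also have "\<dots> = E * E" by (simp add: E_def exp_add[symmetric])
    finally show ?thesis .
  qed
  have c: "(1 + real N) * E \<le> 33"
  proof -
    have "1 + real N \<le> 33 * exp (real N / 32)" using exp_ge_add_one_self[of "real N / 32"] by linarith
    then have "(1 + real N) * E \<le> 33 * exp (real N / 32) * E" by (intro mult_right_mono) (simp_all add: E_def)
    also have "\<dots> = 33" by (simp add: E_def exp_minus)
    finally show ?thesis .
  qed
  have d: "E \<le> real n powr (- C) / (real n ^ 3 * 2145)"
  proof -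
    \<comment> \<open>\<open>exp (1/2) \<ge> 1 + 1/2 + 1/8 = 13/8\<close>, and the 16th power of
      13/8 exceeds 2145.\<close>
    have e8: "2145 \<le> exp (8 :: real)"
    proof -
      have "(13 / 8) ^ 16 \<le> exp (1 / 2 :: real) ^ 16"
        using exp_lower_Taylor_quadratic[of "1 / 2 :: real"] by (intro power_mono) (auto simp: power2_eq_square)
      also have "\<dots> = exp 8" by (simp add: exp_of_nat_mult[symmetric])
      finally show ?thesis by (simp add: eval_nat_numeral)
    qed
    have "E \<le> exp (- C * ln (real n) - (3 * ln (real n) + 8))" unfolding E_def using N by (simp add: algebra_simps)
    also have "\<dots> = real n powr (- C) / exp (3 * ln (real n) + 8)" using n1 by (simp add: exp_diff powr_def)
    also have "exp (3 * ln (real n) + 8) = real n ^ 3 * exp 8"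
      using n1 exp_of_nat_mult[of 3 "ln (real n)"] by (simp add: exp_add)
    also have "real n powr (- C) / (real n ^ 3 * exp 8) \<le> real n powr (- C) / (real n ^ 3 * 2145)"
      using e8 n1 by (intro divide_left_mono mult_left_mono) auto
    finally show ?thesis .
  qed
  have "(1 + 64 * real d * real N) * (15 / 16) ^ N * (real n)\<^sup>2 \<le> (65 * real n * (1 + real N)) * (E * E) * (real n)\<^sup>2"
    using a b by (intro mult_right_mono mult_mono) auto
  also have "\<dots> = 65 * real n ^ 3 * (((1 + real N) * E) * E)" by (simp add: eval_nat_numeral)
  also have "\<dots> \<le> 65 * real n ^ 3 * (33 * (real n powr (- C) / (real n ^ 3 * 2145)))"
    using c d by (intro mult_left_mono mult_mono) (auto simp: E_def)
  also have "\<dots> = real n powr (- C)" using n1 by simp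
  finally show ?thesis .
qed

lemma hits_return: "s \<in> S \<Longrightarrow> hits (return_spmf s) S = 1"
  by (simp add: hits_def measure_measure_spmf_conv_measure_pmf indicator_def)

lemma hits_Seq:
  "det A T p s (\<lambda>s'. L \<le> hits (exec A T q s') S) \<Longrightarrow> L \<le> hits (exec A T (Seq p q) s) S"
  by (auto simp: det_def)

lemma hits_bind_Seq:
  "det A T p s (\<lambda>s'. L \<le> hits (bind_spmf (exec A T q s') k) S) \<Longrightarrow> L \<le> hits (bind_spmf (exec A T (Seq p q) s) k) S"
  by (auto simp: det_def)

lemma linf_norm_res:
  assumes "v \<in> carrier_vec n" "\<And>i. i < n \<Longrightarrow> v $ i = b i"
  shows "linf_norm (A *\<^sub>v Matrix.vec d x - v) = res b x"
proof -
  have "(A *\<^sub>v Matrix.vec d x - v) $ i = lin_app A x i - b i" if "i < n" for i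
    using assms that carrier by (subst index_minus_vec) (auto simp: mult_mat_vec_lin_app simp del: index_mult_mat_vec)
  then have "linf_norm (A *\<^sub>v Matrix.vec d x - v) = Max ((\<lambda>i. \<bar>lin_app A x i - b i\<bar>) ` {..<n})"
    unfolding linf_norm_def using assms(1) by (intro arg_cong[where f = Max] image_cong) auto
  also have "\<dots> = res b x"
    unfolding res_def
  proof (rule Max_eqI)
    show "max_abs n (\<lambda>i. lin_app A x i - b i) \<in> (\<lambda>i. \<bar>lin_app A x i - b i\<bar>) ` {..<n}"
      using max_abs_attained[of n "\<lambda>i. lin_app A x i - b i"] n_pos by auto
  qed (auto intro: max_abs_ge)
  finally show ?thesis .
qed

text \<open>Once the weights are good, accuracy and running time hold with certainty
  (\<open>fin\<close>). The whole loss of probability is that of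
  \<open>failure_bound\<close>.\<close>

theorem REGRESSION_correct:
  assumes b: "b \<in> carrier_vec n" and eps: "0 < eps" "eps < 1" and C: "0 < C"
  shows "1 - real n powr (- C) \<le> measure (measure_spmf (exec A T REGRESSION (input_state A es b eps C)))
          {s. linf_norm (A *\<^sub>v output_vec d s - b) \<le> (1 + eps) * (INF x \<in> carrier_vec d. linf_norm (A *\<^sub>v x - b)) \<and>
              clock s \<le> time_const C * lg ^ 4 * (real d powr (1 / 3) * eps powr (- 2 / 3) * T)}"
    (is "_ \<le> measure _ ?S")
proof -
  define b' where "b' i = (if i < dim_vec b then b $ i else 0)" for i
  define v where "v = 32 * ((C + 3) * ln (real n) + 8)"
  define N where "N = nat \<lceil>v\<rceil>"
  define c where "c = (14 + cost_bound (\<lambda>_. 0) LEWIS) * T"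
  define cl where "cl = 49 * T"
  define X where "X = real d powr (1 / 3) * eps powr (- 2 / 3)"
  have n1: "1 \<le> real n" "1 \<le> real d" using n_pos d_pos by auto
  have X1: "1 \<le> X" unfolding X_def using n1 eps by (intro powr_third_ge_1) auto
  have NL: "real N \<le> (32 * C + 400) * lg"
  proof -
    have "0 \<le> v" using n1 C by (simp add: v_def)
    then have "real N \<le> v + 1" unfolding N_def by (intro nat_ceiling_le) auto
    also have "\<dots> \<le> (32 * C + 400) * lg" using n1 C by (simp add: v_def algebra_simps)
    finally show ?thesis .
  qed
  have fin: "1 \<le> hits (exec A T (compile 0 REST) s) ?S"
    if ls: "lewis_state eps C b' N s" and g: "good (rarr s 3)" and cs: "clock s \<le> cl + real N * c + 1" for s
  proof -
    define \<sigma> where "\<sigma> = \<lparr>reg = rvar s, mem = rarr s\<rparr>"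
    have sim: "sim \<sigma> s" using ls by (simp add: sim_def \<sigma>_def lewis_state_def)
    have sg: "reg \<sigma> 2 = real n" "reg \<sigma> 0 = eps" "mem \<sigma> 1 = b'" "good (mem \<sigma> 3)" "\<forall>i<n. 0 < mem \<sigma> 3 i"
      "1 \<le> (\<Sum>i<n. mem \<sigma> 3 i)" "(\<Sum>i<n. mem \<sigma> 3 i) \<le> 1 + 64 * real d * real N"
      using ls g by (auto simp: \<sigma>_def lewis_state_def)
    obtain s' where s': "exec A T (compile 0 REST) s = return_spmf s'" "sim (run A REST \<sigma>) s'"
      "clock s' \<le> clock s + cost A REST \<sigma> * T"
      using compile_correct[OF sim wf_REST] by (auto simp: det_def)
    have out: "linf_norm (A *\<^sub>v output_vec d s' - b) \<le> (1 + eps) * (INF x \<in> carrier_vec d. linf_norm (A *\<^sub>v x - b))"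
    proof -
      have b2: "\<And>i. i < n \<Longrightarrow> b $ i = b' i" using b by (simp add: b'_def)
      have o: "linf_norm (A *\<^sub>v output_vec d s' - b) = res b' (mem (run A REST \<sigma>) 2)"
        unfolding output_vec_def using linf_norm_res[OF b b2] s'(2) by (simp add: sim_def)
      \<comment> \<open>Comparison with each single \<open>x\<close> passes to the infimum without
        choosing a minimiser.\<close>
      have "linf_norm (A *\<^sub>v output_vec d s' - b) / (1 + eps) \<le> (INF x \<in> carrier_vec d. linf_norm (A *\<^sub>v x - b))"
      proof (rule cINF_greatest)
        have "0\<^sub>v d \<in> (carrier_vec d :: real Matrix.vec set)" by simp
        then show "(carrier_vec d :: real Matrix.vec set) \<noteq> {}" by (metis empty_iff)
        fix x :: "real Matrix.vec" assume x: "x \<in> carrier_vec d"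
        then have "x = Matrix.vec d (\<lambda>j. x $ j)" by (intro eq_vecI) auto
        then have "linf_norm (A *\<^sub>v x - b) = res b' (\<lambda>j. x $ j)" using linf_norm_res[OF b b2] by metis
        then show "linf_norm (A *\<^sub>v output_vec d s' - b) / (1 + eps) \<le> linf_norm (A *\<^sub>v x - b)"
          using REST_spec[of \<sigma> "\<lambda>j. x $ j"] sg eps o by (simp add: field_simps)
      qed
      then show ?thesis using eps by (simp add: field_simps)
    qed
    have "clock s' \<le> time_const C * lg ^ 4 * (X * T)"
    proof -
      have L1: "1 \<le> lewis_const C" using C by (simp add: lewis_const_def)
      have "(\<Sum>i<n. mem \<sigma> 3 i) \<le> lewis_const C * real d * lg"
      proof -
        have "64 * real d * real N \<le> 64 * real d * ((32 * C + 400) * lg)" using NL by (intro mult_left_mono) auto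
        moreover have "1 * 1 \<le> real d * lg" using n1 lg_ge_1 by (intro mult_mono) auto
        ultimately show ?thesis using sg(7) by (simp add: lewis_const_def algebra_simps)
      qed
      then have "cost A REST \<sigma> \<le> rest_const (lewis_const C) * (lg ^ 4 * X)"
        unfolding X_def using sg eps L1 by (intro REST_cost) auto
      then have r: "cost A REST \<sigma> * T \<le> rest_const (lewis_const C) * (lg ^ 4 * X) * T" using T_nonneg by (intro mult_right_mono)
      have l4: "1 * 1 \<le> lg ^ 4 * X" "lg * 1 \<le> lg ^ 4 * X"
        using lg_ge_1 X1 by (intro mult_mono one_le_power self_le_power; simp)+
      have q0: "0 \<le> 14 + cost_bound (\<lambda>_. 0) LEWIS" using cost_bound_ge[of "\<lambda>_. 0" LEWIS] by simp
      have "real N * c \<le> (32 * C + 400) * (lg ^ 4 * X) * c"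
      proof (rule mult_right_mono)
        have "(32 * C + 400) * lg \<le> (32 * C + 400) * (lg ^ 4 * X)" using l4 C by (intro mult_left_mono) auto
        then show "real N \<le> (32 * C + 400) * (lg ^ 4 * X)" using NL by linarith
        show "0 \<le> c" unfolding c_def using q0 T_nonneg by (rule mult_nonneg_nonneg)
      qed
      moreover have "cl + 1 \<le> 50 * (lg ^ 4 * X) * T"
      proof -
        have "1 * T \<le> (lg ^ 4 * X) * T" using l4 T_nonneg by (intro mult_right_mono) auto
        moreover have "50 * (lg ^ 4 * X) * T = 50 * ((lg ^ 4 * X) * T)" by (rule mult.assoc)
        ultimately show ?thesis using T_ge_1 unfolding cl_def by linarith
      qed
      ultimately have "clock s' \<le> 50 * (lg ^ 4 * X) * T + (32 * C + 400) * (lg ^ 4 * X) * c + rest_const (lewis_const C) * (lg ^ 4 * X) * T"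
        using s'(3) cs r by linarith
      also have "\<dots> = time_const C * lg ^ 4 * (X * T)"
        unfolding time_const_def c_def by (simp add: algebra_simps)
      finally show ?thesis .
    qed
    then have "s' \<in> ?S" using out by (simp add: X_def)
    then show ?thesis unfolding s'(1) using hits_return by simp
  qed
  let ?s0 = "input_state A es b eps C"
  define s1 where "s1 = tick 1 (set_rvar 3 (real d) (tick 1 (set_rvar 2 (real n) ?s0)))"
  define \<sigma>1 where "\<sigma>1 = \<lparr>reg = rvar s1, mem = rarr s1\<rparr>"
  have sim1: "sim \<sigma>1 s1"
    by (simp add: sim_def \<sigma>1_def s1_def) (simp add: base_def input_state_def)
  have r1: "rvar s1 0 = eps" "rvar s1 1 = C" "rvar s1 2 = real n" "rvar s1 3 = real d" "rarr s1 1 = b'" "clock s1 = 2"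
    by (auto simp: s1_def input_state_def b'_def)
  let ?loop = "for_real 0 LEWIS_COUNT (Seq FLIPS (compile 1 LEWIS))"
  have lp: "1 - real n powr (- C) \<le> hits (bind_spmf (exec A T ?loop s2) (exec A T (compile 0 REST))) ?S"
    if s2: "sim (run A (Fill Rows 3 (Cst 1 [/] V 2)) \<sigma>1) s2" "clock s2 \<le> 2 + 14 * T" for s2
  proof -
    have w2: "rarr s2 3 i = 1 / real n" if "i < n" for i using s2(1) that by (simp add: sim_def \<sigma>1_def r1)
    have r2: "rvar s2 0 = eps" "rvar s2 1 = C" "rvar s2 2 = real n" "rvar s2 3 = real d" "rarr s2 1 = b'" "base s2"
      using s2(1) r1 by (simp_all add: sim_def \<sigma>1_def)
    have main: "1 - real n powr (- C) \<le> hits (bind_spmf (exec A T (While (RLess 50 51)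
        (Seq lewis_body (Seq (RConst 100 1) (ROp RAdd 50 50 100)))) s3) (exec A T (compile 0 REST))) ?S"
      if s3: "base s3" "\<forall>x<50. rvar s3 x = rvar s2 x" "rarr s3 = rarr s2" "rvar s3 50 = 0" "rvar s3 51 = v" "clock s3 \<le> cl" for s3
    proof -
      have sm: "(\<Sum>i<n. rarr s3 3 i) = 1" using w2 n1 by (simp add: s3)
      have "lewis_state eps C b' 0 s3"
        using s3 r2 w2 n1 sm by (auto simp: lewis_state_def)
      then have "1 - (1 + 64 * real d * real N) * (15 / 16) ^ N * badness (rarr s3 3) \<le> hits (bind_spmf (exec A T (While (RLess 50 51)
        (Seq lewis_body (Seq (RConst 100 1) (ROp RAdd 50 50 100)))) s3) (exec A T (compile 0 REST))) ?S"
        unfolding N_def using fin[unfolded N_def c_def] s3 by (intro lewis_loop_hits) auto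
      moreover have "(1 + 64 * real d * real N) * (15 / 16) ^ N * badness (rarr s3 3) \<le> real n powr (- C)"
      proof -
        have "badness (rarr s3 3) \<le> (real n)\<^sup>2" using w2 s3 by (intro badness_uniform) auto
        then have "(1 + 64 * real d * real N) * (15 / 16) ^ N * badness (rarr s3 3) \<le> (1 + 64 * real d * real N) * (15 / 16) ^ N * (real n)\<^sup>2"
          by (intro mult_left_mono) auto
        also have "\<dots> \<le> real n powr (- C)" unfolding N_def v_def by (rule failure_bound[OF C])
        finally show ?thesis .
      qed
      ultimately show ?thesis by linarith
    qed
    show ?thesis
      unfolding for_real_def
    proof (rule hits_bind_Seq, simp only: det_prims, rule hits_bind_Seq, rule cexp_correct, goal_cases)
      case (3 \<rho>' c')
      have v: "\<rho>' 100 = v" using 3(1) by (simp add: LEWIS_COUNT_def r2 r2(2)[unfolded One_nat_def] v_def)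
      have "c' \<le> clock s2 + 14" using 3(3) by (simp add: LEWIS_COUNT_def)
      then have "c' + 2 \<le> cl" using s2(2) T_ge_1 by (simp add: cl_def)
      with v 3 r2 show ?case
        apply -
        apply (rule hits_bind_Seq, simp only: det_prims, rule hits_bind_Seq, simp only: det_prims)
        unfolding lewis_body_def[symmetric]
        apply (simp only: mult_0_right add_0_right)
        apply (rule main)
        by auto
    qed (simp_all add: LEWIS_COUNT_def)
  qed
  have "1 - real n powr (- C) \<le> hits (exec A T REGRESSION ?s0) ?S"
    unfolding REGRESSION_def
  proof (rule hits_Seq, simp only: det_prims, rule hits_Seq, simp only: det_prims, rule hits_Seq)
    have e: "tick 1 (set_rvar 3 (real (nvar (tick 1 (set_rvar 2 (real (nvar ?s0 0)) ?s0)) 1)) (tick 1 (set_rvar 2 (real (nvar ?s0 0)) ?s0))) = s1"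
      unfolding s1_def by (simp add: input_state_def)
    show "det A T (compile 0 (Fill Rows 3 (Cst 1 [/] V 2)))
      (tick 1 (set_rvar 3 (real (nvar (tick 1 (set_rvar 2 (real (nvar ?s0 0)) ?s0)) 1)) (tick 1 (set_rvar 2 (real (nvar ?s0 0)) ?s0))))
      (\<lambda>s'. 1 - real n powr (- C) \<le> hits (exec A T (Seq ?loop (compile 0 REST)) s') ?S)"
      unfolding e
    proof (rule det_mono, rule compile_correct[OF sim1, of 0])
      fix s' assume "sim (run A (Fill Rows 3 (Cst 1 [/] V 2)) \<sigma>1) s' \<and>
        clock s' \<le> clock s1 + cost A (Fill Rows 3 (Cst 1 [/] V 2)) \<sigma>1 * T \<and> (\<forall>x. 50 \<le> x \<and> x < 50 + 2 * 0 \<longrightarrow> rvar s' x = rvar s1 x)"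
      then show "1 - real n powr (- C) \<le> hits (exec A T (Seq ?loop (compile 0 REST)) s') ?S"
        using lp[of s'] by (simp add: r1(6) del: run.simps)
    qed simp_all
  qed
  then show ?thesis by (simp add: hits_def)
qed

end

theorem theorem1p3:
  shows "\<exists>P :: prog. \<forall>C :: real. C > 0 \<longrightarrow>
    (\<exists>(K :: real) (k :: nat).
      \<forall>(n :: nat) (d :: nat) (A :: real mat) (es :: (nat \<times> nat) list)
        (b :: real Matrix.vec) (eps :: real) (T :: real).
        1 \<le> d \<longrightarrow> d \<le> n \<longrightarrow> A \<in> carrier_mat n d \<longrightarrow> vec_space.rank n A = d \<longrightarrow>
        b \<in> carrier_vec n \<longrightarrow> 0 < eps \<longrightarrow> eps < 1 \<longrightarrow>
        distinct es \<longrightarrow> set es = support A \<longrightarrow>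
        real (nnz A) + real n \<le> T \<longrightarrow>
        measure (measure_spmf (exec A T P (input_state A es b eps C)))
          {s. linf_norm (A *\<^sub>v output_vec d s - b)
                \<le> (1 + eps) * (INF x \<in> carrier_vec d. linf_norm (A *\<^sub>v x - b)) \<and>
              clock s \<le> K * (1 + ln (real n)) ^ k *
                (real d powr (1 / 3) * eps powr (- 2 / 3) * T)}
          \<ge> 1 - real n powr (- C))"
proof (intro exI allI impI)
  fix C :: real and n d :: nat and A :: "real mat" and es :: "(nat \<times> nat) list" and b :: "real Matrix.vec" and eps T :: real
  assume C: "C > 0" and h: "1 \<le> d" "d \<le> n" "A \<in> carrier_mat n d" "vec_space.rank n A = d"
    "b \<in> carrier_vec n" "0 < eps" "eps < 1" "distinct es" "set es = support A" "real (nnz A) + real n \<le> T"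
  have "length es = nnz A" using h(8,9) by (simp add: nnz_def distinct_card[symmetric])
  then interpret regression A T es n d using h by unfold_locales auto
  show "1 - real n powr (- C) \<le> measure (measure_spmf (exec A T REGRESSION (input_state A es b eps C)))
          {s. linf_norm (A *\<^sub>v output_vec d s - b) \<le> (1 + eps) * (INF x \<in> carrier_vec d. linf_norm (A *\<^sub>v x - b)) \<and>
              clock s \<le> time_const C * (1 + ln (real n)) ^ 4 * (real d powr (1 / 3) * eps powr (- 2 / 3) * T)}"
    by (rule REGRESSION_correct[OF h(5-7) C])
qed

end
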